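(* Let $R$ be a commutative Noetherian ring, $\mathfrak a$ a proper ideal of $R$, and $M$ a finitely generated RCMF $R$-module with respect to $\mathfrak a$. Then $\widehat M$ is an RCMF $\widehat R$-module with respect to $\mathfrak a\widehat R$, where $\widehat{\ }$ denotes $\mathfrak a$-adic completion.
   Context: $H^i_{\mathfrak a}(-)$ denotes local cohomology with respect to $\mathfrak a$ and $\operatorname{cd}(\mathfrak a,M)=\sup\{i\in\mathbb Z\mid H^i_{\mathfrak a}(M)\neq0\}$ (so the zero module has $\operatorname{cd}=-\infty$). Cohomological dimension filtration (cd-filtration): for a finitely generated $R$-module $M$ with $c=\operatorname{cd}(\mathfrak a,M)$, it is the increasing filtration $\{M_i\}_{i=0}^c$ of submodules in which $M_i$ is the largest submodule of $M$ with $\operatorname{cd}(\mathfrak a,M_i)\le i$. Relative Cohen-Macaulay: a finitely generated $R$-module $N$ is relative Cohen-Macaulay with respect to $\mathfrak a$ if there is precisely one $i$ with $H^i_{\mathfrak a}(N)\ne0$ (equivalently $\operatorname{grade}(\mathfrak a,N)=\operatorname{cd}(\mathfrak a,N)$). RCMF (relative Cohen-Macaulay filtered): a finitely generated $R$-module $M$ with cd-filtration $\{M_i\}_{i=0}^c$, $c=\operatorname{cd}(\mathfrak a,M)$, is RCMF with respect to $\mathfrak a$ if for all $1\le i\le c$ the module $M_i/M_{i-1}$ is either zero or relative Cohen-Macaulay with respect to $\mathfrak a$ with $\operatorname{cd}(\mathfrak a,M_i/M_{i-1})=i$. *)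

theory Defs
  imports
    "HOL-Algebra.Ring_Divisibility"
    "HOL-Algebra.Ideal_Product"
    "HOL-Algebra.QuotRing"
    "HOL-Algebra.Module"
    "HOL-Library.Extended_Real"
begin

definition zero_module :: "('a, 'm, 's) module_scheme \<Rightarrow> bool" where
  "zero_module M \<longleftrightarrow> carrier M = {\<zero>\<^bsub>M\<^esub>}"

definition submodule_span ::
    "('a, 'r) ring_scheme \<Rightarrow> ('a, 'm, 's) module_scheme \<Rightarrow> 'm set \<Rightarrow> 'm set" where
  "submodule_span R M S = \<Inter> {N. submodule N R M \<and> S \<subseteq> N}"

definition fin_gen_module ::
    "('a, 'r) ring_scheme \<Rightarrow> ('a, 'm, 's) module_scheme \<Rightarrow> bool" where
  "fin_gen_module R M \<longleftrightarrow>
     module R M \<and> (\<exists>S. finite S \<and> S \<subseteq> carrier M \<and> submodule_span R M S = carrier M)"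

definition ring_as_module :: "('a, 'r) ring_scheme \<Rightarrow> ('a, 'a) module" where
  "ring_as_module R =
     \<lparr>carrier = carrier R, mult = mult R, one = one R, zero = zero R, add = add R,
      smult = mult R\<rparr>"

text \<open>A module record carries irrelevant fields \<^const>\<open>mult\<close> and \<^const>\<open>one\<close>, which the
  locale \<^locale>\<open>module\<close> ignores; they are left undefined below.\<close>

definition quot_module ::
    "('a, 'r) ring_scheme \<Rightarrow> ('a, 'm, 's) module_scheme \<Rightarrow> 'm set \<Rightarrow> ('a, 'm set) module" where
  "quot_module R M N =
     \<lparr>carrier = a_rcosets\<^bsub>M\<^esub> N, mult = undefined, one = undefined, zero = N, add = set_add M,
      smult = (\<lambda>r X. \<Union>x\<in>X. N +>\<^bsub>M\<^esub> (r \<odot>\<^bsub>M\<^esub> x))\<rparr>"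

text \<open>For submodules \<open>N' \<subseteq> N\<close> of \<open>M\<close>, the canonical map \<open>M/N' \<rightarrow> M/N\<close>.\<close>

definition quot_proj ::
    "('a, 'm, 's) module_scheme \<Rightarrow> 'm set \<Rightarrow> 'm set \<Rightarrow> 'm set \<Rightarrow> 'm set" where
  "quot_proj M N' N = (\<lambda>X\<in>a_rcosets\<^bsub>M\<^esub> N'. N <+>\<^bsub>M\<^esub> X)"

definition module_homs ::
    "('a, 'r) ring_scheme \<Rightarrow> ('a, 'm, 's) module_scheme \<Rightarrow> ('a, 'n, 't) module_scheme
      \<Rightarrow> ('m \<Rightarrow> 'n) set" where
  "module_homs R M N =
     {f \<in> carrier M \<rightarrow>\<^sub>E carrier N.
        (\<forall>x\<in>carrier M. \<forall>y\<in>carrier M. f (x \<oplus>\<^bsub>M\<^esub> y) = f x \<oplus>\<^bsub>N\<^esub> f y) \<and>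
        (\<forall>r\<in>carrier R. \<forall>x\<in>carrier M. f (r \<odot>\<^bsub>M\<^esub> x) = r \<odot>\<^bsub>N\<^esub> f x)}"

definition Hom_module ::
    "('a, 'r) ring_scheme \<Rightarrow> ('a, 'm, 's) module_scheme \<Rightarrow> ('a, 'n, 't) module_scheme
      \<Rightarrow> ('a, 'm \<Rightarrow> 'n) module" where
  "Hom_module R M N =
     \<lparr>carrier = module_homs R M N, mult = undefined, one = undefined,
      zero = (\<lambda>x\<in>carrier M. \<zero>\<^bsub>N\<^esub>),
      add = (\<lambda>f g. \<lambda>x\<in>carrier M. f x \<oplus>\<^bsub>N\<^esub> g x),
      smult = (\<lambda>r f. \<lambda>x\<in>carrier M. r \<odot>\<^bsub>N\<^esub> f x)\<rparr>"

definition free_module :: "('a, 'r) ring_scheme \<Rightarrow> nat \<Rightarrow> ('a, nat \<Rightarrow> 'a) module" where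
  "free_module R n =
     \<lparr>carrier = {..<n} \<rightarrow>\<^sub>E carrier R, mult = undefined, one = undefined,
      zero = (\<lambda>j\<in>{..<n}. \<zero>\<^bsub>R\<^esub>),
      add = (\<lambda>x y. \<lambda>j\<in>{..<n}. x j \<oplus>\<^bsub>R\<^esub> y j),
      smult = (\<lambda>r x. \<lambda>j\<in>{..<n}. r \<otimes>\<^bsub>R\<^esub> x j)\<rparr>"

text \<open>Over a Noetherian ring every finitely generated module has a resolution
  \<open>\<dots> \<rightarrow> F\<^sub>1 \<rightarrow> F\<^sub>0 \<rightarrow> N \<rightarrow> 0\<close> by free modules of finite rank. Restricting to such resolutions
  keeps all of them in one type; up to isomorphism Ext does not depend on the
  resolution chosen.\<close>

record ('a, 'n) free_res =
  res_rank :: "nat \<Rightarrow> nat"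
  res_diff :: "nat \<Rightarrow> (nat \<Rightarrow> 'a) \<Rightarrow> (nat \<Rightarrow> 'a)"  \<comment> \<open>\<open>F\<^sub>i\<^sub>+\<^sub>1 \<rightarrow> F\<^sub>i\<close> at index \<open>i\<close>\<close>
  res_aug :: "(nat \<Rightarrow> 'a) \<Rightarrow> 'n"

definition res_module ::
    "('a, 'r) ring_scheme \<Rightarrow> ('a, 'n) free_res \<Rightarrow> nat \<Rightarrow> ('a, nat \<Rightarrow> 'a) module" where
  "res_module R F i = free_module R (res_rank F i)"

definition is_free_resolution ::
    "('a, 'r) ring_scheme \<Rightarrow> ('a, 'n, 't) module_scheme \<Rightarrow> ('a, 'n) free_res \<Rightarrow> bool" where
  "is_free_resolution R N F \<longleftrightarrow>
     (\<forall>i. res_diff F i \<in> module_homs R (res_module R F (Suc i)) (res_module R F i)) \<and>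
     res_aug F \<in> module_homs R (res_module R F 0) N \<and>
     res_aug F ` carrier (res_module R F 0) = carrier N \<and>
     res_diff F 0 ` carrier (res_module R F 1) = a_kernel (res_module R F 0) N (res_aug F) \<and>
     (\<forall>i. res_diff F (Suc i) ` carrier (res_module R F (Suc (Suc i))) =
            a_kernel (res_module R F (Suc i)) (res_module R F i) (res_diff F i))"

definition free_resolution ::
    "('a, 'r) ring_scheme \<Rightarrow> ('a, 'n, 't) module_scheme \<Rightarrow> ('a, 'n) free_res" where
  "free_resolution R N = (SOME F. is_free_resolution R N F)"

definition cochain_module ::
    "('a, 'r) ring_scheme \<Rightarrow> ('a, 'n) free_res \<Rightarrow> ('a, 'm, 's) module_scheme \<Rightarrow> nat
      \<Rightarrow> ('a, (nat \<Rightarrow> 'a) \<Rightarrow> 'm) module" where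
  "cochain_module R F M i = Hom_module R (res_module R F i) M"

definition cochain_diff ::
    "('a, 'r) ring_scheme \<Rightarrow> ('a, 'n) free_res \<Rightarrow> nat
      \<Rightarrow> ((nat \<Rightarrow> 'a) \<Rightarrow> 'm) \<Rightarrow> ((nat \<Rightarrow> 'a) \<Rightarrow> 'm)" where
  "cochain_diff R F i f = compose (carrier (res_module R F (Suc i))) f (res_diff F i)"

definition cocycles ::
    "('a, 'r) ring_scheme \<Rightarrow> ('a, 'n) free_res \<Rightarrow> ('a, 'm, 's) module_scheme \<Rightarrow> nat
      \<Rightarrow> ((nat \<Rightarrow> 'a) \<Rightarrow> 'm) set" where
  "cocycles R F M i =
     a_kernel (cochain_module R F M i) (cochain_module R F M (Suc i)) (cochain_diff R F i)"

fun coboundaries ::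
    "('a, 'r) ring_scheme \<Rightarrow> ('a, 'n) free_res \<Rightarrow> ('a, 'm, 's) module_scheme \<Rightarrow> nat
      \<Rightarrow> ((nat \<Rightarrow> 'a) \<Rightarrow> 'm) set" where
  "coboundaries R F M 0 = {\<zero>\<^bsub>cochain_module R F M 0\<^esub>}"
| "coboundaries R F M (Suc i) = cochain_diff R F i ` carrier (cochain_module R F M i)"

definition Ext_module ::
    "('a, 'r) ring_scheme \<Rightarrow> nat \<Rightarrow> ('a, 'n, 't) module_scheme \<Rightarrow> ('a, 'm, 's) module_scheme
      \<Rightarrow> ('a, ((nat \<Rightarrow> 'a) \<Rightarrow> 'm) set) module" where
  "Ext_module R i N M =
     (let F = free_resolution R N
      in quot_module R ((cochain_module R F M i)\<lparr>carrier := cocycles R F M i\<rparr>)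
           (coboundaries R F M i))"

definition is_chain_lift ::
    "('a, 'r) ring_scheme \<Rightarrow> ('a, 'n') free_res \<Rightarrow> ('a, 'n) free_res \<Rightarrow> ('n' \<Rightarrow> 'n)
      \<Rightarrow> (nat \<Rightarrow> (nat \<Rightarrow> 'a) \<Rightarrow> (nat \<Rightarrow> 'a)) \<Rightarrow> bool" where
  "is_chain_lift R F' F g \<phi> \<longleftrightarrow>
     (\<forall>i. \<phi> i \<in> module_homs R (res_module R F' i) (res_module R F i)) \<and>
     (\<forall>x\<in>carrier (res_module R F' 0). res_aug F (\<phi> 0 x) = g (res_aug F' x)) \<and>
     (\<forall>i. \<forall>x\<in>carrier (res_module R F' (Suc i)).
        res_diff F i (\<phi> (Suc i) x) = \<phi> i (res_diff F' i x))"

text \<open>For a homomorphism \<open>g : N' \<rightarrow> N\<close>, the induced map \<open>Ext\<^sup>i(N, M) \<rightarrow> Ext\<^sup>i(N', M)\<close>; it does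
  not depend on the chain map chosen.\<close>

definition Ext_map ::
    "('a, 'r) ring_scheme \<Rightarrow> nat \<Rightarrow> ('a, 'n', 't') module_scheme \<Rightarrow> ('a, 'n, 't) module_scheme
      \<Rightarrow> ('n' \<Rightarrow> 'n) \<Rightarrow> ('a, 'm, 's) module_scheme
      \<Rightarrow> ((nat \<Rightarrow> 'a) \<Rightarrow> 'm) set \<Rightarrow> ((nat \<Rightarrow> 'a) \<Rightarrow> 'm) set" where
  "Ext_map R i N' N g M =
     (let F' = free_resolution R N'; F = free_resolution R N;
          \<phi> = (SOME \<phi>. is_chain_lift R F' F g \<phi>)
      in (\<lambda>X\<in>carrier (Ext_module R i N M).
            \<Union>f\<in>X. coboundaries R F' M i +>\<^bsub>cochain_module R F' M i\<^esub>
                     compose (carrier (res_module R F' i)) f (\<phi> i)))"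

text \<open>\<open>transition t n k\<close> is the composite \<open>A\<^sub>n \<rightarrow> A\<^sub>n\<^sub>+\<^sub>k\<close> of the maps \<open>t\<^sub>n : A\<^sub>n \<rightarrow> A\<^sub>n\<^sub>+\<^sub>1\<close>.\<close>

fun transition :: "(nat \<Rightarrow> 'x \<Rightarrow> 'x) \<Rightarrow> nat \<Rightarrow> nat \<Rightarrow> 'x \<Rightarrow> 'x" where
  "transition t n 0 x = x"
| "transition t n (Suc k) x = t (n + k) (transition t n k x)"

definition dirlim_rel ::
    "(nat \<Rightarrow> ('a, 'x) module) \<Rightarrow> (nat \<Rightarrow> 'x \<Rightarrow> 'x) \<Rightarrow> ((nat \<times> 'x) \<times> (nat \<times> 'x)) set" where
  "dirlim_rel A t =
     {((n, x), (m, y)). x \<in> carrier (A n) \<and> y \<in> carrier (A m) \<and>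
        (\<exists>k l. n + k = m + l \<and> transition t n k x = transition t m l y)}"

definition dirlim ::
    "(nat \<Rightarrow> ('a, 'x) module) \<Rightarrow> (nat \<Rightarrow> 'x \<Rightarrow> 'x) \<Rightarrow> ('a, (nat \<times> 'x) set) module" where
  "dirlim A t =
     \<lparr>carrier = (SIGMA n:UNIV. carrier (A n)) // dirlim_rel A t,
      mult = undefined, one = undefined,
      zero = dirlim_rel A t `` {(0, \<zero>\<^bsub>A 0\<^esub>)},
      add = (\<lambda>X Y. \<Union>(n, x)\<in>X. \<Union>(m, y)\<in>Y.
               dirlim_rel A t `` {(n + m, transition t n m x \<oplus>\<^bsub>A (n + m)\<^esub> transition t m n y)}),
      smult = (\<lambda>r X. \<Union>(n, x)\<in>X. dirlim_rel A t `` {(n, r \<odot>\<^bsub>A n\<^esub> x)})\<rparr>"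

abbreviation ideal_power :: "('a, 'r) ring_scheme \<Rightarrow> 'a set \<Rightarrow> nat \<Rightarrow> 'a set" where
  "ideal_power R I n \<equiv> I [^]\<^bsub>ideals_set R\<^esub> n"

definition quot_power :: "('a, 'r) ring_scheme \<Rightarrow> 'a set \<Rightarrow> nat \<Rightarrow> ('a, 'a set) module" where
  "quot_power R I n = quot_module R (ring_as_module R) (ideal_power R I n)"

text \<open>Grothendieck's formula: \<open>H\<^sup>i\<^sub>\<aa>(M)\<close> is the direct limit over \<open>n\<close> of \<open>Ext\<^sup>i(R/\<aa>\<^sup>n, M)\<close>,
  along the maps induced by the projections \<open>R/\<aa>\<^sup>n\<^sup>+\<^sup>1 \<rightarrow> R/\<aa>\<^sup>n\<close>.\<close>

definition local_cohomology ::
    "('a, 'r) ring_scheme \<Rightarrow> 'a set \<Rightarrow> nat \<Rightarrow> ('a, 'm, 's) module_scheme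
      \<Rightarrow> ('a, (nat \<times> ((nat \<Rightarrow> 'a) \<Rightarrow> 'm) set) set) module" where
  "local_cohomology R \<aa> i M =
     dirlim (\<lambda>n. Ext_module R i (quot_power R \<aa> n) M)
       (\<lambda>n. Ext_map R i (quot_power R \<aa> (Suc n)) (quot_power R \<aa> n)
          (quot_proj (ring_as_module R) (ideal_power R \<aa> (Suc n)) (ideal_power R \<aa> n)) M)"

text \<open>Local cohomology vanishes in negative degrees, so the supremum may be taken over natural
  numbers; in \<^typ>\<open>ereal\<close> the supremum of the empty set is \<open>-\<infinity>\<close>.\<close>

definition cd ::
    "('a, 'r) ring_scheme \<Rightarrow> 'a set \<Rightarrow> ('a, 'm, 's) module_scheme \<Rightarrow> ereal" where
  "cd R \<aa> M = (SUP i\<in>{i. \<not> zero_module (local_cohomology R \<aa> i M)}. ereal (real i))"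

definition relative_CM ::
    "('a, 'r) ring_scheme \<Rightarrow> 'a set \<Rightarrow> ('a, 'm, 's) module_scheme \<Rightarrow> bool" where
  "relative_CM R \<aa> N \<longleftrightarrow>
     fin_gen_module R N \<and> (\<exists>!i. \<not> zero_module (local_cohomology R \<aa> i N))"

definition is_cd_filtration ::
    "('a, 'r) ring_scheme \<Rightarrow> 'a set \<Rightarrow> ('a, 'm, 's) module_scheme \<Rightarrow> (nat \<Rightarrow> 'm set) \<Rightarrow> bool"
  where
  "is_cd_filtration R \<aa> M F \<longleftrightarrow>
     (\<forall>i. ereal (real i) \<le> cd R \<aa> M \<longrightarrow>
        submodule (F i) R M \<and> cd R \<aa> (M\<lparr>carrier := F i\<rparr>) \<le> ereal (real i) \<and>
        (\<forall>N. submodule N R M \<and> cd R \<aa> (M\<lparr>carrier := N\<rparr>) \<le> ereal (real i) \<longrightarrow> N \<subseteq> F i))"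

text \<open>The cd-filtration is uniquely determined on the indices \<open>0 \<le> i \<le> cd(\<aa>, M)\<close>, the only ones
  that matter.\<close>

definition rcmf ::
    "('a, 'r) ring_scheme \<Rightarrow> 'a set \<Rightarrow> ('a, 'm, 's) module_scheme \<Rightarrow> bool" where
  "rcmf R \<aa> M \<longleftrightarrow>
     fin_gen_module R M \<and>
     (\<exists>F. is_cd_filtration R \<aa> M F \<and>
        (\<forall>i\<ge>1. ereal (real i) \<le> cd R \<aa> M \<longrightarrow>
           (let Q = quot_module R (M\<lparr>carrier := F i\<rparr>) (F (i - 1))
            in zero_module Q \<or> relative_CM R \<aa> Q \<and> cd R \<aa> Q = ereal (real i))))"

definition ideal_smult ::
    "('a, 'r) ring_scheme \<Rightarrow> 'a set \<Rightarrow> ('a, 'm, 's) module_scheme \<Rightarrow> 'm set" where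
  "ideal_smult R I M = submodule_span R M {r \<odot>\<^bsub>M\<^esub> x | r x. r \<in> I \<and> x \<in> carrier M}"

text \<open>The inverse limit of the rings \<open>R/\<aa>\<^sup>n\<close>.\<close>

definition completion_ring ::
    "('a, 'r) ring_scheme \<Rightarrow> 'a set \<Rightarrow> (nat \<Rightarrow> 'a set) ring" where
  "completion_ring R \<aa> =
     (let Q = (\<lambda>n. R Quot (ideal_power R \<aa> n))
      in \<lparr>carrier = {x. \<forall>n. x n \<in> carrier (Q n) \<and>
                      quot_proj (ring_as_module R) (ideal_power R \<aa> (Suc n)) (ideal_power R \<aa> n)
                        (x (Suc n)) = x n},
          mult = (\<lambda>x y n. x n \<otimes>\<^bsub>Q n\<^esub> y n), one = (\<lambda>n. \<one>\<^bsub>Q n\<^esub>),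
          zero = (\<lambda>n. \<zero>\<^bsub>Q n\<^esub>), add = (\<lambda>x y n. x n \<oplus>\<^bsub>Q n\<^esub> y n)\<rparr>)"

definition completion_map :: "('a, 'r) ring_scheme \<Rightarrow> 'a set \<Rightarrow> 'a \<Rightarrow> (nat \<Rightarrow> 'a set)" where
  "completion_map R \<aa> r = (\<lambda>n. ideal_power R \<aa> n +>\<^bsub>R\<^esub> r)"

text \<open>The inverse limit of the modules \<open>M/\<aa>\<^sup>nM\<close>. A coset \<open>c \<in> R/\<aa>\<^sup>n\<close> acts on \<open>M/\<aa>\<^sup>nM\<close> through any
  of its representatives, so the union below is over equal sets.\<close>

definition completion_module ::
    "('a, 'r) ring_scheme \<Rightarrow> 'a set \<Rightarrow> ('a, 'm, 's) module_scheme
      \<Rightarrow> (nat \<Rightarrow> 'a set, nat \<Rightarrow> 'm set) module" where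
  "completion_module R \<aa> M =
     (let S = (\<lambda>n. ideal_smult R (ideal_power R \<aa> n) M); Q = (\<lambda>n. quot_module R M (S n))
      in \<lparr>carrier = {x. \<forall>n. x n \<in> carrier (Q n) \<and>
                      quot_proj M (S (Suc n)) (S n) (x (Suc n)) = x n},
          mult = undefined, one = undefined,
          zero = (\<lambda>n. \<zero>\<^bsub>Q n\<^esub>), add = (\<lambda>x y n. x n \<oplus>\<^bsub>Q n\<^esub> y n),
          smult = (\<lambda>c x n. \<Union>r\<in>c n. r \<odot>\<^bsub>Q n\<^esub> x n)\<rparr>)"

definition extended_ideal :: "('a, 'r) ring_scheme \<Rightarrow> 'a set \<Rightarrow> (nat \<Rightarrow> 'a set) set" where
  "extended_ideal R \<aa> = Idl\<^bsub>completion_ring R \<aa>\<^esub> (completion_map R \<aa> ` \<aa>)"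

end

theory Submission
  imports Defs
begin

text \<open>For submodules \<open>L \<subseteq> N\<close> of \<open>X\<close>, the vanishing of \<open>H\<^sup>k\<^sub>\<aa>(N/L)\<close> means that every cocycle on a free resolution of
  \<open>R/\<aa>\<^sup>n\<close> with values in \<open>N\<close>, modulo \<open>L\<close>, becomes a coboundary on resolutions of \<open>R/\<aa>\<^sup>m\<close> for \<open>m \<ge> n\<close>
  large. A resolution of \<open>R/\<aa>\<^sup>n\<close> stays one after tensoring with the completed ring, and by Artin--Rees a
  cocycle with values in the completion of \<open>M\<close> differs by a coboundary from one with values in
  \<open>M\<close>. So passing from submodules of \<open>M\<close> to their closures in the completion preserves the local
  cohomology of all subquotients, and the closures of the \<open>M\<^sub>i\<close> have the required quotients.

  It remains to see that the closure of \<open>M\<^sub>i\<close> contains every submodule \<open>N\<close> of the completion with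
  \<open>cd(N) \<le> i\<close>, even if \<open>N\<close> is not the closure of a submodule of \<open>M\<close>. If
  \<open>N\<close> lies in the closure \<open>C\<^sub>j\<close> of \<open>M\<^sub>j\<close> for some \<open>j > i\<close>, then \<open>H\<^sup>k(N) = 0\<close> for \<open>k > i\<close> while
  \<open>H\<^sup>k(C\<^sub>j / C\<^sub>j\<^sub>-\<^sub>1) = 0\<close> for \<open>k \<le> i\<close>. Climbing along a resolution with the first property and
  descending with the second gives \<open>N \<subseteq> \<aa>\<^sup>n C\<^sub>j + C\<^sub>j\<^sub>-\<^sub>1\<close> for all \<open>n\<close>, hence \<open>N \<subseteq> C\<^sub>j\<^sub>-\<^sub>1\<close> because the
  completion is separated.\<close>

text \<open>The completed ring is never shown to be Noetherian. Artin-Rees and the construction of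
  resolutions run over \<open>R\<close>; over the completed ring it suffices that resolutions exist
  and that closures are finitely generated, and both are inherited from \<open>R\<close>. Cochains
  are kept as representatives in one ambient module, so that a single predicate
  \<open>vanish\<close> serves \<open>M\<close>, its completion over \<open>R\<close> and its
  completion over the completed ring, although the quotients would all have different types. The
  climb needs a place to start, a chain map that vanishes in high degrees. Koszul or Cech complexes
  would provide it, but local cohomology is defined through free resolutions, so a lift between
  resolutions of two powers that is zero above the number of generators is built by induction on the
  generators. It also bounds the cohomological dimension, which gives the descent through the
  filtration its top index. Approximation of cocycles is turned into equality of classes by the fact
  that \<open>\<aa>^n\<close> annihilates Ext of \<open>R/\<aa>^n\<close>: an error lying in
  \<open>\<aa>^n\<close> times the cocycles is a coboundary.\<close>

abbreviation "FM \<equiv> free_module"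

abbreviation "RM \<equiv> ring_as_module"

text \<open>No extensionality is required, unlike in \<open>module_homs\<close>, so that composites
  and pointwise sums written as plain abstractions qualify without being restricted to the
  carrier.\<close>

definition lin ::
    "('a, 'r) ring_scheme \<Rightarrow> ('a, 'm, 's) module_scheme \<Rightarrow> ('a, 'n, 't) module_scheme
      \<Rightarrow> ('m \<Rightarrow> 'n) \<Rightarrow> bool" where
  "lin R M N f \<longleftrightarrow>
     (\<forall>x\<in>carrier M. f x \<in> carrier N) \<and>
     (\<forall>x\<in>carrier M. \<forall>y\<in>carrier M. f (x \<oplus>\<^bsub>M\<^esub> y) = f x \<oplus>\<^bsub>N\<^esub> f y) \<and>
     (\<forall>r\<in>carrier R. \<forall>x\<in>carrier M. f (r \<odot>\<^bsub>M\<^esub> x) = r \<odot>\<^bsub>N\<^esub> f x)"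

lemma lin_closed: "lin R M N f ==> x \<in> carrier M ==> f x \<in> carrier N"
  and lin_add: "lin R M N f ==> x \<in> carrier M ==> y \<in> carrier M ==> f (x \<oplus>\<^bsub>M\<^esub> y) = f x \<oplus>\<^bsub>N\<^esub> f y"
  and lin_smult: "lin R M N f ==> r \<in> carrier R ==> x \<in> carrier M ==> f (r \<odot>\<^bsub>M\<^esub> x) = r \<odot>\<^bsub>N\<^esub> f x"
  by (auto simp: lin_def)

lemma lin_zero:
  fixes M (structure)
  assumes "module R M" "module R N" "lin R M N f"
  shows "f \<zero> = \<zero>\<^bsub>N\<^esub>"
proof -
  interpret M: module R M by fact
  interpret N: module R N by fact
  have "f (\<zero>\<^bsub>R\<^esub> \<odot> \<zero>) = \<zero>\<^bsub>R\<^esub> \<odot>\<^bsub>N\<^esub> f \<zero>"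
    by (rule lin_smult[OF assms(3)]) auto
  then show ?thesis using lin_closed[OF assms(3)] by simp
qed

lemma lin_uminus:
  fixes R (structure)
  assumes "module R M" "module R N" "lin R M N f" "x \<in> carrier M"
  shows "f (\<ominus>\<^bsub>M\<^esub> x) = \<ominus>\<^bsub>N\<^esub> f x"
proof -
  interpret M: module R M by fact
  interpret N: module R N by fact
  have "\<ominus>\<^bsub>M\<^esub> x = (\<ominus> \<one>) \<odot>\<^bsub>M\<^esub> x" using assms(4) by (simp add: M.smult_l_minus)
  also have "f \<dots> = (\<ominus> \<one>) \<odot>\<^bsub>N\<^esub> f x" by (rule lin_smult[OF assms(3)]) (use assms in auto)
  finally show ?thesis using lin_closed[OF assms(3,4)] by (simp add: N.smult_l_minus)
qed

lemma lin_minus: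
  assumes "module R M" "module R N" "lin R M N f" "x \<in> carrier M" "y \<in> carrier M"
  shows "f (x \<ominus>\<^bsub>M\<^esub> y) = f x \<ominus>\<^bsub>N\<^esub> f y"
proof -
  interpret M: module R M by fact
  interpret N: module R N by fact
  show ?thesis using assms
    by (simp add: a_minus_def lin_add[OF assms(3)] lin_uminus[OF assms(1-3)])
qed

lemma lin_comp: "lin R A B f ==> lin R B C g ==> lin R A C (\<lambda>x. g (f x))"
  by (auto simp: lin_def)

lemma lin_const_zero: "module R N ==> lin R M N (\<lambda>x. \<zero>\<^bsub>N\<^esub>)"
  unfolding lin_def by (simp add: module.smult_r_null abelian_group.axioms(1)
    abelian_monoid.zero_closed abelian_monoid.l_zero module.axioms(2))

lemma lin_ident: "lin R M M (\<lambda>x. x)"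
  by (auto simp: lin_def)

lemma lin_plus:
  assumes "module R N" "lin R M N f" "lin R M N g"
  shows "lin R M N (\<lambda>x. f x \<oplus>\<^bsub>N\<^esub> g x)"
proof -
  interpret N: module R N by fact
  show ?thesis using assms(2,3) unfolding lin_def by (auto simp: N.smult_r_distr N.a_ac)
qed

lemma lin_scale:
  assumes "module R N" "lin R M N f" "r \<in> carrier R"
  shows "lin R M N (\<lambda>x. r \<odot>\<^bsub>N\<^esub> f x)"
proof -
  interpret N: module R N by fact
  show ?thesis using assms(2,3) unfolding lin_def
    by (auto simp: N.smult_r_distr N.smult_assoc1[symmetric] N.m_comm)
qed

lemma lin_diff:
  assumes "module R N" "lin R M N f" "lin R M N g"
  shows "lin R M N (\<lambda>x. f x \<ominus>\<^bsub>N\<^esub> g x)"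
proof -
  interpret N: module R N by fact
  show ?thesis using assms(2,3) unfolding lin_def
    by (auto simp: a_minus_def N.smult_r_distr N.smult_r_minus N.minus_add N.a_ac)
qed

lemma lin_scale_elt:
  assumes "module R N" "lin R M (RM R) f" "y \<in> carrier N"
  shows "lin R M N (\<lambda>x. f x \<odot>\<^bsub>N\<^esub> y)"
proof -
  interpret N: module R N by fact
  show ?thesis using assms(2,3) unfolding lin_def ring_as_module_def
    by (auto simp: N.smult_l_distr N.smult_assoc1)
qed

lemma module_ring_as_module:
  assumes "cring R"
  shows "module R (RM R)"
proof -
  interpret cring R by fact
  have "abelian_group (RM R)"
    by (rule abelian_groupI) (auto simp: ring_as_module_def a_ac intro: l_neg)
  then show ?thesis
    by (intro moduleI[OF assms]) (auto simp: ring_as_module_def l_distr r_distr m_assoc)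
qed

lemma ring_as_module_simps [simp]:
  "carrier (RM R) = carrier R" "zero (RM R) = zero R"
  "add (RM R) = add R" "smult (RM R) = mult R"
  by (simp_all add: ring_as_module_def)

lemma a_inv_ring_as_module [simp]: "a_inv (RM R) = a_inv R"
  by (rule ext) (simp add: a_inv_def m_inv_def)

lemma a_minus_ring_as_module [simp]: "x \<ominus>\<^bsub>RM R\<^esub> y = x \<ominus>\<^bsub>R\<^esub> y"
  by (simp add: a_minus_def)

section \<open>Submodules\<close>

lemma sub_carr: "submodule N R M ==> x \<in> N ==> x \<in> carrier M"
  using submodule.axioms(1) subgroup.mem_carrier by fastforce

lemma sub_zero: "submodule N R M ==> \<zero>\<^bsub>M\<^esub> \<in> N"
  using submodule.axioms(1) subgroup.one_closed by fastforce

lemma sub_add: "submodule N R M ==> x \<in> N ==> y \<in> N ==> x \<oplus>\<^bsub>M\<^esub> y \<in> N"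
  using submodule.axioms(1) subgroup.m_closed by fastforce

lemma sub_smult: "submodule N R M ==> r \<in> carrier R ==> x \<in> N ==> r \<odot>\<^bsub>M\<^esub> x \<in> N"
  by (rule submodule.smult_closed)

lemma sub_uminus: "submodule N R M ==> x \<in> N ==> \<ominus>\<^bsub>M\<^esub> x \<in> N"
  unfolding a_inv_def using submodule.axioms(1) subgroup.m_inv_closed by fastforce

lemma sub_minus: "submodule N R M ==> x \<in> N ==> y \<in> N ==> x \<ominus>\<^bsub>M\<^esub> y \<in> N"
  by (simp add: a_minus_def sub_add sub_uminus)

text \<open>Negatives are obtained by scaling with minus one, so closure under them need not be
  checked separately.\<close>

lemma submoduleI':
  fixes M (structure)
  assumes "module R M" "N \<subseteq> carrier M" "\<zero> \<in> N"
    "\<And>x y. x \<in> N ==> y \<in> N ==> x \<oplus> y \<in> N"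
    "\<And>r x. r \<in> carrier R ==> x \<in> N ==> r \<odot> x \<in> N"
  shows "submodule N R M"
proof -
  interpret module R M by fact
  have "\<ominus> x \<in> N" if "x \<in> N" for x
  proof -
    have "\<ominus> x = (\<ominus>\<^bsub>R\<^esub> \<one>\<^bsub>R\<^esub>) \<odot> x" using that assms(2) by (auto simp: smult_l_minus)
    then show ?thesis using assms(5) that by simp
  qed
  with assms show ?thesis by (intro submoduleI) auto
qed

lemma submodule_zero: "module R M ==> submodule {\<zero>\<^bsub>M\<^esub>} R M"
proof -
  assume "module R M"
  then interpret module R M .
  show ?thesis by (rule submoduleI'[OF \<open>module R M\<close>]) auto
qed

lemma submodule_inter:
  "module R M ==> submodule A R M ==> submodule B R M ==> submodule (A \<inter> B) R M"
  by (rule submoduleI') (auto intro: sub_add sub_zero sub_smult dest: sub_carr)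

text \<open>Ideals are handled as submodules of \<open>R\<close> over itself, so that the congruence
  lemmas for submodules apply to them.\<close>

lemma ideal_iff_submodule:
  assumes "cring R"
  shows "ideal I R \<longleftrightarrow> submodule I R (RM R)"
proof
  interpret cring R by fact
  assume "ideal I R"
  then interpret I: ideal I R .
  show "submodule I R (RM R)"
    by (rule submoduleI'[OF module_ring_as_module[OF assms]]) (auto intro: I.I_l_closed)
next
  interpret cring R by fact
  interpret Rm: module R "RM R" by (rule module_ring_as_module[OF assms])
  assume S: "submodule I R (RM R)"
  have "subgroup I (add_monoid R)"
    by (rule add.subgroupI) (use sub_carr[OF S] sub_zero[OF S] sub_add[OF S] sub_uminus[OF S]
        in \<open>auto simp: a_inv_def[symmetric]\<close>)
  moreover have "a \<otimes>\<^bsub>R\<^esub> x \<in> I" "x \<otimes>\<^bsub>R\<^esub> a \<in> I" if "a \<in> I" "x \<in> carrier R" for a x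
    using sub_smult[OF S that(2,1)] sub_carr[OF S that(1)] m_comm[of a x] that(2) by auto
  ultimately show "ideal I R"
    by (intro idealI) (auto simp: ring_axioms)
qed

lemma submodule_kernel:
  assumes "module R M" "module R N" "lin R M N f" "submodule A R M" "submodule L R N"
  shows "submodule {x \<in> A. f x \<in> L} R M"
proof -
  show ?thesis
    by (rule submoduleI'[OF assms(1)])
      (auto simp: lin_zero[OF assms(1-3)] sub_zero[OF assms(4)] sub_zero[OF assms(5)]
        lin_add[OF assms(3)] lin_smult[OF assms(3)] sub_carr[OF assms(4)]
        intro: sub_add[OF assms(4)] sub_add[OF assms(5)] sub_smult[OF assms(4)] sub_smult[OF assms(5)])
qed

lemma submodule_image:
  fixes N (structure)
  assumes "module R M" "module R N" "lin R M N f" "submodule A R M"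
  shows "submodule (f ` A) R N"
proof (rule submoduleI'[OF assms(2)])
  show "f ` A \<subseteq> carrier N" using assms lin_closed sub_carr by fastforce
  show "\<zero> \<in> f ` A" using lin_zero[OF assms(1-3)] sub_zero[OF assms(4)] by force
  show "x \<oplus> y \<in> f ` A" if xy: "x \<in> f ` A" "y \<in> f ` A" for x y
  proof -
    obtain u v where "u \<in> A" "v \<in> A" "x = f u" "y = f v" using xy by blast
    then have "x \<oplus> y = f (u \<oplus>\<^bsub>M\<^esub> v)" "u \<oplus>\<^bsub>M\<^esub> v \<in> A"
      using lin_add[OF assms(3)] sub_carr[OF assms(4)] sub_add[OF assms(4)] by auto
    then show ?thesis by blast
  qed
  show "r \<odot> x \<in> f ` A" if rx: "r \<in> carrier R" "x \<in> f ` A" for r x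
  proof -
    obtain u where "u \<in> A" "x = f u" using rx by auto
    then have "r \<odot> x = f (r \<odot>\<^bsub>M\<^esub> u)" "r \<odot>\<^bsub>M\<^esub> u \<in> A"
      using lin_smult[OF assms(3)] sub_carr[OF assms(4)] sub_smult[OF assms(4)] rx by auto
    then show ?thesis by blast
  qed
qed

lemma submodule_sum:
  fixes M (structure)
  assumes "module R M" "submodule A R M" "submodule B R M"
  shows "submodule {x \<oplus> y | x y. x \<in> A \<and> y \<in> B} R M"
proof -
  interpret module R M by fact
  note [simp] = sub_carr[OF assms(2)] sub_carr[OF assms(3)]
  show ?thesis
  proof (rule submoduleI'[OF assms(1)], goal_cases)
    case 1 then show ?case by auto
  next
    case 2
    have "\<zero> = \<zero> \<oplus> \<zero>" by simp
    then show ?case using sub_zero[OF assms(2)] sub_zero[OF assms(3)] by blast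
  next
    case (3 x y)
    then obtain a b c d where e: "a \<in> A" "b \<in> B" "c \<in> A" "d \<in> B" "x = a \<oplus> b" "y = c \<oplus> d" by blast
    have "x \<oplus> y = (a \<oplus> c) \<oplus> (b \<oplus> d)" using e by (simp add: M.a_ac)
    then show ?case using sub_add[OF assms(2)] sub_add[OF assms(3)] e by blast
  next
    case (4 r x)
    then obtain a b where e: "a \<in> A" "b \<in> B" "x = a \<oplus> b" by blast
    have "r \<odot> x = r \<odot> a \<oplus> r \<odot> b" using e 4 by (simp add: smult_r_distr)
    then show ?case using sub_smult[OF assms(2)] sub_smult[OF assms(3)] e 4 by blast
  qed
qed

section \<open>Finite linear combinations\<close>

primrec lincomb :: "('a, 'm, 's) module_scheme \<Rightarrow> (nat \<Rightarrow> 'm) \<Rightarrow> (nat \<Rightarrow> 'a) \<Rightarrow> nat \<Rightarrow> 'm" where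
  "lincomb M g x 0 = \<zero>\<^bsub>M\<^esub>"
| "lincomb M g x (Suc k) = lincomb M g x k \<oplus>\<^bsub>M\<^esub> x k \<odot>\<^bsub>M\<^esub> g k"

lemma lincomb_closed:
  assumes "module R M" "\<And>i. i < k ==> g i \<in> carrier M" "\<And>i. i < k ==> x i \<in> carrier R"
  shows "lincomb M g x k \<in> carrier M"
  using assms(2,3)
proof (induction k)
  case 0
  interpret module R M by fact
  show ?case by simp
next
  case (Suc k)
  interpret module R M by fact
  show ?case using Suc by simp
qed

lemma lincomb_cong:
  "(\<And>i. i < k ==> g i = g' i) ==> (\<And>i. i < k ==> x i = x' i) ==> lincomb M g x k = lincomb M g' x' k"
  by (induction k) auto

lemma lincomb_in_sub:
  assumes "submodule N R M" "\<And>i. i < k ==> g i \<in> N" "\<And>i. i < k ==> x i \<in> carrier R"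
  shows "lincomb M g x k \<in> N"
  using assms(2,3) by (induction k) (auto intro: sub_zero[OF assms(1)] sub_add[OF assms(1)] sub_smult[OF assms(1)])

lemma lincomb_add_coeff:
  assumes "module R M" "\<And>i. i < k ==> g i \<in> carrier M" "\<And>i. i < k ==> x i \<in> carrier R" "\<And>i. i < k ==> y i \<in> carrier R"
  shows "lincomb M g (\<lambda>i. x i \<oplus>\<^bsub>R\<^esub> y i) k = lincomb M g x k \<oplus>\<^bsub>M\<^esub> lincomb M g y k"
  using assms(2-)
proof (induction k)
  case 0
  interpret module R M by fact
  show ?case by simp
next
  case (Suc k)
  interpret module R M by fact
  show ?case using Suc by (simp add: smult_l_distr lincomb_closed[OF assms(1)] M.a_ac)
qed

lemma lincomb_smult_coeff:
  assumes "module R M" "\<And>i. i < k ==> g i \<in> carrier M" "\<And>i. i < k ==> x i \<in> carrier R" "r \<in> carrier R"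
  shows "lincomb M g (\<lambda>i. r \<otimes>\<^bsub>R\<^esub> x i) k = r \<odot>\<^bsub>M\<^esub> lincomb M g x k"
  using assms(2,3)
proof (induction k)
  case 0
  interpret module R M by fact
  show ?case using assms by simp
next
  case (Suc k)
  interpret module R M by fact
  show ?case using Suc assms(4) by (simp add: smult_r_distr smult_assoc1 lincomb_closed[OF assms(1)])
qed

lemma lincomb_zero_coeff:
  assumes "module R M" "\<And>i. i < k ==> g i \<in> carrier M"
  shows "lincomb M g (\<lambda>i. \<zero>\<^bsub>R\<^esub>) k = \<zero>\<^bsub>M\<^esub>"
  using assms(2)
proof (induction k)
  case (Suc k)
  interpret module R M by fact
  show ?case using Suc by simp
qed simp

lemma lincomb_image:
  assumes "module R M" "module R N" "lin R M N f"
    "\<And>i. i < k ==> g i \<in> carrier M" "\<And>i. i < k ==> x i \<in> carrier R"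
  shows "f (lincomb M g x k) = lincomb N (\<lambda>i. f (g i)) x k"
  using assms(4-)
proof (induction k)
  case 0
  show ?case by (simp add: lin_zero[OF assms(1-3)])
next
  case (Suc k)
  interpret M: module R M by fact
  show ?case using Suc by (simp add: lin_add[OF assms(3)] lin_smult[OF assms(3)] lincomb_closed[OF assms(1)])
qed

lemma lincomb_unit:
  fixes R (structure)
  assumes "module R M" "\<And>i. i < k ==> g i \<in> carrier M" "j < k"
    "\<And>i. i < k ==> x i = (if i = j then \<one> else \<zero>)"
  shows "lincomb M g x k = g j"
proof -
  interpret module R M by fact
  have "lincomb M g (\<lambda>i. if i = j then \<one> else \<zero>) k = (if j < k then g j else \<zero>\<^bsub>M\<^esub>)"
    using assms(2) by (induction k) (auto simp: less_Suc_eq)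
  then show ?thesis using assms(3,4) lincomb_cong[of k g g x "\<lambda>i. if i = j then \<one> else \<zero>" M] by auto
qed

lemma lincomb_append:
  assumes "module R M" "\<And>i. i < k ==> g i \<in> carrier M" "\<And>i. i < k ==> x i \<in> carrier R"
    "\<And>i. i < l ==> h i \<in> carrier M" "\<And>i. i < l ==> y i \<in> carrier R"
  shows "lincomb M (\<lambda>i. if i < k then g i else h (i - k)) (\<lambda>i. if i < k then x i else y (i - k)) (k + l)
    = lincomb M g x k \<oplus>\<^bsub>M\<^esub> lincomb M h y l"
  using assms(4,5)
proof (induction l)
  case 0
  interpret module R M by fact
  show ?case using lincomb_closed[OF assms(1-3)]
    by (auto intro: trans[OF lincomb_cong])
next
  case (Suc l)
  interpret module R M by fact
  show ?case using Suc lincomb_closed[OF assms(1-3)] lincomb_closed[OF assms(1), of l h y]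
    by (simp add: M.a_assoc)
qed

lemma submodule_lincombs:
  assumes "module R M" "\<And>i. i < k ==> g i \<in> carrier M"
  shows "submodule {lincomb M g x k | x. \<forall>i<k. x i \<in> carrier R} R M"
proof -
  interpret module R M by fact
  show ?thesis
  proof (rule submoduleI'[OF assms(1)], goal_cases)
    case 1 then show ?case using lincomb_closed[OF assms] by auto
  next
    case 2 show ?case using lincomb_zero_coeff[OF assms] by (auto intro!: exI[of _ "\<lambda>i. \<zero>\<^bsub>R\<^esub>"])
  next
    case (3 u v)
    then obtain x y where "\<forall>i<k. x i \<in> carrier R" "\<forall>i<k. y i \<in> carrier R" "u = lincomb M g x k" "v = lincomb M g y k" by auto
    then show ?case using lincomb_add_coeff[OF assms, where x=x and y=y and k=k] by (auto intro!: exI[of _ "\<lambda>i. x i \<oplus>\<^bsub>R\<^esub> y i"])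
  next
    case (4 r u)
    then obtain x where "\<forall>i<k. x i \<in> carrier R" "u = lincomb M g x k" by auto
    then show ?case using 4 lincomb_smult_coeff[OF assms, where x=x and r=r and k=k] by (auto intro!: exI[of _ "\<lambda>i. r \<otimes>\<^bsub>R\<^esub> x i"])
  qed
qed

text \<open>Separates the last generator \<open>b\<close> from a family of elements
  \<open>a i + r i b\<close>. The coefficient collected at \<open>b\<close> is itself a combination
  in the ring, which is how an ideal of coefficients enters the induction on the number of
  generators.\<close>

lemma lincomb_shift:
  fixes M (structure)
  assumes "module R M" "\<And>i. i < k ==> a i \<in> carrier M" "\<And>i. i < k ==> r i \<in> carrier R" "b \<in> carrier M"
    "\<And>i. i < k ==> c i \<in> carrier R"
  shows "lincomb M (\<lambda>i. a i \<oplus> r i \<odot> b) c k = lincomb M a c k \<oplus> lincomb (RM R) r c k \<odot> b"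
  using assms(2,3,5)
proof (induction k)
  case 0
  interpret module R M by fact
  show ?case using assms(4) by simp
next
  case (Suc k)
  interpret module R M by fact
  have "lincomb (RM R) r c k \<in> carrier R"
    using lincomb_closed[OF module_ring_as_module[OF is_cring], of k r c] Suc by simp
  then show ?case using Suc assms(4) lincomb_closed[OF assms(1), of k a c]
    by (simp add: smult_r_distr smult_l_distr smult_assoc1 M.a_ac)
qed

definition generates ::
    "('a, 'r) ring_scheme \<Rightarrow> ('a, 'm, 's) module_scheme \<Rightarrow> 'm set \<Rightarrow> nat \<Rightarrow> (nat \<Rightarrow> 'm) \<Rightarrow> bool" where
  "generates R M N k g \<longleftrightarrow>
     (\<forall>i<k. g i \<in> N) \<and> (\<forall>y\<in>N. \<exists>x. (\<forall>i<k. x i \<in> carrier R) \<and> y = lincomb M g x k)"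

lemma fin_gen_moduleD: "fin_gen_module R M ==> module R M"
  by (simp add: fin_gen_module_def)

text \<open>The span is an intersection of submodules. The combinations of an enumeration of the
  finite set form one of these submodules; conversely every submodule that contains the generators
  contains their combinations.\<close>

lemma fin_gen_module_iff:
  fixes R (structure)
  assumes "module R M"
  shows "fin_gen_module R M \<longleftrightarrow> (\<exists>k g. generates R M (carrier M) k g)"
proof
  interpret module R M by fact
  assume "fin_gen_module R M"
  then obtain S where S: "finite S" "S \<subseteq> carrier M" "submodule_span R M S = carrier M"
    by (auto simp: fin_gen_module_def)
  obtain k and g :: "nat \<Rightarrow> 'c" where kg: "S = g ` {i. i < k}" using finite_imp_nat_seg_image_inj_on[OF S(1)] by auto
  have g: "g i \<in> carrier M" if "i < k" for i using kg that S by auto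
  have "S \<subseteq> {lincomb M g x k | x. \<forall>i<k. x i \<in> carrier R}"
  proof
    fix s assume "s \<in> S"
    then obtain j where j: "j < k" "s = g j" using kg by auto
    have "lincomb M g (\<lambda>i. if i = j then \<one> else \<zero>) k = g j"
      by (rule lincomb_unit[OF assms]) (use g j in auto)
    then show "s \<in> {lincomb M g x k | x. \<forall>i<k. x i \<in> carrier R}"
      using j by (auto intro!: exI[of _ "\<lambda>i. if i = j then \<one> else \<zero>"])
  qed
  then have "carrier M \<subseteq> {lincomb M g x k | x. \<forall>i<k. x i \<in> carrier R}"
    using submodule_lincombs[OF assms, of k g] g S(3) unfolding submodule_span_def by auto
  then show "\<exists>k g. generates R M (carrier M) k g" unfolding generates_def using g by blast
next
  interpret module R M by fact
  assume "\<exists>k g. generates R M (carrier M) k g"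
  then obtain k g where kg: "generates R M (carrier M) k g" by auto
  have "submodule_span R M (g ` {..<k}) = carrier M"
  proof
    show "submodule_span R M (g ` {..<k}) \<subseteq> carrier M"
      using kg carrier_is_submodule unfolding submodule_span_def generates_def by auto
    show "carrier M \<subseteq> submodule_span R M (g ` {..<k})"
      using kg unfolding submodule_span_def generates_def by (auto intro!: lincomb_in_sub) (metis image_subset_iff lessThan_iff lincomb_in_sub)
  qed
  moreover have "finite (g ` {..<k})" "g ` {..<k} \<subseteq> carrier M" using kg by (auto simp: generates_def)
  ultimately show "fin_gen_module R M" using assms unfolding fin_gen_module_def by blast
qed

section \<open>Congruences modulo a submodule\<close>

lemma minus_zero_iff:
  assumes "module R M" "x \<in> carrier M" "y \<in> carrier M"
  shows "x \<ominus>\<^bsub>M\<^esub> y = \<zero>\<^bsub>M\<^esub> \<longleftrightarrow> x = y"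
proof -
  interpret module R M by fact
  show ?thesis using assms(2,3)
    by (metis M.add.inv_closed M.add.inv_equality M.minus_minus M.r_neg a_minus_def)
qed

lemma mod_trans:
  fixes M (structure)
  assumes "module R M" "submodule T R M" "x \<in> carrier M" "y \<in> carrier M" "z \<in> carrier M"
    "x \<ominus> y \<in> T" "y \<ominus> z \<in> T"
  shows "x \<ominus> z \<in> T"
proof -
  interpret module R M by fact
  have "x \<ominus> z = (x \<ominus> y) \<oplus> (y \<ominus> z)" using assms(3-5)
    by (simp add: a_minus_def M.a_assoc M.r_neg1 M.r_neg2)
  then show ?thesis using sub_add[OF assms(2,6,7)] by simp
qed

lemma mod_sym:
  fixes M (structure)
  assumes "module R M" "submodule T R M" "x \<in> carrier M" "y \<in> carrier M" "x \<ominus> y \<in> T"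
  shows "y \<ominus> x \<in> T"
proof -
  interpret module R M by fact
  have "y \<ominus> x = \<ominus> (x \<ominus> y)" using assms(3,4)
    by (simp add: a_minus_def M.minus_add M.a_comm)
  then show ?thesis using sub_uminus[OF assms(2,5)] by simp
qed

lemma mod_refl:
  assumes "module R M" "submodule T R M" "x \<in> carrier M"
  shows "x \<ominus>\<^bsub>M\<^esub> x \<in> T"
proof -
  interpret module R M by fact
  have "x \<ominus>\<^bsub>M\<^esub> x = \<zero>\<^bsub>M\<^esub>" using assms(3) minus_zero_iff[OF assms(1)] by blast
  then show ?thesis using sub_zero[OF assms(2)] by simp
qed

lemma mod_add:
  fixes M (structure)
  assumes "module R M" "submodule T R M" "x \<in> carrier M" "y \<in> carrier M" "x' \<in> carrier M" "y' \<in> carrier M"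
    "x \<ominus> y \<in> T" "x' \<ominus> y' \<in> T"
  shows "(x \<oplus> x') \<ominus> (y \<oplus> y') \<in> T"
proof -
  interpret module R M by fact
  have "(x \<oplus> x') \<ominus> (y \<oplus> y') = (x \<ominus> y) \<oplus> (x' \<ominus> y')" using assms(3-6)
    by (simp add: a_minus_def M.minus_add M.a_ac)
  then show ?thesis using sub_add[OF assms(2,7,8)] by simp
qed

lemma mod_cancel:
  fixes M (structure)
  assumes "module R M" "x \<in> carrier M" "y \<in> carrier M"
  shows "(x \<ominus> y) \<oplus> y = x" "y \<oplus> (x \<ominus> y) = x" "x \<ominus> (x \<ominus> y) = y"
    "(x \<oplus> y) \<ominus> y = x" "(y \<oplus> x) \<ominus> y = x"
proof -
  interpret module R M by fact
  show "(x \<ominus> y) \<oplus> y = x" using assms(2,3) by (simp add: a_minus_def M.a_assoc M.l_neg)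
  then show "y \<oplus> (x \<ominus> y) = x" using assms(2,3) by (simp add: M.a_comm)
  show "x \<ominus> (x \<ominus> y) = y" using assms(2,3)
    by (simp add: a_minus_def M.minus_add M.r_neg2)
  show "(x \<oplus> y) \<ominus> y = x" using assms(2,3) by (simp add: a_minus_def M.a_assoc M.r_neg)
  then show "(y \<oplus> x) \<ominus> y = x" using assms(2,3) by (simp add: M.a_comm)
qed

lemma minus_add_cancel_right:
  fixes M (structure)
  assumes "module R M" "x \<in> carrier M" "y \<in> carrier M" "z \<in> carrier M"
  shows "(x \<oplus> z) \<ominus> (y \<oplus> z) = x \<ominus> y"
proof -
  interpret module R M by fact
  show ?thesis using assms(2-) M.a_comm[of "\<ominus> y" "\<ominus> z"]
    by (simp add: a_minus_def M.minus_add M.a_assoc M.r_neg2)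
qed

lemma mod_mem:
  assumes "module R M" "submodule T R M" "x \<in> carrier M" "y \<in> T" "x \<ominus>\<^bsub>M\<^esub> y \<in> T"
  shows "x \<in> T"
  using sub_add[OF assms(2,5,4)] mod_cancel(1)[OF assms(1,3) sub_carr[OF assms(2,4)]] by simp

section \<open>Noetherian modules\<close>

definition noeth :: "('a, 'r) ring_scheme \<Rightarrow> ('a, 'm, 's) module_scheme \<Rightarrow> bool" where
  "noeth R M \<longleftrightarrow> module R M \<and> (\<forall>N. submodule N R M \<longrightarrow> (\<exists>k g. generates R M N k g))"

lemma generates_ideal:
  fixes R (structure)
  assumes "cring R" "noetherian_ring R" "ideal I R"
  shows "\<exists>k g. generates R (RM R) I k g"
proof -
  interpret cring R by fact
  note Rm = module_ring_as_module[OF assms(1)]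
  obtain A where A: "A \<subseteq> carrier R" "finite A" "I = Idl A"
    using noetherian_ring.finetely_gen[OF assms(2,3)] by auto
  obtain k and g :: "nat \<Rightarrow> 'a" where kg: "A = g ` {i. i < k}" using finite_imp_nat_seg_image_inj_on[OF A(2)] by auto
  have g: "g i \<in> carrier (RM R)" if "i < k" for i using kg that A by auto
  let ?T = "{lincomb (RM R) g x k | x. \<forall>i<k. x i \<in> carrier R}"
  have "A \<subseteq> ?T"
  proof
    fix s assume "s \<in> A"
    then obtain j where j: "j < k" "s = g j" using kg by auto
    have "lincomb (RM R) g (\<lambda>i. if i = j then \<one> else \<zero>) k = g j"
      by (rule lincomb_unit[OF Rm]) (use g j in auto)
    then show "s \<in> ?T"
      using j by (auto intro!: exI[of _ "\<lambda>i. if i = j then \<one> else \<zero>"])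
  qed
  moreover have "ideal ?T R" using submodule_lincombs[OF Rm, of k g] g ideal_iff_submodule[OF assms(1)] by blast
  ultimately have "I \<subseteq> ?T" using A(3) genideal_minimal by auto
  moreover have "\<forall>i<k. g i \<in> I" using A genideal_self kg by auto
  ultimately show ?thesis unfolding generates_def by blast
qed

text \<open>The coefficients at the last generator \<open>g k\<close> form an ideal of
  \<open>R\<close>, which is finitely generated. Elements of \<open>N\<close> realising its
  generators reduce any element of \<open>N\<close> to one in which \<open>g k\<close> does not
  occur, and the induction hypothesis treats those.\<close>

lemma noetherian_generates:
  fixes M (structure)
  assumes "cring R" "noetherian_ring R" "module R M"
  shows "(\<And>i. i < k ==> g i \<in> carrier M) ==> submodule N R M ==>
    (\<And>y. y \<in> N ==> \<exists>x. (\<forall>i<k. x i \<in> carrier R) \<and> y = lincomb M g x k) ==>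
    \<exists>l h. generates R M N l h"
proof (induction k arbitrary: N)
  case 0
  then show ?case by (intro exI[of _ 0]) (auto simp: generates_def)
next
  case (Suc k)
  interpret module R M by fact
  note Rm = module_ring_as_module[OF assms(1)]
  note N = Suc.prems(2)
  have g: "\<And>i. i < k ==> g i \<in> carrier M" "g k \<in> carrier M" using Suc.prems by auto
  let ?S = "{lincomb M g x k | x. \<forall>i<k. x i \<in> carrier R}"
  have S: "submodule ?S R M" by (rule submodule_lincombs[OF assms(3) g(1)])
  \<comment> \<open>The ideal of all coefficients with which \<open>g k\<close> occurs in elements
    of \<open>N\<close>.\<close>
  define J where "J = {r \<in> carrier R. \<exists>a\<in>?S. a \<oplus> r \<odot> g k \<in> N}"
  have "submodule J R (RM R)"
  proof (rule submoduleI'[OF Rm])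
    show "J \<subseteq> carrier (RM R)" by (auto simp: J_def)
    have "\<zero> \<oplus> \<zero>\<^bsub>R\<^esub> \<odot> g k \<in> N" using g sub_zero[OF N] by simp
    then show "\<zero>\<^bsub>RM R\<^esub> \<in> J" using sub_zero[OF S] unfolding J_def by auto
  next
    fix x y assume "x \<in> J" "y \<in> J"
    then obtain a b where ab: "x \<in> carrier R" "y \<in> carrier R" "a \<in> ?S" "b \<in> ?S"
      "a \<oplus> x \<odot> g k \<in> N" "b \<oplus> y \<odot> g k \<in> N" unfolding J_def by blast
    have "(a \<oplus> b) \<oplus> (x \<oplus>\<^bsub>R\<^esub> y) \<odot> g k = (a \<oplus> x \<odot> g k) \<oplus> (b \<oplus> y \<odot> g k)"
      using ab(1,2) g(2) sub_carr[OF S ab(3)] sub_carr[OF S ab(4)] by (simp add: smult_l_distr M.a_ac)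
    then have "(a \<oplus> b) \<oplus> (x \<oplus>\<^bsub>R\<^esub> y) \<odot> g k \<in> N" using sub_add[OF N ab(5,6)] by simp
    then show "x \<oplus>\<^bsub>RM R\<^esub> y \<in> J" using sub_add[OF S ab(3,4)] ab(1,2) unfolding J_def by auto
  next
    fix r x assume r: "r \<in> carrier R" and "x \<in> J"
    then obtain a where ab: "x \<in> carrier R" "a \<in> ?S" "a \<oplus> x \<odot> g k \<in> N" unfolding J_def by blast
    have "r \<odot> a \<oplus> (r \<otimes>\<^bsub>R\<^esub> x) \<odot> g k = r \<odot> (a \<oplus> x \<odot> g k)"
      using ab(1) r g(2) sub_carr[OF S ab(2)] by (simp add: smult_r_distr smult_assoc1)
    then have "r \<odot> a \<oplus> (r \<otimes>\<^bsub>R\<^esub> x) \<odot> g k \<in> N" using sub_smult[OF N r ab(3)] by simp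
    then show "r \<odot>\<^bsub>RM R\<^esub> x \<in> J" using sub_smult[OF S r ab(2)] ab(1) r unfolding J_def by auto
  qed
  then have "ideal J R" using ideal_iff_submodule[OF assms(1)] by blast
  then obtain l \<rho> where \<rho>: "generates R (RM R) J l \<rho>" using generates_ideal[OF assms(1,2)] by blast
  then have "\<forall>i<l. \<exists>a\<in>?S. a \<oplus> \<rho> i \<odot> g k \<in> N" and \<rho>c: "\<And>i. i < l ==> \<rho> i \<in> carrier R"
    unfolding generates_def J_def by blast+
  then obtain a where a: "\<And>i. i < l ==> a i \<in> ?S" "\<And>i. i < l ==> a i \<oplus> \<rho> i \<odot> g k \<in> N"
    using that[of "\<lambda>i. SOME a. a \<in> ?S \<and> a \<oplus> \<rho> i \<odot> g k \<in> N"] someI_ex by (smt (verit, ccfv_threshold))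
  have ac: "\<And>i. i < l ==> a i \<in> carrier M" using a(1) sub_carr[OF S] by blast
  let ?n = "\<lambda>i. a i \<oplus> \<rho> i \<odot> g k"
  have "\<exists>l h. generates R M (N \<inter> ?S) l h"
    by (rule Suc.IH) (use g submodule_inter[OF assms(3) N S] in auto)
  then obtain l' h where h: "generates R M (N \<inter> ?S) l' h" by blast
  have hN: "\<And>i. i < l' ==> h i \<in> N" using h unfolding generates_def by blast
  have "generates R M N (l + l') (\<lambda>i. if i < l then ?n i else h (i - l))"
    unfolding generates_def
  proof (intro conjI ballI allI impI)
    fix i assume "i < l + l'"
    then show "(if i < l then ?n i else h (i - l)) \<in> N" using a(2) hN by auto
  next
    fix y assume y: "y \<in> N"
    obtain x where x: "\<forall>i<Suc k. x i \<in> carrier R" "y = lincomb M g x (Suc k)" using Suc.prems(3)[OF y] by blast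
    let ?s = "lincomb M g x k"
    have sS: "?s \<in> ?S" using x by auto
    have yx: "y = ?s \<oplus> x k \<odot> g k" using x by simp
    then have "x k \<in> J" using x y sS unfolding J_def by auto
    then obtain c where c: "\<forall>i<l. c i \<in> carrier R" "x k = lincomb (RM R) \<rho> c l"
      using \<rho> unfolding generates_def by blast
    \<comment> \<open>\<open>?z\<close> lies in \<open>N\<close> and contains the same term
      \<open>x k \<odot> g k\<close> as \<open>y\<close>, so the difference falls into
      \<open>N \<inter> ?S\<close>.\<close>
    let ?z = "lincomb M ?n c l"
    have z: "?z = lincomb M a c l \<oplus> x k \<odot> g k"
      unfolding c(2) by (rule lincomb_shift[OF assms(3)]) (use ac \<rho>c g c in auto)
    have aS: "lincomb M a c l \<in> ?S" by (rule lincomb_in_sub[OF S]) (use a c in auto)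
    have zN: "?z \<in> N" by (rule lincomb_in_sub[OF N]) (use a c in auto)
    have "y \<ominus> ?z = ?s \<ominus> lincomb M a c l"
      unfolding z yx using sub_carr[OF S aS] sub_carr[OF S sS] x(1) g(2)
      by (intro minus_add_cancel_right[OF assms(3)]) auto
    then have "y \<ominus> ?z \<in> N \<inter> ?S" using sub_minus[OF N y zN] sub_minus[OF S sS aS] by simp
    then obtain t where t: "\<forall>i<l'. t i \<in> carrier R" "y \<ominus> ?z = lincomb M h t l'"
      using h unfolding generates_def by blast
    have "y = ?z \<oplus> lincomb M h t l'"
      using mod_cancel(2)[OF assms(3) sub_carr[OF N y] sub_carr[OF N zN]] t(2) by simp
    also have "\<dots> = lincomb M (\<lambda>i. if i < l then ?n i else h (i - l)) (\<lambda>i. if i < l then c i else t (i - l)) (l + l')"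
      by (rule lincomb_append[OF assms(3), symmetric]) (use ac \<rho>c g c t hN sub_carr[OF N] in auto)
    finally show "\<exists>x. (\<forall>i<l + l'. x i \<in> carrier R) \<and> y = lincomb M (\<lambda>i. if i < l then ?n i else h (i - l)) x (l + l')"
      using c t by (auto intro!: exI[of _ "\<lambda>i. if i < l then c i else t (i - l)"])
  qed
  then show ?case by blast
qed

lemma fin_gen_noeth:
  assumes "cring R" "noetherian_ring R" "fin_gen_module R M"
  shows "noeth R M"
proof -
  have M: "module R M" using assms(3) by (simp add: fin_gen_module_def)
  obtain k g where kg: "generates R M (carrier M) k g" using assms(3) fin_gen_module_iff[OF M] by blast
  show ?thesis unfolding noeth_def
  proof (intro conjI allI impI M)
    fix N assume N: "submodule N R M"
    show "\<exists>k g. generates R M N k g"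
      by (rule noetherian_generates[OF assms(1,2) M _ N, of k g])
        (use kg sub_carr[OF N] in \<open>auto simp: generates_def\<close>)
  qed
qed

text \<open>Without a maximal member, dependent choice gives a strictly increasing chain. Its union
  is a finitely generated submodule, so some member of the chain already contains all generators,
  and the chain stops there.\<close>

lemma noeth_max:
  assumes "noeth R M" "\<And>W. W \<in> \<S> ==> submodule W R M" "W0 \<in> \<S>"
  shows "\<exists>W\<in>\<S>. \<forall>V\<in>\<S>. W \<subseteq> V \<longrightarrow> V = W"
proof (rule ccontr)
  assume "\<not> ?thesis"
  then have step: "\<forall>W\<in>\<S>. \<exists>V\<in>\<S>. W \<subset> V" by blast
  have M: "module R M" using assms(1) by (simp add: noeth_def)
  have "\<exists>f. \<forall>n. f n \<in> \<S> \<and> f n \<subset> f (Suc n)"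
    by (rule dependent_nat_choice) (use step assms(3) in auto)
  then obtain f where f: "\<And>n. f n \<in> \<S>" "\<And>n. f n \<subset> f (Suc n)" by blast
  have sub: "submodule (f n) R M" for n using assms(2) f by blast
  have mono: "f m \<subseteq> f n" if "m \<le> n" for m n
    using lift_Suc_mono_le[of f m n] f(2) that by blast
  have "submodule (\<Union>n. f n) R M"
  proof (rule submoduleI'[OF M])
    fix x y assume "x \<in> (\<Union>n. f n)" "y \<in> (\<Union>n. f n)"
    then obtain m n where "x \<in> f m" "y \<in> f n" by blast
    then have "x \<in> f (max m n)" "y \<in> f (max m n)" using mono[of m "max m n"] mono[of n "max m n"] by auto
    then show "x \<oplus>\<^bsub>M\<^esub> y \<in> (\<Union>n. f n)" using sub_add[OF sub] by blast
  next
    show "(\<Union>n. f n) \<subseteq> carrier M" using sub_carr[OF sub] by auto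
    show "\<zero>\<^bsub>M\<^esub> \<in> (\<Union>n. f n)" using sub_zero[OF sub] by auto
    show "r \<odot>\<^bsub>M\<^esub> x \<in> (\<Union>n. f n)" if "r \<in> carrier R" "x \<in> (\<Union>n. f n)" for r x
      using sub_smult[OF sub] that by auto
  qed
  then obtain k g where kg: "generates R M (\<Union>n. f n) k g" using assms(1) by (auto simp: noeth_def)
  then have "\<forall>i<k. \<exists>n. g i \<in> f n" by (auto simp: generates_def)
  then obtain n where n: "\<And>i. i < k ==> g i \<in> f (n i)" by metis
  \<comment> \<open>The sum dominates every \<open>n i\<close> and also makes sense for
    \<open>k = 0\<close>.\<close>
  define m where "m = (\<Sum>i<k. n i)"
  have gm: "g i \<in> f m" if "i < k" for i
    using n[OF that] mono[of "n i" m] member_le_sum[of i "{..<k}" n] that unfolding m_def by auto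
  have "f (Suc m) \<subseteq> f m"
  proof
    fix y assume "y \<in> f (Suc m)"
    then obtain x where "\<forall>i<k. x i \<in> carrier R" "y = lincomb M g x k" using kg unfolding generates_def by blast
    then show "y \<in> f m" using lincomb_in_sub[OF sub, of k g m x] gm by blast
  qed
  then show False using f(2) by blast
qed

subsection \<open>Free modules\<close>

text \<open>Tuples over an arbitrary module and not only over \<open>R\<close>: by their values on
  the basis, homomorphisms from a free module of rank \<open>n\<close> to \<open>M\<close> become
  elements of \<open>tup M n\<close>. Thus cochains form a finitely generated module to which
  Artin-Rees applies.\<close>

definition tup :: "('a, 'm, 's) module_scheme \<Rightarrow> nat \<Rightarrow> ('a, nat \<Rightarrow> 'm) module" where
  "tup M n =
     \<lparr>carrier = {..<n} \<rightarrow>\<^sub>E carrier M, mult = undefined, one = undefined,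
      zero = (\<lambda>j\<in>{..<n}. \<zero>\<^bsub>M\<^esub>),
      add = (\<lambda>x y. \<lambda>j\<in>{..<n}. x j \<oplus>\<^bsub>M\<^esub> y j),
      smult = (\<lambda>r x. \<lambda>j\<in>{..<n}. r \<odot>\<^bsub>M\<^esub> x j)\<rparr>"

lemma free_module_tup: "FM R n = tup (RM R) n"
  by (simp add: free_module_def tup_def)

lemma tup_eqI: "x \<in> carrier (tup M n) ==> y \<in> carrier (tup M n) ==> (\<And>j. j < n ==> x j = y j) ==> x = y"
  by (auto simp: tup_def intro: PiE_ext)

lemma tup_simps:
  "x \<in> carrier (tup M n) ==> j < n ==> x j \<in> carrier M"
  "j < n ==> \<zero>\<^bsub>tup M n\<^esub> j = \<zero>\<^bsub>M\<^esub>"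
  "j < n ==> (x \<oplus>\<^bsub>tup M n\<^esub> y) j = x j \<oplus>\<^bsub>M\<^esub> y j"
  "j < n ==> (r \<odot>\<^bsub>tup M n\<^esub> x) j = r \<odot>\<^bsub>M\<^esub> x j"
  by (auto simp: tup_def)

lemma tup_closed:
  assumes "module R M"
  shows "\<zero>\<^bsub>tup M n\<^esub> \<in> carrier (tup M n)"
    "x \<in> carrier (tup M n) ==> y \<in> carrier (tup M n) ==> x \<oplus>\<^bsub>tup M n\<^esub> y \<in> carrier (tup M n)"
    "r \<in> carrier R ==> x \<in> carrier (tup M n) ==> r \<odot>\<^bsub>tup M n\<^esub> x \<in> carrier (tup M n)"
proof -
  interpret module R M by fact
  have [simp]: "x \<in> {..<n} \<rightarrow>\<^sub>E carrier M ==> j < n ==> x j \<in> carrier M" for x j by auto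
  show "\<zero>\<^bsub>tup M n\<^esub> \<in> carrier (tup M n)"
    "x \<in> carrier (tup M n) ==> y \<in> carrier (tup M n) ==> x \<oplus>\<^bsub>tup M n\<^esub> y \<in> carrier (tup M n)"
    "r \<in> carrier R ==> x \<in> carrier (tup M n) ==> r \<odot>\<^bsub>tup M n\<^esub> x \<in> carrier (tup M n)"
    by (simp_all add: tup_def)
qed

lemma module_tup:
  assumes "module R M"
  shows "module R (tup M n)"
proof -
  interpret module R M by fact
  note [simp] = tup_simps tup_closed[OF assms]
  have "abelian_group (tup M n)"
  proof (rule abelian_groupI)
    fix x assume x: "x \<in> carrier (tup M n)"
    have y: "(\<lambda>j\<in>{..<n}. \<ominus>\<^bsub>M\<^esub> x j) \<in> carrier (tup M n)" using x by (simp add: tup_def PiE_mem)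
    have "(\<lambda>j\<in>{..<n}. \<ominus>\<^bsub>M\<^esub> x j) \<oplus>\<^bsub>tup M n\<^esub> x = \<zero>\<^bsub>tup M n\<^esub>"
      by (rule tup_eqI[of _ M n]) (use x y in \<open>simp_all add: M.l_neg\<close>)
    with y show "\<exists>y\<in>carrier (tup M n). y \<oplus>\<^bsub>tup M n\<^esub> x = \<zero>\<^bsub>tup M n\<^esub>" by blast
    show "\<zero>\<^bsub>tup M n\<^esub> \<oplus>\<^bsub>tup M n\<^esub> x = x" by (rule tup_eqI[of _ M n]) (use x in simp_all)
    fix y assume y: "y \<in> carrier (tup M n)"
    show "x \<oplus>\<^bsub>tup M n\<^esub> y = y \<oplus>\<^bsub>tup M n\<^esub> x" by (rule tup_eqI[of _ M n]) (use x y in \<open>simp_all add: M.a_comm\<close>)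
    fix z assume z: "z \<in> carrier (tup M n)"
    show "x \<oplus>\<^bsub>tup M n\<^esub> y \<oplus>\<^bsub>tup M n\<^esub> z = x \<oplus>\<^bsub>tup M n\<^esub> (y \<oplus>\<^bsub>tup M n\<^esub> z)"
      by (rule tup_eqI[of _ M n]) (use x y z in \<open>simp_all add: M.a_assoc\<close>)
  qed simp_all
  note ab = this
  show ?thesis
    by (intro moduleI[OF is_cring ab]; (rule tup_eqI[of _ M n])?)
      (auto simp: smult_l_distr smult_r_distr smult_assoc1)
qed

definition tup_inj :: "('a, 'm, 's) module_scheme \<Rightarrow> nat \<Rightarrow> nat \<Rightarrow> 'm \<Rightarrow> (nat \<Rightarrow> 'm)" where
  "tup_inj M n j y = (\<lambda>i\<in>{..<n}. if i = j then y else \<zero>\<^bsub>M\<^esub>)"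

lemma lin_tup_inj: "module R M ==> lin R M (tup M n) (tup_inj M n j)"
proof -
  assume "module R M"
  then interpret module R M .
  show ?thesis by (auto simp: lin_def tup_def tup_inj_def)
qed

lemma lin_tup_proj: "j < n ==> lin R (tup M n) M (\<lambda>x. x j)"
  by (auto simp: lin_def tup_def)

lemma lin_into_tup:
  assumes "\<And>j. j < n ==> lin R A M (f j)"
  shows "lin R A (tup M n) (\<lambda>x. \<lambda>j\<in>{..<n}. f j x)"
  using assms by (auto simp: lin_def tup_def)

text \<open>A tuple is the sum of its coordinate injections; the partial sums are collected one
  coordinate at a time.\<close>

lemma tup_in_sub:
  fixes M (structure)
  assumes "module R M" "submodule T R (tup M n)" "u \<in> carrier (tup M n)"
    "\<And>j. j < n ==> tup_inj M n j (u j) \<in> T"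
  shows "u \<in> T"
proof -
  interpret module R M by fact
  have [simp]: "j < n ==> u j \<in> carrier M" for j using assms(3) tup_simps by blast
  have "(\<lambda>i\<in>{..<n}. if i < k then u i else \<zero>) \<in> T" if "k \<le> n" for k
    using that
  proof (induction k)
    case 0
    then show ?case using sub_zero[OF assms(2)] by (simp add: tup_def restrict_def)
  next
    case (Suc k)
    have e: "(\<lambda>i\<in>{..<n}. if i < Suc k then u i else \<zero>) =
        (\<lambda>i\<in>{..<n}. if i < k then u i else \<zero>) \<oplus>\<^bsub>tup M n\<^esub> tup_inj M n k (u k)"
      using Suc.prems by (auto simp: tup_def tup_inj_def)
    show ?case unfolding e by (rule sub_add[OF assms(2) Suc.IH assms(4)]) (use Suc.prems in auto)
  qed
  from this[of n] have "(\<lambda>i\<in>{..<n}. if i < n then u i else \<zero>) \<in> T" by simp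
  also have "(\<lambda>i\<in>{..<n}. if i < n then u i else \<zero>) = u"
    using assms(3) by (auto simp: tup_def PiE_def extensional_def)
  finally show ?thesis .
qed

lemma fin_gen_tup:
  assumes "fin_gen_module R M"
  shows "fin_gen_module R (tup M n)"
proof -
  have M: "module R M" using assms(1) by (simp add: fin_gen_module_def)
  interpret T: module R "tup M n" by (rule module_tup[OF M])
  obtain k g where kg: "generates R M (carrier M) k g" using assms fin_gen_module_iff[OF M] by blast
  let ?S = "(\<lambda>(j, i). tup_inj M n j (g i)) ` ({..<n} \<times> {..<k})"
  have S: "?S \<subseteq> carrier (tup M n)" using kg lin_closed[OF lin_tup_inj[OF M]] by (auto simp: generates_def)
  have "carrier (tup M n) \<subseteq> N" if N: "submodule N R (tup M n)" "?S \<subseteq> N" for N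
  proof
    fix u assume u: "u \<in> carrier (tup M n)"
    show "u \<in> N"
    proof (rule tup_in_sub[OF M N(1) u])
      fix j assume j: "j < n"
      then have "u j \<in> carrier M" using u tup_simps by blast
      then obtain x where x: "\<forall>i<k. x i \<in> carrier R" "u j = lincomb M g x k" using kg unfolding generates_def by blast
      have "tup_inj M n j (u j) = lincomb (tup M n) (\<lambda>i. tup_inj M n j (g i)) x k"
        unfolding x(2) by (rule lincomb_image[OF M module_tup[OF M] lin_tup_inj[OF M]]) (use kg x in \<open>auto simp: generates_def\<close>)
      also have "\<dots> \<in> N" by (rule lincomb_in_sub[OF N(1)]) (use x N(2) j in auto)
      finally show "tup_inj M n j (u j) \<in> N" .
    qed
  qed
  then have "submodule_span R (tup M n) ?S = carrier (tup M n)"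
    using S T.carrier_is_submodule unfolding submodule_span_def by blast
  then show ?thesis unfolding fin_gen_module_def using S T.module_axioms by (intro conjI exI[of _ ?S]) auto
qed

lemma fin_gen_ring: "cring R ==> fin_gen_module R (RM R)"
proof -
  assume R: "cring R"
  interpret cring R by fact
  note Rm = module_ring_as_module[OF R]
  have "generates R (RM R) (carrier R) 1 (\<lambda>_. \<one>\<^bsub>R\<^esub>)"
    unfolding generates_def by (auto intro!: exI[of _ "\<lambda>_. _"])
  then show ?thesis using fin_gen_module_iff[OF Rm] by auto
qed

definition basis :: "('a, 'r) ring_scheme \<Rightarrow> nat \<Rightarrow> nat \<Rightarrow> (nat \<Rightarrow> 'a)" where
  "basis R n j = tup_inj (RM R) n j \<one>\<^bsub>R\<^esub>"

lemma module_free: "cring R ==> module R (FM R n)"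
  by (simp add: free_module_tup module_tup module_ring_as_module)

lemma fin_gen_free: "cring R ==> fin_gen_module R (FM R n)"
  by (simp add: free_module_tup fin_gen_tup fin_gen_ring)

lemma basis_closed: "cring R ==> basis R n j \<in> carrier (FM R n)"
  unfolding basis_def free_module_tup
  by (rule lin_closed[OF lin_tup_inj[OF module_ring_as_module]]) (auto simp: cring.cring_simprules)

lemma free_in_sub:
  assumes "cring R" "submodule T R (FM R n)" "\<And>j. j < n ==> basis R n j \<in> T"
    "x \<in> carrier (FM R n)"
  shows "x \<in> T"
proof (rule tup_in_sub[OF module_ring_as_module[OF assms(1)]])
  interpret cring R by fact
  show "submodule T R (tup (RM R) n)" "x \<in> carrier (tup (RM R) n)"
    using assms by (auto simp: free_module_tup)
  fix j assume j: "j < n"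
  then have xj: "x j \<in> carrier R" using assms(4) tup_simps(1)[of x "RM R" n j] by (simp add: free_module_tup)
  have "tup_inj (RM R) n j (x j) = x j \<odot>\<^bsub>FM R n\<^esub> basis R n j"
    using xj by (auto simp: tup_inj_def basis_def free_module_def)
  then show "tup_inj (RM R) n j (x j) \<in> T" using sub_smult[OF assms(2) xj assms(3)[OF j]] by simp
qed

text \<open>Preimages of submodules are submodules, so membership of all values has to be tested on
  the basis only. Most identities between maps on free modules are reduced to the basis in this
  way.\<close>

lemma lin_in_sub:
  assumes "module R M" "lin R (FM R n) M f" "submodule L R M" "\<And>j. j < n ==> f (basis R n j) \<in> L"
    "x \<in> carrier (FM R n)"
  shows "f x \<in> L"
proof -
  interpret module R M by fact
  interpret F: module R "FM R n" by (rule module_free[OF is_cring])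
  have "submodule {x \<in> carrier (FM R n). f x \<in> L} R (FM R n)"
    by (rule submodule_kernel[OF F.module_axioms assms(1,2) F.carrier_is_submodule assms(3)])
  from free_in_sub[OF is_cring this] show ?thesis using assms(4,5) basis_closed[OF is_cring] by auto
qed

lemma lin_eq_basis:
  assumes "module R M" "lin R (FM R n) M f" "lin R (FM R n) M g"
    "\<And>j. j < n ==> f (basis R n j) = g (basis R n j)" "x \<in> carrier (FM R n)"
  shows "f x = g x"
proof -
  interpret module R M by fact
  have "f x \<ominus>\<^bsub>M\<^esub> g x \<in> {\<zero>\<^bsub>M\<^esub>}"
    by (rule lin_in_sub[OF assms(1) lin_diff[OF assms(1-3)] submodule_zero[OF assms(1)] _ assms(5)])
      (use assms(4) lin_closed[OF assms(3) basis_closed[OF is_cring]] in \<open>simp add: minus_zero_iff[OF assms(1)]\<close>)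
  then show ?thesis using lin_closed[OF assms(2,5)] lin_closed[OF assms(3,5)] by (simp add: minus_zero_iff[OF assms(1)])
qed

lemma lin_lincomb:
  assumes "module R M" "\<And>j. j < n ==> u j \<in> carrier M"
  shows "lin R (FM R n) M (\<lambda>x. lincomb M u x n)"
proof -
  interpret module R M by fact
  have [simp]: "x \<in> carrier (FM R n) ==> j < n ==> x j \<in> carrier R" for x j by (auto simp: free_module_def)
  show ?thesis unfolding lin_def
  proof (intro conjI ballI)
    fix x assume x: "x \<in> carrier (FM R n)"
    then show "lincomb M u x n \<in> carrier M" by (intro lincomb_closed[OF assms]) auto
    fix y assume y: "y \<in> carrier (FM R n)"
    show "lincomb M u (x \<oplus>\<^bsub>FM R n\<^esub> y) n = lincomb M u x n \<oplus>\<^bsub>M\<^esub> lincomb M u y n"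
      using x y by (subst lincomb_add_coeff[OF assms, symmetric]) (auto simp: free_module_tup tup_simps cong: lincomb_cong)
  next
    fix r x assume x: "r \<in> carrier R" "x \<in> carrier (FM R n)"
    show "lincomb M u (r \<odot>\<^bsub>FM R n\<^esub> x) n = r \<odot>\<^bsub>M\<^esub> lincomb M u x n"
      using x by (subst lincomb_smult_coeff[OF assms, symmetric]) (auto simp: free_module_tup tup_simps cong: lincomb_cong)
  qed
qed

lemma lincomb_basis:
  assumes "module R M" "\<And>j. j < n ==> u j \<in> carrier M" "j < n"
  shows "lincomb M u (basis R n j) n = u j"
  by (rule lincomb_unit[OF assms]) (auto simp: basis_def tup_inj_def)

lemma lin_expand:
  assumes "module R M" "lin R (FM R n) M f" "x \<in> carrier (FM R n)"
  shows "f x = lincomb M (\<lambda>j. f (basis R n j)) x n"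
proof -
  interpret module R M by fact
  have c: "f (basis R n j) \<in> carrier M" for j by (rule lin_closed[OF assms(2) basis_closed[OF is_cring]])
  show ?thesis
    by (rule lin_eq_basis[OF assms(1,2) lin_lincomb[OF assms(1)] _ assms(3)])
      (use c lincomb_basis[OF assms(1)] in auto)
qed

text \<open>The universal property of free modules, arranged so that the values on the basis are
  chosen one by one subject to a condition.\<close>

lemma lin_choice:
  assumes "module R M" "\<And>j. j < n ==> \<exists>y\<in>carrier M. P j y"
  obtains f where "lin R (FM R n) M f" "\<And>j. j < n ==> P j (f (basis R n j))"
proof -
  obtain u where u: "\<And>j. j < n ==> u j \<in> carrier M" "\<And>j. j < n ==> P j (u j)" using assms(2) by metis
  show ?thesis
    by (rule that[OF lin_lincomb[OF assms(1) u(1)]]) (use u lincomb_basis[OF assms(1), of n u] in auto)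
qed

text \<open>Projectivity of free modules relative to submodules: the lift is demanded only modulo
  \<open>L\<close>, and its values can be kept in \<open>C\<close>. This replaces lifting along maps
  between quotients, which are never formed.\<close>

lemma lin_lift:
  assumes "module R A" "module R B" "lin R A B \<pi>" "lin R (FM R n) B f" "submodule L R B"
    "submodule C R A"
    "\<And>x. x \<in> carrier (FM R n) ==> \<exists>y\<in>C. f x \<ominus>\<^bsub>B\<^esub> \<pi> y \<in> L"
  obtains g where "lin R (FM R n) A g" "\<And>x. x \<in> carrier (FM R n) ==> f x \<ominus>\<^bsub>B\<^esub> \<pi> (g x) \<in> L"
    "\<And>x. x \<in> carrier (FM R n) ==> g x \<in> C"
proof -
  interpret A: module R A by fact
  have b: "basis R n j \<in> carrier (FM R n)" for j by (rule basis_closed[OF A.is_cring])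
  have "\<exists>y\<in>carrier A. y \<in> C \<and> f (basis R n j) \<ominus>\<^bsub>B\<^esub> \<pi> y \<in> L" for j
    using assms(7)[OF b] sub_carr[OF assms(6)] by blast
  then obtain g where g: "lin R (FM R n) A g"
    "\<And>j. j < n ==> g (basis R n j) \<in> C \<and> f (basis R n j) \<ominus>\<^bsub>B\<^esub> \<pi> (g (basis R n j)) \<in> L"
    using lin_choice[OF assms(1), of n "\<lambda>j y. y \<in> C \<and> f (basis R n j) \<ominus>\<^bsub>B\<^esub> \<pi> y \<in> L"] by blast
  show ?thesis
  proof (rule that[OF g(1)])
    fix x assume x: "x \<in> carrier (FM R n)"
    show "f x \<ominus>\<^bsub>B\<^esub> \<pi> (g x) \<in> L"
      by (rule lin_in_sub[OF assms(2) lin_diff[OF assms(2,4) lin_comp[OF g(1) assms(3)]] assms(5) _ x]) (use g in auto)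
    show "g x \<in> C" by (rule lin_in_sub[OF assms(1) g(1) assms(6) _ x]) (use g in auto)
  qed
qed

subsection \<open>Ideal powers and the Artin--Rees property\<close>

text \<open>The submodule \<open>I N\<close>, built by adding one product at a time so that
  statements about it are proved by rule induction; \<open>ideal_smult_imul\<close> identifies it
  with the span that occurs in the definition of the completion.\<close>

inductive_set imul :: "('a, 'm, 's) module_scheme \<Rightarrow> 'a set \<Rightarrow> 'm set \<Rightarrow> 'm set" for M I N where
  imul_zero: "\<zero>\<^bsub>M\<^esub> \<in> imul M I N"
| imul_step: "y \<in> imul M I N ==> r \<in> I ==> x \<in> N ==> y \<oplus>\<^bsub>M\<^esub> r \<odot>\<^bsub>M\<^esub> x \<in> imul M I N"

lemma imul_mono: "I \<subseteq> I' ==> N \<subseteq> N' ==> imul M I N \<subseteq> imul M I' N'"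
proof
  fix x assume "I \<subseteq> I'" "N \<subseteq> N'" "x \<in> imul M I N"
  from this(3,1,2) show "x \<in> imul M I' N'" by (induction) (auto intro: imul.intros)
qed

lemma imul_in_sub:
  assumes "submodule T R M" "\<And>r x. r \<in> I ==> x \<in> N ==> r \<odot>\<^bsub>M\<^esub> x \<in> T" "y \<in> imul M I N"
  shows "y \<in> T"
  using assms(3) by induction (auto intro: sub_zero[OF assms(1)] sub_add[OF assms(1)] assms(2))

lemma imul_subset:
  assumes "submodule N R M" "I \<subseteq> carrier R"
  shows "imul M I N \<subseteq> N"
  using imul_in_sub[OF assms(1), of I N] sub_smult[OF assms(1)] assms(2) by blast

lemma submodule_imul:
  assumes "module R M" "ideal I R" "submodule N R M"
  shows "submodule (imul M I N) R M"
proof -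
  interpret module R M by fact
  interpret I: ideal I R by fact
  have c: "x \<in> carrier M" if "x \<in> imul M I N" for x
    using imul_subset[OF assms(3)] I.Icarr sub_carr[OF assms(3)] that by blast
  note [simp] = sub_carr[OF assms(3)]
  show ?thesis
  proof (rule submoduleI'[OF assms(1)])
    show "imul M I N \<subseteq> carrier M" using c by blast
    show "\<zero>\<^bsub>M\<^esub> \<in> imul M I N" by (rule imul_zero)
    fix y assume y: "y \<in> imul M I N"
    show "x \<oplus>\<^bsub>M\<^esub> y \<in> imul M I N" if "x \<in> imul M I N" for x using y
    proof induction
      case imul_zero
      then show ?case using c[OF that] that by simp
    next
      case (imul_step y r z)
      then show ?case using imul.imul_step[OF imul_step.IH imul_step(2,3)] c[OF that] c by (simp add: M.a_assoc)
    qed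
    show "s \<odot>\<^bsub>M\<^esub> y \<in> imul M I N" if "s \<in> carrier R" for s using y
    proof induction
      case imul_zero
      then show ?case using that by (simp add: imul.imul_zero)
    next
      case (imul_step y r z)
      then show ?case using imul.imul_step[OF imul_step.IH I.I_l_closed[OF imul_step(2) that] imul_step(3)] c that
        by (simp add: smult_r_distr smult_assoc1)
    qed
  qed
qed

lemma imul_prod:
  assumes "module R M" "ideal I R" "submodule N R M" "r \<in> I" "x \<in> N"
  shows "r \<odot>\<^bsub>M\<^esub> x \<in> imul M I N"
proof -
  interpret module R M by fact
  interpret I: ideal I R by fact
  show ?thesis using imul_step[OF imul_zero assms(4,5), of M] sub_carr[OF assms(3,5)] I.Icarr[OF assms(4)] by simp
qed

lemma ideal_smult_imul:
  assumes "module R M" "ideal I R"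
  shows "ideal_smult R I M = imul M I (carrier M)"
proof -
  interpret module R M by fact
  note s = submodule_imul[OF assms carrier_is_submodule]
  have "{r \<odot>\<^bsub>M\<^esub> x | r x. r \<in> I \<and> x \<in> carrier M} \<subseteq> imul M I (carrier M)"
    using imul_prod[OF assms carrier_is_submodule] by auto
  moreover have "imul M I (carrier M) \<subseteq> N"
    if "submodule N R M" "{r \<odot>\<^bsub>M\<^esub> x | r x. r \<in> I \<and> x \<in> carrier M} \<subseteq> N" for N
    using imul_in_sub[OF that(1), of I "carrier M"] that(2) by blast
  ultimately show ?thesis unfolding ideal_smult_def submodule_span_def using s by auto
qed

lemma imul_image:
  assumes "module R M" "module R N" "lin R M N f" "I \<subseteq> carrier R" "A \<subseteq> carrier M" "f ` A \<subseteq> B"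
    "y \<in> imul M I A"
  shows "f y \<in> imul N I B"
proof -
  interpret module R M by fact
  from assms(7) have "y \<in> carrier M \<and> f y \<in> imul N I B"
  proof induction
    case imul_zero
    then show ?case by (simp add: lin_zero[OF assms(1-3)] imul.imul_zero)
  next
    case (imul_step y r x)
    then have "x \<in> carrier M" "r \<in> carrier R" using assms by auto
    then show ?case using imul_step imul.imul_step[of "f y" N I B r "f x"] assms(6)
      by (auto simp: lin_add[OF assms(3)] lin_smult[OF assms(3)])
  qed
  then show ?thesis by simp
qed

text \<open>Smallness of an element passes to its coefficients with respect to fixed generators of
  \<open>N\<close>. The coherent coefficient sequences of limits are produced from this.\<close>

lemma imul_generates:
  fixes R (structure)
  assumes "module R M" "ideal I R" "submodule N R M" "generates R M N k g" "y \<in> imul M I N"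
  shows "\<exists>c. (\<forall>i<k. c i \<in> I) \<and> y = lincomb M g c k"
proof -
  interpret module R M by fact
  interpret I: ideal I R by fact
  have g: "\<And>i. i < k ==> g i \<in> carrier M" using assms(4) sub_carr[OF assms(3)] by (auto simp: generates_def)
  from assms(5) show ?thesis
  proof induction
    case imul_zero
    then show ?case using lincomb_zero_coeff[OF assms(1), of k g] g by (intro exI[of _ "\<lambda>_. \<zero>"]) auto
  next
    case (imul_step y r x)
    then obtain c where c: "\<forall>i<k. c i \<in> I" "y = lincomb M g c k" by blast
    obtain d where d: "\<forall>i<k. d i \<in> carrier R" "x = lincomb M g d k" using assms(4) imul_step(3) unfolding generates_def by blast
    have r: "r \<in> carrier R" using imul_step I.Icarr by blast
    have "y \<oplus>\<^bsub>M\<^esub> r \<odot>\<^bsub>M\<^esub> x = lincomb M g c k \<oplus>\<^bsub>M\<^esub> lincomb M g (\<lambda>i. r \<otimes> d i) k"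
      using c d lincomb_smult_coeff[OF assms(1) g, where x=d and r=r and k=k] r by simp
    also have "\<dots> = lincomb M g (\<lambda>i. c i \<oplus> r \<otimes> d i) k"
      by (rule lincomb_add_coeff[OF assms(1) g, symmetric]) (use c d r I.Icarr in auto)
    finally show ?case using c d imul_step(2) I.I_r_closed by (intro exI[of _ "\<lambda>i. c i \<oplus> r \<otimes> d i"]) auto
  qed
qed

text \<open>Together with \<open>imul_tup_D\<close>: the adic filtration on tuples is the
  coordinatewise one.\<close>

lemma imul_tup:
  assumes "module R M" "ideal I R" "u \<in> carrier (tup M n)" "\<And>j. j < n ==> u j \<in> imul M I (carrier M)"
  shows "u \<in> imul (tup M n) I (carrier (tup M n))"
proof -
  interpret T: module R "tup M n" by (rule module_tup[OF assms(1)])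
  interpret I: ideal I R by fact
  show ?thesis
    by (rule tup_in_sub[OF assms(1) submodule_imul[OF T.module_axioms assms(2) T.carrier_is_submodule] assms(3)])
      (rule imul_image[OF assms(1) T.module_axioms lin_tup_inj[OF assms(1)]],
        use assms(4) I.Icarr lin_closed[OF lin_tup_inj[OF assms(1)]] in auto)
qed

lemma imul_tup_D:
  assumes "module R M" "ideal I R" "u \<in> imul (tup M n) I (carrier (tup M n))" "j < n"
  shows "u j \<in> imul M I (carrier M)"
  by (rule imul_image[OF module_tup[OF assms(1)] assms(1) lin_tup_proj[OF assms(4)] _ _ _ assms(3)])
    (use ideal.Icarr[OF assms(2)] tup_simps(1)[OF _ assms(4)] in auto)

context
  fixes R :: "('a, 'r) ring_scheme" (structure) and \<aa> :: "'a set"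
  assumes R: "cring R" and \<aa>: "ideal \<aa> R"
begin

interpretation cring R by (rule R)
interpretation IS: comm_monoid "ideals_set R" by (rule ideals_set_is_comm_monoid)

lemma ideal_power_ideal: "ideal (ideal_power R \<aa> n) R"
proof -
  have "\<aa> \<in> carrier (ideals_set R)" using \<aa> by (simp add: ideals_set_def)
  then have "ideal_power R \<aa> n \<in> carrier (ideals_set R)" by (rule IS.nat_pow_closed)
  then show ?thesis by (simp add: ideals_set_def)
qed

lemma ideal_power_0: "ideal_power R \<aa> 0 = carrier R"
  by (simp add: ideals_set_def)

lemma ideal_power_Suc: "ideal_power R \<aa> (Suc n) = ideal_prod R (ideal_power R \<aa> n) \<aa>"
  by (simp add: ideals_set_def)

lemma ideal_power_1: "ideal_power R \<aa> (Suc 0) = \<aa>"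
  using ideal_power_Suc[of 0] ideal_prod_commute[OF oneideal \<aa>] ideal_prod_one[OF \<aa>] ideal_power_0 by simp

lemma ideal_power_antimono: "m \<le> n ==> ideal_power R \<aa> n \<subseteq> ideal_power R \<aa> m"
proof (induction rule: dec_induct)
  case (step n)
  then show ?case using ideal_prod_inter[OF ideal_power_ideal \<aa>, of n] ideal_power_Suc by blast
qed simp

lemma ideal_power_mult: "ideal_power R (ideal_power R \<aa> n) m = ideal_power R \<aa> (n * m)"
proof -
  have "\<aa> \<in> carrier (ideals_set R)" using \<aa> by (simp add: ideals_set_def)
  then show ?thesis by (rule IS.nat_pow_pow)
qed

lemma ideal_power_carr: "x \<in> ideal_power R \<aa> n ==> x \<in> carrier R"
  using ideal.Icarr[OF ideal_power_ideal] .

text \<open>Binomial expansion for \<open>\<bb> + (x)\<close>: a product of \<open>m + n\<close>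
  factors contains \<open>m\<close> factors from \<open>\<bb>\<close> or at least \<open>n\<close>
  factors \<open>x\<close>. The induction on \<open>m + n\<close> avoids selecting factors by
  expanding all but the last factor in two ways.\<close>

lemma ideal_power_add:
  assumes "ideal \<bb> R" "x \<in> carrier R" "\<And>y. y \<in> \<aa> ==> \<exists>u\<in>\<bb>. \<exists>t\<in>carrier R. y = u \<oplus> x \<otimes> t"
  shows "y \<in> ideal_power R \<aa> (m + n) ==>
    \<exists>u\<in>ideal_power R \<bb> m. \<exists>t\<in>carrier R. y = u \<oplus> x [^] n \<otimes> t"
proof (induction "m + n" arbitrary: m n y)
  case 0
  then show ?case by (intro bexI[of _ y] bexI[of _ "\<zero>"]) (auto simp: ideals_set_def)
next
  case (Suc N)
  have B: "ideal (ideal_power R \<bb> k) R" for k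
  proof -
    have "\<bb> \<in> carrier (ideals_set R)" using assms(1) by (simp add: ideals_set_def)
    then have "ideal_power R \<bb> k \<in> carrier (ideals_set R)" by (rule IS.nat_pow_closed)
    then show ?thesis by (simp add: ideals_set_def)
  qed
  have y: "y \<in> carrier R" using Suc.prems ideal_power_carr by blast
  \<comment> \<open>In the border cases one of the two powers is trivial and one summand can be
    taken zero.\<close>
  consider "m = 0" | "n = 0" | m' n' where "m = Suc m'" "n = Suc n'" by (cases m; cases n) auto
  then show ?case
  proof cases
    case 1
    then show ?thesis using y assms(2) by (intro bexI[of _ y] bexI[of _ "\<zero>"]) (auto simp: ideals_set_def)
  next
    case 2
    then show ?thesis using y assms(2) additive_subgroup.zero_closed[OF ideal.axioms(1)[OF B]]
      by (intro bexI[of _ "\<zero>"] bexI[of _ y]) auto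
  next
    case 3
    interpret bm: ideal "ideal_power R \<bb> m" R by (rule B)
    have "y \<in> ideal_prod R (ideal_power R \<aa> N) \<aa>" using Suc.prems Suc.hyps(2) ideal_power_Suc by metis
    then show ?thesis
    proof induction
      case (prod i j)
      obtain u t where ut: "u \<in> \<bb>" "t \<in> carrier R" "j = u \<oplus> x \<otimes> t" using assms(3)[OF prod(2)] by blast
      have N1: "N = m' + n" "N = m + n'" using Suc.hyps(2) 3 by auto
      obtain u1 t1 where 1: "u1 \<in> ideal_power R \<bb> m'" "t1 \<in> carrier R" "i = u1 \<oplus> x [^] n \<otimes> t1"
        using Suc.hyps(1)[OF N1(1)] prod(1) N1(1) by blast
      obtain u2 t2 where 2: "u2 \<in> ideal_power R \<bb> m" "t2 \<in> carrier R" "i = u2 \<oplus> x [^] n' \<otimes> t2"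
        using Suc.hyps(1)[OF N1(2)] prod(1) N1(2) by blast
      have c: "u \<in> carrier R" "u1 \<in> carrier R" "u2 \<in> carrier R" "i \<in> carrier R"
        using ut 1 2 ideal.Icarr[OF assms(1)] ideal.Icarr[OF B] prod ideal_power_carr by blast+
      \<comment> \<open>The expansion of \<open>i\<close> with exponents \<open>m'\<close> and
        \<open>n\<close> is multiplied by \<open>u\<close>, which raises the power of
        \<open>\<bb>\<close>; the one with exponents \<open>m\<close> and \<open>n'\<close> is
        multiplied by \<open>x \<otimes> t\<close>, which raises the power of
        \<open>x\<close>.\<close>
      have "i \<otimes> j = i \<otimes> u \<oplus> i \<otimes> (x \<otimes> t)" using ut c assms(2) by (simp add: r_distr)
      also have "i \<otimes> u = u1 \<otimes> u \<oplus> x [^] n \<otimes> (t1 \<otimes> u)"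
        using 1 c assms(2) by (simp add: l_distr m_assoc)
      also have "i \<otimes> (x \<otimes> t) = u2 \<otimes> (x \<otimes> t) \<oplus> x [^] n \<otimes> (t2 \<otimes> t)"
      proof -
        have "i \<otimes> (x \<otimes> t) = u2 \<otimes> (x \<otimes> t) \<oplus> (x [^] n' \<otimes> t2) \<otimes> (x \<otimes> t)"
          unfolding 2(3) by (rule l_distr) (use 2 c ut assms(2) in auto)
        also have "(x [^] n' \<otimes> t2) \<otimes> (x \<otimes> t) = x [^] n \<otimes> (t2 \<otimes> t)"
          using 2 c ut assms(2) 3 by (simp add: m_ac)
        finally show ?thesis .
      qed
      finally have e: "i \<otimes> j = (u1 \<otimes> u \<oplus> u2 \<otimes> (x \<otimes> t)) \<oplus> x [^] n \<otimes> (t1 \<otimes> u \<oplus> t2 \<otimes> t)"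
        using 1 2 c ut assms(2) by (simp add: r_distr a_ac)
      have "u1 \<otimes> u \<in> ideal_power R \<bb> m" using ideal_prod.prod[OF 1(1) ut(1), of R] 3 by (simp add: ideals_set_def)
      moreover have "u2 \<otimes> (x \<otimes> t) \<in> ideal_power R \<bb> m" using 2 ut assms(2) by (intro bm.I_r_closed) auto
      ultimately show ?case using e 1 2 c ut
        by (intro bexI[of _ "u1 \<otimes> u \<oplus> u2 \<otimes> (x \<otimes> t)"] bexI[of _ "t1 \<otimes> u \<oplus> t2 \<otimes> t"]) auto
    next
      case (sum s1 s2)
      then obtain u1 t1 u2 t2 where 1: "u1 \<in> ideal_power R \<bb> m" "t1 \<in> carrier R" "s1 = u1 \<oplus> x [^] n \<otimes> t1"
        "u2 \<in> ideal_power R \<bb> m" "t2 \<in> carrier R" "s2 = u2 \<oplus> x [^] n \<otimes> t2" by blast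
      then have "s1 \<oplus> s2 = (u1 \<oplus> u2) \<oplus> x [^] n \<otimes> (t1 \<oplus> t2)"
        using assms(2) bm.Icarr by (simp add: r_distr a_ac)
      then show ?case using 1 by (intro bexI[of _ "u1 \<oplus> u2"] bexI[of _ "t1 \<oplus> t2"]) auto
    qed
  qed
qed

end

section \<open>Powers of finitely generated ideals\<close>

definition gen_ideal :: "('a, 'r) ring_scheme \<Rightarrow> (nat \<Rightarrow> 'a) \<Rightarrow> nat \<Rightarrow> 'a set" where
  "gen_ideal R g k = {lincomb (RM R) g x k | x. \<forall>i<k. x i \<in> carrier R}"

lemma gen_ideal_ideal: "cring R ==> (\<And>i. i < k ==> g i \<in> carrier R) ==> ideal (gen_ideal R g k) R"
  unfolding gen_ideal_def using submodule_lincombs[OF module_ring_as_module, of R k g] ideal_iff_submodule by fastforce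

lemma gen_ideal_0: "gen_ideal R g 0 = {\<zero>\<^bsub>R\<^esub>}"
  by (auto simp: gen_ideal_def)

lemma gen_ideal_Suc:
  fixes R (structure)
  assumes "cring R" "g k \<in> carrier R" "y \<in> gen_ideal R g (Suc k)"
  shows "\<exists>u\<in>gen_ideal R g k. \<exists>t\<in>carrier R. y = u \<oplus> g k \<otimes> t"
proof -
  interpret cring R by fact
  obtain x where x: "\<forall>i<Suc k. x i \<in> carrier R" "y = lincomb (RM R) g x (Suc k)"
    using assms(3) by (auto simp: gen_ideal_def)
  then have "y = lincomb (RM R) g x k \<oplus> g k \<otimes> x k" using assms(2) by (simp add: m_comm)
  moreover have "lincomb (RM R) g x k \<in> gen_ideal R g k" "x k \<in> carrier R" using x unfolding gen_ideal_def by auto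
  ultimately show ?thesis by blast
qed

lemma gen_ideal_mono:
  fixes R (structure)
  assumes "cring R" "\<And>i. i < Suc k ==> g i \<in> carrier R"
  shows "gen_ideal R g k \<subseteq> gen_ideal R g (Suc k)" "g k \<in> gen_ideal R g (Suc k)"
proof -
  interpret cring R by fact
  note Rm = module_ring_as_module[OF assms(1)]
  show "gen_ideal R g k \<subseteq> gen_ideal R g (Suc k)"
  proof
    fix y assume "y \<in> gen_ideal R g k"
    then obtain x where x: "\<forall>i<k. x i \<in> carrier R" "y = lincomb (RM R) g x k" by (auto simp: gen_ideal_def)
    let ?x = "\<lambda>i. if i < k then x i else \<zero>"
    have "lincomb (RM R) g ?x (Suc k) = lincomb (RM R) g x k \<oplus> \<zero>"
      using assms(2)[of k] by (simp cong: lincomb_cong)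
    also have "\<dots> = y" using x assms(2) lincomb_closed[OF Rm, of k g x] by simp
    finally show "y \<in> gen_ideal R g (Suc k)" using x unfolding gen_ideal_def by (auto intro!: exI[of _ ?x])
  qed
  have "lincomb (RM R) g (\<lambda>i. if i = k then \<one> else \<zero>) (Suc k) = g k"
    by (rule lincomb_unit[OF Rm]) (use assms in auto)
  then show "g k \<in> gen_ideal R g (Suc k)"
    unfolding gen_ideal_def by (auto intro!: exI[of _ "\<lambda>i. if i = k then \<one> else \<zero>"])
qed

lemma generates_gen_ideal:
  assumes "cring R" "ideal I R" "generates R (RM R) I k g"
  shows "I = gen_ideal R g k"
  using assms(3) lincomb_in_sub[of I R "RM R" k g] ideal_iff_submodule[OF assms(1), of I] assms(2)
  unfolding gen_ideal_def generates_def by auto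

text \<open>Exponents add up: if the power \<open>m\<close> of the ideal of the first
  \<open>k\<close> generators and the power \<open>n\<close> of the next generator lie in
  \<open>K\<close>, then \<open>ideal_power_add\<close> puts the power \<open>m + n\<close> into
  \<open>K\<close>. The base case takes exponent one, because the zeroth power of the zero ideal is
  \<open>R\<close>.\<close>

lemma ideal_power_radical:
  fixes R (structure)
  assumes "cring R" "ideal K R"
  shows "(\<And>i. i < k ==> g i \<in> carrier R) ==> (\<And>i. i < k ==> \<exists>n. g i [^] (n::nat) \<in> K) ==>
    \<exists>m. ideal_power R (gen_ideal R g k) m \<subseteq> K"
proof (induction k)
  case 0
  interpret cring R by fact
  have "ideal_power R (gen_ideal R g 0) (Suc 0) = {\<zero>}"
    using ideal_power_1[OF assms(1) zeroideal] by (simp add: gen_ideal_0)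
  then show ?case using additive_subgroup.zero_closed[OF ideal.axioms(1)[OF assms(2)]] by (intro exI[of _ "Suc 0"]) auto
next
  case (Suc k)
  interpret cring R by fact
  interpret K: ideal K R by fact
  have g: "ideal (gen_ideal R g k) R" "ideal (gen_ideal R g (Suc k)) R"
    using gen_ideal_ideal[OF assms(1)] Suc.prems(1) by simp_all
  obtain m n where m: "ideal_power R (gen_ideal R g k) m \<subseteq> K" and n: "g k [^] (n::nat) \<in> K"
    using Suc.IH Suc.prems by (metis less_Suc_eq)
  have "ideal_power R (gen_ideal R g (Suc k)) (m + n) \<subseteq> K"
  proof
    fix y assume "y \<in> ideal_power R (gen_ideal R g (Suc k)) (m + n)"
    from ideal_power_add[OF assms(1) g(2) g(1) Suc.prems(1)[OF lessI] gen_ideal_Suc[OF assms(1), where g=g and k=k, OF Suc.prems(1)[OF lessI]] this]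
    obtain u t where "u \<in> ideal_power R (gen_ideal R g k) m" "t \<in> carrier R" "y = u \<oplus> g k [^] n \<otimes> t" by auto
    then show "y \<in> K" using m K.I_r_closed[OF n] by auto
  qed
  then show ?case by blast
qed

text \<open>Take \<open>W\<close> maximal with \<open>W \<inter> N = \<bb>N + L\<close>; maximality forces a power of every element of \<open>\<bb>\<close>
  to map \<open>M\<close> into \<open>W\<close>.\<close>

lemma weak_artin_rees_aux:
  fixes M (structure)
  assumes "cring R" "noetherian_ring R" "noeth R M" "ideal \<bb> R"
    "submodule N R M" "submodule L R M" "L \<subseteq> N"
  shows "\<exists>m. \<forall>x\<in>N. (\<exists>l\<in>L. x \<ominus> l \<in> imul M (ideal_power R \<bb> m) (carrier M)) \<longrightarrow>
    (\<exists>y\<in>imul M \<bb> N. \<exists>l\<in>L. x = y \<oplus> l)"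
proof -
  have M: "module R M" using assms(3) by (simp add: noeth_def)
  interpret module R M by (rule M)
  interpret b: ideal \<bb> R by fact
  define B where "B = {y \<oplus> l | y l. y \<in> imul M \<bb> N \<and> l \<in> L}"
  have bN: "submodule (imul M \<bb> N) R M" by (rule submodule_imul[OF M assms(4,5)])
  have B: "submodule B R M" unfolding B_def by (rule submodule_sum[OF M bN assms(6)])
  have bB: "y \<in> B" if "y \<in> imul M \<bb> N" for y
    unfolding B_def using that sub_zero[OF assms(6)] sub_carr[OF bN that] by force
  have LB: "l \<in> B" if "l \<in> L" for l
    unfolding B_def using that sub_zero[OF bN] sub_carr[OF assms(6) that] by force
  define \<S> where "\<S> = {W. submodule W R M \<and> B \<subseteq> W \<and> W \<inter> N \<subseteq> B}"
  have "\<exists>W\<in>\<S>. \<forall>V\<in>\<S>. W \<subseteq> V \<longrightarrow> V = W"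
    by (rule noeth_max[OF assms(3), of _ B]) (auto simp: \<S>_def B)
  then obtain W where W\<S>: "W \<in> \<S>" and Wmax: "\<And>V. V \<in> \<S> ==> W \<subseteq> V ==> V = W"
    by blast
  have W: "submodule W R M" "B \<subseteq> W" "W \<inter> N \<subseteq> B" using W\<S> by (auto simp: \<S>_def)
  \<comment> \<open>Maximality of \<open>W\<close> is exploited through the ascending chain of
    \<open>(W : x^k)\<close>. Once it is stationary, \<open>x^k M + W\<close> still meets
    \<open>N\<close> inside \<open>B\<close> and hence equals \<open>W\<close>.\<close>
  have pow: "\<exists>k::nat. \<forall>y\<in>carrier M. x [^]\<^bsub>R\<^esub> k \<odot> y \<in> W" if x: "x \<in> \<bb>" for x
  proof -
    have xc: "x \<in> carrier R" using x b.Icarr by blast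
    let ?V = "\<lambda>k::nat. {y \<in> carrier M. x [^]\<^bsub>R\<^esub> k \<odot> y \<in> W}"
    have V: "submodule (?V k) R M" for k
      by (rule submodule_kernel[OF M M lin_scale[OF M lin_ident] carrier_is_submodule W(1)]) (use xc in simp)
    have Vs: "?V k \<subseteq> ?V (Suc k)" for k
    proof
      fix y assume y: "y \<in> ?V k"
      have "x [^]\<^bsub>R\<^esub> Suc k \<odot> y = x \<odot> (x [^]\<^bsub>R\<^esub> k \<odot> y)"
        using y xc by (simp add: smult_assoc1[symmetric] m_comm)
      then show "y \<in> ?V (Suc k)" using y sub_smult[OF W(1) xc] by simp
    qed
    have "\<exists>W\<in>range ?V. \<forall>V\<in>range ?V. W \<subseteq> V \<longrightarrow> V = W"
      by (rule noeth_max[OF assms(3), of _ "?V 0"]) (use V in blast)+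
    then obtain k where "\<forall>V\<in>range ?V. ?V k \<subseteq> V \<longrightarrow> V = ?V k" by auto
    then have k: "?V (Suc k) = ?V k" using Vs[of k] by blast
    let ?W = "{a \<oplus> w | a w. a \<in> (\<lambda>y. x [^]\<^bsub>R\<^esub> k \<odot> y) ` carrier M \<and> w \<in> W}"
    have im: "submodule ((\<lambda>y. x [^]\<^bsub>R\<^esub> k \<odot> y) ` carrier M) R M"
      by (rule submodule_image[OF M M lin_scale[OF M lin_ident] carrier_is_submodule]) (use xc in simp)
    have W': "submodule ?W R M" by (rule submodule_sum[OF M im W(1)])
    have WW: "W \<subseteq> ?W"
    proof
      fix w assume "w \<in> W"
      then have "w = \<zero> \<oplus> w" "w \<in> W" using sub_carr[OF W(1)] by auto
      then show "w \<in> ?W" using sub_zero[OF im] by blast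
    qed
    have "?W \<inter> N \<subseteq> B"
    proof
      fix u assume "u \<in> ?W \<inter> N"
      then obtain y w where u: "u \<in> N" "y \<in> carrier M" "w \<in> W" "u = x [^]\<^bsub>R\<^esub> k \<odot> y \<oplus> w" by auto
      have wc: "w \<in> carrier M" using u sub_carr[OF W(1)] by blast
      \<comment> \<open>\<open>x u\<close> lies in \<open>\<bb> N\<close> and therefore in
        \<open>W\<close>, so \<open>x^(k+1) y\<close> does as well; stationarity lowers the exponent
        to \<open>k\<close>.\<close>
      have "x \<odot> u \<in> W" using bB[OF imul_prod[OF M assms(4,5) x u(1)]] W(2) by blast
      moreover have "x [^]\<^bsub>R\<^esub> Suc k \<odot> y = x \<odot> u \<ominus> x \<odot> w"
        using u wc xc mod_cancel(4)[OF M, of "x \<odot> (x [^]\<^bsub>R\<^esub> k \<odot> y)" "x \<odot> w"]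
        by (simp add: smult_r_distr smult_assoc1[symmetric] m_comm)
      ultimately have "x [^]\<^bsub>R\<^esub> Suc k \<odot> y \<in> W" using sub_minus[OF W(1)] sub_smult[OF W(1) xc u(3)] by simp
      then have "y \<in> ?V k" using k u(2) by blast
      then have "u \<in> W" using u sub_add[OF W(1)] by simp
      then show "u \<in> B" using u W(3) by blast
    qed
    then have "?W = W" using Wmax[of ?W] W' WW W(2) unfolding \<S>_def by blast
    moreover have "x [^]\<^bsub>R\<^esub> k \<odot> y \<in> ?W" if "y \<in> carrier M" for y
    proof -
      have "x [^]\<^bsub>R\<^esub> k \<odot> y = x [^]\<^bsub>R\<^esub> k \<odot> y \<oplus> \<zero>" using that xc by simp
      then show ?thesis using that sub_zero[OF W(1)] by blast
    qed
    ultimately show ?thesis by blast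
  qed
  \<comment> \<open>The annihilator of \<open>M / W\<close>. It contains a power of each generator
    of \<open>\<bb>\<close>, hence a power of \<open>\<bb>\<close> itself.\<close>
  define K where "K = {r \<in> carrier R. \<forall>y\<in>carrier M. r \<odot> y \<in> W}"
  have "submodule K R (RM R)"
    by (rule submoduleI'[OF module_ring_as_module[OF assms(1)]])
      (auto simp: K_def smult_l_distr smult_assoc1 sub_zero[OF W(1)] intro: sub_add[OF W(1)] sub_smult[OF W(1)])
  then have K: "ideal K R" using ideal_iff_submodule[OF assms(1)] by blast
  obtain k g where kg: "generates R (RM R) \<bb> k g" using generates_ideal[OF assms(1,2,4)] by blast
  have gb: "\<And>i. i < k ==> g i \<in> \<bb>" using kg by (auto simp: generates_def)
  have "\<exists>m. ideal_power R (gen_ideal R g k) m \<subseteq> K"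
  proof (rule ideal_power_radical[OF assms(1) K])
    fix i assume i: "i < k"
    show "g i \<in> carrier R" using gb[OF i] b.Icarr by blast
    then show "\<exists>n. g i [^]\<^bsub>R\<^esub> (n::nat) \<in> K" using pow[OF gb[OF i]] unfolding K_def by auto
  qed
  then obtain m where "ideal_power R \<bb> m \<subseteq> K" using generates_gen_ideal[OF assms(1,4) kg] by auto
  then have mW: "imul M (ideal_power R \<bb> m) (carrier M) \<subseteq> W"
    using imul_in_sub[OF W(1), of "ideal_power R \<bb> m" "carrier M"] unfolding K_def by blast
  show ?thesis
  proof (intro exI[of _ m] ballI impI)
    fix x assume x: "x \<in> N" "\<exists>l\<in>L. x \<ominus> l \<in> imul M (ideal_power R \<bb> m) (carrier M)"
    then obtain l where l: "l \<in> L" "x \<ominus> l \<in> W" using mW by blast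
    have "x \<in> W" by (rule mod_mem[OF M W(1) sub_carr[OF assms(5) x(1)] _ l(2)]) (use LB[OF l(1)] W(2) in blast)
    then have "x \<in> B" using x W(3) by blast
    then show "\<exists>y\<in>imul M \<bb> N. \<exists>l\<in>L. x = y \<oplus> l" unfolding B_def by blast
  qed
qed

text \<open>Weak because \<open>m\<close> depends on \<open>n\<close> without a linear bound. It is
  the preceding statement for the ideal \<open>\<aa>^n\<close>, whose \<open>m\<close>-th power is
  \<open>\<aa>^(n m)\<close>.\<close>

lemma weak_artin_rees:
  fixes M (structure)
  assumes "cring R" "noetherian_ring R" "noeth R M" "ideal \<aa> R"
    "submodule N R M" "submodule L R M" "L \<subseteq> N"
  obtains m where "\<And>x l. x \<in> N ==> l \<in> L ==> x \<ominus> l \<in> imul M (ideal_power R \<aa> m) (carrier M) ==>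
    \<exists>y\<in>imul M (ideal_power R \<aa> n) N. \<exists>l\<in>L. x = y \<oplus> l"
proof -
  obtain m where "\<forall>x\<in>N. (\<exists>l\<in>L. x \<ominus> l \<in> imul M (ideal_power R (ideal_power R \<aa> n) m) (carrier M)) \<longrightarrow>
    (\<exists>y\<in>imul M (ideal_power R \<aa> n) N. \<exists>l\<in>L. x = y \<oplus> l)"
    using weak_artin_rees_aux[OF assms(1-3) ideal_power_ideal[OF assms(1,4)] assms(5-7)] by blast
  then show ?thesis using that[of "n * m"] unfolding ideal_power_mult[OF assms(1,4)] by blast
qed

text \<open>The exactness of completion for finitely generated modules, in terms of Cauchy sequences.\<close>

lemma completion_generates:
  fixes R :: "('a, 'r) ring_scheme" and A :: "('a, 'm, 's) module_scheme" and B :: "('a, 'n, 't) module_scheme"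
  assumes "cring R" "noetherian_ring R" "ideal \<aa> R" "fin_gen_module R A" "fin_gen_module R B"
    "lin R A B \<delta>" "submodule C R A" "submodule L R B"
  obtains k g where "\<And>i. i < k ==> g i \<in> C" "\<And>i. i < k ==> \<delta> (g i) \<in> L"
    "\<And>v. (\<And>n. v n \<in> C) ==> (\<And>n. v (Suc n) \<ominus>\<^bsub>A\<^esub> v n \<in> imul A (ideal_power R \<aa> n) (carrier A)) ==>
      (\<And>n. \<exists>l\<in>L. \<delta> (v n) \<ominus>\<^bsub>B\<^esub> l \<in> imul B (ideal_power R \<aa> n) (carrier B)) ==>
      \<exists>r. (\<forall>i<k. \<forall>n. r i n \<in> carrier R \<and> r i (Suc n) \<ominus>\<^bsub>R\<^esub> r i n \<in> ideal_power R \<aa> n) \<and>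
        (\<forall>n. v n \<ominus>\<^bsub>A\<^esub> lincomb A g (\<lambda>i. r i n) k \<in> imul A (ideal_power R \<aa> n) (carrier A))"
proof -
  let ?J = "ideal_power R \<aa>"
  have A: "module R A" and B: "module R B" using assms(4,5) by (auto simp: fin_gen_module_def)
  interpret A: module R A by (rule A)
  interpret B: module R B by (rule B)
  have nA: "noeth R A" and nB: "noeth R B" using fin_gen_noeth[OF assms(1,2)] assms(4,5) by auto
  note J = ideal_power_ideal[OF assms(1,3)]
  have Jc: "?J n \<subseteq> carrier R" for n using ideal.Icarr[OF J] by blast
  let ?I = "\<lambda>n. imul A (?J n) (carrier A)"
  have I: "submodule (?I n) R A" for n by (rule submodule_imul[OF A J A.carrier_is_submodule])
  have Imono: "?I n \<subseteq> ?I m" if "m \<le> n" for m n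
    by (rule imul_mono[OF ideal_power_antimono[OF assms(1,3) that] subset_refl])
  \<comment> \<open>The elements that satisfy the condition exactly. Fixed generators of
    \<open>Z\<close> will express all limits.\<close>
  define Z where "Z = {u \<in> C. \<delta> u \<in> L}"
  have Z: "submodule Z R A" unfolding Z_def by (rule submodule_kernel[OF A B assms(6,7,8)])
  note Cc = sub_carr[OF assms(7)]
  obtain k g where kg: "generates R A Z k g" using nA Z by (auto simp: noeth_def)
  have gZ: "\<And>i. i < k ==> g i \<in> Z" using kg by (auto simp: generates_def)
  have gc: "\<And>i. i < k ==> g i \<in> carrier A" using gZ sub_carr[OF Z] by blast
  \<comment> \<open>Artin-Rees for \<open>Z\<close> inside \<open>A\<close>: order
    \<open>s t\<close> in \<open>A\<close> suffices for coefficients in \<open>\<aa>^t\<close> with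
    respect to the generators of \<open>Z\<close>.\<close>
  have "\<exists>s. \<forall>t. \<forall>x\<in>Z. x \<in> ?I (s t) \<longrightarrow> x \<in> imul A (?J t) Z"
  proof (intro choice allI)
    fix t
    have z: "submodule {\<zero>\<^bsub>A\<^esub>} R A" "{\<zero>\<^bsub>A\<^esub>} \<subseteq> Z" using submodule_zero[OF A] sub_zero[OF Z] by auto
    obtain m where m: "\<And>x l. x \<in> Z ==> l \<in> {\<zero>\<^bsub>A\<^esub>} ==> x \<ominus>\<^bsub>A\<^esub> l \<in> ?I m ==>
      \<exists>y\<in>imul A (?J t) Z. \<exists>l\<in>{\<zero>\<^bsub>A\<^esub>}. x = y \<oplus>\<^bsub>A\<^esub> l"
      using weak_artin_rees[OF assms(1,2) nA assms(3) Z z] by blast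
    have "x \<in> imul A (?J t) Z" if x: "x \<in> Z" "x \<in> ?I m" for x
    proof -
      have "x \<ominus>\<^bsub>A\<^esub> \<zero>\<^bsub>A\<^esub> \<in> ?I m" using x sub_carr[OF Z] mod_cancel(4)[OF A, of x "\<zero>\<^bsub>A\<^esub>"] by simp
      then obtain y where "y \<in> imul A (?J t) Z" "x = y \<oplus>\<^bsub>A\<^esub> \<zero>\<^bsub>A\<^esub>" using m[OF x(1)] by blast
      then show ?thesis using sub_carr[OF submodule_imul[OF A J Z]] by simp
    qed
    then show "\<exists>m. \<forall>x\<in>Z. x \<in> ?I m \<longrightarrow> x \<in> imul A (?J t) Z" by blast
  qed
  then obtain s where s: "\<And>t x. x \<in> Z ==> x \<in> ?I (s t) ==> x \<in> imul A (?J t) Z" by blast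
  \<comment> \<open>An increasing sequence of indices that dominates both \<open>t\<close> and
    \<open>s t\<close>.\<close>
  define \<sigma> where "\<sigma> t = t + (\<Sum>i\<le>t. s i)" for t
  have \<sigma>: "t \<le> \<sigma> t" "s t \<le> \<sigma> t" "\<sigma> t \<le> \<sigma> (Suc t)" for t
    using member_le_sum[of t "{..t}" s] by (auto simp: \<sigma>_def)
  have main: "\<exists>r. (\<forall>i<k. \<forall>n. r i n \<in> carrier R \<and> r i (Suc n) \<ominus>\<^bsub>R\<^esub> r i n \<in> ?J n) \<and>
        (\<forall>n. v n \<ominus>\<^bsub>A\<^esub> lincomb A g (\<lambda>i. r i n) k \<in> ?I n)"
    if v: "\<And>n. v n \<in> C" "\<And>n. v (Suc n) \<ominus>\<^bsub>A\<^esub> v n \<in> ?I n"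
      "\<And>n. \<exists>l\<in>L. \<delta> (v n) \<ominus>\<^bsub>B\<^esub> l \<in> imul B (?J n) (carrier B)" for v
  proof -
    have vc: "v n \<in> carrier A" for n using v(1) Cc by blast
    have vv: "v n \<ominus>\<^bsub>A\<^esub> v m \<in> ?I m" if "m \<le> n" for m n
      using that
    proof (induction rule: dec_induct)
      case base
      show ?case by (rule mod_refl[OF A I vc])
    next
      case (step n)
      have "v (Suc n) \<ominus>\<^bsub>A\<^esub> v n \<in> ?I m" using v(2) Imono[OF step(1)] by blast
      then show ?case by (rule mod_trans[OF A I vc vc vc _ step(3)])
    qed
    \<comment> \<open>The terms \<open>v t\<close> satisfy the condition on \<open>Z\<close> only up
      to small errors; they are replaced by members of \<open>Z\<close> that agree with them to
      order \<open>t\<close>.\<close>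
    have "\<exists>u. \<forall>t. u t \<in> Z \<and> v t \<ominus>\<^bsub>A\<^esub> u t \<in> ?I t"
    proof (intro choice allI)
      fix t
      define N where "N = {x \<oplus>\<^bsub>B\<^esub> y | x y. x \<in> \<delta> ` C \<and> y \<in> L}"
      have im: "submodule (\<delta> ` C) R B" by (rule submodule_image[OF A B assms(6,7)])
      have N: "submodule N R B" unfolding N_def by (rule submodule_sum[OF B im assms(8)])
      have LN: "L \<subseteq> N"
      proof
        fix l assume "l \<in> L"
        then have "l = \<zero>\<^bsub>B\<^esub> \<oplus>\<^bsub>B\<^esub> l" "l \<in> L" using sub_carr[OF assms(8)] by auto
        then show "l \<in> N" unfolding N_def using sub_zero[OF im] by blast
      qed
      obtain m where m: "\<And>x l. x \<in> N ==> l \<in> L ==> x \<ominus>\<^bsub>B\<^esub> l \<in> imul B (?J m) (carrier B) ==>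
        \<exists>y\<in>imul B (?J t) N. \<exists>l\<in>L. x = y \<oplus>\<^bsub>B\<^esub> l"
        using weak_artin_rees[OF assms(1,2) nB assms(3) N assms(8) LN] by blast
      \<comment> \<open>\<open>m\<close> serves Artin-Rees in \<open>B\<close>, and \<open>t\<close>
        keeps the chosen term close to \<open>v t\<close>.\<close>
      let ?n = "max m t"
      have "\<delta> (v ?n) = \<delta> (v ?n) \<oplus>\<^bsub>B\<^esub> \<zero>\<^bsub>B\<^esub>" using lin_closed[OF assms(6) vc] by simp
      then have dN: "\<delta> (v ?n) \<in> N" unfolding N_def using v(1) sub_zero[OF assms(8)] by blast
      obtain l where l: "l \<in> L" "\<delta> (v ?n) \<ominus>\<^bsub>B\<^esub> l \<in> imul B (?J ?n) (carrier B)" using v(3) by blast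
      then have "\<delta> (v ?n) \<ominus>\<^bsub>B\<^esub> l \<in> imul B (?J m) (carrier B)"
        using imul_mono[OF ideal_power_antimono[OF assms(1,3), of m ?n] subset_refl, of B "carrier B"] by auto
      then obtain y l' where y: "y \<in> imul B (?J t) N" "l' \<in> L" "\<delta> (v ?n) = y \<oplus>\<^bsub>B\<^esub> l'" using m[OF dN l(1)] by blast
      \<comment> \<open>An element of \<open>\<aa>^t N\<close> is, up to \<open>L\<close>, the image
        of an element \<open>w\<close> of \<open>\<aa>^t C\<close>. Subtracting this
        \<open>w\<close> moves \<open>v ?n\<close> into \<open>Z\<close> without changing it to
        order \<open>t\<close>.\<close>
      have "\<exists>w\<in>imul A (?J t) C. \<exists>l\<in>L. y = \<delta> w \<oplus>\<^bsub>B\<^esub> l" using y(1)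
      proof induction
        case imul_zero
        then show ?case using lin_zero[OF A B assms(6)] sub_zero[OF assms(8)]
          by (intro bexI[of _ "\<zero>\<^bsub>A\<^esub>"] bexI[of _ "\<zero>\<^bsub>B\<^esub>"]) (auto intro: imul.imul_zero)
      next
        case (imul_step y r x)
        then obtain w l where w: "w \<in> imul A (?J t) C" "l \<in> L" "y = \<delta> w \<oplus>\<^bsub>B\<^esub> l" by blast
        obtain c l2 where c: "c \<in> C" "l2 \<in> L" "x = \<delta> c \<oplus>\<^bsub>B\<^esub> l2" using imul_step(3) unfolding N_def by blast
        have r: "r \<in> carrier R" using imul_step(2) Jc by blast
        have wc: "w \<in> carrier A" using sub_carr[OF submodule_imul[OF A J assms(7)] w(1)] .
        have "y \<oplus>\<^bsub>B\<^esub> r \<odot>\<^bsub>B\<^esub> x = \<delta> (w \<oplus>\<^bsub>A\<^esub> r \<odot>\<^bsub>A\<^esub> c) \<oplus>\<^bsub>B\<^esub> (l \<oplus>\<^bsub>B\<^esub> r \<odot>\<^bsub>B\<^esub> l2)"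
          using w(2,3) c wc r Cc[OF c(1)] sub_carr[OF assms(8) w(2)] sub_carr[OF assms(8) c(2)]
            lin_closed[OF assms(6) wc] lin_closed[OF assms(6) Cc[OF c(1)]]
          by (simp add: lin_add[OF assms(6)] lin_smult[OF assms(6)] B.smult_r_distr B.a_ac)
        moreover have "w \<oplus>\<^bsub>A\<^esub> r \<odot>\<^bsub>A\<^esub> c \<in> imul A (?J t) C" by (rule imul.imul_step[OF w(1) imul_step(2) c(1)])
        moreover have "l \<oplus>\<^bsub>B\<^esub> r \<odot>\<^bsub>B\<^esub> l2 \<in> L" using sub_add[OF assms(8) w(2) sub_smult[OF assms(8) r c(2)]] .
        ultimately show ?case by blast
      qed
      then obtain w l2 where w: "w \<in> imul A (?J t) C" "l2 \<in> L" "y = \<delta> w \<oplus>\<^bsub>B\<^esub> l2" by blast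
      have wC: "w \<in> C" using imul_subset[OF assms(7) Jc] w(1) by blast
      have wI: "w \<in> ?I t" using w(1) imul_mono[OF subset_refl, of C "carrier A" A] Cc by blast
      have "\<delta> (v ?n \<ominus>\<^bsub>A\<^esub> w) = \<delta> (v ?n) \<ominus>\<^bsub>B\<^esub> \<delta> w" by (rule lin_minus[OF A B assms(6) vc Cc[OF wC]])
      also have "\<delta> (v ?n) = \<delta> w \<oplus>\<^bsub>B\<^esub> (l2 \<oplus>\<^bsub>B\<^esub> l')"
        using y w lin_closed[OF assms(6) Cc[OF wC]] sub_carr[OF assms(8)] by (simp add: B.a_assoc)
      also have "\<dots> \<ominus>\<^bsub>B\<^esub> \<delta> w = l2 \<oplus>\<^bsub>B\<^esub> l'"
        using lin_closed[OF assms(6) Cc[OF wC]] sub_carr[OF assms(8)] w y by (intro mod_cancel(5)[OF B]) auto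
      finally have "v ?n \<ominus>\<^bsub>A\<^esub> w \<in> Z"
        unfolding Z_def using sub_minus[OF assms(7) v(1) wC] sub_add[OF assms(8) w(2) y(2)] by simp
      moreover have "v t \<ominus>\<^bsub>A\<^esub> (v ?n \<ominus>\<^bsub>A\<^esub> w) \<in> ?I t"
      proof (rule mod_trans[OF A I vc vc])
        show "v ?n \<ominus>\<^bsub>A\<^esub> w \<in> carrier A" using vc Cc[OF wC] by simp
        show "v t \<ominus>\<^bsub>A\<^esub> v ?n \<in> ?I t" by (rule mod_sym[OF A I vc vc vv]) simp
        show "v ?n \<ominus>\<^bsub>A\<^esub> (v ?n \<ominus>\<^bsub>A\<^esub> w) \<in> ?I t" using mod_cancel(3)[OF A vc Cc[OF wC]] wI by simp
      qed
      ultimately show "\<exists>u. u \<in> Z \<and> v t \<ominus>\<^bsub>A\<^esub> u \<in> ?I t" by blast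
    qed
    then obtain u where u: "\<And>t. u t \<in> Z" "\<And>t. v t \<ominus>\<^bsub>A\<^esub> u t \<in> ?I t" by blast
    have uc: "u t \<in> carrier A" for t using u(1) sub_carr[OF Z] by blast
    have us: "v t \<ominus>\<^bsub>A\<^esub> u n \<in> ?I t" if "t \<le> n" for t n
      by (rule mod_trans[OF A I vc vc uc mod_sym[OF A I vc vc vv[OF that]]])
        (use u(2)[of n] Imono[OF that] in blast)
    have "u (\<sigma> (Suc t)) \<ominus>\<^bsub>A\<^esub> u (\<sigma> t) \<in> imul A (?J t) Z" for t
    proof (rule s)
      show "u (\<sigma> (Suc t)) \<ominus>\<^bsub>A\<^esub> u (\<sigma> t) \<in> Z" by (rule sub_minus[OF Z u(1) u(1)])
      have "u (\<sigma> (Suc t)) \<ominus>\<^bsub>A\<^esub> u (\<sigma> t) \<in> ?I (\<sigma> t)"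
        by (rule mod_trans[OF A I uc vc uc mod_sym[OF A I vc uc us]]) (use \<sigma>(3) us in auto)
      then show "u (\<sigma> (Suc t)) \<ominus>\<^bsub>A\<^esub> u (\<sigma> t) \<in> ?I (s t)" using Imono[OF \<sigma>(2)] by blast
    qed
    then have "\<forall>t. \<exists>c. (\<forall>i<k. c i \<in> ?J t) \<and> u (\<sigma> (Suc t)) \<ominus>\<^bsub>A\<^esub> u (\<sigma> t) = lincomb A g c k"
      using imul_generates[OF A J Z kg] by blast
    then obtain c where c: "\<And>t i. i < k ==> c t i \<in> ?J t"
      "\<And>t. u (\<sigma> (Suc t)) \<ominus>\<^bsub>A\<^esub> u (\<sigma> t) = lincomb A g (c t) k" using choice[of "\<lambda>t c. (\<forall>i<k. c i \<in> ?J t) \<and> u (\<sigma> (Suc t)) \<ominus>\<^bsub>A\<^esub> u (\<sigma> t) = lincomb A g c k"] by blast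
    obtain r0 where r0: "\<And>i. i < k ==> r0 i \<in> carrier R" "u (\<sigma> 0) = lincomb A g r0 k"
      using kg u(1)[of "\<sigma> 0"] unfolding generates_def by blast
    \<comment> \<open>The coefficients of the limit are partial sums of the coefficients of the
      increments.\<close>
    define r where "r i n = rec_nat (r0 i) (\<lambda>t x. x \<oplus>\<^bsub>R\<^esub> c t i) n" for i n
    have r: "r i 0 = r0 i" "r i (Suc n) = r i n \<oplus>\<^bsub>R\<^esub> c n i" for i n by (simp_all add: r_def)
    have cc: "i < k ==> c t i \<in> carrier R" for t i using c(1) Jc by blast
    have rc: "r i n \<in> carrier R" if "i < k" for i n
      by (induction n) (use r r0 cc that in auto)
    have ru: "lincomb A g (\<lambda>i. r i n) k = u (\<sigma> n)" for n
    proof (induction n)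
      case 0
      then show ?case using r0 r(1) by simp
    next
      case (Suc n)
      have "lincomb A g (\<lambda>i. r i (Suc n)) k = lincomb A g (\<lambda>i. r i n) k \<oplus>\<^bsub>A\<^esub> lincomb A g (c n) k"
        unfolding r(2) by (rule lincomb_add_coeff[OF A gc rc cc])
      also have "\<dots> = u (\<sigma> n) \<oplus>\<^bsub>A\<^esub> (u (\<sigma> (Suc n)) \<ominus>\<^bsub>A\<^esub> u (\<sigma> n))" using Suc c(2) by simp
      also have "\<dots> = u (\<sigma> (Suc n))" by (rule mod_cancel(2)[OF A uc uc])
      finally show ?case .
    qed
    show ?thesis
    proof (intro exI[of _ r] conjI allI impI)
      fix i n assume i: "i < k"
      show "r i n \<in> carrier R" by (rule rc[OF i])
      have "r i (Suc n) \<ominus>\<^bsub>R\<^esub> r i n = c n i"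
        using mod_cancel(5)[OF module_ring_as_module[OF assms(1)], of "c n i" "r i n"] cc[OF i] rc[OF i] r(2) by simp
      then show "r i (Suc n) \<ominus>\<^bsub>R\<^esub> r i n \<in> ?J n" using c(1)[OF i] by simp
    next
      fix n
      show "v n \<ominus>\<^bsub>A\<^esub> lincomb A g (\<lambda>i. r i n) k \<in> ?I n" unfolding ru by (rule us[OF \<sigma>(1)])
    qed
  qed
  show ?thesis
    by (rule that[of k g]) (use gZ main in \<open>auto simp: Z_def\<close>)
qed

subsection \<open>Resolutions of powers\<close>

text \<open>A resolution of \<open>R/J\<close> whose augmentation takes values in \<open>R\<close>
  and is read modulo \<open>J\<close>. Surjectivity becomes the existence of a preimage of one
  modulo \<open>J\<close>, and no carrier of cosets appears.\<close>

definition fres ::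
    "('a, 'r) ring_scheme \<Rightarrow> 'a set \<Rightarrow> (nat \<Rightarrow> nat) \<Rightarrow> (nat \<Rightarrow> (nat \<Rightarrow> 'a) \<Rightarrow> (nat \<Rightarrow> 'a))
      \<Rightarrow> ((nat \<Rightarrow> 'a) \<Rightarrow> 'a) \<Rightarrow> bool" where
  "fres R J p d e \<longleftrightarrow>
     (\<forall>i. lin R (FM R (p (Suc i))) (FM R (p i)) (d i)) \<and>
     lin R (FM R (p 0)) (RM R) e \<and>
     (\<exists>u\<in>carrier (FM R (p 0)). e u \<ominus>\<^bsub>R\<^esub> \<one>\<^bsub>R\<^esub> \<in> J) \<and>
     (\<forall>x\<in>carrier (FM R (p 0)). e x \<in> J \<longleftrightarrow> x \<in> d 0 ` carrier (FM R (p (Suc 0)))) \<and>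
     (\<forall>i. \<forall>x\<in>carrier (FM R (p (Suc i))).
        d i x = \<zero>\<^bsub>FM R (p i)\<^esub> \<longleftrightarrow> x \<in> d (Suc i) ` carrier (FM R (p (Suc (Suc i)))))"

lemma free_closed: "x \<in> carrier (FM R n) ==> i < n ==> x i \<in> carrier R"
  by (auto simp: free_module_def)

definition cmap where
  "cmap R p d p' d' \<phi> \<longleftrightarrow>
     (\<forall>i. lin R (FM R (p i)) (FM R (p' i)) (\<phi> i)) \<and>
     (\<forall>i. \<forall>x\<in>carrier (FM R (p (Suc i))). d' i (\<phi> (Suc i) x) = \<phi> i (d i x))"

text \<open>A chain map over the projection between two residue rings; \<open>J\<close> is the ideal
  belonging to the target, since that is where the augmentations have to agree.\<close>

definition clift where
  "clift R p d e p' d' e' J \<phi> \<longleftrightarrow>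
     cmap R p d p' d' \<phi> \<and> (\<forall>x\<in>carrier (FM R (p 0)). e' (\<phi> 0 x) \<ominus>\<^bsub>R\<^esub> e x \<in> J)"

lemma fresD:
  fixes R (structure)
  assumes "fres R J p d e"
  shows "lin R (FM R (p (Suc i))) (FM R (p i)) (d i)"
    "lin R (FM R (p 0)) (RM R) e"
    "\<exists>u\<in>carrier (FM R (p 0)). e u \<ominus> \<one> \<in> J"
    "x \<in> carrier (FM R (p 0)) ==> e x \<in> J ==> \<exists>y\<in>carrier (FM R (p (Suc 0))). x = d 0 y"
    "y \<in> carrier (FM R (p (Suc 0))) ==> e (d 0 y) \<in> J"
    "z \<in> carrier (FM R (p (Suc i))) ==> d i z = \<zero>\<^bsub>FM R (p i)\<^esub> ==>
      \<exists>y\<in>carrier (FM R (p (Suc (Suc i)))). z = d (Suc i) y"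
    "w \<in> carrier (FM R (p (Suc (Suc i)))) ==> d i (d (Suc i) w) = \<zero>\<^bsub>FM R (p i)\<^esub>"
proof -
  note f = assms[unfolded fres_def]
  show l: "lin R (FM R (p (Suc i))) (FM R (p i)) (d i)" for i using f by blast
  show "lin R (FM R (p 0)) (RM R) e" using f by blast
  show "\<exists>u\<in>carrier (FM R (p 0)). e u \<ominus> \<one> \<in> J" using f by blast
  have 4: "\<forall>x\<in>carrier (FM R (p 0)). e x \<in> J \<longleftrightarrow> x \<in> d 0 ` carrier (FM R (p (Suc 0)))" using f by blast
  then show "x \<in> carrier (FM R (p 0)) ==> e x \<in> J ==> \<exists>y\<in>carrier (FM R (p (Suc 0))). x = d 0 y" by blast
  show "y \<in> carrier (FM R (p (Suc 0))) ==> e (d 0 y) \<in> J" using 4 lin_closed[OF l] by blast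
  have 6: "\<forall>i. \<forall>x\<in>carrier (FM R (p (Suc i))).
        d i x = \<zero>\<^bsub>FM R (p i)\<^esub> \<longleftrightarrow> x \<in> d (Suc i) ` carrier (FM R (p (Suc (Suc i))))" using f by blast
  then show "z \<in> carrier (FM R (p (Suc i))) ==> d i z = \<zero>\<^bsub>FM R (p i)\<^esub> ==>
      \<exists>y\<in>carrier (FM R (p (Suc (Suc i)))). z = d (Suc i) y" by blast
  show "w \<in> carrier (FM R (p (Suc (Suc i)))) ==> d i (d (Suc i) w) = \<zero>\<^bsub>FM R (p i)\<^esub>"
    using 6 lin_closed[OF l] by blast
qed

context
  fixes R :: "('a, 'r) ring_scheme" (structure)
  assumes R: "cring R"
begin

interpretation cring R by (rule R)

private lemmas Rmod = module_ring_as_module[OF R]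
private lemmas Fmod = module_free[OF R]

lemma lin_lift_eq:
  assumes "module R A" "module R B" "lin R A B \<pi>" "lin R (FM R n) B f"
    "\<And>x. x \<in> carrier (FM R n) ==> \<exists>y\<in>carrier A. f x = \<pi> y"
  obtains g where "lin R (FM R n) A g" "\<And>x. x \<in> carrier (FM R n) ==> f x = \<pi> (g x)"
proof -
  have "\<exists>y\<in>carrier A. f x \<ominus>\<^bsub>B\<^esub> \<pi> y \<in> {\<zero>\<^bsub>B\<^esub>}" if "x \<in> carrier (FM R n)" for x
    using assms(5)[OF that] minus_zero_iff[OF assms(2)] lin_closed[OF assms(3)] lin_closed[OF assms(4) that]
    by (metis singletonI)
  then obtain g where g: "lin R (FM R n) A g" "\<And>x. x \<in> carrier (FM R n) ==> f x \<ominus>\<^bsub>B\<^esub> \<pi> (g x) \<in> {\<zero>\<^bsub>B\<^esub>}"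
    using lin_lift[OF assms(1-4) submodule_zero[OF assms(2)] module.carrier_is_submodule[OF assms(1)]] by blast
  show ?thesis
    by (rule that[OF g(1)]) (use g(2) minus_zero_iff[OF assms(2)] lin_closed[OF assms(3)] lin_closed[OF assms(4)] lin_closed[OF g(1)] in auto)
qed

lemma fres_unit_smult:
  assumes "fres R J p d e" "ideal J R" "u \<in> carrier (FM R (p 0))" "e u \<ominus> \<one> \<in> J" "r \<in> carrier R"
  shows "e (r \<odot>\<^bsub>FM R (p 0)\<^esub> u) \<ominus> r \<in> J"
proof -
  interpret J: ideal J R by fact
  have eu: "e u \<in> carrier R" using lin_closed[OF fresD(2)[OF assms(1)] assms(3)] by simp
  have "e (r \<odot>\<^bsub>FM R (p 0)\<^esub> u) \<ominus> r = r \<otimes> (e u \<ominus> \<one>)"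
    using eu assms(5) lin_smult[OF fresD(2)[OF assms(1)] assms(5,3)] by (simp add: a_minus_def r_distr r_minus)
  then show ?thesis using J.I_l_closed[OF assms(4,5)] by simp
qed

lemma fres_aug_lift:
  assumes "fres R J p d e" "ideal J R" "lin R (FM R n) (RM R) f"
  obtains g where "lin R (FM R n) (FM R (p 0)) g" "\<And>x. x \<in> carrier (FM R n) ==> e (g x) \<ominus> f x \<in> J"
proof -
  obtain u where u: "u \<in> carrier (FM R (p 0))" "e u \<ominus> \<one> \<in> J" using fresD(3)[OF assms(1)] by blast
  have "lin R (FM R n) (FM R (p 0)) (\<lambda>x. f x \<odot>\<^bsub>FM R (p 0)\<^esub> u)" by (rule lin_scale_elt[OF Fmod assms(3) u(1)])
  then show ?thesis using that fres_unit_smult[OF assms(1,2) u] lin_closed[OF assms(3)] by auto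
qed

lemma sub_is_image:
  assumes "noetherian_ring R" "submodule K R (FM R a)"
  shows "\<exists>b D. lin R (FM R b) (FM R a) D \<and> D ` carrier (FM R b) = K"
proof -
  obtain k g where kg: "generates R (FM R a) K k g"
    using fin_gen_noeth[OF R assms(1) fin_gen_free[OF R]] assms(2) unfolding noeth_def by blast
  have g: "\<And>i. i < k ==> g i \<in> K" using kg by (simp add: generates_def)
  have gc: "\<And>i. i < k ==> g i \<in> carrier (FM R a)" using g sub_carr[OF assms(2)] by blast
  have l: "lin R (FM R k) (FM R a) (\<lambda>x. lincomb (FM R a) g x k)" by (rule lin_lincomb[OF Fmod gc])
  have "(\<lambda>x. lincomb (FM R a) g x k) ` carrier (FM R k) = K"
  proof (intro equalityI subsetI)
    fix y assume "y \<in> (\<lambda>x. lincomb (FM R a) g x k) ` carrier (FM R k)"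
    then obtain x where x: "x \<in> carrier (FM R k)" "y = lincomb (FM R a) g x k" by blast
    show "y \<in> K" unfolding x(2) by (rule lincomb_in_sub[OF assms(2)]) (use g free_closed[OF x(1)] in auto)
  next
    fix y assume "y \<in> K"
    then obtain x where x: "\<forall>i<k. x i \<in> carrier R" "y = lincomb (FM R a) g x k" using kg unfolding generates_def by blast
    have "y = lincomb (FM R a) g (restrict x {..<k}) k" unfolding x(2) by (rule lincomb_cong) auto
    moreover have "restrict x {..<k} \<in> carrier (FM R k)" using x(1) by (auto simp: free_module_def)
    ultimately show "y \<in> (\<lambda>x. lincomb (FM R a) g x k) ` carrier (FM R k)" by blast
  qed
  with l show ?thesis by blast
qed

text \<open>The resolution starts in rank one with the coordinate as augmentation. Then a free
  module of finite rank is repeatedly mapped onto the kernel of the last map, which is finitely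
  generated.\<close>

lemma fres_exists:
  assumes "noetherian_ring R" "ideal J R"
  shows "\<exists>p d e. fres R J p d e"
proof -
  let ?e = "\<lambda>x::nat \<Rightarrow> 'a. x 0"
  let ?K0 = "{x \<in> carrier (FM R 1). ?e x \<in> J}"
  have le: "lin R (FM R 1) (RM R) ?e" unfolding free_module_tup by (rule lin_tup_proj) simp
  have J: "submodule J R (RM R)" using ideal_iff_submodule[OF R] assms(2) by blast
  have K0: "submodule ?K0 R (FM R 1)"
    by (rule submodule_kernel[OF Fmod Rmod le module.carrier_is_submodule[OF Fmod] J])
  \<comment> \<open>A state is one differential \<open>D\<close> together with its two ranks, from
    \<open>b\<close> to \<open>a\<close>; \<open>Q\<close> says that the next differential covers
    the kernel of this one.\<close>
  define P where "P i s = (case s of (a, b, D) \<Rightarrow> lin R (FM R b) (FM R a) D \<and> (i = 0 \<longrightarrow> a = 1 \<and> D ` carrier (FM R b) = ?K0))"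
    for i :: nat and s :: "nat \<times> nat \<times> ((nat \<Rightarrow> 'a) \<Rightarrow> (nat \<Rightarrow> 'a))"
  define Q where "Q i s s' = (case s of (a, b, D) \<Rightarrow> case s' of (a', b', D') \<Rightarrow>
    a' = b \<and> D' ` carrier (FM R b') = {x \<in> carrier (FM R b). D x \<in> {\<zero>\<^bsub>FM R a\<^esub>}})"
    for i :: nat and s s' :: "nat \<times> nat \<times> ((nat \<Rightarrow> 'a) \<Rightarrow> (nat \<Rightarrow> 'a))"
  have "\<exists>f. \<forall>n. P n (f n) \<and> Q n (f n) (f (Suc n))"
  proof (rule dependent_nat_choice)
    obtain b D where "lin R (FM R b) (FM R 1) D" "D ` carrier (FM R b) = ?K0" using sub_is_image[OF assms(1) K0] by blast
    then show "\<exists>x. P 0 x" unfolding P_def by (intro exI[of _ "(1, b, D)"]) simp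
  next
    fix s i assume "P i s"
    moreover obtain a b D where s: "s = (a, b, D)" by (cases s) auto
    ultimately have D: "lin R (FM R b) (FM R a) D" by (auto simp: P_def)
    have "submodule {x \<in> carrier (FM R b). D x \<in> {\<zero>\<^bsub>FM R a\<^esub>}} R (FM R b)"
      by (rule submodule_kernel[OF Fmod Fmod D module.carrier_is_submodule[OF Fmod] submodule_zero[OF Fmod]])
    then obtain b' D' where "lin R (FM R b') (FM R b) D'" "D' ` carrier (FM R b') = {x \<in> carrier (FM R b). D x \<in> {\<zero>\<^bsub>FM R a\<^esub>}}"
      using sub_is_image[OF assms(1)] by blast
    then show "\<exists>y. P (Suc i) y \<and> Q i s y" unfolding P_def Q_def s by (intro exI[of _ "(b, b', D')"]) simp
  qed
  then obtain f where f: "\<And>n. P n (f n)" "\<And>n. Q n (f n) (f (Suc n))" by blast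
  define p where "p n = fst (f n)" for n
  define d where "d n = snd (snd (f n))" for n
  have ps: "fst (snd (f n)) = p (Suc n)" for n
    using f(2)[of n] unfolding Q_def p_def by (auto split: prod.splits)
  have feq: "f n = (p n, p (Suc n), d n)" for n using ps unfolding p_def d_def by (metis prod.collapse)
  have 1: "lin R (FM R (p (Suc i))) (FM R (p i)) (d i)" for i using f(1)[of i] unfolding P_def feq by simp
  have 2: "p 0 = 1" "d 0 ` carrier (FM R (p (Suc 0))) = ?K0" using f(1)[of 0] unfolding P_def feq by auto
  have 3: "d (Suc i) ` carrier (FM R (p (Suc (Suc i)))) = {x \<in> carrier (FM R (p (Suc i))). d i x \<in> {\<zero>\<^bsub>FM R (p i)\<^esub>}}" for i
    using f(2)[of i] unfolding Q_def feq by simp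
  have "\<exists>u\<in>carrier (FM R (p 0)). u 0 \<ominus> \<one> \<in> J"
  proof (rule bexI[of _ "basis R 1 0"])
    have "basis R 1 0 0 = \<one>" by (simp add: basis_def tup_inj_def)
    then show "basis R 1 0 0 \<ominus> \<one> \<in> J"
      using additive_subgroup.zero_closed[OF ideal.axioms(1)[OF assms(2)]] by (simp add: a_minus_def r_neg)
    show "basis R 1 0 \<in> carrier (FM R (p 0))" unfolding 2(1) by (rule basis_closed[OF R])
  qed
  then have "fres R J p d ?e" unfolding fres_def 3 2(2) using 1 2(1) le by auto
  then show ?thesis by blast
qed

text \<open>The comparison theorem: freeness of the source lets the map be chosen degree by degree,
  and exactness of the target makes each next choice possible.\<close>

lemma clift_exists:
  assumes "\<And>i. lin R (FM R (p (Suc i))) (FM R (p i)) (d i)" "lin R (FM R (p 0)) (RM R) e"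
    "\<And>y. y \<in> carrier (FM R (p (Suc 0))) ==> e (d 0 y) \<in> J"
    "\<And>i w. w \<in> carrier (FM R (p (Suc (Suc i)))) ==> d i (d (Suc i) w) = \<zero>\<^bsub>FM R (p i)\<^esub>"
    "fres R J p' d' e'" "ideal J R"
  shows "\<exists>\<phi>. clift R p d e p' d' e' J \<phi>"
proof -
  interpret J: ideal J R by fact
  note d' = fresD[OF assms(5)]
  \<comment> \<open>Besides linearity, \<open>P\<close> records what the next lift requires: the
    augmentations agree modulo \<open>J\<close> in degree zero, and boundaries go to cycles in
    higher degrees.\<close>
  define P where "P i \<phi> \<longleftrightarrow> lin R (FM R (p i)) (FM R (p' i)) \<phi> \<and>
      (case i of 0 \<Rightarrow> (\<forall>x\<in>carrier (FM R (p 0)). e' (\<phi> x) \<ominus> e x \<in> J)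
        | Suc j \<Rightarrow> (\<forall>x\<in>carrier (FM R (p (Suc i))). d' j (\<phi> (d i x)) = \<zero>\<^bsub>FM R (p' j)\<^esub>))" for i \<phi>
  define Q where "Q i \<phi> \<phi>' \<longleftrightarrow> (\<forall>x\<in>carrier (FM R (p (Suc i))). \<phi> (d i x) = d' i (\<phi>' x))" for i \<phi> \<phi>'
  have "\<exists>\<phi>. \<forall>n. P n (\<phi> n) \<and> Q n (\<phi> n) (\<phi> (Suc n))"
  proof (rule dependent_nat_choice)
    obtain g where "lin R (FM R (p 0)) (FM R (p' 0)) g" "\<And>x. x \<in> carrier (FM R (p 0)) ==> e' (g x) \<ominus> e x \<in> J"
      using fres_aug_lift[OF assms(5,6,2)] by blast
    then show "\<exists>x. P 0 x" unfolding P_def by (intro exI[of _ g]) simp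
  next
    fix \<phi> i assume P: "P i \<phi>"
    then have \<phi>: "lin R (FM R (p i)) (FM R (p' i)) \<phi>" by (simp add: P_def)
    have l: "lin R (FM R (p (Suc i))) (FM R (p' i)) (\<lambda>x. \<phi> (d i x))" by (rule lin_comp[OF assms(1) \<phi>])
    have "\<exists>y\<in>carrier (FM R (p' (Suc i))). \<phi> (d i x) = d' i y" if x: "x \<in> carrier (FM R (p (Suc i)))" for x
    proof (cases i)
      case 0
      have dx: "d 0 x \<in> carrier (FM R (p 0))" using lin_closed[OF assms(1)] x 0 by blast
      have c: "e' (\<phi> (d 0 x)) \<in> carrier R" "e (d 0 x) \<in> carrier R"
        using lin_closed[OF d'(2)] lin_closed[OF \<phi>] lin_closed[OF assms(2)] dx 0 by auto
      have "e' (\<phi> (d 0 x)) \<ominus> e (d 0 x) \<in> J" using P dx 0 by (simp add: P_def)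
      then have "e' (\<phi> (d 0 x)) \<in> J"
        using mod_mem[OF Rmod, of J "e' (\<phi> (d 0 x))" "e (d 0 x)"] ideal_iff_submodule[OF R] assms(3,6) x c 0 by simp
      then show ?thesis using d'(4) lin_closed[OF l x] 0 by simp
    next
      case (Suc j)
      then show ?thesis using P x d'(6) lin_closed[OF l x] by (simp add: P_def)
    qed
    then obtain \<psi> where \<psi>: "lin R (FM R (p (Suc i))) (FM R (p' (Suc i))) \<psi>"
      "\<And>x. x \<in> carrier (FM R (p (Suc i))) ==> \<phi> (d i x) = d' i (\<psi> x)"
      using lin_lift_eq[OF Fmod Fmod d'(1) l] by blast
    moreover have "d' i (\<psi> (d (Suc i) x)) = \<zero>\<^bsub>FM R (p' i)\<^esub>" if "x \<in> carrier (FM R (p (Suc (Suc i))))" for x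
      using \<psi>(2)[symmetric] assms(4)[OF that] lin_closed[OF assms(1) that] lin_zero[OF Fmod Fmod \<phi>] by simp
    ultimately show "\<exists>y. P (Suc i) y \<and> Q i \<phi> y" unfolding P_def Q_def by auto
  qed
  then obtain \<phi> where \<phi>: "\<And>n. P n (\<phi> n)" "\<And>n. Q n (\<phi> n) (\<phi> (Suc n))" by blast
  have "e' (\<phi> 0 x) \<ominus> e x \<in> J" if "x \<in> carrier (FM R (p 0))" for x using \<phi>(1)[of 0] that by (simp add: P_def)
  then show ?thesis unfolding clift_def cmap_def using \<phi> unfolding P_def Q_def by (intro exI[of _ \<phi>]) auto
qed

lemma fres_clift:
  assumes "fres R J p d e" "fres R J' p' d' e'" "J \<subseteq> J'" "ideal J' R"
  shows "\<exists>\<phi>. clift R p d e p' d' e' J' \<phi>"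
  by (rule clift_exists[OF fresD(1,2)[OF assms(1)] _ fresD(7)[OF assms(1)] assms(2,4)])
    (use fresD(5)[OF assms(1)] assms(3) in auto)

text \<open>The condition on the augmentation says that the chain map induces zero on the resolved
  module. Exactness of the target then yields the homotopy degree by degree.\<close>

lemma null_homotopy:
  assumes "\<And>i. lin R (FM R (p (Suc i))) (FM R (p i)) (d i)"
    "\<And>i w. w \<in> carrier (FM R (p (Suc (Suc i)))) ==> d i (d (Suc i) w) = \<zero>\<^bsub>FM R (p i)\<^esub>"
    "fres R J p' d' e'" "cmap R p d p' d' \<phi>" "\<And>x. x \<in> carrier (FM R (p 0)) ==> e' (\<phi> 0 x) \<in> J"
  obtains h where "\<And>i. lin R (FM R (p i)) (FM R (p' (Suc i))) (h i)"
    "\<And>x. x \<in> carrier (FM R (p 0)) ==> \<phi> 0 x = d' 0 (h 0 x)"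
    "\<And>i x. x \<in> carrier (FM R (p (Suc i))) ==>
      \<phi> (Suc i) x = d' (Suc i) (h (Suc i) x) \<oplus>\<^bsub>FM R (p' (Suc i))\<^esub> h i (d i x)"
proof -
  note d' = fresD[OF assms(3)]
  have \<phi>: "lin R (FM R (p i)) (FM R (p' i)) (\<phi> i)"
    "x \<in> carrier (FM R (p (Suc i))) ==> d' i (\<phi> (Suc i) x) = \<phi> i (d i x)" for i x using assms(4) by (auto simp: cmap_def)
  \<comment> \<open>The last clause says that the chain map minus \<open>h d\<close> takes values in
    cycles, which is the condition for choosing the next component.\<close>
  define P where "P i h \<longleftrightarrow> lin R (FM R (p i)) (FM R (p' (Suc i))) h \<and>
      (i = 0 \<longrightarrow> (\<forall>x\<in>carrier (FM R (p 0)). \<phi> 0 x = d' 0 (h x))) \<and>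
      (\<forall>x\<in>carrier (FM R (p (Suc i))). d' i (\<phi> (Suc i) x) = d' i (h (d i x)))" for i h
  define Q where "Q i h h' \<longleftrightarrow> (\<forall>x\<in>carrier (FM R (p (Suc i))).
      \<phi> (Suc i) x = d' (Suc i) (h' x) \<oplus>\<^bsub>FM R (p' (Suc i))\<^esub> h (d i x))" for i h h'
  have "\<exists>h. \<forall>n. P n (h n) \<and> Q n (h n) (h (Suc n))"
  proof (rule dependent_nat_choice)
    have "\<exists>y\<in>carrier (FM R (p' (Suc 0))). \<phi> 0 x = d' 0 y" if "x \<in> carrier (FM R (p 0))" for x
      using d'(4)[OF lin_closed[OF \<phi>(1) that] assms(5)[OF that]] .
    then obtain h where h: "lin R (FM R (p 0)) (FM R (p' (Suc 0))) h" "\<And>x. x \<in> carrier (FM R (p 0)) ==> \<phi> 0 x = d' 0 (h x)"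
      using lin_lift_eq[OF Fmod Fmod d'(1) \<phi>(1)] by blast
    then show "\<exists>x. P 0 x" unfolding P_def using \<phi>(2)[of _ 0] lin_closed[OF assms(1)] by (intro exI[of _ h]) auto
  next
    fix h i assume P: "P i h"
    then have h: "lin R (FM R (p i)) (FM R (p' (Suc i))) h" by (simp add: P_def)
    have hd: "lin R (FM R (p (Suc i))) (FM R (p' (Suc i))) (\<lambda>x. h (d i x))" by (rule lin_comp[OF assms(1) h])
    let ?f = "\<lambda>x. \<phi> (Suc i) x \<ominus>\<^bsub>FM R (p' (Suc i))\<^esub> h (d i x)"
    have f: "lin R (FM R (p (Suc i))) (FM R (p' (Suc i))) ?f" by (rule lin_diff[OF Fmod \<phi>(1) hd])
    have "\<exists>y\<in>carrier (FM R (p' (Suc (Suc i)))). ?f x = d' (Suc i) y" if x: "x \<in> carrier (FM R (p (Suc i)))" for x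
    proof (rule d'(6)[OF lin_closed[OF f x]])
      have "d' i (?f x) = d' i (\<phi> (Suc i) x) \<ominus>\<^bsub>FM R (p' i)\<^esub> d' i (h (d i x))"
        by (rule lin_minus[OF Fmod Fmod d'(1) lin_closed[OF \<phi>(1) x] lin_closed[OF hd x]])
      also have "\<dots> = \<zero>\<^bsub>FM R (p' i)\<^esub>" using P x minus_zero_iff[OF Fmod] lin_closed[OF d'(1) lin_closed[OF hd x]] by (simp add: P_def)
      finally show "d' i (?f x) = \<zero>\<^bsub>FM R (p' i)\<^esub>" .
    qed
    then obtain h' where h': "lin R (FM R (p (Suc i))) (FM R (p' (Suc (Suc i)))) h'"
      "\<And>x. x \<in> carrier (FM R (p (Suc i))) ==> ?f x = d' (Suc i) (h' x)"
      using lin_lift_eq[OF Fmod Fmod d'(1) f] by blast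
    have q: "\<phi> (Suc i) x = d' (Suc i) (h' x) \<oplus>\<^bsub>FM R (p' (Suc i))\<^esub> h (d i x)" if x: "x \<in> carrier (FM R (p (Suc i)))" for x
      using h'(2)[OF x] mod_cancel(1)[OF Fmod lin_closed[OF \<phi>(1) x] lin_closed[OF hd x]] by simp
    have "d' (Suc i) (\<phi> (Suc (Suc i)) x) = d' (Suc i) (h' (d (Suc i) x))" if x: "x \<in> carrier (FM R (p (Suc (Suc i))))" for x
    proof -
      interpret FF: module R "FM R (p' (Suc i))" by (rule Fmod)
      have dx: "d (Suc i) x \<in> carrier (FM R (p (Suc i)))" by (rule lin_closed[OF assms(1) x])
      have "d' (Suc i) (\<phi> (Suc (Suc i)) x) = \<phi> (Suc i) (d (Suc i) x)" by (rule \<phi>(2)[OF x])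
      also have "\<dots> = d' (Suc i) (h' (d (Suc i) x))"
        using q[OF dx] assms(2)[OF x] lin_zero[OF Fmod Fmod h] lin_closed[OF d'(1) lin_closed[OF h'(1) dx]] by simp
      finally show ?thesis .
    qed
    then show "\<exists>y. P (Suc i) y \<and> Q i h y" unfolding P_def Q_def using h' q by (intro exI[of _ h']) auto
  qed
  then obtain h where h: "\<And>n. P n (h n)" "\<And>n. Q n (h n) (h (Suc n))" by blast
  show ?thesis
    by (rule that[of h]) (use h in \<open>auto simp: P_def Q_def\<close>)
qed

lemma clift_comp:
  assumes "clift R p d e p' d' e' J \<phi>" "clift R p' d' e' p'' d'' e'' J' \<psi>" "J \<subseteq> J'" "ideal J' R"
    "lin R (FM R (p 0)) (RM R) e" "lin R (FM R (p' 0)) (RM R) e'" "lin R (FM R (p'' 0)) (RM R) e''"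
    "\<And>i. lin R (FM R (p (Suc i))) (FM R (p i)) (d i)"
  shows "clift R p d e p'' d'' e'' J' (\<lambda>i x. \<psi> i (\<phi> i x))"
proof -
  have \<phi>: "lin R (FM R (p i)) (FM R (p' i)) (\<phi> i)"
    "x \<in> carrier (FM R (p (Suc i))) ==> d' i (\<phi> (Suc i) x) = \<phi> i (d i x)"
    "y \<in> carrier (FM R (p 0)) ==> e' (\<phi> 0 y) \<ominus> e y \<in> J'" for i x y
    using assms(1,3) by (auto simp: cmap_def clift_def)
  have \<psi>: "lin R (FM R (p' i)) (FM R (p'' i)) (\<psi> i)"
    "x \<in> carrier (FM R (p' (Suc i))) ==> d'' i (\<psi> (Suc i) x) = \<psi> i (d' i x)"
    "y \<in> carrier (FM R (p' 0)) ==> e'' (\<psi> 0 y) \<ominus> e' y \<in> J'" for i x y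
    using assms(2) by (auto simp: cmap_def clift_def)
  have J': "submodule J' R (RM R)" using assms(4) ideal_iff_submodule[OF R] by blast
  show ?thesis unfolding clift_def cmap_def
  proof (intro conjI allI ballI)
    fix i show "lin R (FM R (p i)) (FM R (p'' i)) (\<lambda>x. \<psi> i (\<phi> i x))" by (rule lin_comp[OF \<phi>(1) \<psi>(1)])
    fix x assume x: "x \<in> carrier (FM R (p (Suc i)))"
    show "d'' i (\<psi> (Suc i) (\<phi> (Suc i) x)) = \<psi> i (\<phi> i (d i x))"
      using \<psi>(2)[OF lin_closed[OF \<phi>(1) x]] \<phi>(2)[OF x] by simp
  next
    fix x assume x: "x \<in> carrier (FM R (p 0))"
    have fx: "\<phi> 0 x \<in> carrier (FM R (p' 0))" by (rule lin_closed[OF \<phi>(1) x])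
    show "e'' (\<psi> 0 (\<phi> 0 x)) \<ominus> e x \<in> J'"
      using mod_trans[OF Rmod J', of "e'' (\<psi> 0 (\<phi> 0 x))" "e' (\<phi> 0 x)" "e x"] \<psi>(3)[OF fx] \<phi>(3)[OF x]
        lin_closed[OF assms(5) x] lin_closed[OF assms(6) fx] lin_closed[OF assms(7) lin_closed[OF \<psi>(1) fx]] by simp
  qed
qed

end

subsection \<open>Cocycles relative to a submodule\<close>

text \<open>Representatives of cocycles with values in \<open>N / L\<close>. By freeness every
  cochain into \<open>N / L\<close> lifts to a map into \<open>N\<close>, so nothing is lost by
  staying inside \<open>X\<close>.\<close>

definition relcoc where
  "relcoc R p d X N L k f \<longleftrightarrow>
     lin R (FM R (p k)) X f \<and> (\<forall>x\<in>carrier (FM R (p k)). f x \<in> N) \<and>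
     (\<forall>x\<in>carrier (FM R (p (Suc k))). f (d k x) \<in> L)"

text \<open>In degree zero the only coboundary is zero, that is, a map with values in
  \<open>L\<close>.\<close>

definition relcob where
  "relcob R p d X N L k f \<longleftrightarrow>
     (case k of 0 \<Rightarrow> \<forall>x\<in>carrier (FM R (p 0)). f x \<in> L
      | Suc j \<Rightarrow> \<exists>g. lin R (FM R (p j)) X g \<and> (\<forall>x\<in>carrier (FM R (p j)). g x \<in> N) \<and>
          (\<forall>x\<in>carrier (FM R (p (Suc j))). f x \<ominus>\<^bsub>X\<^esub> g (d j x) \<in> L))"

text \<open>\<open>vanish R \<aa> X N L k\<close> expresses \<open>H\<^sup>k\<^sub>\<aa>(N/L) = 0\<close> for submodules \<open>L \<subseteq> N\<close> of \<open>X\<close>, without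
  forming the quotient.\<close>

definition vanish ::
    "('a, 'r) ring_scheme \<Rightarrow> 'a set \<Rightarrow> ('a, 'm, 's) module_scheme \<Rightarrow> 'm set \<Rightarrow> 'm set \<Rightarrow> nat \<Rightarrow> bool" where
  "vanish R \<aa> X N L k \<longleftrightarrow>
     (\<forall>n p d e f. fres R (ideal_power R \<aa> n) p d e \<longrightarrow> relcoc R p d X N L k f \<longrightarrow>
        (\<exists>m0\<ge>n. \<forall>m\<ge>m0. \<forall>p' d' e' \<phi>. fres R (ideal_power R \<aa> m) p' d' e' \<longrightarrow>
           clift R p' d' e' p d e (ideal_power R \<aa> n) \<phi> \<longrightarrow> relcob R p' d' X N L k (\<lambda>x. f (\<phi> k x))))"

lemma relcob_cong:
  assumes "relcob R p d X N L k f" "\<And>x. x \<in> carrier (FM R (p k)) ==> f' x = f x"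
  shows "relcob R p d X N L k f'"
  using assms by (cases k) (auto simp: relcob_def)

context
  fixes R :: "('a, 'r) ring_scheme" and X :: "('a, 'm, 's) module_scheme" (structure) and N L :: "'m set"
  assumes X: "module R X" and N: "submodule N R X" and L: "submodule L R X" and LN: "L \<subseteq> N"
begin

interpretation module R X by (rule X)

private lemmas R' = is_cring
private lemmas Rmod' = module_ring_as_module[OF R']
private lemmas Fmod' = module_free[OF R']

lemma relcoc_comp:
  assumes "relcoc R p d X N L k f" "cmap R p' d' p d \<phi>"
  shows "relcoc R p' d' X N L k (\<lambda>x. f (\<phi> k x))"
proof -
  have \<phi>: "lin R (FM R (p' i)) (FM R (p i)) (\<phi> i)"
    "x \<in> carrier (FM R (p' (Suc i))) ==> d i (\<phi> (Suc i) x) = \<phi> i (d' i x)" for i x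
    using assms(2) by (auto simp: cmap_def)
  show ?thesis using assms(1) lin_comp[OF \<phi>(1), of k X f] lin_closed[OF \<phi>(1)] \<phi>(2)[symmetric]
    unfolding relcoc_def by auto
qed

lemma relcob_comp:
  assumes "relcob R p d X N L k f" "cmap R p' d' p d \<phi>"
  shows "relcob R p' d' X N L k (\<lambda>x. f (\<phi> k x))"
proof -
  have \<phi>: "lin R (FM R (p' i)) (FM R (p i)) (\<phi> i)"
    "x \<in> carrier (FM R (p' (Suc i))) ==> d i (\<phi> (Suc i) x) = \<phi> i (d' i x)" for i x
    using assms(2) by (auto simp: cmap_def)
  show ?thesis
  proof (cases k)
    case 0
    then show ?thesis using assms(1) lin_closed[OF \<phi>(1)] by (auto simp: relcob_def)
  next
    case (Suc j)
    then obtain g where g: "lin R (FM R (p j)) X g" "\<And>x. x \<in> carrier (FM R (p j)) ==> g x \<in> N"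
      "\<And>x. x \<in> carrier (FM R (p (Suc j))) ==> f x \<ominus> g (d j x) \<in> L"
      using assms(1) by (auto simp: relcob_def)
    have "f (\<phi> k x) \<ominus> g (\<phi> j (d' j x)) \<in> L" if "x \<in> carrier (FM R (p' (Suc j)))" for x
      using g(3)[OF lin_closed[OF \<phi>(1) that]] \<phi>(2)[OF that] Suc by simp
    then show ?thesis unfolding relcob_def using Suc lin_comp[OF \<phi>(1) g(1)] g(2) lin_closed[OF \<phi>(1)]
      by (auto intro!: exI[of _ "\<lambda>x. g (\<phi> j x)"])
  qed
qed

lemma relcob_zero: "relcob R p d X N L k (\<lambda>x. \<zero>)"
  using lin_const_zero[OF X] sub_zero[OF L] sub_zero[OF N] mod_refl[OF X L M.zero_closed]
  by (cases k) (auto simp: relcob_def intro!: exI[of _ "\<lambda>_. \<zero>"])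

lemma relcob_smult:
  assumes "relcob R p d X N L k f" "lin R (FM R (p k)) X f" "\<And>i. lin R (FM R (p (Suc i))) (FM R (p i)) (d i)" "r \<in> carrier R"
  shows "relcob R p d X N L k (\<lambda>x. r \<odot> f x)"
proof (rule relcob_cong[OF relcob_comp[OF assms(1)]])
  show "cmap R p d p d (\<lambda>i x. r \<odot>\<^bsub>FM R (p i)\<^esub> x)"
    unfolding cmap_def using lin_scale[OF Fmod' lin_ident assms(4)] lin_smult[OF assms(3,4)] by auto
  show "r \<odot> f x = f (r \<odot>\<^bsub>FM R (p k)\<^esub> x)" if "x \<in> carrier (FM R (p k))" for x
    using lin_smult[OF assms(2,4) that] by simp
qed

lemma relcob_mod:
  assumes "relcob R p d X N L k f" "\<And>x. x \<in> carrier (FM R (p k)) ==> f' x \<ominus> f x \<in> L"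
    "\<And>x. x \<in> carrier (FM R (p k)) ==> f x \<in> carrier X" "\<And>x. x \<in> carrier (FM R (p k)) ==> f' x \<in> carrier X"
    "\<And>i. lin R (FM R (p (Suc i))) (FM R (p i)) (d i)"
  shows "relcob R p d X N L k f'"
proof (cases k)
  case 0
  then show ?thesis using assms(1-4) mod_mem[OF X L] by (auto simp: relcob_def)
next
  case (Suc j)
  then obtain g where g: "lin R (FM R (p j)) X g" "\<And>x. x \<in> carrier (FM R (p j)) ==> g x \<in> N"
    "\<And>x. x \<in> carrier (FM R (p (Suc j))) ==> f x \<ominus> g (d j x) \<in> L"
    using assms(1) by (auto simp: relcob_def)
  have "f' x \<ominus> g (d j x) \<in> L" if x: "x \<in> carrier (FM R (p (Suc j)))" for x
    by (rule mod_trans[OF X L, of _ "f x"])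
      (use assms(2-4) g(3)[OF x] x lin_closed[OF g(1) lin_closed[OF assms(5) x]] Suc in auto)
  then show ?thesis unfolding relcob_def using Suc g by auto
qed

lemma relcob_add:
  assumes "relcob R p d X N L k f" "relcob R p d X N L k f'"
    "\<And>x. x \<in> carrier (FM R (p k)) ==> f x \<in> carrier X" "\<And>x. x \<in> carrier (FM R (p k)) ==> f' x \<in> carrier X"
    "\<And>i. lin R (FM R (p (Suc i))) (FM R (p i)) (d i)"
  shows "relcob R p d X N L k (\<lambda>x. f x \<oplus> f' x)"
proof (cases k)
  case 0
  then show ?thesis using assms(1,2) sub_add[OF L] by (auto simp: relcob_def)
next
  case (Suc j)
  obtain g g' where g: "lin R (FM R (p j)) X g" "\<And>x. x \<in> carrier (FM R (p j)) ==> g x \<in> N"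
    "\<And>x. x \<in> carrier (FM R (p (Suc j))) ==> f x \<ominus> g (d j x) \<in> L"
   and g': "lin R (FM R (p j)) X g'" "\<And>x. x \<in> carrier (FM R (p j)) ==> g' x \<in> N"
    "\<And>x. x \<in> carrier (FM R (p (Suc j))) ==> f' x \<ominus> g' (d j x) \<in> L"
    using assms(1,2) Suc by (auto simp: relcob_def)
  have "(f x \<oplus> f' x) \<ominus> (g (d j x) \<oplus> g' (d j x)) \<in> L" if x: "x \<in> carrier (FM R (p (Suc j)))" for x
    by (rule mod_add[OF X L])
      (use assms(3,4) g(3)[OF x] g'(3)[OF x] x lin_closed[OF g(1) lin_closed[OF assms(5) x]] lin_closed[OF g'(1) lin_closed[OF assms(5) x]] Suc in auto)
  moreover have "g x \<oplus> g' x \<in> N" if "x \<in> carrier (FM R (p j))" for x by (rule sub_add[OF N g(2)[OF that] g'(2)[OF that]])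
  ultimately show ?thesis unfolding relcob_def using Suc lin_plus[OF X g(1) g'(1)]
    by (auto intro!: exI[of _ "\<lambda>x. g x \<oplus> g' x"])
qed

text \<open>With a homotopy, \<open>f \<phi> = f d h + f h d\<close>. The first summand has values
  in \<open>L\<close> because \<open>f\<close> is a cocycle, and the second is the coboundary of
  \<open>f h\<close>.\<close>

lemma relcob_null:
  assumes "relcoc R p d X N L k f" "fres R J p d e"
    "\<And>i. lin R (FM R (p' (Suc i))) (FM R (p' i)) (d' i)"
    "\<And>i w. w \<in> carrier (FM R (p' (Suc (Suc i)))) ==> d' i (d' (Suc i) w) = \<zero>\<^bsub>FM R (p' i)\<^esub>"
    "cmap R p' d' p d \<phi>" "\<And>x. x \<in> carrier (FM R (p' 0)) ==> e (\<phi> 0 x) \<in> J"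
  shows "relcob R p' d' X N L k (\<lambda>x. f (\<phi> k x))"
proof -
  have f: "lin R (FM R (p k)) X f" "\<And>x. x \<in> carrier (FM R (p k)) ==> f x \<in> N"
    "\<And>x. x \<in> carrier (FM R (p (Suc k))) ==> f (d k x) \<in> L" using assms(1) by (auto simp: relcoc_def)
  note d = fresD[OF assms(2)]
  obtain h where h: "\<And>i. lin R (FM R (p' i)) (FM R (p (Suc i))) (h i)"
    "\<And>x. x \<in> carrier (FM R (p' 0)) ==> \<phi> 0 x = d 0 (h 0 x)"
    "\<And>i x. x \<in> carrier (FM R (p' (Suc i))) ==> \<phi> (Suc i) x = d (Suc i) (h (Suc i) x) \<oplus>\<^bsub>FM R (p (Suc i))\<^esub> h i (d' i x)"
    using null_homotopy[OF R' assms(3,4,2,5,6)] by blast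
  show ?thesis
  proof (cases k)
    case 0
    then show ?thesis using h(2) f(3) lin_closed[OF h(1)] by (auto simp: relcob_def)
  next
    case (Suc j)
    have "f (\<phi> k x) \<ominus> f (h j (d' j x)) \<in> L" if x: "x \<in> carrier (FM R (p' (Suc j)))" for x
    proof -
      let ?a = "d k (h k x)" and ?b = "h j (d' j x)"
      have a: "?a \<in> carrier (FM R (p k))" "f ?a \<in> L" using lin_closed[OF d(1) lin_closed[OF h(1)]] f(3) lin_closed[OF h(1)] x Suc by auto
      have b: "?b \<in> carrier (FM R (p k))" using lin_closed[OF h(1) lin_closed[OF assms(3) x]] Suc by simp
      have "f (\<phi> k x) = f ?a \<oplus> f ?b" using h(3)[OF x] lin_add[OF f(1) a(1) b] Suc by simp
      then have "f (\<phi> k x) \<ominus> f ?b = f ?a" using mod_cancel(4)[OF X lin_closed[OF f(1) a(1)] lin_closed[OF f(1) b]] by simp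
      then show ?thesis using a by simp
    qed
    then show ?thesis unfolding relcob_def using Suc lin_comp[OF h(1), of j X f] f lin_closed[OF h(1)]
      by (auto intro!: exI[of _ "\<lambda>x. f (h j x)"])
  qed
qed

lemma cmap_diff:
  assumes "cmap R p' d' p d \<phi>" "cmap R p' d' p d \<psi>"
    "\<And>i. lin R (FM R (p (Suc i))) (FM R (p i)) (d i)" "\<And>i. lin R (FM R (p' (Suc i))) (FM R (p' i)) (d' i)"
  shows "cmap R p' d' p d (\<lambda>i x. \<phi> i x \<ominus>\<^bsub>FM R (p i)\<^esub> \<psi> i x)"
proof -
  have \<phi>: "lin R (FM R (p' i)) (FM R (p i)) (\<phi> i)" "lin R (FM R (p' i)) (FM R (p i)) (\<psi> i)"
    "x \<in> carrier (FM R (p' (Suc i))) ==> d i (\<phi> (Suc i) x) = \<phi> i (d' i x)"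
    "x \<in> carrier (FM R (p' (Suc i))) ==> d i (\<psi> (Suc i) x) = \<psi> i (d' i x)" for i x
    using assms(1,2) by (auto simp: cmap_def)
  show ?thesis unfolding cmap_def
    using lin_diff[OF Fmod' \<phi>(1,2)] lin_minus[OF Fmod' Fmod' assms(3) lin_closed[OF \<phi>(1)] lin_closed[OF \<phi>(2)]] \<phi>(3,4)
    by auto
qed

text \<open>Two lifts of the same projection differ by a null-homotopic map, so the choice of the
  lift does not decide whether a cocycle dies.\<close>

lemma relcob_lifts:
  assumes "relcoc R p d X N L k f" "fres R J p d e" "fres R J' p' d' e'" "ideal J R"
    "clift R p' d' e' p d e J \<phi>" "clift R p' d' e' p d e J \<psi>" "relcob R p' d' X N L k (\<lambda>x. f (\<psi> k x))"
  shows "relcob R p' d' X N L k (\<lambda>x. f (\<phi> k x))"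
proof -
  note d = fresD[OF assms(2)] and d' = fresD[OF assms(3)]
  have f: "lin R (FM R (p k)) X f" using assms(1) by (auto simp: relcoc_def)
  have J: "submodule J R (RM R)" using ideal_iff_submodule[OF R'] assms(4) by blast
  have c: "cmap R p' d' p d \<phi>" "cmap R p' d' p d \<psi>" using assms(5,6) by (auto simp: clift_def)
  then have l: "lin R (FM R (p' i)) (FM R (p i)) (\<phi> i)" "lin R (FM R (p' i)) (FM R (p i)) (\<psi> i)" for i by (auto simp: cmap_def)
  note c3 = cmap_diff[OF c d(1) d'(1)]
  have "e (\<phi> 0 x \<ominus>\<^bsub>FM R (p 0)\<^esub> \<psi> 0 x) \<in> J" if x: "x \<in> carrier (FM R (p' 0))" for x
  proof -
    have e: "e (\<phi> 0 x) \<ominus>\<^bsub>R\<^esub> e' x \<in> J" "e (\<psi> 0 x) \<ominus>\<^bsub>R\<^esub> e' x \<in> J" using assms(5,6) x by (auto simp: clift_def)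
    have cc: "e (\<phi> 0 x) \<in> carrier R" "e (\<psi> 0 x) \<in> carrier R" "e' x \<in> carrier R"
      using lin_closed[OF d(2) lin_closed[OF l(1) x]] lin_closed[OF d(2) lin_closed[OF l(2) x]] lin_closed[OF d'(2) x] by auto
    have "e' x \<ominus>\<^bsub>R\<^esub> e (\<psi> 0 x) \<in> J" using mod_sym[OF Rmod' J, of "e (\<psi> 0 x)" "e' x"] e cc by simp
    then have "e (\<phi> 0 x) \<ominus>\<^bsub>R\<^esub> e (\<psi> 0 x) \<in> J" using mod_trans[OF Rmod' J, of "e (\<phi> 0 x)" "e' x" "e (\<psi> 0 x)"] e cc by simp
    then show ?thesis using lin_minus[OF Fmod' Rmod' d(2) lin_closed[OF l(1) x] lin_closed[OF l(2) x]] by simp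
  qed
  from relcob_null[OF assms(1,2), where p'=p' and d'=d', OF d'(1,7) c3 this]
  have "relcob R p' d' X N L k (\<lambda>x. f (\<phi> k x \<ominus>\<^bsub>FM R (p k)\<^esub> \<psi> k x))" by blast
  from relcob_add[OF this assms(7) _ _ d'(1)]
  have "relcob R p' d' X N L k (\<lambda>x. f (\<phi> k x \<ominus>\<^bsub>FM R (p k)\<^esub> \<psi> k x) \<oplus> f (\<psi> k x))"
    using lin_closed[OF f] lin_closed[OF l(2)] lin_closed[OF lin_diff[OF Fmod' l(1,2)]] by blast
  then show ?thesis
  proof (rule relcob_mod[where p=p' and d=d', OF _ _ _ _ d'(1)])
    fix x assume x: "x \<in> carrier (FM R (p' k))"
    note 1 = lin_closed[OF l(1) x] lin_closed[OF l(2) x]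
    have e: "f (\<phi> k x \<ominus>\<^bsub>FM R (p k)\<^esub> \<psi> k x) \<oplus> f (\<psi> k x) = f (\<phi> k x)"
      using lin_minus[OF Fmod' X f 1] mod_cancel(1)[OF X lin_closed[OF f 1(1)] lin_closed[OF f 1(2)]] by simp
    show "f (\<phi> k x) \<in> carrier X" by (rule lin_closed[OF f 1(1)])
    then show "f (\<phi> k x \<ominus>\<^bsub>FM R (p k)\<^esub> \<psi> k x) \<oplus> f (\<psi> k x) \<in> carrier X"
      "f (\<phi> k x) \<ominus> (f (\<phi> k x \<ominus>\<^bsub>FM R (p k)\<^esub> \<psi> k x) \<oplus> f (\<psi> k x)) \<in> L" unfolding e using mod_refl[OF X L] by auto
  qed
qed

text \<open>Multiplication by an element of \<open>J\<close> is null homotopic on a resolution of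
  \<open>R/J\<close>; in other words, \<open>J\<close> annihilates Ext of \<open>R/J\<close>. The
  comparison of \<open>M\<close> with its completion depends on this.\<close>

lemma relcob_scale:
  assumes "relcoc R p d X N L k f" "fres R J p d e" "ideal J R" "r \<in> J"
  shows "relcob R p d X N L k (\<lambda>x. r \<odot> f x)"
proof -
  interpret J: ideal J R by fact
  note d = fresD[OF assms(2)]
  have f: "lin R (FM R (p k)) X f" using assms(1) by (auto simp: relcoc_def)
  have r: "r \<in> carrier R" using assms(4) J.Icarr by blast
  let ?\<phi> = "\<lambda>i x. r \<odot>\<^bsub>FM R (p i)\<^esub> x"
  have "cmap R p d p d ?\<phi>" unfolding cmap_def using lin_scale[OF Fmod' lin_ident r] lin_smult[OF d(1) r] by auto
  moreover have "e (?\<phi> 0 x) \<in> J" if "x \<in> carrier (FM R (p 0))" for x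
    using lin_smult[OF d(2) r that] J.I_r_closed[OF assms(4)] lin_closed[OF d(2) that] by simp
  ultimately have "relcob R p d X N L k (\<lambda>x. f (?\<phi> k x))" using relcob_null[OF assms(1,2), where p'=p and d'=d, OF d(1,7)] by blast
  then show ?thesis
  proof (rule relcob_mod[where p=p and d=d, OF _ _ _ _ d(1)])
    fix x assume x: "x \<in> carrier (FM R (p k))"
    show "r \<odot> f x \<in> carrier X" using lin_closed[OF f x] r by simp
    then show "f (?\<phi> k x) \<in> carrier X" "r \<odot> f x \<ominus> f (?\<phi> k x) \<in> L"
      using lin_smult[OF f r x] mod_refl[OF X L] by auto
  qed
qed

context
  fixes \<aa> :: "'a set"
  assumes \<aa>: "ideal \<aa> R"
begin

private abbreviation "J \<equiv> ideal_power R \<aa>"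
private lemmas JI = ideal_power_ideal[OF R' \<aa>]

text \<open>Once a class dies along one lift, it dies along every lift from every resolution of a
  later power, because such a lift factors through the first one up to homotopy. This justifies the
  universal quantifiers in \<open>vanish\<close>.\<close>

lemma relcob_strong:
  assumes "fres R (J n) p d e" "relcoc R p d X N L k f"
    "fres R (J m) p1 d1 e1" "clift R p1 d1 e1 p d e (J n) \<phi>1" "relcob R p1 d1 X N L k (\<lambda>x. f (\<phi>1 k x))"
    "n \<le> m" "m \<le> m'" "fres R (J m') p' d' e'" "clift R p' d' e' p d e (J n) \<phi>"
  shows "relcob R p' d' X N L k (\<lambda>x. f (\<phi> k x))"
proof -
  obtain \<psi> where \<psi>: "clift R p' d' e' p1 d1 e1 (J m) \<psi>"
    using fres_clift[OF R' assms(8,3) ideal_power_antimono[OF R' \<aa> assms(7)] JI] by blast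
  have c: "clift R p' d' e' p d e (J n) (\<lambda>i x. \<phi>1 i (\<psi> i x))"
    by (rule clift_comp[OF R' \<psi> assms(4) ideal_power_antimono[OF R' \<aa> assms(6)] JI
        fresD(2)[OF assms(8)] fresD(2)[OF assms(3)] fresD(2)[OF assms(1)] fresD(1)[OF assms(8)]])
  have "cmap R p' d' p1 d1 \<psi>" using \<psi> by (auto simp: clift_def)
  from relcob_comp[OF assms(5) this] have "relcob R p' d' X N L k (\<lambda>x. f (\<phi>1 k (\<psi> k x)))" .
  then show ?thesis using relcob_lifts[OF assms(2,1,8) JI assms(9) c] by blast
qed

text \<open>One resolution per power and one lift per cocycle are enough: an arbitrary resolution is
  compared with the given one of the same power, and \<open>relcob_strong\<close> handles all later
  stages.\<close>

lemma vanishI: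
  assumes "\<And>n. fres R (J n) (P n) (D n) (E n)"
    "\<And>n f. relcoc R (P n) (D n) X N L k f ==>
      \<exists>m\<ge>n. \<exists>\<phi>. clift R (P m) (D m) (E m) (P n) (D n) (E n) (J n) \<phi> \<and> relcob R (P m) (D m) X N L k (\<lambda>x. f (\<phi> k x))"
  shows "vanish R \<aa> X N L k"
  unfolding vanish_def
proof (intro allI impI)
  fix n p d e f assume p: "fres R (J n) p d e" "relcoc R p d X N L k f"
  obtain \<beta> where \<beta>: "clift R (P n) (D n) (E n) p d e (J n) \<beta>" using fres_clift[OF R' assms(1) p(1) subset_refl JI] by blast
  have "relcoc R (P n) (D n) X N L k (\<lambda>x. f (\<beta> k x))" by (rule relcoc_comp[OF p(2)]) (use \<beta> in \<open>auto simp: clift_def\<close>)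
  from assms(2)[OF this] obtain m \<phi> where m: "m \<ge> n" "clift R (P m) (D m) (E m) (P n) (D n) (E n) (J n) \<phi>"
    "relcob R (P m) (D m) X N L k (\<lambda>x. f (\<beta> k (\<phi> k x)))" by blast
  have c: "clift R (P m) (D m) (E m) p d e (J n) (\<lambda>i x. \<beta> i (\<phi> i x))"
    by (rule clift_comp[OF R' m(2) \<beta> subset_refl JI fresD(2)[OF assms(1)] fresD(2)[OF assms(1)] fresD(2)[OF p(1)] fresD(1)[OF assms(1)]])
  show "\<exists>m0\<ge>n. \<forall>m\<ge>m0. \<forall>p' d' e' \<phi>. fres R (J m) p' d' e' \<longrightarrow>
           clift R p' d' e' p d e (J n) \<phi> \<longrightarrow> relcob R p' d' X N L k (\<lambda>x. f (\<phi> k x))"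
    using relcob_strong[OF p assms(1) c m(3,1)] m(1) by blast
qed

lemma vanishD:
  assumes "vanish R \<aa> X N L k" "\<And>n. fres R (J n) (P n) (D n) (E n)" "relcoc R (P n) (D n) X N L k f"
  obtains m0 where "m0 \<ge> n" "\<And>m \<phi>. m \<ge> m0 ==> clift R (P m) (D m) (E m) (P n) (D n) (E n) (J n) \<phi> ==>
    relcob R (P m) (D m) X N L k (\<lambda>x. f (\<phi> k x))"
  using assms(1)[unfolded vanish_def] assms(2)[of n] assms(3) assms(2) that by metis

end

end

subsection \<open>Lifts of bounded length\<close>

lemma ideal_power_mono:
  assumes "cring R" "ideal \<bb> R" "ideal \<aa> R" "\<bb> \<subseteq> \<aa>"
  shows "ideal_power R \<bb> n \<subseteq> ideal_power R \<aa> n"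
proof (induction n)
  case 0
  then show ?case by (simp add: ideal_power_0[OF assms(1)])
next
  case (Suc n)
  have "x \<in> ideal_prod R (ideal_power R \<aa> n) \<aa>" if "x \<in> ideal_prod R (ideal_power R \<bb> n) \<bb>" for x
    using that by induction (use Suc assms(4) in \<open>auto intro: ideal_prod.intros\<close>)
  then show ?case unfolding ideal_power_Suc[OF assms(1,2)] ideal_power_Suc[OF assms(1,3)] by blast
qed

lemma elem_power_in_ideal_power:
  assumes "cring R" "ideal \<aa> R" "x \<in> \<aa>"
  shows "x [^]\<^bsub>R\<^esub> n \<in> ideal_power R \<aa> n"
proof (induction n)
  case 0
  interpret cring R by fact
  show ?case unfolding ideal_power_0[OF assms(1,2)] by simp
next
  case (Suc n)
  interpret cring R by fact
  show ?case unfolding ideal_power_Suc[OF assms(1,2)] by (simp add: ideal_prod.prod[OF Suc assms(3)])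
qed

text \<open>For \<open>\<aa> = \<bb> + (x)\<close> the lift factors through the cones of \<open>x\<^sup>n\<close> on resolutions \<open>P\<close>, \<open>Q\<close> of
  \<open>R/\<bb>\<^sup>m\<close>, \<open>R/\<bb>\<^sup>n\<close>: the components \<open>\<gamma>\<close>, \<open>G1\<close>, \<open>G2\<close> below form a chain map into the first cone, which
  exists although that cone has homology in degree one because \<open>(\<bb>\<^sup>m : x\<^sup>k)\<close> is stationary in \<open>k\<close>;
  \<open>\<eta>\<close> and the null homotopy \<open>h\<close> of \<open>x\<^sup>n\<eta>\<close> form a chain map out of the second.\<close>

lemma bounded_lift:
  fixes R :: "('a, 'r) ring_scheme" (structure)
  assumes R: "cring R" and NR: "noetherian_ring R"
  shows "(\<And>i. i < r ==> g i \<in> carrier R) ==> \<exists>m\<ge>n. \<forall>p d e p' d' e'.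
    fres R (ideal_power R (gen_ideal R g r) m) p d e \<longrightarrow>
    fres R (ideal_power R (gen_ideal R g r) n) p' d' e' \<longrightarrow>
    (\<exists>\<phi>. clift R p d e p' d' e' (ideal_power R (gen_ideal R g r) n) \<phi> \<and>
      (\<forall>i>r. \<forall>x\<in>carrier (FM R (p i)). \<phi> i x = \<zero>\<^bsub>FM R (p' i)\<^esub>))"
proof (induction r arbitrary: n)
  case 0
  interpret cring R by (rule R)
  note Fmod = module_free[OF R] and Rmod = module_ring_as_module[OF R]
  let ?J = "ideal_power R (gen_ideal R g 0)"
  \<comment> \<open>A positive power, since the zeroth power of the zero ideal is \<open>R\<close>.
    Then \<open>e d\<close> is exactly zero and a map concentrated in degree zero is a chain
    map.\<close>
  let ?m = "Suc n"
  have z: "ideal {\<zero>} R" by (rule zeroideal)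
  have "?J ?m \<subseteq> ?J (Suc 0)" using ideal_power_antimono[OF R z, of "Suc 0" ?m] by (simp add: gen_ideal_0)
  then have Jm: "?J ?m \<subseteq> {\<zero>}" using ideal_power_1[OF R z] by (simp add: gen_ideal_0)
  have Jn: "ideal (?J n) R" using ideal_power_ideal[OF R z] by (simp add: gen_ideal_0)
  show ?case
  proof (intro exI[of _ ?m] conjI allI impI)
    fix p d e p' d' e' assume P: "fres R (?J ?m) p d e" and Q: "fres R (?J n) p' d' e'"
    obtain u where u: "u \<in> carrier (FM R (p' 0))" "e' u \<ominus> \<one> \<in> ?J n" using fresD(3)[OF Q] by blast
    define \<phi> where "\<phi> i = (\<lambda>x. if i = 0 then e x \<odot>\<^bsub>FM R (p' 0)\<^esub> u else \<zero>\<^bsub>FM R (p' i)\<^esub>)" for i :: nat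
    have \<phi>0: "\<phi> 0 = (\<lambda>x. e x \<odot>\<^bsub>FM R (p' 0)\<^esub> u)" and \<phi>S: "\<phi> (Suc i) = (\<lambda>x. \<zero>\<^bsub>FM R (p' (Suc i))\<^esub>)" for i
      by (simp_all add: \<phi>_def)
    have "lin R (FM R (p i)) (FM R (p' i)) (\<phi> i)" for i
      by (cases i) (simp_all add: \<phi>0 \<phi>S lin_scale_elt[OF Fmod fresD(2)[OF P] u(1)] lin_const_zero[OF Fmod])
    moreover have "d' i (\<phi> (Suc i) x) = \<phi> i (d i x)" if x: "x \<in> carrier (FM R (p (Suc i)))" for i x
    proof (cases i)
      case 0
      have "e (d 0 x) = \<zero>" using fresD(5)[OF P] x 0 Jm by blast
      then show ?thesis using 0 lin_zero[OF Fmod Fmod fresD(1)[OF Q]] module.smult_l_null[OF Fmod u(1)] by (simp add: \<phi>0 \<phi>S)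
    next
      case (Suc j)
      then show ?thesis using lin_zero[OF Fmod Fmod fresD(1)[OF Q]] by (simp add: \<phi>S)
    qed
    moreover have "e' (\<phi> 0 x) \<ominus> e x \<in> ?J n" if "x \<in> carrier (FM R (p 0))" for x
      using fres_unit_smult[OF R Q Jn u] lin_closed[OF fresD(2)[OF P] that] by (simp add: \<phi>0)
    ultimately have "clift R p d e p' d' e' (?J n) \<phi>" unfolding clift_def cmap_def by blast
    then show "\<exists>\<phi>. clift R p d e p' d' e' (?J n) \<phi> \<and>
      (\<forall>i>0. \<forall>x\<in>carrier (FM R (p i)). \<phi> i x = \<zero>\<^bsub>FM R (p' i)\<^esub>)"
      by (intro exI[of _ \<phi>]) (auto simp: \<phi>_def)
  qed simp
next
  case (Suc r)
  interpret cring R by (rule R)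
  note Fmod = module_free[OF R] and Rmod = module_ring_as_module[OF R]
  let ?F = "FM R"
  let ?b = "gen_ideal R g r" and ?a = "gen_ideal R g (Suc r)" and ?x = "g r"
  have gc: "\<And>i. i < r ==> g i \<in> carrier R" and xc: "?x \<in> carrier R" using Suc.prems by auto
  have b: "ideal ?b R" and a: "ideal ?a R" using gen_ideal_ideal[OF R] Suc.prems by simp_all
  have ba: "?b \<subseteq> ?a" and xa: "?x \<in> ?a" using gen_ideal_mono[OF R Suc.prems] by auto
  note bI = ideal_power_ideal[OF R b] and aI = ideal_power_ideal[OF R a]
  obtain m where mn: "m \<ge> n" and IH: "\<And>p d e p' d' e'.
    fres R (ideal_power R ?b m) p d e ==> fres R (ideal_power R ?b n) p' d' e' ==>
    \<exists>\<phi>. clift R p d e p' d' e' (ideal_power R ?b n) \<phi> \<and>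
      (\<forall>i>r. \<forall>x\<in>carrier (?F (p i)). \<phi> i x = \<zero>\<^bsub>?F (p' i)\<^esub>)" using Suc.IH[OF gc, of n] by blast
  let ?bm = "ideal_power R ?b m"
  interpret bm: ideal ?bm R by (rule bI)
  have bms: "submodule ?bm R (RM R)" using ideal_iff_submodule[OF R] bI by blast
  have ans: "submodule (ideal_power R ?a n) R (RM R)" using ideal_iff_submodule[OF R] aI by blast
  \<comment> \<open>The ascending chain \<open>(\<bb>^m : x^k)\<close>, where \<open>\<bb>\<close>
    stands for the ideal \<open>?b\<close> of the first \<open>r\<close> generators.\<close>
  let ?V = "\<lambda>k::nat. {y \<in> carrier R. ?x [^] k \<otimes> y \<in> ?bm}"
  have V: "submodule (?V k) R (RM R)" for k
    using submodule_kernel[OF Rmod Rmod lin_scale[OF Rmod lin_ident] module.carrier_is_submodule[OF Rmod] bms, of "?x [^] k"] xc by simp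
  have Vs: "?V k \<subseteq> ?V (Suc k)" for k
  proof
    fix y assume y: "y \<in> ?V k"
    have "?x [^] Suc k \<otimes> y = ?x \<otimes> (?x [^] k \<otimes> y)" using y xc by (simp add: m_ac)
    then show "y \<in> ?V (Suc k)" using y bm.I_l_closed[OF _ xc] by simp
  qed
  have "\<exists>W\<in>range ?V. \<forall>V\<in>range ?V. W \<subseteq> V \<longrightarrow> V = W"
    by (rule noeth_max[OF fin_gen_noeth[OF R NR fin_gen_ring[OF R]], of _ "?V 0"]) (use V in blast)+
  then obtain k0 where "\<forall>V\<in>range ?V. ?V k0 \<subseteq> V \<longrightarrow> V = ?V k0" by auto
  then have k0: "?V (Suc k0) = ?V k0" using Vs[of k0] by blast
  have stab: "?V (k0 + j) \<subseteq> ?V k0" for j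
  proof (induction j)
    case (Suc j)
    show ?case
    proof
      fix y assume y: "y \<in> ?V (k0 + Suc j)"
      have "?x [^] (k0 + Suc j) \<otimes> y = ?x [^] (k0 + j) \<otimes> (?x \<otimes> y)" using y xc by (simp add: m_ac)
      then have "?x \<otimes> y \<in> ?V (k0 + j)" using y xc by simp
      then have "?x [^] k0 \<otimes> (?x \<otimes> y) \<in> ?bm" using Suc by blast
      then have "y \<in> ?V (Suc k0)" using y xc by (simp add: m_ac)
      then show "y \<in> ?V k0" using k0 by blast
    qed
  qed simp
  \<comment> \<open>\<open>n\<close> factors \<open>x\<close> form the multiplication whose cones
    are used, and \<open>k0\<close> further ones reach the stationary part of the chain.
    \<open>?M\<close> is the exponent for which \<open>ideal_power_add\<close> yields elements of
    \<open>?bm\<close> plus multiples of \<open>?x [^] ?K\<close>.\<close>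
  let ?K = "n + k0"
  let ?M = "m + ?K"
  let ?xn = "?x [^] n"
  have xnc: "?xn \<in> carrier R" using xc by simp
  have xK: "?x [^] ?K = ?xn \<otimes> ?x [^] k0" using xc by (simp add: nat_pow_mult)
  have aM: "\<exists>v\<in>?bm. \<exists>t\<in>carrier R. y = v \<oplus> ?x [^] ?K \<otimes> t" if "y \<in> ideal_power R ?a ?M" for y
    by (rule ideal_power_add[OF R a b xc gen_ideal_Suc[OF R, where g=g and k=r, OF xc] that])
  have xna: "?xn \<in> ideal_power R ?a n" by (rule elem_power_in_ideal_power[OF R a xa])
  have bna: "ideal_power R ?b n \<subseteq> ideal_power R ?a n" by (rule ideal_power_mono[OF R b a ba])
  have bmn: "?bm \<subseteq> ideal_power R ?b n" by (rule ideal_power_antimono[OF R b mn])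
  obtain pP dP eP where P: "fres R ?bm pP dP eP" using fres_exists[OF R NR bI] by blast
  obtain pQ dQ eQ where Q: "fres R (ideal_power R ?b n) pQ dQ eQ" using fres_exists[OF R NR bI] by blast
  obtain \<beta> where \<beta>: "clift R pP dP eP pQ dQ eQ (ideal_power R ?b n) \<beta>"
    and \<beta>z: "\<And>i x. i > r ==> x \<in> carrier (?F (pP i)) ==> \<beta> i x = \<zero>\<^bsub>?F (pQ i)\<^esub>" using IH[OF P Q] by blast
  have \<beta>l: "lin R (?F (pP i)) (?F (pQ i)) (\<beta> i)"
    and \<beta>d: "x \<in> carrier (?F (pP (Suc i))) ==> dQ i (\<beta> (Suc i) x) = \<beta> i (dP i x)"
    and \<beta>e: "y \<in> carrier (?F (pP 0)) ==> eQ (\<beta> 0 y) \<ominus> eP y \<in> ideal_power R ?b n" for i x y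
    using \<beta> by (auto simp: clift_def cmap_def)
  note P' = fresD[OF P] and Q' = fresD[OF Q]
  obtain uP where u: "uP \<in> carrier (?F (pP 0))" "eP uP \<ominus> \<one> \<in> ?bm" using P'(3) by blast
  show ?case
  proof (intro exI[of _ ?M] conjI allI impI)
    show "n \<le> ?M" by simp
    fix p d e p' d' e' assume G: "fres R (ideal_power R ?a ?M) p d e" and H: "fres R (ideal_power R ?a n) p' d' e'"
    note G' = fresD[OF G] and H' = fresD[OF H]
    obtain \<eta> where \<eta>: "clift R pQ dQ eQ p' d' e' (ideal_power R ?a n) \<eta>" using fres_clift[OF R Q H bna aI] by blast
    have \<eta>l: "lin R (?F (pQ i)) (?F (p' i)) (\<eta> i)"
      and \<eta>d: "x \<in> carrier (?F (pQ (Suc i))) ==> d' i (\<eta> (Suc i) x) = \<eta> i (dQ i x)"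
      and \<eta>e: "y \<in> carrier (?F (pQ 0)) ==> e' (\<eta> 0 y) \<ominus> eQ y \<in> ideal_power R ?a n" for i x y
      using \<eta> by (auto simp: clift_def cmap_def)
    let ?x\<eta> = "\<lambda>i y. ?xn \<odot>\<^bsub>?F (p' i)\<^esub> \<eta> i y"
    have x\<eta>: "cmap R pQ dQ p' d' ?x\<eta>"
      unfolding cmap_def using lin_scale[OF Fmod \<eta>l xnc] lin_smult[OF H'(1) xnc lin_closed[OF \<eta>l]] \<eta>d by auto
    have "e' (?x\<eta> 0 y) \<in> ideal_power R ?a n" if y: "y \<in> carrier (?F (pQ 0))" for y
      using lin_smult[OF H'(2) xnc lin_closed[OF \<eta>l y]] ideal.I_r_closed[OF aI xna] lin_closed[OF H'(2) lin_closed[OF \<eta>l y]] by simp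
    from null_homotopy[OF R Q'(1,7) H x\<eta> this]
    obtain h where h: "\<And>i. lin R (?F (pQ i)) (?F (p' (Suc i))) (h i)"
      "\<And>x. x \<in> carrier (?F (pQ 0)) ==> ?x\<eta> 0 x = d' 0 (h 0 x)"
      "\<And>i x. x \<in> carrier (?F (pQ (Suc i))) ==>
        ?x\<eta> (Suc i) x = d' (Suc i) (h (Suc i) x) \<oplus>\<^bsub>?F (p' (Suc i))\<^esub> h i (dQ i x)" by blast
    obtain \<gamma> where \<gamma>: "lin R (?F (p 0)) (?F (pP 0)) \<gamma>" "\<And>y. y \<in> carrier (?F (p 0)) ==> eP (\<gamma> y) \<ominus> e y \<in> ?bm"
      using fres_aug_lift[OF R P bI G'(2)] by blast
    have \<gamma>d: "lin R (?F (p (Suc 0))) (?F (pP 0)) (\<lambda>y. \<gamma> (d 0 y))" by (rule lin_comp[OF G'(1) \<gamma>(1)])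
    have ex_t: "\<exists>t\<in>carrier R. eP (\<gamma> (d 0 y)) \<ominus> ?x [^] ?K \<otimes> t \<in> ?bm" if y: "y \<in> carrier (?F (p (Suc 0)))" for y
    proof -
      obtain v t where vt: "v \<in> ?bm" "t \<in> carrier R" "e (d 0 y) = v \<oplus> ?x [^] ?K \<otimes> t"
        using aM[OF G'(5)[OF y]] by blast
      have c: "eP (\<gamma> (d 0 y)) \<in> carrier R" "e (d 0 y) \<in> carrier R" "v \<in> carrier R" "?x [^] ?K \<otimes> t \<in> carrier R"
        using lin_closed[OF P'(2) lin_closed[OF \<gamma>d y]] lin_closed[OF G'(2) lin_closed[OF G'(1) y]] vt bm.Icarr xc by auto
      have "e (d 0 y) \<ominus> ?x [^] ?K \<otimes> t = v"
        using mod_cancel(4)[OF Rmod, of v "?x [^] ?K \<otimes> t"] vt(3) c by simp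
      then show ?thesis
        using mod_trans[OF Rmod bms, of "eP (\<gamma> (d 0 y))" "e (d 0 y)" "?x [^] ?K \<otimes> t"] c vt
          \<gamma>(2)[OF lin_closed[OF G'(1) y]] by auto
    qed
    have xKc: "?x [^] ?K \<in> carrier R" using xc by simp
    \<comment> \<open>The cofactor of \<open>?x [^] ?K\<close> is chosen linearly, which is possible
      because the source is free.\<close>
    obtain t where t: "lin R (?F (p (Suc 0))) (RM R) t"
      "\<And>y. y \<in> carrier (?F (p (Suc 0))) ==> eP (\<gamma> (d 0 y)) \<ominus> ?x [^] ?K \<otimes> t y \<in> ?bm"
      using lin_lift[OF Rmod Rmod lin_scale[OF Rmod lin_ident xKc] lin_comp[OF \<gamma>d P'(2)] bms module.carrier_is_submodule[OF Rmod], unfolded ring_as_module_simps a_minus_ring_as_module]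
        ex_t by metis
    have tc: "t y \<in> carrier R" if "y \<in> carrier (?F (p (Suc 0)))" for y using lin_closed[OF t(1) that] by simp
    \<comment> \<open>Of the factor \<open>?x [^] ?K\<close>, the part with exponent
      \<open>k0\<close> stays inside \<open>?T\<close>, where it makes \<open>?T\<close> of a
      boundary a boundary; the part with exponent \<open>n\<close> stays outside, as the map whose
      cone is formed.\<close>
    let ?T = "\<lambda>y. (?x [^] k0 \<otimes> t y) \<odot>\<^bsub>?F (pP 0)\<^esub> uP"
    have "lin R (?F (p (Suc 0))) (RM R) (\<lambda>y. ?x [^] k0 \<otimes> t y)"
      using lin_scale[OF Rmod t(1), of "?x [^] k0"] xc by simp
    then have T: "lin R (?F (p (Suc 0))) (?F (pP 0)) ?T" by (rule lin_scale_elt[OF Fmod _ u(1)])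
    have eT: "eP (?T y) \<ominus> ?x [^] k0 \<otimes> t y \<in> ?bm" if y: "y \<in> carrier (?F (p (Suc 0)))" for y
      by (rule fres_unit_smult[OF R P bI u]) (use tc[OF y] xc in simp)
    let ?f = "\<lambda>y. \<gamma> (d 0 y) \<ominus>\<^bsub>?F (pP 0)\<^esub> ?xn \<odot>\<^bsub>?F (pP 0)\<^esub> ?T y"
    have xT: "lin R (?F (p (Suc 0))) (?F (pP 0)) (\<lambda>y. ?xn \<odot>\<^bsub>?F (pP 0)\<^esub> ?T y)" by (rule lin_scale[OF Fmod T xnc])
    have f: "lin R (?F (p (Suc 0))) (?F (pP 0)) ?f" by (rule lin_diff[OF Fmod \<gamma>d xT])
    have "\<exists>s\<in>carrier (?F (pP (Suc 0))). ?f y = dP 0 s" if y: "y \<in> carrier (?F (p (Suc 0)))" for y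
    proof (rule P'(4)[OF lin_closed[OF f y]])
      have c: "eP (\<gamma> (d 0 y)) \<in> carrier R" "eP (?T y) \<in> carrier R" "?x [^] k0 \<otimes> t y \<in> carrier R"
        using lin_closed[OF P'(2) lin_closed[OF \<gamma>d y]] lin_closed[OF P'(2) lin_closed[OF T y]] tc[OF y] xc by auto
      have "?xn \<otimes> (eP (?T y) \<ominus> ?x [^] k0 \<otimes> t y) \<in> ?bm" by (rule bm.I_l_closed[OF eT[OF y] xnc])
      also have "?xn \<otimes> (eP (?T y) \<ominus> ?x [^] k0 \<otimes> t y) = ?xn \<otimes> eP (?T y) \<ominus> ?x [^] ?K \<otimes> t y"
        unfolding xK using c tc[OF y] xc by (simp add: a_minus_def r_distr r_minus m_assoc)
      finally have "?x [^] ?K \<otimes> t y \<ominus> ?xn \<otimes> eP (?T y) \<in> ?bm"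
        using mod_sym[OF Rmod bms, of "?xn \<otimes> eP (?T y)" "?x [^] ?K \<otimes> t y"] c tc[OF y] xc by simp
      then have "eP (\<gamma> (d 0 y)) \<ominus> ?xn \<otimes> eP (?T y) \<in> ?bm"
        using mod_trans[OF Rmod bms, of "eP (\<gamma> (d 0 y))" "?x [^] ?K \<otimes> t y" "?xn \<otimes> eP (?T y)"] t(2)[OF y] c tc[OF y] xc by simp
      then show "eP (?f y) \<in> ?bm"
        using lin_minus[OF Fmod Rmod P'(2) lin_closed[OF \<gamma>d y] lin_closed[OF xT y]] lin_smult[OF P'(2) xnc lin_closed[OF T y]] by simp
    qed
    then obtain s where s: "lin R (?F (p (Suc 0))) (?F (pP (Suc 0))) s" "\<And>y. y \<in> carrier (?F (p (Suc 0))) ==> ?f y = dP 0 (s y)"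
      using lin_lift_eq[OF R Fmod Fmod P'(1) f] by blast
    have s0: "\<gamma> (d 0 y) = dP 0 (s y) \<oplus>\<^bsub>?F (pP 0)\<^esub> ?xn \<odot>\<^bsub>?F (pP 0)\<^esub> ?T y" if y: "y \<in> carrier (?F (p (Suc 0)))" for y
      using s(2)[OF y] mod_cancel(1)[OF Fmod lin_closed[OF \<gamma>d y] lin_closed[OF xT y]] by simp
    \<comment> \<open>\<open>G1\<close> and \<open>G2\<close> are the components in the cone, with
      values in degrees \<open>j + 1\<close> and \<open>j\<close> of the resolution of
      \<open>R/\<bb>^m\<close>. \<open>PP\<close> holds the conditions for continuing,
      \<open>QQ\<close> the chain map equations; the minus sign is that of the cone
      differential.\<close>
    define PP where "PP j = (\<lambda>(G1, G2). lin R (?F (p (Suc j))) (?F (pP (Suc j))) G1 \<and> lin R (?F (p (Suc j))) (?F (pP j)) G2 \<and>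
      (j = 0 \<longrightarrow> (\<forall>y\<in>carrier (?F (p (Suc 0))). \<gamma> (d 0 y) = dP 0 (G1 y) \<oplus>\<^bsub>?F (pP 0)\<^esub> ?xn \<odot>\<^bsub>?F (pP 0)\<^esub> G2 y)) \<and>
      (\<forall>y\<in>carrier (?F (p (Suc (Suc j)))). (\<exists>z\<in>carrier (?F (pP (Suc j))). G2 (d (Suc j) y) = dP j z) \<and>
        dP j (G1 (d (Suc j) y)) \<oplus>\<^bsub>?F (pP j)\<^esub> ?xn \<odot>\<^bsub>?F (pP j)\<^esub> G2 (d (Suc j) y) = \<zero>\<^bsub>?F (pP j)\<^esub>))" for j
    define QQ where "QQ j = (\<lambda>(G1, G2) (G1', G2'). \<forall>y\<in>carrier (?F (p (Suc (Suc j)))).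
        G2 (d (Suc j) y) = \<ominus>\<^bsub>?F (pP j)\<^esub> dP j (G2' y) \<and>
        G1 (d (Suc j) y) = dP (Suc j) (G1' y) \<oplus>\<^bsub>?F (pP (Suc j))\<^esub> ?xn \<odot>\<^bsub>?F (pP (Suc j))\<^esub> G2' y)"
      for j :: nat
    have "\<exists>GG. \<forall>j. PP j (GG j) \<and> QQ j (GG j) (GG (Suc j))"
    proof (rule dependent_nat_choice)
      have "(\<exists>z\<in>carrier (?F (pP (Suc 0))). ?T (d (Suc 0) y) = dP 0 z) \<and>
        dP 0 (s (d (Suc 0) y)) \<oplus>\<^bsub>?F (pP 0)\<^esub> ?xn \<odot>\<^bsub>?F (pP 0)\<^esub> ?T (d (Suc 0) y) = \<zero>\<^bsub>?F (pP 0)\<^esub>"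
        if y: "y \<in> carrier (?F (p (Suc (Suc 0))))" for y
      proof
        let ?y = "d (Suc 0) y"
        have dy: "?y \<in> carrier (?F (p (Suc 0)))" by (rule lin_closed[OF G'(1) y])
        have "\<gamma> (d 0 ?y) = \<zero>\<^bsub>?F (pP 0)\<^esub>" using G'(7)[OF y] lin_zero[OF Fmod Fmod \<gamma>(1)] by simp
        then show z: "dP 0 (s ?y) \<oplus>\<^bsub>?F (pP 0)\<^esub> ?xn \<odot>\<^bsub>?F (pP 0)\<^esub> ?T ?y = \<zero>\<^bsub>?F (pP 0)\<^esub>" using s0[OF dy] by simp
        have "eP (\<gamma> (d 0 ?y)) = \<zero>" using \<open>\<gamma> (d 0 ?y) = _\<close> lin_zero[OF Fmod Rmod P'(2)] by simp
        then have "?x [^] ?K \<otimes> t ?y \<ominus> \<zero> \<in> ?bm"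
          using mod_sym[OF Rmod bms, of "\<zero>" "?x [^] ?K \<otimes> t ?y"] t(2)[OF dy] tc[OF dy] xc by simp
        then have "?x [^] ?K \<otimes> t ?y \<in> ?bm"
          using mod_mem[OF Rmod bms, of "?x [^] ?K \<otimes> t ?y" "\<zero>"] tc[OF dy] xc by simp
        \<comment> \<open>Stationarity enters here: \<open>x^(k0+n) t \<in> \<bb>^m\<close> already
          forces \<open>x^k0 t \<in> \<bb>^m\<close>.\<close>
        then have "t ?y \<in> ?V (k0 + n)" using tc[OF dy] by (simp add: add.commute)
        then have "?x [^] k0 \<otimes> t ?y \<in> ?bm" using stab by blast
        then have "eP (?T ?y) \<in> ?bm"
          using mod_mem[OF Rmod bms, of "eP (?T ?y)" "?x [^] k0 \<otimes> t ?y"] eT[OF dy] lin_closed[OF P'(2) lin_closed[OF T dy]] by simp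
        then show "\<exists>z\<in>carrier (?F (pP (Suc 0))). ?T ?y = dP 0 z" using P'(4) lin_closed[OF T dy] by blast
      qed
      then show "\<exists>x. PP 0 x" unfolding PP_def using s(1) T s0 by (intro exI[of _ "(s, ?T)"]) auto
    next
      fix GG j assume PP: "PP j GG"
      obtain G1 G2 where GG: "GG = (G1, G2)" by (cases GG)
      have G12: "lin R (?F (p (Suc j))) (?F (pP (Suc j))) G1" "lin R (?F (p (Suc j))) (?F (pP j)) G2"
        and ex: "\<And>y. y \<in> carrier (?F (p (Suc (Suc j)))) ==> \<exists>z\<in>carrier (?F (pP (Suc j))). G2 (d (Suc j) y) = dP j z"
        and eq: "\<And>y. y \<in> carrier (?F (p (Suc (Suc j)))) ==>
          dP j (G1 (d (Suc j) y)) \<oplus>\<^bsub>?F (pP j)\<^esub> ?xn \<odot>\<^bsub>?F (pP j)\<^esub> G2 (d (Suc j) y) = \<zero>\<^bsub>?F (pP j)\<^esub>"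
        using PP unfolding GG PP_def by auto
      interpret F1: module R "?F (pP j)" by (rule Fmod)
      interpret F2: module R "?F (pP (Suc j))" by (rule Fmod)
      note G1d = lin_comp[OF G'(1)[of "Suc j"] G12(1)] and G2d = lin_comp[OF G'(1)[of "Suc j"] G12(2)]
      obtain Z where Z: "lin R (?F (p (Suc (Suc j)))) (?F (pP (Suc j))) Z"
        "\<And>y. y \<in> carrier (?F (p (Suc (Suc j)))) ==> G2 (d (Suc j) y) = dP j (Z y)"
        using lin_lift_eq[OF R Fmod Fmod P'(1) G2d] ex by blast
      \<comment> \<open>Negated to meet the sign in the differential of the cone.\<close>
      define G2' where "G2' y = (\<ominus> \<one>) \<odot>\<^bsub>?F (pP (Suc j))\<^esub> Z y" for y
      have G2': "lin R (?F (p (Suc (Suc j)))) (?F (pP (Suc j))) G2'" unfolding G2'_def by (rule lin_scale[OF Fmod Z(1)]) simp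
      have G2'd: "G2 (d (Suc j) y) = \<ominus>\<^bsub>?F (pP j)\<^esub> dP j (G2' y)" if y: "y \<in> carrier (?F (p (Suc (Suc j))))" for y
        unfolding G2'_def using Z(2)[OF y] lin_smult[OF P'(1) _ lin_closed[OF Z(1) y], of "\<ominus> \<one>"] lin_closed[OF P'(1) lin_closed[OF Z(1) y]]
        by (simp add: F1.smult_l_minus)
      note xG2' = lin_scale[OF Fmod G2' xnc]
      let ?f = "\<lambda>y. G1 (d (Suc j) y) \<ominus>\<^bsub>?F (pP (Suc j))\<^esub> ?xn \<odot>\<^bsub>?F (pP (Suc j))\<^esub> G2' y"
      have f: "lin R (?F (p (Suc (Suc j)))) (?F (pP (Suc j))) ?f" by (rule lin_diff[OF Fmod G1d xG2'])
      have "\<exists>z\<in>carrier (?F (pP (Suc (Suc j)))). ?f y = dP (Suc j) z" if y: "y \<in> carrier (?F (p (Suc (Suc j))))" for y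
      proof (rule P'(6)[OF lin_closed[OF f y]])
        note c = lin_closed[OF P'(1) lin_closed[OF G2' y]]
        have "dP j (?f y) = dP j (G1 (d (Suc j) y)) \<ominus>\<^bsub>?F (pP j)\<^esub> ?xn \<odot>\<^bsub>?F (pP j)\<^esub> dP j (G2' y)"
          using lin_minus[OF Fmod Fmod P'(1) lin_closed[OF G1d y] lin_closed[OF xG2' y]] lin_smult[OF P'(1) xnc lin_closed[OF G2' y]] by simp
        also have "\<dots> = dP j (G1 (d (Suc j) y)) \<oplus>\<^bsub>?F (pP j)\<^esub> ?xn \<odot>\<^bsub>?F (pP j)\<^esub> G2 (d (Suc j) y)"
          unfolding G2'd[OF y] a_minus_def using c xnc by (simp add: F1.smult_r_minus)
        finally show "dP j (?f y) = \<zero>\<^bsub>?F (pP j)\<^esub>" using eq[OF y] by simp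
      qed
      then obtain G1' where G1': "lin R (?F (p (Suc (Suc j)))) (?F (pP (Suc (Suc j)))) G1'"
        "\<And>y. y \<in> carrier (?F (p (Suc (Suc j)))) ==> ?f y = dP (Suc j) (G1' y)"
        using lin_lift_eq[OF R Fmod Fmod P'(1) f] by blast
      have G1'd: "G1 (d (Suc j) y) = dP (Suc j) (G1' y) \<oplus>\<^bsub>?F (pP (Suc j))\<^esub> ?xn \<odot>\<^bsub>?F (pP (Suc j))\<^esub> G2' y"
        if y: "y \<in> carrier (?F (p (Suc (Suc j))))" for y
        using G1'(2)[OF y] mod_cancel(1)[OF Fmod lin_closed[OF G1d y] lin_closed[OF xG2' y]] by simp
      have "(\<exists>z\<in>carrier (?F (pP (Suc (Suc j)))). G2' (d (Suc (Suc j)) y) = dP (Suc j) z) \<and>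
        dP (Suc j) (G1' (d (Suc (Suc j)) y)) \<oplus>\<^bsub>?F (pP (Suc j))\<^esub> ?xn \<odot>\<^bsub>?F (pP (Suc j))\<^esub> G2' (d (Suc (Suc j)) y) = \<zero>\<^bsub>?F (pP (Suc j))\<^esub>"
        if y: "y \<in> carrier (?F (p (Suc (Suc (Suc j)))))" for y
      proof
        note dy = lin_closed[OF G'(1) y]
        note c = lin_closed[OF P'(1) lin_closed[OF G2' dy]]
        show "dP (Suc j) (G1' (d (Suc (Suc j)) y)) \<oplus>\<^bsub>?F (pP (Suc j))\<^esub> ?xn \<odot>\<^bsub>?F (pP (Suc j))\<^esub> G2' (d (Suc (Suc j)) y) = \<zero>\<^bsub>?F (pP (Suc j))\<^esub>"
          using G1'd[OF dy] G'(7)[OF y] lin_zero[OF Fmod Fmod G12(1)] by simp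
        have "\<ominus>\<^bsub>?F (pP j)\<^esub> dP j (G2' (d (Suc (Suc j)) y)) = \<zero>\<^bsub>?F (pP j)\<^esub>"
          using G2'd[OF dy] G'(7)[OF y] lin_zero[OF Fmod Fmod G12(2)] by simp
        then have "dP j (G2' (d (Suc (Suc j)) y)) = \<zero>\<^bsub>?F (pP j)\<^esub>" using c
          by (metis F1.add.inv_eq_1_iff a_inv_def)
        then show "\<exists>z\<in>carrier (?F (pP (Suc (Suc j)))). G2' (d (Suc (Suc j)) y) = dP (Suc j) z"
          using P'(6) lin_closed[OF G2' dy] by blast
      qed
      then have "PP (Suc j) (G1', G2')" unfolding PP_def using G1'(1) G2' by simp
      moreover have "QQ j GG (G1', G2')" unfolding QQ_def GG using G1'd G2'd by simp
      ultimately show "\<exists>y. PP (Suc j) y \<and> QQ j GG y" by blast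
    qed
    then obtain GG where GG: "\<And>j. PP j (GG j)" "\<And>j. QQ j (GG j) (GG (Suc j))" by blast
    define G1 where "G1 j = fst (GG j)" for j
    define G2 where "G2 j = snd (GG j)" for j
    have GGe: "GG j = (G1 j, G2 j)" for j by (simp add: G1_def G2_def)
    have G1l: "lin R (?F (p (Suc j))) (?F (pP (Suc j))) (G1 j)" and G2l: "lin R (?F (p (Suc j))) (?F (pP j)) (G2 j)" for j
      using GG(1)[of j] unfolding GGe PP_def by auto
    have r0: "\<gamma> (d 0 y) = dP 0 (G1 0 y) \<oplus>\<^bsub>?F (pP 0)\<^esub> ?xn \<odot>\<^bsub>?F (pP 0)\<^esub> G2 0 y" if "y \<in> carrier (?F (p (Suc 0)))" for y
      using GG(1)[of 0] that unfolding GGe PP_def by auto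
    have r2: "G2 j (d (Suc j) y) = \<ominus>\<^bsub>?F (pP j)\<^esub> dP j (G2 (Suc j) y)"
      and r1: "G1 j (d (Suc j) y) = dP (Suc j) (G1 (Suc j) y) \<oplus>\<^bsub>?F (pP (Suc j))\<^esub> ?xn \<odot>\<^bsub>?F (pP (Suc j))\<^esub> G2 (Suc j) y"
      if "y \<in> carrier (?F (p (Suc (Suc j))))" for j y
      using GG(2)[of j] that unfolding GGe QQ_def by auto
    \<comment> \<open>The map into the first cone, followed by the map that \<open>\<beta>\<close>
      induces between the cones, followed by the map out of the second cone.\<close>
    define \<theta> where "\<theta> i = (case i of 0 \<Rightarrow> (\<lambda>y. \<eta> 0 (\<beta> 0 (\<gamma> y)))
      | Suc j \<Rightarrow> (\<lambda>y. \<eta> (Suc j) (\<beta> (Suc j) (G1 j y)) \<oplus>\<^bsub>?F (p' (Suc j))\<^esub> h j (\<beta> j (G2 j y))))" for i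
    have \<theta>0: "\<theta> 0 y = \<eta> 0 (\<beta> 0 (\<gamma> y))"
      and \<theta>S: "\<theta> (Suc j) y = \<eta> (Suc j) (\<beta> (Suc j) (G1 j y)) \<oplus>\<^bsub>?F (p' (Suc j))\<^esub> h j (\<beta> j (G2 j y))" for j y
      by (simp_all add: \<theta>_def)
    note \<eta>\<beta> = lin_comp[OF \<beta>l \<eta>l]
    note \<theta>1l = lin_comp[OF G1l \<eta>\<beta>] and \<theta>2l = lin_comp[OF G2l lin_comp[OF \<beta>l h(1)]]
    have \<theta>l: "lin R (?F (p i)) (?F (p' i)) (\<theta> i)" for i
    proof (cases i)
      case 0
      show ?thesis unfolding 0 \<theta>_def using lin_comp[OF \<gamma>(1) \<eta>\<beta>] by simp
    next
      case (Suc j)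
      show ?thesis unfolding Suc \<theta>_def using lin_plus[OF Fmod \<theta>1l \<theta>2l] by simp
    qed
    have \<theta>d: "d' i (\<theta> (Suc i) y) = \<theta> i (d i y)" if y: "y \<in> carrier (?F (p (Suc i)))" for i y
    proof -
      interpret F0: module R "?F (p' i)" by (rule Fmod)
      note g1 = lin_closed[OF G1l y] and g2 = lin_closed[OF G2l y]
      note bg1 = lin_closed[OF \<beta>l g1] and bg2 = lin_closed[OF \<beta>l g2]
      have "d' i (\<theta> (Suc i) y) = d' i (\<eta> (Suc i) (\<beta> (Suc i) (G1 i y))) \<oplus>\<^bsub>?F (p' i)\<^esub> d' i (h i (\<beta> i (G2 i y)))"
        unfolding \<theta>S by (rule lin_add[OF H'(1) lin_closed[OF \<theta>1l y] lin_closed[OF \<theta>2l y]])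
      also have "d' i (\<eta> (Suc i) (\<beta> (Suc i) (G1 i y))) = \<eta> i (\<beta> i (dP i (G1 i y)))"
        using \<eta>d[OF bg1] \<beta>d[OF g1] by simp
      finally have 1: "d' i (\<theta> (Suc i) y) = \<eta> i (\<beta> i (dP i (G1 i y))) \<oplus>\<^bsub>?F (p' i)\<^esub> d' i (h i (\<beta> i (G2 i y)))" .
      have xg2: "?xn \<odot>\<^bsub>?F (pP i)\<^esub> G2 i y \<in> carrier (?F (pP i))" by (rule lin_closed[OF lin_scale[OF Fmod G2l xnc] y])
      have 2: "\<eta> i (\<beta> i (dP i (G1 i y) \<oplus>\<^bsub>?F (pP i)\<^esub> ?xn \<odot>\<^bsub>?F (pP i)\<^esub> G2 i y)) =
          \<eta> i (\<beta> i (dP i (G1 i y))) \<oplus>\<^bsub>?F (p' i)\<^esub> ?x\<eta> i (\<beta> i (G2 i y))"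
        using lin_add[OF \<eta>\<beta> lin_closed[OF P'(1) g1] xg2] lin_smult[OF \<eta>\<beta> xnc g2] by simp
      show ?thesis
      proof (cases i)
        case 0
        show ?thesis using 1 2 r0[of y] y h(2)[of "\<beta> 0 (G2 0 y)"] bg2 unfolding 0 \<theta>0 by simp
      next
        case (Suc j)
        note y' = y[unfolded Suc]
        have bj: "dQ j (\<beta> (Suc j) (G2 (Suc j) y)) = \<beta> j (dP j (G2 (Suc j) y))" by (rule \<beta>d) (use g2 Suc in simp)
        have dg: "dP j (G2 (Suc j) y) \<in> carrier (?F (pP j))" by (rule lin_closed[OF P'(1)]) (use g2 Suc in simp)
        note hb = lin_comp[OF \<beta>l[of j] h(1)[of j]]
        \<comment> \<open>This term occurs once from the homotopy and once, with opposite sign, from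
          \<open>r2\<close>; the two cancel.\<close>
        let ?w = "h j (\<beta> j (dP j (G2 (Suc j) y)))"
        have w: "?w \<in> carrier (?F (p' i))" using lin_closed[OF hb dg] Suc by simp
        have A: "?x\<eta> i (\<beta> i (G2 i y)) = d' i (h i (\<beta> i (G2 i y))) \<oplus>\<^bsub>?F (p' i)\<^esub> ?w"
          using h(3)[of "\<beta> i (G2 i y)" j] bg2 bj unfolding Suc by simp
        have dh: "d' i (h i (\<beta> i (G2 i y))) \<in> carrier (?F (p' i))" by (rule lin_closed[OF H'(1) lin_closed[OF h(1) bg2]])
        have "\<theta> i (d i y) = \<eta> i (\<beta> i (G1 j (d i y))) \<oplus>\<^bsub>?F (p' i)\<^esub> h j (\<beta> j (G2 j (d i y)))" unfolding Suc \<theta>S by simp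
        also have "h j (\<beta> j (G2 j (d i y))) = \<ominus>\<^bsub>?F (p' i)\<^esub> ?w"
          unfolding Suc r2[OF y'] using lin_uminus[OF Fmod Fmod hb dg] by simp
        also have "\<eta> i (\<beta> i (G1 j (d i y))) = \<eta> i (\<beta> i (dP i (G1 i y))) \<oplus>\<^bsub>?F (p' i)\<^esub> ?x\<eta> i (\<beta> i (G2 i y))"
          using 2 r1[OF y'] unfolding Suc by simp
        finally have "\<theta> i (d i y) = (\<eta> i (\<beta> i (dP i (G1 i y))) \<oplus>\<^bsub>?F (p' i)\<^esub> (d' i (h i (\<beta> i (G2 i y))) \<oplus>\<^bsub>?F (p' i)\<^esub> ?w)) \<oplus>\<^bsub>?F (p' i)\<^esub> \<ominus>\<^bsub>?F (p' i)\<^esub> ?w"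
          unfolding A .
        also have "\<dots> = \<eta> i (\<beta> i (dP i (G1 i y))) \<oplus>\<^bsub>?F (p' i)\<^esub> d' i (h i (\<beta> i (G2 i y)))"
          using w dh lin_closed[OF \<eta>\<beta> lin_closed[OF P'(1) g1]] by (simp add: F0.a_assoc F0.r_neg)
        finally show ?thesis using 1 by simp
      qed
    qed
    have \<theta>e: "e' (\<theta> 0 y) \<ominus> e y \<in> ideal_power R ?a n" if y: "y \<in> carrier (?F (p 0))" for y
    proof -
      note gy = lin_closed[OF \<gamma>(1) y]
      note by' = lin_closed[OF \<beta>l gy]
      have c: "e y \<in> carrier R" "eP (\<gamma> y) \<in> carrier R" "eQ (\<beta> 0 (\<gamma> y)) \<in> carrier R" "e' (\<theta> 0 y) \<in> carrier R"
        using lin_closed[OF G'(2) y] lin_closed[OF P'(2) gy] lin_closed[OF Q'(2) by'] lin_closed[OF H'(2) lin_closed[OF \<theta>l y]] by auto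
      have 1: "eP (\<gamma> y) \<ominus> e y \<in> ideal_power R ?a n" using \<gamma>(2)[OF y] bmn bna by blast
      have 2: "eQ (\<beta> 0 (\<gamma> y)) \<ominus> eP (\<gamma> y) \<in> ideal_power R ?a n" using \<beta>e[OF gy] bna by blast
      have 3: "e' (\<theta> 0 y) \<ominus> eQ (\<beta> 0 (\<gamma> y)) \<in> ideal_power R ?a n" using \<eta>e[OF by'] by (simp add: \<theta>0)
      show ?thesis
        using mod_trans[OF Rmod ans, of "e' (\<theta> 0 y)" "eQ (\<beta> 0 (\<gamma> y))" "eP (\<gamma> y)"] 
          mod_trans[OF Rmod ans, of "e' (\<theta> 0 y)" "eP (\<gamma> y)" "e y"] 1 2 3 c by simp
    qed
    \<comment> \<open>Degree \<open>Suc j\<close> of \<open>\<theta>\<close> involves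
      \<open>\<beta>\<close> only in degrees \<open>Suc j\<close> and \<open>j\<close>, both above
      \<open>r\<close>. Thus each generator costs exactly one degree.\<close>
    have "\<theta> i y = \<zero>\<^bsub>?F (p' i)\<^esub>" if i: "i > Suc r" and y: "y \<in> carrier (?F (p i))" for i y
    proof -
      obtain j where j: "i = Suc j" "j > r" using i by (cases i) auto
      interpret F0: module R "?F (p' i)" by (rule Fmod)
      have "\<beta> (Suc j) (G1 j y) = \<zero>\<^bsub>?F (pQ (Suc j))\<^esub>" "\<beta> j (G2 j y) = \<zero>\<^bsub>?F (pQ j)\<^esub>"
        using \<beta>z lin_closed[OF G1l] lin_closed[OF G2l] y j by auto
      then show ?thesis unfolding j \<theta>S using lin_zero[OF Fmod Fmod \<eta>l] lin_zero[OF Fmod Fmod h(1)] F0.l_zero[OF F0.zero_closed] j by simp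
    qed
    then show "\<exists>\<phi>. clift R p d e p' d' e' (ideal_power R ?a n) \<phi> \<and>
      (\<forall>i>Suc r. \<forall>x\<in>carrier (?F (p i)). \<phi> i x = \<zero>\<^bsub>?F (p' i)\<^esub>)"
      using \<theta>l \<theta>d \<theta>e unfolding clift_def cmap_def by blast
  qed
qed

subsection \<open>Submodules of small cohomological dimension\<close>

lemma fres_system:
  assumes "cring R" "noetherian_ring R" "ideal \<aa> R"
  obtains P D E where "\<And>n. fres R (ideal_power R \<aa> n) (P n) (D n) (E n)"
proof -
  have "\<forall>n. \<exists>s. fres R (ideal_power R \<aa> n) (fst s) (fst (snd s)) (snd (snd s))"
    using fres_exists[OF assms(1,2) ideal_power_ideal[OF assms(1,3)]] by (metis fst_conv snd_conv)
  from choice[OF this] obtain s where "\<And>n. fres R (ideal_power R \<aa> n) (fst (s n)) (fst (snd (s n))) (snd (snd (s n)))" by blast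
  then show ?thesis using that[of "\<lambda>n. fst (s n)" "\<lambda>n. fst (snd (s n))" "\<lambda>n. snd (snd (s n))"] by simp
qed

text \<open>Along the lift of bounded length every cochain of degree above \<open>r\<close> pulls
  back to zero.\<close>

lemma vanish_bounded:
  assumes "noetherian_ring R" "ideal \<aa> R" "generates R (RM R) \<aa> r g"
    "module R X" "submodule N R X" "submodule L R X" "L \<subseteq> N" "k > r"
  shows "vanish R \<aa> X N L k"
proof -
  interpret module R X by fact
  note R = is_cring
  have \<aa>: "\<aa> = gen_ideal R g r" by (rule generates_gen_ideal[OF R assms(2,3)])
  have gc: "\<And>i. i < r ==> g i \<in> carrier R" using assms(3) ideal.Icarr[OF assms(2)] by (auto simp: generates_def)
  obtain P D E where S: "\<And>n. fres R (ideal_power R \<aa> n) (P n) (D n) (E n)" using fres_system[OF R assms(1,2)] by blast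
  show ?thesis
  proof (rule vanishI[OF assms(4-7,2) S])
    fix n f assume f: "relcoc R (P n) (D n) X N L k f"
    obtain m \<phi> where m: "m \<ge> n" "clift R (P m) (D m) (E m) (P n) (D n) (E n) (ideal_power R \<aa> n) \<phi>"
      "\<And>i x. i > r ==> x \<in> carrier (FM R (P m i)) ==> \<phi> i x = \<zero>\<^bsub>FM R (P n i)\<^esub>"
      using bounded_lift[OF R assms(1), where r=r and g=g and n=n, OF gc] S unfolding \<aa> by (metis (no_types, lifting))
    have "f (\<phi> k x) = \<zero>\<^bsub>X\<^esub>" if "x \<in> carrier (FM R (P m k))" for x
      using m(3)[OF assms(8) that] f lin_zero[OF module_free[OF R] assms(4)] by (auto simp: relcoc_def)
    moreover obtain j where "k = Suc j" using assms(8) by (cases k) auto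
    ultimately have "relcob R (P m) (D m) X N L k (\<lambda>x. f (\<phi> k x))"
      unfolding relcob_def using lin_const_zero[OF assms(4)] sub_zero[OF assms(5)] mod_refl[OF assms(4,6) M.zero_closed]
      by (auto intro!: exI[of _ "\<lambda>_. \<zero>\<^bsub>X\<^esub>"])
    then show "\<exists>m\<ge>n. \<exists>\<phi>. clift R (P m) (D m) (E m) (P n) (D n) (E n) (ideal_power R \<aa> n) \<phi> \<and>
        relcob R (P m) (D m) X N L k (\<lambda>x. f (\<phi> k x))" using m(1,2) by blast
  qed
qed

lemma lin_cong:
  assumes "module R M" "lin R M N f" "\<And>x. x \<in> carrier M ==> f x = g x"
  shows "lin R M N g"
proof -
  interpret module R M by fact
  show ?thesis using assms(2,3) unfolding lin_def by simp
qed

lemma lin_lincomb_vec: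
  assumes "module R M" "module R X" "\<And>l. l < k ==> lin R M X (w l)" "\<And>l. l < k ==> c l \<in> carrier R"
  shows "lin R M X (\<lambda>x. lincomb X (\<lambda>l. w l x) c k)"
  using assms(3,4)
proof (induction k)
  case 0
  then show ?case by (simp add: lin_const_zero[OF assms(2)])
next
  case (Suc k)
  have "lin R M X (\<lambda>x. lincomb X (\<lambda>l. w l x) c k)" using Suc by simp
  moreover have "lin R M X (\<lambda>x. c k \<odot>\<^bsub>X\<^esub> w k x)" by (rule lin_scale[OF assms(2)]) (use Suc.prems in auto)
  ultimately show ?case using lin_plus[OF assms(2)] by fastforce
qed

lemma lincomb_mod:
  fixes X (structure)
  assumes "module R X" "submodule L R X" "\<And>l. l < k ==> a l \<in> carrier X" "\<And>l. l < k ==> b l \<in> carrier X"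
    "\<And>l. l < k ==> a l \<ominus> b l \<in> L" "\<And>l. l < k ==> c l \<in> carrier R"
  shows "lincomb X a c k \<ominus> lincomb X b c k \<in> L"
  using assms(3-)
proof (induction k)
  case 0
  interpret module R X by fact
  show ?case using mod_refl[OF assms(1,2)] by simp
next
  case (Suc k)
  interpret module R X by fact
  have "c k \<odot> a k \<ominus> c k \<odot> b k = c k \<odot> (a k \<ominus> b k)"
    using Suc.prems by (simp add: a_minus_def smult_r_distr smult_r_minus)
  then have "c k \<odot> a k \<ominus> c k \<odot> b k \<in> L" using sub_smult[OF assms(2)] Suc.prems by simp
  moreover have "lincomb X a c k \<ominus> lincomb X b c k \<in> L" using Suc by simp
  ultimately show ?case
    using mod_add[OF assms(1,2) lincomb_closed[OF assms(1), of k a c] lincomb_closed[OF assms(1), of k b c]] Suc.prems by simp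
qed

lemma lincomb_in_imul:
  "(\<And>i. i < k ==> c i \<in> I) ==> (\<And>i. i < k ==> g i \<in> N) ==> lincomb M g c k \<in> imul M I N"
  by (induction k) (auto intro: imul.intros)

section \<open>The dual of a resolution and the shortening of zigzags\<close>

lemma lincomb_swap:
  assumes "cring R" "\<And>i. i < k ==> l i \<in> carrier R" "\<And>i. i < k ==> x i \<in> carrier R"
  shows "lincomb (RM R) l x k = lincomb (RM R) x l k"
proof -
  interpret cring R by fact
  show ?thesis using assms(2,3) by (induction k) (auto simp: m_comm)
qed

text \<open>The transpose of \<open>d q\<close>. A functional on a free module is stored as its
  tuple of coordinates, with \<open>lincomb (RM R) l x\<close> as evaluation, and composition with
  \<open>d q\<close> is computed on these tuples.\<close>

definition codiff where
  "codiff R p d q l = (\<lambda>j\<in>{..<p (Suc q)}. lincomb (RM R) l (d q (basis R (p (Suc q)) j)) (p q))"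

lemma lin_pairing:
  assumes "cring R" "x \<in> carrier (FM R n)"
  shows "lin R (FM R n) (RM R) (\<lambda>l. lincomb (RM R) l x n)"
proof (rule lin_cong[OF module_free[OF assms(1)]])
  show "lin R (FM R n) (RM R) (\<lambda>l. lincomb (RM R) x l n)"
    by (rule lin_lincomb[OF module_ring_as_module[OF assms(1)]]) (use free_closed[OF assms(2)] in auto)
  show "lincomb (RM R) x l n = lincomb (RM R) l x n" if "l \<in> carrier (FM R n)" for l
    by (rule lincomb_swap[OF assms(1)]) (use free_closed[OF assms(2)] free_closed[OF that] in auto)
qed

context
  fixes R :: "('a, 'r) ring_scheme" (structure) and p d
  assumes R: "cring R" and d: "\<And>i. lin R (FM R (p (Suc i))) (FM R (p i)) (d i)"
begin

lemma lin_codiff: "lin R (FM R (p q)) (FM R (p (Suc q))) (codiff R p d q)"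
proof -
  have "lin R (FM R (p q)) (tup (RM R) (p (Suc q)))
      (\<lambda>l. \<lambda>j\<in>{..<p (Suc q)}. lincomb (RM R) l (d q (basis R (p (Suc q)) j)) (p q))"
    by (rule lin_into_tup[OF lin_pairing[OF R lin_closed[OF d basis_closed[OF R]]]])
  then show ?thesis by (simp add: codiff_def[abs_def] free_module_tup)
qed

lemma codiff_adjoint:
  assumes "l \<in> carrier (FM R (p q))" "x \<in> carrier (FM R (p (Suc q)))"
  shows "lincomb (RM R) (codiff R p d q l) x (p (Suc q)) = lincomb (RM R) l (d q x) (p q)"
proof -
  note Rmod = module_ring_as_module[OF R]
  have 0: "\<And>j. j < p (Suc q) ==> codiff R p d q l j \<in> carrier (RM R)"
    using free_closed[OF lin_closed[OF lin_codiff assms(1)]] by simp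
  have 1: "lin R (FM R (p (Suc q))) (RM R) (\<lambda>x. lincomb (RM R) (codiff R p d q l) x (p (Suc q)))"
    by (rule lin_lincomb[OF Rmod 0])
  have 2: "lin R (FM R (p (Suc q))) (RM R) (\<lambda>x. lincomb (RM R) l (d q x) (p q))"
    by (rule lin_comp[OF d lin_lincomb[OF Rmod]]) (use free_closed[OF assms(1)] in auto)
  show ?thesis
  proof (rule lin_eq_basis[OF Rmod 1 2 _ assms(2)])
    fix j assume j: "j < p (Suc q)"
    have "lincomb (RM R) (codiff R p d q l) (basis R (p (Suc q)) j) (p (Suc q)) = codiff R p d q l j"
      by (rule lincomb_basis[OF Rmod 0 j])
    also have "\<dots> = lincomb (RM R) l (d q (basis R (p (Suc q)) j)) (p q)" using j by (simp add: codiff_def)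
    finally show "lincomb (RM R) (codiff R p d q l) (basis R (p (Suc q)) j) (p (Suc q)) =
      lincomb (RM R) l (d q (basis R (p (Suc q)) j)) (p q)" .
  qed
qed

lemma codiff_codiff:
  assumes "\<And>i w. w \<in> carrier (FM R (p (Suc (Suc i)))) ==> d i (d (Suc i) w) = \<zero>\<^bsub>FM R (p i)\<^esub>"
    "l \<in> carrier (FM R (p q))"
  shows "codiff R p d (Suc q) (codiff R p d q l) = \<zero>\<^bsub>FM R (p (Suc (Suc q)))\<^esub>"
proof -
  note Rmod = module_ring_as_module[OF R]
  have z: "lincomb (RM R) l (\<zero>\<^bsub>FM R (p q)\<^esub>) (p q) = \<zero>"
    using lin_zero[OF module_free[OF R] Rmod lin_lincomb[OF Rmod], of "p q" l] free_closed[OF assms(2)] by simp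
  have "codiff R p d (Suc q) (codiff R p d q l) j = \<zero>" if "j < p (Suc (Suc q))" for j
    using codiff_adjoint[OF assms(2) lin_closed[OF d basis_closed[OF R]]] assms(1)[OF basis_closed[OF R]] z that
    by (simp add: codiff_def[of R p d "Suc q"])
  then show ?thesis
    using tup_eqI[of "codiff R p d (Suc q) (codiff R p d q l)" "RM R" "p (Suc (Suc q))" "\<zero>\<^bsub>FM R (p (Suc (Suc q)))\<^esub>"]
      lin_closed[OF lin_codiff lin_closed[OF lin_codiff assms(2)]] tup_closed(1)[OF Rmod, of "p (Suc (Suc q))"] tup_simps(2)[of _ "p (Suc (Suc q))" "RM R"]
    by (simp add: free_module_tup)
qed

end

text \<open>A chain map \<open>z\<close> from a resolution of \<open>R/\<aa>\<^sup>m\<close> to \<open>N \<otimes> F\<close>, \<open>F\<close> a resolution of \<open>R/\<aa>\<^sup>n\<close>, taken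
  modulo \<open>L\<close>: it vanishes above degree \<open>k\<close> and induces \<open>1 \<mapsto> y\<close> modulo \<open>\<aa>\<^sup>n\<close>. The
  argument \<open>l\<close> of \<open>z\<close> runs through the dual of \<open>F\<close>, which avoids the tensor product.\<close>

definition zigmap where
  "zigmap R \<aa> X N L n p d e y k m p' d' e' u z \<longleftrightarrow>
     fres R (ideal_power R \<aa> m) p' d' e' \<and>
     u \<in> carrier (FM R (p' 0)) \<and> e' u \<ominus>\<^bsub>R\<^esub> \<one>\<^bsub>R\<^esub> \<in> ideal_power R \<aa> m \<and>
     (\<forall>q. \<forall>l\<in>carrier (FM R (p q)). lin R (FM R (p' q)) X (z q l)) \<and>
     (\<forall>q. \<forall>x\<in>carrier (FM R (p' q)). lin R (FM R (p q)) X (\<lambda>l. z q l x)) \<and>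
     (\<forall>q. \<forall>l\<in>carrier (FM R (p q)). \<forall>x\<in>carrier (FM R (p' q)). z q l x \<in> N) \<and>
     (\<forall>q. \<forall>l\<in>carrier (FM R (p q)). \<forall>x\<in>carrier (FM R (p' (Suc q))).
        z q l (d' q x) \<ominus>\<^bsub>X\<^esub> z (Suc q) (codiff R p d q l) x \<in> L) \<and>
     (\<forall>q>k. \<forall>l\<in>carrier (FM R (p q)). \<forall>x\<in>carrier (FM R (p' q)). z q l x \<in> L) \<and>
     z 0 (\<lambda>j\<in>{..<p 0}. e (basis R (p 0) j)) u \<ominus>\<^bsub>X\<^esub> y
       \<in> {v \<oplus>\<^bsub>X\<^esub> w | v w. v \<in> imul X (ideal_power R \<aa> n) N \<and> w \<in> L}"

definition zigzag where
  "zigzag R \<aa> X N L n p d e y k m \<longleftrightarrow> (\<exists>p' d' e' u z. zigmap R \<aa> X N L n p d e y k m p' d' e' u z)"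

lemma zigmapD:
  assumes "zigmap R \<aa> X N L n p d e y k m p' d' e' u z"
  shows "fres R (ideal_power R \<aa> m) p' d' e'" "u \<in> carrier (FM R (p' 0))"
    "e' u \<ominus>\<^bsub>R\<^esub> \<one>\<^bsub>R\<^esub> \<in> ideal_power R \<aa> m"
    "l \<in> carrier (FM R (p q)) ==> lin R (FM R (p' q)) X (z q l)"
    "x \<in> carrier (FM R (p' q)) ==> lin R (FM R (p q)) X (\<lambda>l. z q l x)"
    "l \<in> carrier (FM R (p q)) ==> x \<in> carrier (FM R (p' q)) ==> z q l x \<in> N"
    "l \<in> carrier (FM R (p q)) ==> x' \<in> carrier (FM R (p' (Suc q))) ==>
      z q l (d' q x') \<ominus>\<^bsub>X\<^esub> z (Suc q) (codiff R p d q l) x' \<in> L"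
    "k < q ==> l \<in> carrier (FM R (p q)) ==> x \<in> carrier (FM R (p' q)) ==> z q l x \<in> L"
    "z 0 (\<lambda>j\<in>{..<p 0}. e (basis R (p 0) j)) u \<ominus>\<^bsub>X\<^esub> y
       \<in> {v \<oplus>\<^bsub>X\<^esub> w | v w. v \<in> imul X (ideal_power R \<aa> n) N \<and> w \<in> L}"
  using assms unfolding zigmap_def by blast+

text \<open>Permits the change from a submodule and zero to a larger pair \<open>N\<close>,
  \<open>L\<close> between two descents.\<close>

lemma zigzag_mono:
  assumes "N \<subseteq> N'" "L \<subseteq> L'" "zigzag R \<aa> X N L n p d e y k m"
  shows "zigzag R \<aa> X N' L' n p d e y k m"
proof -
  have "{v \<oplus>\<^bsub>X\<^esub> w | v w. v \<in> imul X (ideal_power R \<aa> n) N \<and> w \<in> L} \<subseteq>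
    {v \<oplus>\<^bsub>X\<^esub> w | v w. v \<in> imul X (ideal_power R \<aa> n) N' \<and> w \<in> L'}"
    using imul_mono[OF subset_refl assms(1)] assms(2) by blast
  note T = this
  have "zigmap R \<aa> X N' L' n p d e y k m p' d' e' u z" if zm: "zigmap R \<aa> X N L n p d e y k m p' d' e' u z" for p' d' e' u z
  proof -
    note D = zigmapD[OF zm]
    show ?thesis unfolding zigmap_def
      by (intro conjI allI ballI impI;
          (rule D(1-5) subsetD[OF assms(1) D(6)] subsetD[OF assms(2) D(7)] subsetD[OF assms(2) D(8)] subsetD[OF T D(9)];
            assumption))
  qed
  then show ?thesis using assms(3) unfolding zigzag_def by blast
qed

text \<open>The tuple is the augmentation seen as an element of the dual in degree zero. Since
  \<open>e d\<close> has values in the resolved ideal, it is a dual cocycle modulo that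
  ideal.\<close>

lemma fres_dual_unit:
  assumes "cring R" "fres R \<JJ> p d e"
  shows "(\<lambda>j\<in>{..<p 0}. e (basis R (p 0) j)) \<in> carrier (FM R (p 0))"
    "x \<in> carrier (FM R (p 0)) ==>
      lincomb (RM R) (\<lambda>j\<in>{..<p 0}. e (basis R (p 0) j)) x (p 0) = e x"
    "j < p (Suc 0) ==> codiff R p d 0 (\<lambda>j\<in>{..<p 0}. e (basis R (p 0) j)) j \<in> \<JJ>"
proof -
  note Rmod = module_ring_as_module[OF assms(1)] and e = fresD(2)[OF assms(2)]
  have "e (basis R (p 0) j) \<in> carrier R" for j using lin_closed[OF e basis_closed[OF assms(1)]] by simp
  then show "(\<lambda>j\<in>{..<p 0}. e (basis R (p 0) j)) \<in> carrier (FM R (p 0))" by (simp add: free_module_def)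
  show *: "lincomb (RM R) (\<lambda>j\<in>{..<p 0}. e (basis R (p 0) j)) x (p 0) = e x"
    if "x \<in> carrier (FM R (p 0))" for x
    unfolding lin_expand[OF Rmod e that] by (rule lincomb_cong) auto
  show "codiff R p d 0 (\<lambda>j\<in>{..<p 0}. e (basis R (p 0) j)) j \<in> \<JJ>" if "j < p (Suc 0)"
    using that *[OF lin_closed[OF fresD(1)[OF assms(2)] basis_closed[OF assms(1)]]] fresD(5)[OF assms(2) basis_closed[OF assms(1)]]
    by (simp add: codiff_def)
qed

context
  fixes R :: "('a, 'r) ring_scheme" and X :: "('a, 'm, 's) module_scheme" (structure) and N L :: "'m set" and \<aa> :: "'a set"
    and n :: nat and p d e
  assumes NR: "noetherian_ring R" and X: "module R X" and N: "submodule N R X" and L: "submodule L R X" and LN: "L \<subseteq> N"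
    and \<aa>: "ideal \<aa> R" and F: "fres R (ideal_power R \<aa> n) p d e"
begin

interpretation module R X by (rule X)

private abbreviation "\<JJ> \<equiv> ideal_power R \<aa>"
private abbreviation "T \<equiv> {v \<oplus> w | v w. v \<in> imul X (\<JJ> n) N \<and> w \<in> L}"
private abbreviation "\<epsilon> \<equiv> (\<lambda>j\<in>{..<p 0}. e (basis R (p 0) j))"
private abbreviation "\<delta> \<equiv> codiff R p d"

private lemmas R2 = is_cring
private lemmas Rmod2 = module_ring_as_module[OF R2]
private lemmas Fmod2 = module_free[OF R2]
private lemmas JI2 = ideal_power_ideal[OF R2 \<aa>]
private lemmas \<epsilon> = fres_dual_unit[OF R2 F]
private lemmas \<delta>l = lin_codiff[OF R2, where p=p and d=d, OF fresD(1)[OF F]]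

lemma zigzag_target:
  shows "submodule T R X" "L \<subseteq> T" "imul X (\<JJ> n) N \<subseteq> T"
proof -
  note I = submodule_imul[OF X JI2 N]
  show "submodule T R X" by (rule submodule_sum[OF X I L])
  show "L \<subseteq> T"
  proof
    fix l assume l: "l \<in> L"
    then have "l = \<zero> \<oplus> l" using sub_carr[OF L] by simp
    then show "l \<in> T" using l imul_zero by blast
  qed
  show "imul X (\<JJ> n) N \<subseteq> T"
  proof
    fix l assume l: "l \<in> imul X (\<JJ> n) N"
    then have "l = l \<oplus> \<zero>" using sub_carr[OF I] by simp
    then show "l \<in> T" using l sub_zero[OF L] by blast
  qed
qed

private lemmas T = zigzag_target

text \<open>Passing to a later resolution changes the representative of one by a boundary
  \<open>d' 0 s\<close>. Moving the differential to the dual side leaves \<open>z\<close> evaluated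
  at the codifferential of the augmentation, whose entries lie in \<open>\<aa>^n\<close>; so the
  change lies in \<open>\<aa>^n N + L\<close>.\<close>

lemma zigzag_unit:
  assumes "fres R (\<JJ> m) p' d' e'" "u \<in> carrier (FM R (p' 0))" "e' u \<ominus>\<^bsub>R\<^esub> \<one>\<^bsub>R\<^esub> \<in> \<JJ> m"
    "\<And>l. l \<in> carrier (FM R (p 0)) ==> lin R (FM R (p' 0)) X (z 0 l)"
    "\<And>q x. x \<in> carrier (FM R (p' q)) ==> lin R (FM R (p q)) X (\<lambda>l. z q l x)"
    "\<And>q l x. l \<in> carrier (FM R (p q)) ==> x \<in> carrier (FM R (p' q)) ==> z q l x \<in> N"
    "\<And>q l x. l \<in> carrier (FM R (p q)) ==> x \<in> carrier (FM R (p' (Suc q))) ==> z q l (d' q x) \<ominus> z (Suc q) (\<delta> q l) x \<in> L"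
    "m \<le> m'" "fres R (\<JJ> m') p'' d'' e''" "u' \<in> carrier (FM R (p'' 0))" "e'' u' \<ominus>\<^bsub>R\<^esub> \<one>\<^bsub>R\<^esub> \<in> \<JJ> m'"
    "clift R p'' d'' e'' p' d' e' (\<JJ> m) \<phi>"
  shows "z 0 \<epsilon> (\<phi> 0 u') \<ominus> z 0 \<epsilon> u \<in> T"
proof -
  have \<phi>: "lin R (FM R (p'' 0)) (FM R (p' 0)) (\<phi> 0)" "e' (\<phi> 0 u') \<ominus>\<^bsub>R\<^esub> e'' u' \<in> \<JJ> m"
    using assms(10,12) by (auto simp: clift_def cmap_def)
  note d' = fresD[OF assms(1)] and d'' = fresD[OF assms(9)]
  have Jm: "submodule (\<JJ> m) R (RM R)" using ideal_iff_submodule[OF R2] JI2 by blast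
  note f = lin_closed[OF \<phi>(1) assms(10)]
  have c: "e' (\<phi> 0 u') \<in> carrier R" "e' u \<in> carrier R" "e'' u' \<in> carrier R"
    using lin_closed[OF d'(2) f] lin_closed[OF d'(2) assms(2)] lin_closed[OF d''(2) assms(10)] by auto
  have "e'' u' \<ominus>\<^bsub>R\<^esub> \<one>\<^bsub>R\<^esub> \<in> \<JJ> m" using assms(11) ideal_power_antimono[OF R2 \<aa> assms(8)] by blast
  then have "e' (\<phi> 0 u') \<ominus>\<^bsub>R\<^esub> \<one>\<^bsub>R\<^esub> \<in> \<JJ> m" using mod_trans[OF Rmod2 Jm, of "e' (\<phi> 0 u')" "e'' u'" "\<one>\<^bsub>R\<^esub>"] \<phi>(2) c by simp
  moreover have "\<one>\<^bsub>R\<^esub> \<ominus>\<^bsub>R\<^esub> e' u \<in> \<JJ> m" using mod_sym[OF Rmod2 Jm, of "e' u" "\<one>\<^bsub>R\<^esub>"] assms(3) c by simp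
  ultimately have "e' (\<phi> 0 u') \<ominus>\<^bsub>R\<^esub> e' u \<in> \<JJ> m" using mod_trans[OF Rmod2 Jm, of "e' (\<phi> 0 u')" "\<one>\<^bsub>R\<^esub>" "e' u"] c by simp
  then have "e' (\<phi> 0 u' \<ominus>\<^bsub>FM R (p' 0)\<^esub> u) \<in> \<JJ> m" using lin_minus[OF Fmod2 Rmod2 d'(2) f assms(2)] by simp
  moreover have "\<phi> 0 u' \<ominus>\<^bsub>FM R (p' 0)\<^esub> u \<in> carrier (FM R (p' 0))"
    by (rule sub_minus[OF module.carrier_is_submodule[OF Fmod2] f assms(2)])
  ultimately obtain s where s: "s \<in> carrier (FM R (p' (Suc 0)))" "\<phi> 0 u' \<ominus>\<^bsub>FM R (p' 0)\<^esub> u = d' 0 s" using d'(4) by blast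
  have zs: "z 0 \<epsilon> (\<phi> 0 u') \<ominus> z 0 \<epsilon> u = z 0 \<epsilon> (d' 0 s)"
    using lin_minus[OF Fmod2 X assms(4)[OF \<epsilon>(1)] f assms(2)] s(2) by simp
  have de: "\<delta> 0 \<epsilon> \<in> carrier (FM R (p (Suc 0)))" by (rule lin_closed[OF \<delta>l \<epsilon>(1)])
  have z1: "z (Suc 0) (\<delta> 0 \<epsilon>) s \<in> imul X (\<JJ> n) N"
    unfolding lin_expand[OF X assms(5)[OF s(1)] de]
    by (rule lincomb_in_imul) (use \<epsilon>(3) assms(6) s(1) basis_closed[OF R2] in auto)
  have "z 0 \<epsilon> (d' 0 s) \<in> carrier X" by (rule lin_closed[OF assms(4)[OF \<epsilon>(1)] lin_closed[OF d'(1) s(1)]])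
  then have "z 0 \<epsilon> (d' 0 s) \<in> T" using mod_mem[OF X T(1), of "z 0 \<epsilon> (d' 0 s)" "z (Suc 0) (\<delta> 0 \<epsilon>) s"]
      assms(7)[OF \<epsilon>(1) s(1)] z1 T(2,3) by blast
  then show ?thesis using zs by simp
qed

text \<open>The top component is a cocycle modulo \<open>L\<close> for each element of the dual
  basis. After passing to a later resolution it is the coboundary of some \<open>w\<close>, and
  subtracting the homotopy made of these \<open>w\<close> removes it at the price of changing the
  component below.\<close>

lemma zigzag_step:
  assumes "zigzag R \<aa> X N L n p d e y (Suc k) m" "vanish R \<aa> X N L (Suc k)" "y \<in> carrier X"
  shows "\<exists>m. zigzag R \<aa> X N L n p d e y k m"
proof -
  obtain p' d' e' u z where zm: "zigmap R \<aa> X N L n p d e y (Suc k) m p' d' e' u z" using assms(1) unfolding zigzag_def by blast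
  note z = zigmapD[OF zm]
  note d' = fresD[OF z(1)] and d = fresD[OF F]
  have bc: "basis R a l \<in> carrier (FM R a)" for a l by (rule basis_closed[OF R2])
  have "\<exists>m0\<ge>m. \<forall>m'\<ge>m0. \<forall>p'' d'' e'' \<phi>. fres R (\<JJ> m') p'' d'' e'' \<longrightarrow> clift R p'' d'' e'' p' d' e' (\<JJ> m) \<phi> \<longrightarrow>
      relcob R p'' d'' X N L (Suc k) (\<lambda>x. z (Suc k) (basis R (p (Suc k)) l) (\<phi> (Suc k) x))" for l
  proof -
    let ?l = "basis R (p (Suc k)) l"
    \<comment> \<open>The cocycle condition holds because the component of degree
      \<open>k + 2\<close> has values in \<open>L\<close>.\<close>
    have "z (Suc k) ?l (d' (Suc k) x) \<in> L" if x: "x \<in> carrier (FM R (p' (Suc (Suc k))))" for x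
      using mod_mem[OF X L lin_closed[OF z(4)[OF bc] lin_closed[OF d'(1) x]] z(8)[OF _ lin_closed[OF \<delta>l bc] x] z(7)[OF bc x]] by simp
    then have "relcoc R p' d' X N L (Suc k) (z (Suc k) ?l)"
      unfolding relcoc_def using z(4,6) bc by simp
    then show ?thesis using assms(2) z(1) unfolding vanish_def by blast
  qed
  then obtain M where M: "\<And>l. M l \<ge> m" "\<And>l m' p'' d'' e'' \<phi>. m' \<ge> M l ==> fres R (\<JJ> m') p'' d'' e'' ==> clift R p'' d'' e'' p' d' e' (\<JJ> m) \<phi> ==>
      relcob R p'' d'' X N L (Suc k) (\<lambda>x. z (Suc k) (basis R (p (Suc k)) l) (\<phi> (Suc k) x))" by metis
  \<comment> \<open>One index beyond the thresholds of all finitely many basis elements.\<close>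
  define m' where "m' = m + (\<Sum>l<p (Suc k). M l)"
  have m'm: "m \<le> m'" by (simp add: m'_def)
  have Mm': "M l \<le> m'" if "l < p (Suc k)" for l
    using member_le_sum[of l "{..<p (Suc k)}" M] that by (simp add: m'_def)
  obtain p'' d'' e'' where F'': "fres R (\<JJ> m') p'' d'' e''" using fres_exists[OF R2 NR JI2] by blast
  note d'' = fresD[OF F'']
  obtain \<phi> where \<phi>: "clift R p'' d'' e'' p' d' e' (\<JJ> m) \<phi>"
    using fres_clift[OF R2 F'' z(1) ideal_power_antimono[OF R2 \<aa> m'm] JI2] by blast
  have \<phi>l: "lin R (FM R (p'' i)) (FM R (p' i)) (\<phi> i)"
    and \<phi>d: "x \<in> carrier (FM R (p'' (Suc i))) ==> d' i (\<phi> (Suc i) x) = \<phi> i (d'' i x)" for i x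
    using \<phi> by (auto simp: clift_def cmap_def)
  obtain u' where u': "u' \<in> carrier (FM R (p'' 0))" "e'' u' \<ominus>\<^bsub>R\<^esub> \<one>\<^bsub>R\<^esub> \<in> \<JJ> m'" using d''(3) by blast
  have "\<forall>l. \<exists>w. l < p (Suc k) \<longrightarrow> lin R (FM R (p'' k)) X w \<and> (\<forall>x\<in>carrier (FM R (p'' k)). w x \<in> N) \<and>
      (\<forall>x\<in>carrier (FM R (p'' (Suc k))). z (Suc k) (basis R (p (Suc k)) l) (\<phi> (Suc k) x) \<ominus> w (d'' k x) \<in> L)"
    using M(2)[OF Mm' F'' \<phi>] unfolding relcob_def by auto
  from choice[OF this] obtain w where w: "\<And>l. l < p (Suc k) ==> lin R (FM R (p'' k)) X (w l)"
    "\<And>l x. l < p (Suc k) ==> x \<in> carrier (FM R (p'' k)) ==> w l x \<in> N"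
    "\<And>l x. l < p (Suc k) ==> x \<in> carrier (FM R (p'' (Suc k))) ==> z (Suc k) (basis R (p (Suc k)) l) (\<phi> (Suc k) x) \<ominus> w l (d'' k x) \<in> L"
    by blast
  define W where "W l x = lincomb X (\<lambda>j. w j x) l (p (Suc k))" for l x
  have W1: "lin R (FM R (p'' k)) X (W l)" if "l \<in> carrier (FM R (p (Suc k)))" for l
    unfolding W_def by (rule lin_lincomb_vec[OF Fmod2 X w(1)]) (use free_closed[OF that] in auto)
  have W2: "lin R (FM R (p (Suc k))) X (\<lambda>l. W l x)" if "x \<in> carrier (FM R (p'' k))" for x
    unfolding W_def by (rule lin_lincomb[OF X]) (use lin_closed[OF w(1) that] in auto)
  have W3: "W l x \<in> N" if "l \<in> carrier (FM R (p (Suc k)))" "x \<in> carrier (FM R (p'' k))" for l x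
    unfolding W_def by (rule lincomb_in_sub[OF N]) (use w(2) that free_closed[OF that(1)] in auto)
  have W4: "z (Suc k) l (\<phi> (Suc k) x) \<ominus> W l (d'' k x) \<in> L" if l: "l \<in> carrier (FM R (p (Suc k)))" and x: "x \<in> carrier (FM R (p'' (Suc k)))" for l x
    unfolding lin_expand[OF X z(5)[OF lin_closed[OF \<phi>l x]] l] W_def
    by (rule lincomb_mod[OF X L])
      (use lin_closed[OF z(4)[OF bc] lin_closed[OF \<phi>l x]] lin_closed[OF w(1) lin_closed[OF d''(1) x]] w(3)[OF _ x] free_closed[OF l] in auto)
  \<comment> \<open>A null-homotopic map is subtracted. Its homotopy \<open>W\<close> lives in one
    degree, so only the components \<open>k\<close> and \<open>k + 1\<close> are affected; the
    latter falls into \<open>L\<close> and, like all higher ones, is replaced by zero.\<close>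
  define z' where "z' q l x = (if q = k then z q l (\<phi> q x) \<ominus> W (\<delta> q l) x else if q < k then z q l (\<phi> q x) else \<zero>)" for q l x
  have zz': "z' k = (\<lambda>l x. z k l (\<phi> k x) \<ominus> W (\<delta> k l) x)" "q < k ==> z' q = (\<lambda>l x. z q l (\<phi> q x))"
    "k < q ==> z' q = (\<lambda>l x. \<zero>)" for q by (auto simp: z'_def fun_eq_iff)
  note z\<phi> = lin_comp[OF \<phi>l z(4)]
  have a1: "lin R (FM R (p'' q)) X (z' q l)" if l: "l \<in> carrier (FM R (p q))" for q l
  proof -
    consider "q = k" | "q < k" | "k < q" by linarith
    then show ?thesis
    proof cases
      case 1
      have l': "l \<in> carrier (FM R (p k))" using l 1 by simp
      show ?thesis unfolding 1 zz'(1) by (rule lin_diff[OF X z\<phi>[OF l'] W1[OF lin_closed[OF \<delta>l l']]])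
    next
      case 2
      then show ?thesis using z\<phi>[OF l] zz'(2) by simp
    next
      case 3
      then show ?thesis using lin_const_zero[OF X] zz'(3) by simp
    qed
  qed
  have a2: "lin R (FM R (p q)) X (\<lambda>l. z' q l x)" if x: "x \<in> carrier (FM R (p'' q))" for q x
  proof -
    consider "q = k" | "q < k" | "k < q" by linarith
    then show ?thesis
    proof cases
      case 1
      have x': "x \<in> carrier (FM R (p'' k))" using x 1 by simp
      show ?thesis unfolding 1 zz'(1)
        by (rule lin_diff[OF X z(5)[OF lin_closed[OF \<phi>l x']] lin_comp[OF \<delta>l W2[OF x']]])
    next
      case 2
      then show ?thesis using z(5)[OF lin_closed[OF \<phi>l x]] zz'(2) by simp
    next
      case 3
      then show ?thesis using lin_const_zero[OF X] zz'(3) by simp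
    qed
  qed
  have a3: "z' q l x \<in> N" if l: "l \<in> carrier (FM R (p q))" and x: "x \<in> carrier (FM R (p'' q))" for q l x
    unfolding z'_def using z(6)[OF l lin_closed[OF \<phi>l x]] W3 lin_closed[OF \<delta>l l] x sub_zero[OF N] sub_minus[OF N] by auto
  have a4: "z' q l (d'' q x) \<ominus> z' (Suc q) (\<delta> q l) x \<in> L"
    if l: "l \<in> carrier (FM R (p q))" and x: "x \<in> carrier (FM R (p'' (Suc q)))" for q l x
  proof -
    note dl = lin_closed[OF \<delta>l l] and fx = lin_closed[OF \<phi>l x] and dx = lin_closed[OF d''(1) x]
    have A: "z q l (\<phi> q (d'' q x)) \<ominus> z (Suc q) (\<delta> q l) (\<phi> (Suc q) x) \<in> L" using z(7)[OF l fx] \<phi>d[OF x] by simp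
    have cA: "z q l (\<phi> q (d'' q x)) \<in> carrier X" "z (Suc q) (\<delta> q l) (\<phi> (Suc q) x) \<in> carrier X"
      using lin_closed[OF z\<phi>[OF l] dx] lin_closed[OF z\<phi>[OF dl] x] by auto
    have sz: "v \<ominus> \<zero> = v" if "v \<in> carrier X" for v using mod_cancel(4)[OF X that M.zero_closed] that by simp
    consider "q = k" | "Suc q = k" | "Suc q < k" | "k < q" by linarith
    then show ?thesis
    proof cases
      case 1
      have cW: "W (\<delta> k l) (d'' k x) \<in> carrier X" using lin_closed[OF W1 dx[unfolded 1]] dl 1 by simp
      have "z (Suc k) (\<delta> k l) (\<phi> (Suc k) x) \<ominus> W (\<delta> k l) (d'' k x) \<in> L" using W4 dl x 1 by simp
      then have "z k l (\<phi> k (d'' k x)) \<ominus> W (\<delta> k l) (d'' k x) \<in> L"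
        using mod_trans[OF X L, of "z k l (\<phi> k (d'' k x))"] A cA cW 1 by blast
      then show ?thesis using 1 sz cA cW by (simp add: z'_def)
    next
      case 2
      \<comment> \<open>Just below degree \<open>k\<close> the correction disappears because
        \<open>codiff\<close> squares to zero.\<close>
      have "W (\<delta> k (\<delta> q l)) x = \<zero>"
        using codiff_codiff[OF R2, where p=p and d=d, OF d(1) d(7) l] lin_zero[OF Fmod2 X W2] x 2 by simp
      then have "z' (Suc q) (\<delta> q l) x = z (Suc q) (\<delta> q l) (\<phi> (Suc q) x)" using 2 sz cA by (simp add: z'_def)
      then show ?thesis using 2 A by (simp add: z'_def)
    next
      case 3
      then show ?thesis using A by (simp add: z'_def)
    next
      case 4
      then show ?thesis using mod_refl[OF X L M.zero_closed] by (simp add: z'_def)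
    qed
  qed
  have a5: "z' q l x \<in> L" if "k < q" for q l x using that zz'(3) sub_zero[OF L] by simp
  have U: "z 0 \<epsilon> (\<phi> 0 u') \<ominus> z 0 \<epsilon> u \<in> T"
    by (rule zigzag_unit[where z=z, OF z(1-3) z(4) z(5-7) m'm F'' u' \<phi>])
  have cU: "z 0 \<epsilon> (\<phi> 0 u') \<in> carrier X" "z 0 \<epsilon> u \<in> carrier X"
    using lin_closed[OF z\<phi>[OF \<epsilon>(1)] u'(1)] lin_closed[OF z(4)[OF \<epsilon>(1)] z(2)] by auto
  have U2: "z 0 \<epsilon> (\<phi> 0 u') \<ominus> y \<in> T" by (rule mod_trans[OF X T(1) cU assms(3) U z(9)])
  have c': "z' 0 \<epsilon> u' \<in> carrier X" by (rule lin_closed[OF a1[OF \<epsilon>(1)] u'(1)])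
  have "z' 0 \<epsilon> u' \<ominus> z 0 \<epsilon> (\<phi> 0 u') \<in> T"
  \<comment> \<open>For \<open>k = 0\<close> the correction does reach the augmentation, but there
    its coefficients lie in \<open>\<aa>^n\<close>, so it is absorbed by the target.\<close>
  proof (cases "k = 0")
    case True
    have "W (\<delta> 0 \<epsilon>) u' \<in> imul X (\<JJ> n) N"
      unfolding W_def by (rule lincomb_in_imul) (use True \<epsilon>(3) w(2) u'(1) in auto)
    then have WT: "W (\<delta> 0 \<epsilon>) u' \<in> T" using T(3) by blast
    have "z 0 \<epsilon> (\<phi> 0 u') \<ominus> z' 0 \<epsilon> u' = W (\<delta> 0 \<epsilon>) u'"
      using mod_cancel(3)[OF X cU(1) sub_carr[OF T(1) WT]] True by (simp add: z'_def)
    then show ?thesis using mod_sym[OF X T(1) cU(1) c'] WT by simp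
  next
    case False
    then show ?thesis using mod_refl[OF X T(1) cU(1)] by (simp add: z'_def)
  qed
  then have "z' 0 \<epsilon> u' \<ominus> y \<in> T" using mod_trans[OF X T(1) c' cU(1) assms(3) _ U2] by blast
  then have "zigzag R \<aa> X N L n p d e y k m'"
    unfolding zigzag_def zigmap_def using F'' u' a1 a2 a3 a4 a5
    by (intro exI[of _ p''] exI[of _ d''] exI[of _ e''] exI[of _ u'] exI[of _ z'] conjI) blast+
  then show ?thesis by blast
qed

text \<open>With a single component left, \<open>z 0\<close> at the augmentation is a cocycle of
  degree zero. Its becoming a coboundary means values in \<open>L\<close>, and
  \<open>zigzag_unit\<close> transfers this to \<open>y\<close>.\<close>

lemma zigzag_final:
  assumes "zigzag R \<aa> X N L n p d e y 0 m" "vanish R \<aa> X N L 0" "y \<in> carrier X"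
  shows "y \<in> T"
proof -
  obtain p' d' e' u z where zm: "zigmap R \<aa> X N L n p d e y 0 m p' d' e' u z" using assms(1) unfolding zigzag_def by blast
  note z = zigmapD[OF zm]
  note d' = fresD[OF z(1)]
  have "z 0 \<epsilon> (d' 0 x) \<in> L" if x: "x \<in> carrier (FM R (p' (Suc 0)))" for x
    using mod_mem[OF X L lin_closed[OF z(4)[OF \<epsilon>(1)] lin_closed[OF d'(1) x]] z(8)[OF _ lin_closed[OF \<delta>l \<epsilon>(1)] x] z(7)[OF \<epsilon>(1) x]] by simp
  then have "relcoc R p' d' X N L 0 (z 0 \<epsilon>)"
    unfolding relcoc_def using z(4,6) \<epsilon>(1) by simp
  then obtain m' where m': "m' \<ge> m" "\<And>p'' d'' e'' \<phi>. fres R (\<JJ> m') p'' d'' e'' ==> clift R p'' d'' e'' p' d' e' (\<JJ> m) \<phi> ==>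
      relcob R p'' d'' X N L 0 (\<lambda>x. z 0 \<epsilon> (\<phi> 0 x))" using assms(2) z(1) unfolding vanish_def by blast
  obtain p'' d'' e'' where F'': "fres R (\<JJ> m') p'' d'' e''" using fres_exists[OF R2 NR JI2] by blast
  obtain \<phi> where \<phi>: "clift R p'' d'' e'' p' d' e' (\<JJ> m) \<phi>"
    using fres_clift[OF R2 F'' z(1) ideal_power_antimono[OF R2 \<aa> m'(1)] JI2] by blast
  obtain u' where u': "u' \<in> carrier (FM R (p'' 0))" "e'' u' \<ominus>\<^bsub>R\<^esub> \<one>\<^bsub>R\<^esub> \<in> \<JJ> m'" using fresD(3)[OF F''] by blast
  have "z 0 \<epsilon> (\<phi> 0 u') \<in> L" using m'(2)[OF F'' \<phi>] u'(1) by (simp add: relcob_def)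
  then have zT: "z 0 \<epsilon> (\<phi> 0 u') \<in> T" using T(2) by blast
  have U: "z 0 \<epsilon> (\<phi> 0 u') \<ominus> z 0 \<epsilon> u \<in> T"
    by (rule zigzag_unit[where z=z, OF z(1-3) z(4) z(5-7) m'(1) F'' u' \<phi>])
  have c: "z 0 \<epsilon> u \<in> carrier X" by (rule lin_closed[OF z(4)[OF \<epsilon>(1)] z(2)])
  have "z 0 \<epsilon> u \<in> T" using mod_mem[OF X T(1) c zT mod_sym[OF X T(1) sub_carr[OF T(1) zT] c U]] .
  then show ?thesis using mod_mem[OF X T(1) assms(3) _ mod_sym[OF X T(1) c assms(3) z(9)]] by blast
qed

lemma zigzag_descend:
  assumes "zigzag R \<aa> X N L n p d e y k m" "\<And>q. c < q ==> q \<le> k ==> vanish R \<aa> X N L q" "c \<le> k" "y \<in> carrier X"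
  shows "\<exists>m. zigzag R \<aa> X N L n p d e y c m"
  using assms(3,1,2)
proof (induction k arbitrary: m rule: dec_induct)
  case base
  then show ?case by blast
next
  case (step k)
  obtain m' where "zigzag R \<aa> X N L n p d e y k m'" using zigzag_step[OF step.prems(1) _ assms(4)] step by auto
  then show ?case using step by simp
qed

end

text \<open>Multiplication by \<open>y\<close> gives a zigzag for \<open>N0\<close> whose length is
  bounded by the number of generators. The vanishing for \<open>N0\<close> shortens it to degree
  \<open>c\<close>; read in \<open>N\<close> modulo \<open>L\<close>, it is then shortened to degree
  zero by the other vanishing.\<close>

theorem vanish_imp_in_imul_sum:
  fixes X (structure)
  assumes "noetherian_ring R" "ideal \<aa> R" "module R X"
    "submodule N0 R X" "submodule N R X" "submodule L R X" "N0 \<subseteq> N" "L \<subseteq> N"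
    "\<And>k. c < k ==> vanish R \<aa> X N0 {\<zero>} k" "\<And>k. k \<le> c ==> vanish R \<aa> X N L k" "y \<in> N0"
  shows "\<exists>v\<in>imul X (ideal_power R \<aa> n) N. \<exists>w\<in>L. y = v \<oplus> w"
proof -
  interpret module R X by fact
  note R = is_cring
  note Rmod = module_ring_as_module[OF R] and Fmod = module_free[OF R] and JI = ideal_power_ideal[OF R assms(2)]
  let ?\<JJ> = "ideal_power R \<aa>" and ?F = "FM R"
  have yc: "y \<in> carrier X" using assms(11) sub_carr[OF assms(4)] by blast
  have z: "submodule {\<zero>} R X" "{\<zero>} \<subseteq> N0" using submodule_zero[OF assms(3)] sub_zero[OF assms(4)] by auto
  obtain r g where rg: "generates R (RM R) \<aa> r g" using generates_ideal[OF R assms(1,2)] by blast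
  have \<aa>: "\<aa> = gen_ideal R g r" by (rule generates_gen_ideal[OF R assms(2) rg])
  have gc: "\<And>i. i < r ==> g i \<in> carrier R" using rg ideal.Icarr[OF assms(2)] by (auto simp: generates_def)
  obtain p d e where F: "fres R (?\<JJ> n) p d e" using fres_exists[OF R assms(1) JI] by blast
  obtain m where m: "m \<ge> n" "\<And>p' d' e'. fres R (?\<JJ> m) p' d' e' ==>
    \<exists>\<phi>. clift R p' d' e' p d e (?\<JJ> n) \<phi> \<and> (\<forall>i>r. \<forall>x\<in>carrier (?F (p' i)). \<phi> i x = \<zero>\<^bsub>?F (p i)\<^esub>)"
    using bounded_lift[OF R assms(1), where r=r and g=g and n=n, OF gc] F unfolding \<aa> by (metis (no_types, lifting))
  obtain p' d' e' where F': "fres R (?\<JJ> m) p' d' e'" using fres_exists[OF R assms(1) JI] by blast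
  obtain \<phi> where \<phi>: "clift R p' d' e' p d e (?\<JJ> n) \<phi>" "\<And>i x. i > r ==> x \<in> carrier (?F (p' i)) ==> \<phi> i x = \<zero>\<^bsub>?F (p i)\<^esub>"
    using m(2)[OF F'] by blast
  have \<phi>l: "lin R (?F (p' i)) (?F (p i)) (\<phi> i)"
    and \<phi>d: "x \<in> carrier (?F (p' (Suc i))) ==> d i (\<phi> (Suc i) x) = \<phi> i (d' i x)"
    and \<phi>e: "x \<in> carrier (?F (p' 0)) ==> e (\<phi> 0 x) \<ominus>\<^bsub>R\<^esub> e' x \<in> ?\<JJ> n" for i x
    using \<phi>(1) by (auto simp: clift_def cmap_def)
  note d = fresD[OF F] and d' = fresD[OF F']
  obtain u where u: "u \<in> carrier (?F (p' 0))" "e' u \<ominus>\<^bsub>R\<^esub> \<one>\<^bsub>R\<^esub> \<in> ?\<JJ> m" using d'(3) by blast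
  let ?pair = "\<lambda>q l x. lincomb (RM R) l x (p q)"
  \<comment> \<open>The chain map \<open>\<phi>\<close> tensored with \<open>y\<close>, written
    through the pairing with the dual of its target.\<close>
  let ?z = "\<lambda>q l x. ?pair q l (\<phi> q x) \<odot> y"
  have pl: "lin R (?F (p q)) (RM R) (?pair q l)" if "l \<in> carrier (?F (p q))" for q l
    by (rule lin_lincomb[OF Rmod]) (use free_closed[OF that] in auto)
  have a1: "lin R (?F (p' q)) X (?z q l)" if "l \<in> carrier (?F (p q))" for q l
    by (rule lin_scale_elt[OF assms(3) lin_comp[OF \<phi>l pl[OF that]] yc])
  have a2: "lin R (?F (p q)) X (\<lambda>l. ?z q l x)" if "x \<in> carrier (?F (p' q))" for q x
    by (rule lin_scale_elt[OF assms(3) lin_pairing[OF R lin_closed[OF \<phi>l that]] yc])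
  have a3: "?z q l x \<in> N0" if "l \<in> carrier (?F (p q))" "x \<in> carrier (?F (p' q))" for q l x
    using sub_smult[OF assms(4) _ assms(11)] lin_closed[OF pl[OF that(1)] lin_closed[OF \<phi>l that(2)]] by simp
  have a4: "?z q l (d' q x) \<ominus> ?z (Suc q) (codiff R p d q l) x \<in> {\<zero>}"
    if l: "l \<in> carrier (?F (p q))" and x: "x \<in> carrier (?F (p' (Suc q)))" for q l x
    using codiff_adjoint[OF R, where p=p and d=d, OF d(1) l lin_closed[OF \<phi>l x]] \<phi>d[OF x] mod_refl[OF assms(3) z(1) lin_closed[OF a1[OF l] lin_closed[OF d'(1) x]]] by simp
  have a5: "?z q l x \<in> {\<zero>}" if "r < q" "l \<in> carrier (?F (p q))" "x \<in> carrier (?F (p' q))" for q l x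
    using \<phi>(2)[OF that(1,3)] lin_zero[OF Fmod Rmod pl[OF that(2)]] yc by simp
  let ?\<epsilon> = "\<lambda>j\<in>{..<p 0}. e (basis R (p 0) j)"
  note \<epsilon> = fres_dual_unit[OF R F]
  have Jn: "submodule (?\<JJ> n) R (RM R)" using ideal_iff_submodule[OF R] JI by blast
  have ec: "e (\<phi> 0 u) \<in> carrier R" "e' u \<in> carrier R" using lin_closed[OF d(2) lin_closed[OF \<phi>l u(1)]] lin_closed[OF d'(2) u(1)] by auto
  have "e' u \<ominus>\<^bsub>R\<^esub> \<one>\<^bsub>R\<^esub> \<in> ?\<JJ> n" using u(2) ideal_power_antimono[OF R assms(2) m(1)] by blast
  then have e1: "e (\<phi> 0 u) \<ominus>\<^bsub>R\<^esub> \<one>\<^bsub>R\<^esub> \<in> ?\<JJ> n"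
    using mod_trans[OF Rmod Jn, of "e (\<phi> 0 u)" "e' u" "\<one>\<^bsub>R\<^esub>"] \<phi>e[OF u(1)] ec by simp
  have "?z 0 ?\<epsilon> u \<ominus> y = (e (\<phi> 0 u) \<ominus>\<^bsub>R\<^esub> \<one>\<^bsub>R\<^esub>) \<odot> y"
    using \<epsilon>(2)[OF lin_closed[OF \<phi>l u(1)]] ec yc by (simp add: a_minus_def smult_l_distr smult_l_minus)
  then have "?z 0 ?\<epsilon> u \<ominus> y \<in> imul X (?\<JJ> n) N0" using imul_prod[OF assms(3) JI assms(4) e1 assms(11)] by simp
  then have "?z 0 ?\<epsilon> u \<ominus> y \<in> {v \<oplus> w | v w. v \<in> imul X (?\<JJ> n) N0 \<and> w \<in> {\<zero>}}"
    using zigzag_target(3)[OF assms(1,3,4) z assms(2) F] by blast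
  \<comment> \<open>The maximum is taken because \<open>c\<close> may exceed the number of
    generators.\<close>
  then have "zigzag R \<aa> X N0 {\<zero>} n p d e y (max r c) m"
    unfolding zigzag_def zigmap_def using F' u a1 a2 a3 a4 a5
    by (intro exI[of _ p'] exI[of _ d'] exI[of _ e'] exI[of _ u] exI[of _ ?z] conjI) (assumption | auto)+
  from zigzag_descend[OF assms(1,3,4) z assms(2) F this, of c] assms(9) yc
  obtain m1 where "zigzag R \<aa> X N0 {\<zero>} n p d e y c m1" by auto
  then have "zigzag R \<aa> X N L n p d e y c m1" using zigzag_mono[OF assms(7), of "{\<zero>}" L] sub_zero[OF assms(6)] by blast
  from zigzag_descend[OF assms(1,3,5,6,8,2) F this, of 0] assms(10) yc
  obtain m2 where "zigzag R \<aa> X N L n p d e y 0 m2" by auto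
  from zigzag_final[OF assms(1,3,5,6,8,2) F this assms(10) yc] show ?thesis by blast
qed

subsection \<open>Quotients and inverse limits\<close>

lemma submodule_abelian_subgroup:
  assumes "module R X" "submodule T R X"
  shows "abelian_subgroup T X"
proof -
  interpret module R X by fact
  show ?thesis
    using submodule.axioms(1)[OF assms(2)] M.abelian_group_axioms
    by (intro abelian_subgroupI3 additive_subgroup.intro) auto
qed

lemma coset_eq_iff:
  fixes X (structure)
  assumes "module R X" "submodule T R X" "x \<in> carrier X" "y \<in> carrier X"
  shows "T +> x = T +> y \<longleftrightarrow> x \<ominus> y \<in> T"
proof -
  interpret module R X by fact
  interpret abelian_subgroup T X by (rule submodule_abelian_subgroup[OF assms(1,2)])
  have "x \<in> T +> y \<longleftrightarrow> x \<ominus> y \<in> T" using a_rcos_module[OF assms(4,3)] by (simp add: a_minus_def)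
  moreover have "T +> x = T +> y \<longleftrightarrow> x \<in> T +> y"
    using a_repr_independence'[OF _ assms(4)] a_rcos_self[OF assms(3)] by metis
  ultimately show ?thesis by simp
qed

lemma coset_zero:
  assumes "module R X" "submodule T R X"
  shows "T +>\<^bsub>X\<^esub> \<zero>\<^bsub>X\<^esub> = T"
proof -
  interpret module R X by fact
  show ?thesis using sub_carr[OF assms(2)] by (intro M.a_coset_add_zero) auto
qed

lemma coset_eq_self:
  assumes "module R X" "submodule T R X" "x \<in> carrier X"
  shows "T +>\<^bsub>X\<^esub> x = T \<longleftrightarrow> x \<in> T"
proof -
  interpret module R X by fact
  show ?thesis using coset_eq_iff[OF assms M.zero_closed] coset_zero[OF assms(1,2)] 
      mod_mem[OF assms sub_zero[OF assms(2)]] sub_minus[OF assms(2) _ sub_zero[OF assms(2)]] by auto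
qed

lemma coset_add:
  assumes "module R X" "submodule T R X" "x \<in> carrier X" "y \<in> carrier X"
  shows "(T +>\<^bsub>X\<^esub> x) <+>\<^bsub>X\<^esub> (T +>\<^bsub>X\<^esub> y) = T +>\<^bsub>X\<^esub> (x \<oplus>\<^bsub>X\<^esub> y)"
  by (rule abelian_subgroup.a_rcos_sum[OF submodule_abelian_subgroup[OF assms(1,2)] assms(3,4)])

lemma coset_elem:
  assumes "module R X" "submodule T R X" "x \<in> carrier X"
  shows "y \<in> T +>\<^bsub>X\<^esub> x \<longleftrightarrow> y \<in> carrier X \<and> y \<ominus>\<^bsub>X\<^esub> x \<in> T"
proof -
  interpret module R X by fact
  interpret abelian_subgroup T X by (rule submodule_abelian_subgroup[OF assms(1,2)])
  show ?thesis using a_rcos_module[OF assms(3), of y] a_elemrcos_carrier[OF assms(3), of y]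
    by (auto simp: a_minus_def)
qed

lemma coset_proj:
  assumes "module R X" "submodule T R X" "submodule T' R X" "T \<subseteq> T'" "x \<in> carrier X"
  shows "T' <+>\<^bsub>X\<^esub> (T +>\<^bsub>X\<^esub> x) = T' +>\<^bsub>X\<^esub> x"
proof -
  interpret module R X by fact
  show ?thesis
  proof (intro equalityI subsetI)
    fix y assume "y \<in> T' <+>\<^bsub>X\<^esub> (T +>\<^bsub>X\<^esub> x)"
    then obtain t u where tu: "t \<in> T'" "u \<in> T +>\<^bsub>X\<^esub> x" "y = t \<oplus>\<^bsub>X\<^esub> u" by (auto simp: set_add_def')
    then have u: "u \<in> carrier X" "u \<ominus>\<^bsub>X\<^esub> x \<in> T'" using coset_elem[OF assms(1,2,5)] assms(4) by auto
    have t: "t \<in> carrier X" using sub_carr[OF assms(3) tu(1)] .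
    have "y \<ominus>\<^bsub>X\<^esub> x = t \<oplus>\<^bsub>X\<^esub> (u \<ominus>\<^bsub>X\<^esub> x)" using tu(3) t u assms(5) by (simp add: a_minus_def M.a_assoc)
    then show "y \<in> T' +>\<^bsub>X\<^esub> x" unfolding coset_elem[OF assms(1,3,5)] using sub_add[OF assms(3) tu(1) u(2)] tu(3) t u by simp
  next
    fix y assume "y \<in> T' +>\<^bsub>X\<^esub> x"
    then have y: "y \<in> carrier X" "y \<ominus>\<^bsub>X\<^esub> x \<in> T'" unfolding coset_elem[OF assms(1,3,5)] by auto
    have "x \<in> T +>\<^bsub>X\<^esub> x" unfolding coset_elem[OF assms(1,2,5)] using assms(5) mod_refl[OF assms(1,2,5)] by simp
    moreover have "y = (y \<ominus>\<^bsub>X\<^esub> x) \<oplus>\<^bsub>X\<^esub> x" using mod_cancel(1)[OF assms(1) y(1) assms(5)] by simp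
    ultimately show "y \<in> T' <+>\<^bsub>X\<^esub> (T +>\<^bsub>X\<^esub> x)" using y(2) by (auto simp: set_add_def')
  qed
qed

lemma rcosets_iff: "c \<in> a_rcosets\<^bsub>X\<^esub> T \<longleftrightarrow> (\<exists>x\<in>carrier X. c = T +>\<^bsub>X\<^esub> x)"
  by (auto simp: A_RCOSETS_def' a_r_coset_def')

lemma coset_smult:
  fixes X (structure)
  assumes "module R X" "submodule T R X" "x \<in> carrier X" "r \<in> carrier R"
  shows "(\<Union>y\<in>T +> x. T +> (r \<odot> y)) = T +> (r \<odot> x)"
proof -
  interpret module R X by fact
  have "T +> (r \<odot> y) = T +> (r \<odot> x)" if "y \<in> T +> x" for y
  proof -
    have y: "y \<in> carrier X" "y \<ominus> x \<in> T" using that coset_elem[OF assms(1-3)] by auto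
    have "r \<odot> y \<ominus> r \<odot> x = r \<odot> (y \<ominus> x)" using y assms by (simp add: a_minus_def smult_r_distr smult_r_minus)
    then show ?thesis using coset_eq_iff[OF assms(1,2)] y assms sub_smult[OF assms(2,4)] by simp
  qed
  moreover have "x \<in> T +> x" unfolding coset_elem[OF assms(1-3)] using assms(3) mod_refl[OF assms(1-3)] by simp
  ultimately show ?thesis by blast
qed

lemma quot_module_simps:
  "carrier (quot_module R X T) = a_rcosets\<^bsub>X\<^esub> T" "zero (quot_module R X T) = T" "add (quot_module R X T) = set_add X"
  by (simp_all add: quot_module_def)

lemma quot_smult:
  assumes "module R X" "submodule T R X" "x \<in> carrier X" "r \<in> carrier R"
  shows "r \<odot>\<^bsub>quot_module R X T\<^esub> (T +>\<^bsub>X\<^esub> x) = T +>\<^bsub>X\<^esub> (r \<odot>\<^bsub>X\<^esub> x)"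
  using coset_smult[OF assms] by (simp add: quot_module_def)

lemma module_quot:
  fixes X (structure)
  assumes "module R X" "submodule T R X"
  shows "module R (quot_module R X T)"
proof -
  interpret module R X by fact
  let ?Q = "quot_module R X T"
  note ca = coset_add[OF assms] and cs = quot_smult[OF assms] and cz = coset_zero[OF assms]
  have ex: "\<exists>x\<in>carrier X. c = T +> x" if "c \<in> carrier (?Q)" for c
    using that by (simp add: quot_module_simps rcosets_iff)
  have cl: "T +> x \<in> carrier (?Q)" if "x \<in> carrier X" for x
    using that by (auto simp: quot_module_simps rcosets_iff)
  have add: "(T +> x) \<oplus>\<^bsub>?Q\<^esub> (T +> y) = T +> (x \<oplus> y)"
    if "x \<in> carrier X" "y \<in> carrier X" for x y using ca[OF that] by (simp add: quot_module_simps)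
  have zero: "\<zero>\<^bsub>?Q\<^esub> = T +> \<zero>" using cz by (simp add: quot_module_simps)
  have "abelian_group (?Q)"
  proof (rule abelian_groupI)
    fix c assume "c \<in> carrier (?Q)"
    then obtain x where x: "x \<in> carrier X" "c = T +> x" using ex by blast
    show "\<zero>\<^bsub>?Q\<^esub> \<oplus>\<^bsub>?Q\<^esub> c = c" using x by (simp add: zero add)
    show "\<exists>y\<in>carrier (?Q). y \<oplus>\<^bsub>?Q\<^esub> c = \<zero>\<^bsub>?Q\<^esub>"
      using x by (intro bexI[of _ "T +> (\<ominus> x)"]) (auto simp: add zero M.l_neg intro: cl)
    fix c' assume "c' \<in> carrier (?Q)"
    then obtain x' where x': "x' \<in> carrier X" "c' = T +> x'" using ex by blast
    show "c \<oplus>\<^bsub>?Q\<^esub> c' \<in> carrier (?Q)" using x x' by (simp add: add cl)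
    show "c \<oplus>\<^bsub>?Q\<^esub> c' = c' \<oplus>\<^bsub>?Q\<^esub> c" using x x' by (simp add: add M.a_comm)
    fix c'' assume "c'' \<in> carrier (?Q)"
    then obtain x'' where x'': "x'' \<in> carrier X" "c'' = T +> x''" using ex by blast
    show "c \<oplus>\<^bsub>?Q\<^esub> c' \<oplus>\<^bsub>?Q\<^esub> c'' = c \<oplus>\<^bsub>?Q\<^esub> (c' \<oplus>\<^bsub>?Q\<^esub> c'')"
      using x x' x'' by (simp add: add M.a_assoc)
  next
    show "\<zero>\<^bsub>?Q\<^esub> \<in> carrier (?Q)" unfolding zero by (rule cl) simp
  qed
  then show ?thesis
  proof (rule moduleI[OF is_cring])
    fix a c assume a: "a \<in> carrier R" and "c \<in> carrier (?Q)"
    then obtain x where x: "x \<in> carrier X" "c = T +> x" using ex by blast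
    show "a \<odot>\<^bsub>?Q\<^esub> c \<in> carrier (?Q)" using a x by (simp add: cs cl)
    fix b assume b: "b \<in> carrier R"
    show "(a \<oplus>\<^bsub>R\<^esub> b) \<odot>\<^bsub>?Q\<^esub> c = a \<odot>\<^bsub>?Q\<^esub> c \<oplus>\<^bsub>?Q\<^esub> b \<odot>\<^bsub>?Q\<^esub> c"
      using a b x by (simp add: cs add smult_l_distr)
    show "a \<otimes>\<^bsub>R\<^esub> b \<odot>\<^bsub>?Q\<^esub> c = a \<odot>\<^bsub>?Q\<^esub> (b \<odot>\<^bsub>?Q\<^esub> c)"
      using a b x by (simp add: cs smult_assoc1)
  next
    fix a c c' assume a: "a \<in> carrier R" and "c \<in> carrier (?Q)" "c' \<in> carrier (?Q)"
    then obtain x x' where x: "x \<in> carrier X" "c = T +> x" "x' \<in> carrier X" "c' = T +> x'" using ex by metis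
    show "a \<odot>\<^bsub>?Q\<^esub> (c \<oplus>\<^bsub>?Q\<^esub> c') = a \<odot>\<^bsub>?Q\<^esub> c \<oplus>\<^bsub>?Q\<^esub> a \<odot>\<^bsub>?Q\<^esub> c'"
      using a x by (simp add: cs add smult_r_distr)
  next
    fix c assume "c \<in> carrier (?Q)"
    then obtain x where x: "x \<in> carrier X" "c = T +> x" using ex by blast
    then show "\<one>\<^bsub>R\<^esub> \<odot>\<^bsub>?Q\<^esub> c = c" by (simp add: cs)
  qed
qed

lemma lin_quot:
  assumes "module R X" "submodule T R X"
  shows "lin R X (quot_module R X T) (\<lambda>x. T +>\<^bsub>X\<^esub> x)"
  using coset_add[OF assms] quot_smult[OF assms] by (auto simp: lin_def quot_module_simps rcosets_iff)

definition coherent :: "('a, 'm, 's) module_scheme \<Rightarrow> (nat \<Rightarrow> 'm set) \<Rightarrow> (nat \<Rightarrow> 'm) \<Rightarrow> bool" where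
  "coherent X T v \<longleftrightarrow> (\<forall>n. v n \<in> carrier X \<and> v (Suc n) \<ominus>\<^bsub>X\<^esub> v n \<in> T n)"

text \<open>Representatives are chosen for each index separately; compatibility of the cosets is
  then the coherence of the representatives. The completed ring and the completed modules are both
  treated by this.\<close>

lemma inverse_limit_iff:
  fixes X (structure)
  assumes "module R X" "\<And>n. submodule (T n) R X" "\<And>n. T (Suc n) \<subseteq> T n"
  shows "(\<forall>n. x n \<in> a_rcosets T n \<and> quot_proj X (T (Suc n)) (T n) (x (Suc n)) = x n) \<longleftrightarrow>
    (\<exists>v. coherent X T v \<and> x = (\<lambda>n. T n +> v n))"
proof
  have proj: "quot_proj X (T (Suc n)) (T n) (T (Suc n) +> y) = T n +> y" if "y \<in> carrier X" for n y
    using coset_proj[OF assms(1) assms(2) assms(2) assms(3) that] that rcosets_iff[of "T (Suc n) +> y" X "T (Suc n)"]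
    by (auto simp: quot_proj_def)
  {
    assume x: "\<forall>n. x n \<in> a_rcosets T n \<and> quot_proj X (T (Suc n)) (T n) (x (Suc n)) = x n"
    then have "\<forall>n. \<exists>v. v \<in> carrier X \<and> x n = T n +> v" by (simp add: rcosets_iff) blast
    from choice[OF this] obtain v where v: "\<And>n. v n \<in> carrier X" "\<And>n. x n = T n +> v n" by blast
    have "v (Suc n) \<ominus> v n \<in> T n" for n
      using x v(2)[of n] v(2)[of "Suc n"] proj[OF v(1), of n] coset_eq_iff[OF assms(1,2) v(1) v(1)] by metis
    then show "\<exists>v. coherent X T v \<and> x = (\<lambda>n. T n +> v n)"
      using v(1) v(2)[abs_def] by (intro exI[of _ v]) (auto simp: coherent_def)
  next
    assume "\<exists>v. coherent X T v \<and> x = (\<lambda>n. T n +> v n)"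
    then obtain v where v: "\<And>n. v n \<in> carrier X" "\<And>n. v (Suc n) \<ominus> v n \<in> T n" "x = (\<lambda>n. T n +> v n)"
      by (auto simp: coherent_def)
    then show "\<forall>n. x n \<in> a_rcosets T n \<and> quot_proj X (T (Suc n)) (T n) (x (Suc n)) = x n"
      using proj[OF v(1)] coset_eq_iff[OF assms(1,2) v(1) v(1)] rcosets_iff[of _ X] v(1) by auto
  }
qed

lemma coherent_le:
  assumes "module R X" "\<And>n. submodule (T n) R X" "\<And>m n. m \<le> n ==> T n \<subseteq> T m" "coherent X T v" "m \<le> n"
  shows "v n \<ominus>\<^bsub>X\<^esub> v m \<in> T m"
  using assms(5)
proof (induction rule: dec_induct)
  case base
  show ?case using mod_refl[OF assms(1,2)] assms(4) by (simp add: coherent_def)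
next
  case (step n)
  have "v (Suc n) \<ominus>\<^bsub>X\<^esub> v n \<in> T m" using assms(3)[OF step(1)] assms(4) by (auto simp: coherent_def)
  then show ?case using mod_trans[OF assms(1,2) _ _ _ _ step(3)] assms(4) by (simp add: coherent_def)
qed

lemma coset_ring_as_module: "T +>\<^bsub>RM R\<^esub> x = T +>\<^bsub>R\<^esub> x"
  by (simp add: a_r_coset_def')

lemma rcosets_ring_as_module: "a_rcosets\<^bsub>RM R\<^esub> T = a_rcosets\<^bsub>R\<^esub> T"
  by (auto simp: rcosets_iff coset_ring_as_module)

lemma set_add_ring_as_module: "set_add (RM R) = set_add R"
  by (intro ext) (simp add: set_add_def')

text \<open>Turns a module over the completed ring into an \<open>R\<close>-module, so that
  \<open>vanish\<close> over \<open>R\<close> applies to the completion of \<open>M\<close>.\<close>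

definition restrict_scalars :: "('a \<Rightarrow> 'b) \<Rightarrow> ('b, 'm, 's) module_scheme \<Rightarrow> ('a, 'm) module" where
  "restrict_scalars h X =
     \<lparr>carrier = carrier X, mult = undefined, one = undefined, zero = zero X, add = add X,
      smult = (\<lambda>r x. h r \<odot>\<^bsub>X\<^esub> x)\<rparr>"

lemma restrict_scalars_simps [simp]:
  "carrier (restrict_scalars h X) = carrier X" "zero (restrict_scalars h X) = zero X"
  "add (restrict_scalars h X) = add X" "smult (restrict_scalars h X) = (\<lambda>r x. h r \<odot>\<^bsub>X\<^esub> x)"
  by (simp_all add: restrict_scalars_def)

lemma a_inv_restrict_scalars [simp]: "a_inv (restrict_scalars h X) = a_inv X"
  by (rule ext) (simp add: a_inv_def m_inv_def)

lemma a_minus_restrict_scalars [simp]: "x \<ominus>\<^bsub>restrict_scalars h X\<^esub> y = x \<ominus>\<^bsub>X\<^esub> y"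
  by (simp add: a_minus_def)

lemma module_restrict_scalars:
  assumes "cring R" "h \<in> ring_hom R S" "module S X"
  shows "module R (restrict_scalars h X)"
proof -
  interpret X: module S X by fact
  have ag: "abelian_group (restrict_scalars h X)"
    by (rule abelian_groupI) (auto simp: X.a_ac intro: X.l_neg)
  show ?thesis
    by (rule moduleI[OF assms(1) ag])
      (auto simp: ring_hom_closed[OF assms(2)] ring_hom_add[OF assms(2)] ring_hom_mult[OF assms(2)] ring_hom_one[OF assms(2)]
        X.smult_l_distr X.smult_r_distr X.smult_assoc1)
qed

lemma submodule_restrict_scalars:
  assumes "cring R" "h \<in> ring_hom R S" "module S X" "submodule N S X"
  shows "submodule N R (restrict_scalars h X)"
  by (rule submoduleI'[OF module_restrict_scalars[OF assms(1-3)]])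
    (use sub_carr[OF assms(4)] sub_zero[OF assms(4)] sub_add[OF assms(4)] sub_smult[OF assms(4)] ring_hom_closed[OF assms(2)] in auto)

lemma lin_restrict_scalars:
  "h \<in> ring_hom R S ==> lin S X Y f ==> lin R (restrict_scalars h X) (restrict_scalars h Y) f"
  by (auto simp: lin_def ring_hom_closed)

section \<open>The completed ring\<close>

locale adic =
  fixes R :: "('a, 'r) ring_scheme" and \<aa> :: "'a set"
  assumes R: "cring R" and NR: "noetherian_ring R" and \<aa>: "ideal \<aa> R"
begin

sublocale cring R by (rule R)

abbreviation "J \<equiv> ideal_power R \<aa>"
abbreviation "Rm \<equiv> RM R"
abbreviation "S \<equiv> completion_ring R \<aa>"
abbreviation "\<iota> \<equiv> completion_map R \<aa>"
abbreviation mk :: "(nat \<Rightarrow> 'a) \<Rightarrow> nat \<Rightarrow> 'a set" where "mk r \<equiv> (\<lambda>n. J n +>\<^bsub>R\<^esub> r n)"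

lemmas Rmod = module_ring_as_module[OF R]
lemmas Fmod = module_free[OF R]
lemmas JI = ideal_power_ideal[OF R \<aa>]
lemmas J_antimono = ideal_power_antimono[OF R \<aa>]
lemmas Jc = ideal_power_carr[OF R \<aa>]

lemma Jsub: "submodule (J n) R Rm"
  using ideal_iff_submodule[OF R] JI by blast

lemma S_iff: "x \<in> carrier S \<longleftrightarrow> (\<exists>r. coherent Rm J r \<and> x = mk r)"
proof -
  have "x \<in> carrier S \<longleftrightarrow> (\<forall>n. x n \<in> a_rcosets\<^bsub>Rm\<^esub> J n \<and> quot_proj Rm (J (Suc n)) (J n) (x (Suc n)) = x n)"
    by (simp add: completion_ring_def Let_def FactRing_def rcosets_ring_as_module)
  also have "\<dots> \<longleftrightarrow> (\<exists>r. coherent Rm J r \<and> x = mk r)"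
    using inverse_limit_iff[OF Rmod, where T=J and x=x, OF Jsub J_antimono[OF le_SucI[OF le_refl]]]
    unfolding coset_ring_as_module .
  finally show ?thesis .
qed

lemma coherentD: "coherent Rm J r ==> r n \<in> carrier R"
  by (simp add: coherent_def)

lemma mk_closed: "coherent Rm J r ==> mk r \<in> carrier S"
  using S_iff by blast

lemma mk_at_eq: "r \<in> carrier R ==> s \<in> carrier R ==> J n +>\<^bsub>R\<^esub> r = J n +>\<^bsub>R\<^esub> s \<longleftrightarrow> r \<ominus>\<^bsub>R\<^esub> s \<in> J n"
  using coset_eq_iff[OF Rmod Jsub, of r s n] by (simp add: coset_ring_as_module)

lemma mk_zero_at: "r \<in> carrier R ==> J n +>\<^bsub>R\<^esub> r = J n \<longleftrightarrow> r \<in> J n"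
  using mk_at_eq[of r "\<zero>\<^bsub>R\<^esub>" n] coset_zero[OF Rmod Jsub, of n] mod_cancel(4)[OF Rmod, of r "\<zero>\<^bsub>R\<^esub>"] by (simp add: coset_ring_as_module)

lemma S_add: "coherent Rm J r ==> coherent Rm J s ==> mk r \<oplus>\<^bsub>S\<^esub> mk s = mk (\<lambda>n. r n \<oplus>\<^bsub>R\<^esub> s n)"
  using coset_add[OF Rmod Jsub] coherentD
  by (simp add: completion_ring_def Let_def FactRing_def coset_ring_as_module set_add_ring_as_module fun_eq_iff)

lemma S_mult: "coherent Rm J r ==> coherent Rm J s ==> mk r \<otimes>\<^bsub>S\<^esub> mk s = mk (\<lambda>n. r n \<otimes>\<^bsub>R\<^esub> s n)"
  using ideal.rcoset_mult_add[OF JI] coherentD by (simp add: completion_ring_def Let_def FactRing_def fun_eq_iff)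

lemma S_one: "\<one>\<^bsub>S\<^esub> = mk (\<lambda>n. \<one>\<^bsub>R\<^esub>)"
  by (simp add: completion_ring_def Let_def FactRing_def)

lemma S_zero: "\<zero>\<^bsub>S\<^esub> = mk (\<lambda>n. \<zero>\<^bsub>R\<^esub>)"
  using coset_zero[OF Rmod Jsub] by (simp add: completion_ring_def Let_def FactRing_def coset_ring_as_module)

lemma S_zero_at: "\<zero>\<^bsub>S\<^esub> n = J n"
  by (simp add: completion_ring_def Let_def FactRing_def)

lemma coherent_const: "r \<in> carrier R ==> coherent Rm J (\<lambda>n. r)"
  using mod_refl[OF Rmod Jsub, of r] by (simp add: coherent_def)

lemma coherent_add:
  assumes "coherent Rm J r" "coherent Rm J s"
  shows "coherent Rm J (\<lambda>n. r n \<oplus>\<^bsub>R\<^esub> s n)"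
  unfolding coherent_def
proof
  fix n
  show "r n \<oplus>\<^bsub>R\<^esub> s n \<in> carrier Rm \<and> (r (Suc n) \<oplus>\<^bsub>R\<^esub> s (Suc n)) \<ominus>\<^bsub>Rm\<^esub> (r n \<oplus>\<^bsub>R\<^esub> s n) \<in> J n"
    using mod_add[OF Rmod Jsub, of "r (Suc n)" "r n" "s (Suc n)" "s n" n] assms by (simp add: coherent_def)
qed

lemma coherent_mult:
  assumes "coherent Rm J r" "coherent Rm J s"
  shows "coherent Rm J (\<lambda>n. r n \<otimes>\<^bsub>R\<^esub> s n)"
  unfolding coherent_def
proof
  fix n
  interpret Jn: ideal "J n" R by (rule JI)
  have c: "r n \<in> carrier R" "s n \<in> carrier R" "r (Suc n) \<in> carrier R" "s (Suc n) \<in> carrier R" using assms by (auto simp: coherent_def)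
  have "r (Suc n) \<otimes>\<^bsub>R\<^esub> s (Suc n) \<ominus>\<^bsub>R\<^esub> r (Suc n) \<otimes>\<^bsub>R\<^esub> s n = r (Suc n) \<otimes>\<^bsub>R\<^esub> (s (Suc n) \<ominus>\<^bsub>R\<^esub> s n)"
    using c by (simp add: a_minus_def r_distr r_minus)
  also have "\<dots> \<in> J n" using assms c by (intro Jn.I_l_closed) (auto simp: coherent_def)
  finally have 1: "r (Suc n) \<otimes>\<^bsub>R\<^esub> s (Suc n) \<ominus>\<^bsub>R\<^esub> r (Suc n) \<otimes>\<^bsub>R\<^esub> s n \<in> J n" .
  have "r (Suc n) \<otimes>\<^bsub>R\<^esub> s n \<ominus>\<^bsub>R\<^esub> r n \<otimes>\<^bsub>R\<^esub> s n = (r (Suc n) \<ominus>\<^bsub>R\<^esub> r n) \<otimes>\<^bsub>R\<^esub> s n"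
    using c by (simp add: a_minus_def l_distr l_minus)
  also have "\<dots> \<in> J n" using assms c by (intro Jn.I_r_closed) (auto simp: coherent_def)
  finally have 2: "r (Suc n) \<otimes>\<^bsub>R\<^esub> s n \<ominus>\<^bsub>R\<^esub> r n \<otimes>\<^bsub>R\<^esub> s n \<in> J n" .
  show "r n \<otimes>\<^bsub>R\<^esub> s n \<in> carrier Rm \<and> r (Suc n) \<otimes>\<^bsub>R\<^esub> s (Suc n) \<ominus>\<^bsub>Rm\<^esub> r n \<otimes>\<^bsub>R\<^esub> s n \<in> J n"
    using mod_trans[OF Rmod Jsub, of "r (Suc n) \<otimes>\<^bsub>R\<^esub> s (Suc n)" "r (Suc n) \<otimes>\<^bsub>R\<^esub> s n" "r n \<otimes>\<^bsub>R\<^esub> s n"] 1 2 c by simp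
qed

lemma coherent_uminus: "coherent Rm J r ==> coherent Rm J (\<lambda>n. \<ominus>\<^bsub>R\<^esub> r n)"
proof -
  assume r: "coherent Rm J r"
  have "coherent Rm J (\<lambda>n. (\<ominus>\<^bsub>R\<^esub> \<one>\<^bsub>R\<^esub>) \<otimes>\<^bsub>R\<^esub> r n)" by (rule coherent_mult[OF coherent_const r]) simp
  then show ?thesis using coherentD[OF r] by (simp add: l_minus)
qed

lemma cring_S: "cring S"
proof -
  have ex: "\<exists>r. coherent Rm J r \<and> x = mk r" if "x \<in> carrier S" for x using that S_iff by blast
  have 0: "coherent Rm J (\<lambda>n. \<zero>\<^bsub>R\<^esub>)" and 1: "coherent Rm J (\<lambda>n. \<one>\<^bsub>R\<^esub>)" using coherent_const by auto
  have ag: "abelian_group S"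
  proof (rule abelian_groupI)
    fix x assume "x \<in> carrier S"
    then obtain r where r: "coherent Rm J r" "x = mk r" using ex by blast
    show "\<zero>\<^bsub>S\<^esub> \<oplus>\<^bsub>S\<^esub> x = x" using r S_add[OF 0 r(1)] coherentD[OF r(1)] by (simp add: S_zero)
    show "\<exists>y\<in>carrier S. y \<oplus>\<^bsub>S\<^esub> x = \<zero>\<^bsub>S\<^esub>"
      using r S_add[OF coherent_uminus[OF r(1)] r(1)] coherentD[OF r(1)] mk_closed[OF coherent_uminus[OF r(1)]]
      by (intro bexI[of _ "mk (\<lambda>n. \<ominus>\<^bsub>R\<^esub> r n)"]) (auto simp: S_zero l_neg)
    fix y assume "y \<in> carrier S"
    then obtain s where s: "coherent Rm J s" "y = mk s" using ex by blast
    show "x \<oplus>\<^bsub>S\<^esub> y \<in> carrier S" using r s S_add mk_closed[OF coherent_add] by simp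
    show "x \<oplus>\<^bsub>S\<^esub> y = y \<oplus>\<^bsub>S\<^esub> x" using r s S_add coherentD by (simp add: a_comm)
    fix z assume "z \<in> carrier S"
    then obtain t where t: "coherent Rm J t" "z = mk t" using ex by blast
    show "x \<oplus>\<^bsub>S\<^esub> y \<oplus>\<^bsub>S\<^esub> z = x \<oplus>\<^bsub>S\<^esub> (y \<oplus>\<^bsub>S\<^esub> z)"
      using r s t S_add coherent_add coherentD by (simp add: a_assoc)
  next
    show "\<zero>\<^bsub>S\<^esub> \<in> carrier S" unfolding S_zero by (rule mk_closed[OF 0])
  qed
  have cm: "comm_monoid S"
  proof (rule comm_monoidI)
    fix x assume "x \<in> carrier S"
    then obtain r where r: "coherent Rm J r" "x = mk r" using ex by blast
    show "\<one>\<^bsub>S\<^esub> \<otimes>\<^bsub>S\<^esub> x = x" using r S_mult[OF 1 r(1)] coherentD[OF r(1)] by (simp add: S_one)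
    fix y assume "y \<in> carrier S"
    then obtain s where s: "coherent Rm J s" "y = mk s" using ex by blast
    show "x \<otimes>\<^bsub>S\<^esub> y \<in> carrier S" using r s S_mult mk_closed[OF coherent_mult] by simp
    show "x \<otimes>\<^bsub>S\<^esub> y = y \<otimes>\<^bsub>S\<^esub> x" using r s S_mult coherentD by (simp add: m_comm)
    fix z assume "z \<in> carrier S"
    then obtain t where t: "coherent Rm J t" "z = mk t" using ex by blast
    show "x \<otimes>\<^bsub>S\<^esub> y \<otimes>\<^bsub>S\<^esub> z = x \<otimes>\<^bsub>S\<^esub> (y \<otimes>\<^bsub>S\<^esub> z)"
      using r s t S_mult coherent_mult coherentD by (simp add: m_assoc)
  next
    show "\<one>\<^bsub>S\<^esub> \<in> carrier S" unfolding S_one by (rule mk_closed[OF 1])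
  qed
  show ?thesis
  proof (rule cringI[OF ag cm])
    fix x y z assume c: "x \<in> carrier S" "y \<in> carrier S" "z \<in> carrier S"
    obtain r where r: "coherent Rm J r" "x = mk r" using ex[OF c(1)] by blast
    obtain s where s: "coherent Rm J s" "y = mk s" using ex[OF c(2)] by blast
    obtain t where t: "coherent Rm J t" "z = mk t" using ex[OF c(3)] by blast
    note rst = r s t
    show "(x \<oplus>\<^bsub>S\<^esub> y) \<otimes>\<^bsub>S\<^esub> z = x \<otimes>\<^bsub>S\<^esub> z \<oplus>\<^bsub>S\<^esub> y \<otimes>\<^bsub>S\<^esub> z"
      using rst S_mult S_add coherent_mult coherent_add coherentD by (simp add: l_distr)
  qed
qed

sublocale S: cring S by (rule cring_S)

lemma S_uminus:
  assumes "coherent Rm J r"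
  shows "\<ominus>\<^bsub>S\<^esub> mk r = mk (\<lambda>n. \<ominus>\<^bsub>R\<^esub> r n)"
proof -
  have "mk (\<lambda>n. \<ominus>\<^bsub>R\<^esub> r n) \<oplus>\<^bsub>S\<^esub> mk r = \<zero>\<^bsub>S\<^esub>"
    using S_add[OF coherent_uminus[OF assms] assms] coherentD[OF assms] by (simp add: S_zero l_neg)
  then show ?thesis using S.minus_equality mk_closed[OF assms] mk_closed[OF coherent_uminus[OF assms]] by metis
qed

lemma \<iota>_mk: "\<iota> r = mk (\<lambda>n. r)"
  by (simp add: completion_map_def)

lemma \<iota>_hom: "\<iota> \<in> ring_hom R S"
  by (rule ring_hom_memI)
    (use mk_closed coherent_const S_add[OF coherent_const coherent_const] S_mult[OF coherent_const coherent_const] S_one in \<open>auto simp: \<iota>_mk\<close>)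

lemmas \<iota>_closed = ring_hom_closed[OF \<iota>_hom]

lemma \<iota>_zero: "\<iota> \<zero>\<^bsub>R\<^esub> = \<zero>\<^bsub>S\<^esub>"
  by (simp add: \<iota>_mk S_zero)

abbreviation "rs \<equiv> restrict_scalars \<iota>"

lemma module_rs: "module S X ==> module R (rs X)"
  by (rule module_restrict_scalars[OF R \<iota>_hom])

lemma submodule_rs: "module S X ==> submodule N S X ==> submodule N R (rs X)"
  by (rule submodule_restrict_scalars[OF R \<iota>_hom])

lemmas SRmod = module_ring_as_module[OF cring_S]
lemmas SFmod = module_free[OF cring_S]

lemma imul_ring:
  assumes "ideal I R"
  shows "imul Rm I (carrier Rm) = I"
proof
  interpret I: ideal I R by fact
  have s: "submodule I R Rm" using assms ideal_iff_submodule[OF R] by blast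
  show "imul Rm I (carrier Rm) \<subseteq> I"
    using imul_in_sub[OF s, of I "carrier Rm"] I.I_r_closed by auto
  show "I \<subseteq> imul Rm I (carrier Rm)"
  proof
    fix x assume x: "x \<in> I"
    then have "x \<otimes>\<^bsub>R\<^esub> \<one>\<^bsub>R\<^esub> \<in> imul Rm I (carrier Rm)"
      using imul_prod[OF Rmod assms module.carrier_is_submodule[OF Rmod] x, of "\<one>\<^bsub>R\<^esub>"] by simp
    then show "x \<in> imul Rm I (carrier Rm)" using x I.Icarr by simp
  qed
qed

subsection \<open>Completion of modules\<close>

definition JM :: "('a, 'm, 's) module_scheme \<Rightarrow> nat \<Rightarrow> 'm set" where
  "JM M n = imul M (J n) (carrier M)"

abbreviation "Mhat \<equiv> completion_module R \<aa>"
abbreviation mkM :: "('a, 'm, 's) module_scheme \<Rightarrow> (nat \<Rightarrow> 'm) \<Rightarrow> nat \<Rightarrow> 'm set" where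
  "mkM M v \<equiv> (\<lambda>n. JM M n +>\<^bsub>M\<^esub> v n)"

context
  fixes M :: "('a, 'm, 's) module_scheme" (structure)
  assumes M: "module R M"
begin

interpretation M: module R M by (rule M)

private abbreviation "Mh \<equiv> completion_module R \<aa> M"

lemma JMsub: "submodule (JM M n) R M"
  unfolding JM_def by (rule submodule_imul[OF M JI M.carrier_is_submodule])

lemma JM_antimono: "m \<le> n ==> JM M n \<subseteq> (JM M) m"
  unfolding JM_def by (rule imul_mono[OF J_antimono subset_refl])

lemma ideal_smult_JM: "ideal_smult R (J n) M = JM M n"
  unfolding JM_def by (rule ideal_smult_imul[OF M JI])

lemma Mh_iff: "x \<in> carrier Mh \<longleftrightarrow> (\<exists>v. coherent M (JM M) v \<and> x = mkM M v)"
proof -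
  have "x \<in> carrier Mh \<longleftrightarrow> (\<forall>n. x n \<in> a_rcosets JM M n \<and> quot_proj M ((JM M) (Suc n)) (JM M n) (x (Suc n)) = x n)"
    by (simp add: completion_module_def Let_def quot_module_simps ideal_smult_JM)
  also have "\<dots> \<longleftrightarrow> (\<exists>v. coherent M (JM M) v \<and> x = mkM M v)"
    by (rule inverse_limit_iff[OF M, where T="JM M" and x=x, OF JMsub JM_antimono[OF le_SucI[OF le_refl]]])
  finally show ?thesis .
qed

lemma coherentMD: "coherent M (JM M) v ==> v n \<in> carrier M"
  by (simp add: coherent_def)

lemma Mh_add: "coherent M (JM M) v ==> coherent M (JM M) w ==> mkM M v \<oplus>\<^bsub>Mh\<^esub> mkM M w = mkM M (\<lambda>n. v n \<oplus> w n)"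
  using coset_add[OF M JMsub] coherentMD
  by (simp add: completion_module_def Let_def quot_module_simps ideal_smult_JM fun_eq_iff)

lemma Mh_zero: "\<zero>\<^bsub>Mh\<^esub> = mkM M (\<lambda>n. \<zero>)"
  using coset_zero[OF M JMsub] by (simp add: completion_module_def Let_def quot_module_simps ideal_smult_JM)

lemma Mh_smult:
  assumes "coherent Rm J r" "coherent M (JM M) v"
  shows "mk r \<odot>\<^bsub>Mh\<^esub> mkM M v = mkM M (\<lambda>n. r n \<odot> v n)"
proof
  fix n
  have c: "r n \<in> carrier R" "v n \<in> carrier M" using assms by (auto simp: coherent_def)
  have "s \<odot>\<^bsub>quot_module R M (JM M n)\<^esub> (JM M n +> v n) = JM M n +> (r n \<odot> v n)" if "s \<in> J n +>\<^bsub>R\<^esub> r n" for s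
  proof -
    have s: "s \<in> carrier R" "s \<ominus>\<^bsub>R\<^esub> r n \<in> J n"
      using that coset_elem[OF Rmod Jsub, of "r n" s n] c by (auto simp: coset_ring_as_module)
    have "s \<odot> v n \<ominus> r n \<odot> v n = (s \<ominus>\<^bsub>R\<^esub> r n) \<odot> v n"
      using s c by (simp add: a_minus_def M.smult_l_distr M.smult_l_minus)
    also have "\<dots> \<in> JM M n" unfolding JM_def by (rule imul_prod[OF M JI M.carrier_is_submodule s(2) c(2)])
    finally show ?thesis using quot_smult[OF M JMsub c(2) s(1)] coset_eq_iff[OF M JMsub] s c by simp
  qed
  moreover have "r n \<in> J n +>\<^bsub>R\<^esub> r n"
    using coset_elem[OF Rmod Jsub, of "r n" "r n" n] c mod_refl[OF Rmod Jsub, of "r n" n] by (simp add: coset_ring_as_module)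
  ultimately show "(mk r \<odot>\<^bsub>Mh\<^esub> mkM M v) n = JM M n +> (r n \<odot> v n)"
    by (auto simp: completion_module_def Let_def ideal_smult_JM)
qed

lemma mkM_at_eq: "x \<in> carrier M ==> y \<in> carrier M ==> JM M n +> x = JM M n +> y \<longleftrightarrow> x \<ominus> y \<in> JM M n"
  by (rule coset_eq_iff[OF M JMsub])

lemma coherentM_add:
  assumes "coherent M (JM M) v" "coherent M (JM M) w"
  shows "coherent M (JM M) (\<lambda>n. v n \<oplus> w n)"
  using mod_add[OF M JMsub] assms by (simp add: coherent_def)

lemma coherentM_smult:
  assumes "coherent Rm J r" "coherent M (JM M) v"
  shows "coherent M (JM M) (\<lambda>n. r n \<odot> v n)"
  unfolding coherent_def
proof
  fix n
  have c: "r n \<in> carrier R" "v n \<in> carrier M" "r (Suc n) \<in> carrier R" "v (Suc n) \<in> carrier M" using assms by (auto simp: coherent_def)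
  have "r (Suc n) \<odot> v (Suc n) \<ominus> r (Suc n) \<odot> v n = r (Suc n) \<odot> (v (Suc n) \<ominus> v n)"
    using c by (simp add: a_minus_def M.smult_r_distr M.smult_r_minus)
  also have "\<dots> \<in> JM M n" using assms c by (intro sub_smult[OF JMsub]) (auto simp: coherent_def)
  finally have 1: "r (Suc n) \<odot> v (Suc n) \<ominus> r (Suc n) \<odot> v n \<in> JM M n" .
  have "r (Suc n) \<odot> v n \<ominus> r n \<odot> v n = (r (Suc n) \<ominus>\<^bsub>R\<^esub> r n) \<odot> v n"
    using c by (simp add: a_minus_def M.smult_l_distr M.smult_l_minus)
  also have "\<dots> \<in> JM M n" unfolding JM_def by (rule imul_prod[OF M JI M.carrier_is_submodule _ c(2)]) (use assms in \<open>simp add: coherent_def\<close>)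
  finally have 2: "r (Suc n) \<odot> v n \<ominus> r n \<odot> v n \<in> JM M n" .
  show "r n \<odot> v n \<in> carrier M \<and> r (Suc n) \<odot> v (Suc n) \<ominus> r n \<odot> v n \<in> JM M n"
    using mod_trans[OF M JMsub _ _ _ 1 2] c by simp
qed

lemma coherentM_const: "y \<in> carrier M ==> coherent M (JM M) (\<lambda>n. y)"
  using mod_refl[OF M JMsub, of y] by (simp add: coherent_def)

lemma mkM_closed: "coherent M (JM M) v ==> mkM M v \<in> carrier Mh"
  using Mh_iff by blast

lemma module_Mh: "module S Mh"
proof -
  have ex: "\<exists>r. coherent M (JM M) r \<and> x = mkM M r" if "x \<in> carrier Mh" for x using that Mh_iff by blast
  have exS: "\<exists>r. coherent Rm J r \<and> x = mk r" if "x \<in> carrier S" for x using that S_iff by blast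
  have 0: "coherent M (JM M) (\<lambda>n. \<zero>)" using coherentM_const by auto
  have 1: "coherent Rm J (\<lambda>n. \<one>\<^bsub>R\<^esub>)" using coherent_const by auto
  have ag: "abelian_group Mh"
  proof (rule abelian_groupI)
    fix x assume "x \<in> carrier Mh"
    then obtain r where r: "coherent M (JM M) r" "x = mkM M r" using ex by blast
    show "\<zero>\<^bsub>Mh\<^esub> \<oplus>\<^bsub>Mh\<^esub> x = x" using r Mh_add[OF 0 r(1)] coherentMD[OF r(1)] by (simp add: Mh_zero)
    have m: "coherent M (JM M) (\<lambda>n. (\<ominus>\<^bsub>R\<^esub> \<one>\<^bsub>R\<^esub>) \<odot> r n)" by (rule coherentM_smult[OF coherent_const r(1)]) simp
    show "\<exists>y\<in>carrier Mh. y \<oplus>\<^bsub>Mh\<^esub> x = \<zero>\<^bsub>Mh\<^esub>"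
      using r Mh_add[OF m r(1)] coherentMD[OF r(1)] mkM_closed[OF m]
      by (intro bexI[of _ "mkM M (\<lambda>n. (\<ominus>\<^bsub>R\<^esub> \<one>\<^bsub>R\<^esub>) \<odot> r n)"]) (auto simp: Mh_zero M.smult_l_minus M.l_neg)
    fix y assume "y \<in> carrier Mh"
    then obtain s where s: "coherent M (JM M) s" "y = mkM M s" using ex by blast
    show "x \<oplus>\<^bsub>Mh\<^esub> y \<in> carrier Mh" using r s Mh_add mkM_closed[OF coherentM_add] by simp
    show "x \<oplus>\<^bsub>Mh\<^esub> y = y \<oplus>\<^bsub>Mh\<^esub> x" using r s Mh_add coherentMD by (simp add: M.a_comm)
    fix z assume "z \<in> carrier Mh"
    then obtain t where t: "coherent M (JM M) t" "z = mkM M t" using ex by blast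
    show "x \<oplus>\<^bsub>Mh\<^esub> y \<oplus>\<^bsub>Mh\<^esub> z = x \<oplus>\<^bsub>Mh\<^esub> (y \<oplus>\<^bsub>Mh\<^esub> z)"
      using r s t Mh_add coherentM_add coherentMD by (simp add: M.a_assoc)
  next
    show "\<zero>\<^bsub>Mh\<^esub> \<in> carrier Mh" unfolding Mh_zero by (rule mkM_closed[OF 0])
  qed
  show ?thesis
  proof (rule moduleI[OF cring_S ag])
    fix a x assume c: "a \<in> carrier S" "x \<in> carrier Mh"
    obtain r where r: "coherent Rm J r" "a = mk r" using exS[OF c(1)] by blast
    obtain v where v: "coherent M (JM M) v" "x = mkM M v" using ex[OF c(2)] by blast
    note rv = r v
    show "a \<odot>\<^bsub>Mh\<^esub> x \<in> carrier Mh" using rv Mh_smult mkM_closed[OF coherentM_smult] by simp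
    fix b assume "b \<in> carrier S"
    then obtain s where s: "coherent Rm J s" "b = mk s" using exS by metis
    show "(a \<oplus>\<^bsub>S\<^esub> b) \<odot>\<^bsub>Mh\<^esub> x = a \<odot>\<^bsub>Mh\<^esub> x \<oplus>\<^bsub>Mh\<^esub> b \<odot>\<^bsub>Mh\<^esub> x"
      using rv s Mh_smult S_add Mh_add coherentM_smult coherent_add coherentD coherentMD by (simp add: M.smult_l_distr)
    show "a \<otimes>\<^bsub>S\<^esub> b \<odot>\<^bsub>Mh\<^esub> x = a \<odot>\<^bsub>Mh\<^esub> (b \<odot>\<^bsub>Mh\<^esub> x)"
      using rv s Mh_smult S_mult coherentM_smult coherent_mult coherentD coherentMD by (simp add: M.smult_assoc1)
  next
    fix a x y assume c: "a \<in> carrier S" "x \<in> carrier Mh" "y \<in> carrier Mh"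
    obtain r where r: "coherent Rm J r" "a = mk r" using exS[OF c(1)] by blast
    obtain v where v: "coherent M (JM M) v" "x = mkM M v" using ex[OF c(2)] by blast
    obtain w where w: "coherent M (JM M) w" "y = mkM M w" using ex[OF c(3)] by blast
    note rv = r v w
    show "a \<odot>\<^bsub>Mh\<^esub> (x \<oplus>\<^bsub>Mh\<^esub> y) = a \<odot>\<^bsub>Mh\<^esub> x \<oplus>\<^bsub>Mh\<^esub> a \<odot>\<^bsub>Mh\<^esub> y"
      using rv Mh_smult Mh_add coherentM_smult coherentM_add coherentD coherentMD by (simp add: M.smult_r_distr)
  next
    fix x assume "x \<in> carrier Mh"
    then obtain v where v: "coherent M (JM M) v" "x = mkM M v" using ex by metis
    then show "\<one>\<^bsub>S\<^esub> \<odot>\<^bsub>Mh\<^esub> x = x" using Mh_smult[OF 1 v(1)] coherentMD[OF v(1)] by (simp add: S_one)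
  qed
qed

end

end

text \<open>The case of the zero map, where only membership in \<open>C\<close> is imposed on the
  sequence.\<close>

lemma completion_generates_sub:
  fixes A (structure)
  assumes "cring R" "noetherian_ring R" "ideal \<aa> R" "fin_gen_module R A" "submodule C R A"
  obtains k g where "\<And>i. i < k ==> g i \<in> C"
    "\<And>v. (\<And>n. v n \<in> C) ==> (\<And>n. v (Suc n) \<ominus> v n \<in> imul A (ideal_power R \<aa> n) (carrier A)) ==>
      \<exists>r. (\<forall>i<k. \<forall>n. r i n \<in> carrier R \<and> r i (Suc n) \<ominus>\<^bsub>R\<^esub> r i n \<in> ideal_power R \<aa> n) \<and>
        (\<forall>n. v n \<ominus> lincomb A g (\<lambda>i. r i n) k \<in> imul A (ideal_power R \<aa> n) (carrier A))"
proof -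
  have A: "module R A" using assms(4) by (simp add: fin_gen_module_def)
  interpret module R A by (rule A)
  have z: "\<exists>l\<in>{\<zero>}. \<zero> \<ominus> l \<in> imul A (ideal_power R \<aa> n) (carrier A)" for n
    using mod_refl[OF A submodule_imul[OF A ideal_power_ideal[OF assms(1,3)] carrier_is_submodule], of "\<zero>" n] by simp
  show thesis
  proof (rule completion_generates[OF assms(1-4,4) lin_const_zero[OF A] assms(5) submodule_zero[OF A]])
    fix k g
    assume 1: "\<And>i. i < k ==> g i \<in> C"
      and 2: "\<And>v. (\<And>n. v n \<in> C) ==> (\<And>n. v (Suc n) \<ominus> v n \<in> imul A (ideal_power R \<aa> n) (carrier A)) ==>
        (\<And>n. \<exists>l\<in>{\<zero>}. \<zero> \<ominus> l \<in> imul A (ideal_power R \<aa> n) (carrier A)) ==>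
        \<exists>r. (\<forall>i<k. \<forall>n. r i n \<in> carrier R \<and> r i (Suc n) \<ominus>\<^bsub>R\<^esub> r i n \<in> ideal_power R \<aa> n) \<and>
        (\<forall>n. v n \<ominus> lincomb A g (\<lambda>i. r i n) k \<in> imul A (ideal_power R \<aa> n) (carrier A))"
    show thesis by (rule that[OF 1 2[OF _ _ z]])
  qed
qed

context adic
begin

section \<open>Closures of submodules in the completion\<close>

definition \<iota>M :: "('a, 'm, 's) module_scheme \<Rightarrow> 'm \<Rightarrow> nat \<Rightarrow> 'm set" where
  "\<iota>M M y = mkM M (\<lambda>n. y)"

text \<open>The adic closure of the image of \<open>N\<close>, described componentwise so that it
  can be tested at one level at a time.\<close>

definition clos :: "('a, 'm, 's) module_scheme \<Rightarrow> 'm set \<Rightarrow> (nat \<Rightarrow> 'm set) set" where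
  "clos M N = {x \<in> carrier (Mhat M). \<forall>n. \<exists>y\<in>N. x n = JM M n +>\<^bsub>M\<^esub> y}"

text \<open>Computations modulo the \<open>n\<close>-th power are done with such representatives,
  without choosing a whole coherent sequence.\<close>

definition rep :: "('a, 'm, 's) module_scheme \<Rightarrow> nat \<Rightarrow> (nat \<Rightarrow> 'm set) \<Rightarrow> 'm \<Rightarrow> bool" where
  "rep M n x y \<longleftrightarrow> x \<in> carrier (Mhat M) \<and> y \<in> carrier M \<and> x n = JM M n +>\<^bsub>M\<^esub> y"

context
  fixes M :: "('a, 'm, 's) module_scheme" (structure)
  assumes M: "module R M"
begin

interpretation M: module R M by (rule M)

lemma lin_\<iota>M: "lin R M (rs (Mhat M)) (\<iota>M M)"
  unfolding lin_def \<iota>M_def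
  using mkM_closed[OF M coherentM_const[OF M]] Mh_add[OF M coherentM_const[OF M] coherentM_const[OF M]]
    Mh_smult[OF M coherent_const coherentM_const[OF M]]
  by (auto simp: \<iota>_mk)

lemma mkM_eq_iff:
  "coherent M (JM M) v ==> coherent M (JM M) w ==> mkM M v = mkM M w \<longleftrightarrow> (\<forall>n. v n \<ominus> w n \<in> JM M n)"
  using mkM_at_eq[OF M coherentMD[OF M] coherentMD[OF M]] by (simp add: fun_eq_iff)

text \<open>Any choice of representatives in \<open>N\<close> is coherent, since it differs from a
  coherent sequence by elements of \<open>JM M n\<close> at level \<open>n\<close>.\<close>

lemma clos_coherent:
  assumes "x \<in> clos M N" "N \<subseteq> carrier M"
  obtains v where "coherent M (JM M) v" "x = mkM M v" "\<And>n. v n \<in> N"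
proof -
  obtain w where w: "coherent M (JM M) w" "x = mkM M w" using assms(1) Mh_iff[OF M] unfolding clos_def by blast
  have "\<forall>n. \<exists>y. y \<in> N \<and> x n = JM M n +> y" using assms(1) unfolding clos_def by blast
  from choice[OF this] obtain v where v: "\<And>n. v n \<in> N" "\<And>n. x n = JM M n +> v n" by blast
  have vc: "v n \<in> carrier M" for n using v(1) assms(2) by blast
  have wc: "w n \<in> carrier M" for n using w(1) by (simp add: coherent_def)
  have vw: "v n \<ominus> w n \<in> JM M n" for n using v(2)[of n] w(2) mkM_at_eq[OF M vc wc] by metis
  have "v (Suc n) \<ominus> v n \<in> JM M n" for n
  proof -
    have "v (Suc n) \<ominus> w (Suc n) \<in> JM M n" using vw[of "Suc n"] JM_antimono[OF M, of n "Suc n"] by auto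
    then have "v (Suc n) \<ominus> w n \<in> JM M n"
      using mod_trans[OF M JMsub[OF M] vc wc wc] w(1) by (simp add: coherent_def)
    then show ?thesis using mod_trans[OF M JMsub[OF M] vc wc vc _ mod_sym[OF M JMsub[OF M] vc wc vw]] by blast
  qed
  then show ?thesis using that[of v] v vc by (simp add: coherent_def fun_eq_iff)
qed

lemma closI: "coherent M (JM M) v ==> (\<And>n. v n \<in> N) ==> mkM M v \<in> clos M N"
  using mkM_closed[OF M] by (auto simp: clos_def)

lemma clos_carr: "x \<in> clos M N ==> x \<in> carrier (Mhat M)"
  by (simp add: clos_def)

lemma clos_mono: "N \<subseteq> N' ==> clos M N \<subseteq> clos M N'"
  unfolding clos_def by blast

lemma submodule_clos:
  assumes "submodule N R M"
  shows "submodule (clos M N) S (Mhat M)"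
proof (rule submoduleI'[OF module_Mh[OF M]])
  have Nc: "N \<subseteq> carrier M" using sub_carr[OF assms] by blast
  show "clos M N \<subseteq> carrier (Mhat M)" using clos_carr by blast
  show "\<zero>\<^bsub>Mhat M\<^esub> \<in> clos M N"
    unfolding Mh_zero[OF M] by (rule closI[OF coherentM_const[OF M]]) (use sub_zero[OF assms] in auto)
  fix x assume "x \<in> clos M N"
  then obtain v where v: "coherent M (JM M) v" "x = mkM M v" "\<And>n. v n \<in> N" using clos_coherent[OF _ Nc] by blast
  show "x \<oplus>\<^bsub>Mhat M\<^esub> y \<in> clos M N" if y: "y \<in> clos M N" for y
  proof -
    obtain w where w: "coherent M (JM M) w" "y = mkM M w" "\<And>n. w n \<in> N" using clos_coherent[OF y Nc] by blast
    show ?thesis unfolding v(2) w(2) Mh_add[OF M v(1) w(1)]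
      by (rule closI[OF coherentM_add[OF M v(1) w(1)]]) (rule sub_add[OF assms v(3) w(3)])
  qed
  show "r \<odot>\<^bsub>Mhat M\<^esub> x \<in> clos M N" if r: "r \<in> carrier S" for r
  proof -
    obtain s where s: "coherent Rm J s" "r = mk s" using r S_iff by blast
    show ?thesis unfolding v(2) s(2) Mh_smult[OF M s(1) v(1)]
      by (rule closI[OF coherentM_smult[OF M s(1) v(1)]]) (rule sub_smult[OF assms coherentD[OF s(1)] v(3)])
  qed
qed

lemma clos_carrier: "clos M (carrier M) = carrier (Mhat M)"
proof -
  have "x \<in> clos M (carrier M)" if "x \<in> carrier (Mhat M)" for x
    using that Mh_iff[OF M] closI coherentMD[OF M] by metis
  then show ?thesis using clos_carr by blast
qed

lemma clos_zero: "clos M {\<zero>} = {\<zero>\<^bsub>Mhat M\<^esub>}"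
proof (intro equalityI subsetI)
  fix x assume "x \<in> clos M {\<zero>}"
  then have "x = mkM M (\<lambda>n. \<zero>)" by (auto simp: clos_def)
  then show "x \<in> {\<zero>\<^bsub>Mhat M\<^esub>}" using Mh_zero[OF M] by simp
next
  fix x assume "x \<in> {\<zero>\<^bsub>Mhat M\<^esub>}"
  then show "x \<in> clos M {\<zero>}" using sub_zero[OF submodule_clos[OF submodule_zero[OF M]]] by simp
qed

lemma \<iota>M_clos: "submodule N R M ==> y \<in> N ==> \<iota>M M y \<in> clos M N"
  unfolding \<iota>M_def by (rule closI[OF coherentM_const[OF M]]) (auto dest: sub_carr)

lemma mkM_lincomb:
  assumes "\<And>i. i < k ==> coherent Rm J (r i)" "\<And>i. i < k ==> coherent M (JM M) (v i)"
  shows "coherent M (JM M) (\<lambda>n. lincomb M (\<lambda>i. v i n) (\<lambda>i. r i n) k) \<and>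
    lincomb (Mhat M) (\<lambda>i. mkM M (v i)) (\<lambda>i. mk (r i)) k = mkM M (\<lambda>n. lincomb M (\<lambda>i. v i n) (\<lambda>i. r i n) k)"
  using assms
proof (induction k)
  case 0
  then show ?case using coherentM_const[OF M] Mh_zero[OF M] by simp
next
  case (Suc k)
  then have IH: "coherent M (JM M) (\<lambda>n. lincomb M (\<lambda>i. v i n) (\<lambda>i. r i n) k)"
    "lincomb (Mhat M) (\<lambda>i. mkM M (v i)) (\<lambda>i. mk (r i)) k = mkM M (\<lambda>n. lincomb M (\<lambda>i. v i n) (\<lambda>i. r i n) k)" by auto
  have k: "coherent Rm J (r k)" "coherent M (JM M) (v k)" using Suc.prems by auto
  show ?case
    using coherentM_add[OF M IH(1) coherentM_smult[OF M k]] Mh_add[OF M IH(1) coherentM_smult[OF M k]] Mh_smult[OF M k] IH(2) by simp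
qed

text \<open>The coefficients obtained from \<open>completion_generates_sub\<close> are coherent,
  hence elements of the completed ring. This gives finite generation of closures directly from the
  Noetherian property of \<open>R\<close>.\<close>

lemma clos_generated:
  assumes "fin_gen_module R M" "submodule N R M"
  obtains k g where "\<And>i. i < k ==> g i \<in> N" "generates S (Mhat M) (clos M N) k (\<lambda>i. \<iota>M M (g i))"
proof -
  have Nc: "N \<subseteq> carrier M" using sub_carr[OF assms(2)] by blast
  obtain k g where g: "\<And>i. i < k ==> g i \<in> N" "\<And>v. (\<And>n. v n \<in> N) ==> (\<And>n. v (Suc n) \<ominus> v n \<in> imul M (J n) (carrier M)) ==>
      \<exists>r. (\<forall>i<k. \<forall>n. r i n \<in> carrier R \<and> r i (Suc n) \<ominus>\<^bsub>R\<^esub> r i n \<in> J n) \<and>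
        (\<forall>n. v n \<ominus> lincomb M g (\<lambda>i. r i n) k \<in> imul M (J n) (carrier M))"
    using completion_generates_sub[OF R NR \<aa> assms] by blast
  have "generates S (Mhat M) (clos M N) k (\<lambda>i. \<iota>M M (g i))"
    unfolding generates_def
  proof (intro conjI allI impI ballI)
    fix i assume "i < k" then show "\<iota>M M (g i) \<in> clos M N" using \<iota>M_clos[OF assms(2)] g(1) by blast
  next
    fix x assume "x \<in> clos M N"
    then obtain v where v: "coherent M (JM M) v" "x = mkM M v" "\<And>n. v n \<in> N" using clos_coherent[OF _ Nc] by blast
    have "v (Suc n) \<ominus> v n \<in> imul M (J n) (carrier M)" for n using v(1) by (simp add: coherent_def JM_def)
    from g(2)[OF v(3) this] obtain r where r: "\<forall>i<k. \<forall>n. r i n \<in> carrier R \<and> r i (Suc n) \<ominus>\<^bsub>R\<^esub> r i n \<in> J n"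
      "\<forall>n. v n \<ominus> lincomb M g (\<lambda>i. r i n) k \<in> imul M (J n) (carrier M)" by blast
    have rc: "\<And>i. i < k ==> coherent Rm J (r i)" using r(1) by (simp add: coherent_def)
    have gc: "\<And>i. i < k ==> coherent M (JM M) (\<lambda>n. g i)" using coherentM_const[OF M] g(1) Nc by blast
    note L = mkM_lincomb[where v="\<lambda>i n. g i", OF rc gc]
    have "x = lincomb (Mhat M) (\<lambda>i. \<iota>M M (g i)) (\<lambda>i. mk (r i)) k"
      unfolding v(2) \<iota>M_def using L mkM_eq_iff[OF v(1)] r(2) unfolding JM_def by simp
    then show "\<exists>c. (\<forall>i<k. c i \<in> carrier S) \<and> x = lincomb (Mhat M) (\<lambda>i. \<iota>M M (g i)) c k"
      using rc mk_closed by (intro exI[of _ "\<lambda>i. mk (r i)"]) auto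
  qed
  then show ?thesis using that g(1) by blast
qed

lemma rep_mkM: "coherent M (JM M) v ==> rep M n (mkM M v) (v n)"
  using mkM_closed[OF M] coherentMD[OF M] by (simp add: rep_def)

lemma rep_\<iota>M: "y \<in> carrier M ==> rep M n (\<iota>M M y) y"
  unfolding \<iota>M_def using rep_mkM[OF coherentM_const[OF M]] by blast

lemma rep_unique: "rep M n x y ==> rep M n x y' ==> y \<ominus> y' \<in> JM M n"
  using mkM_at_eq[OF M] by (auto simp: rep_def)

lemma rep_mod: "rep M n x y ==> y' \<in> carrier M ==> y' \<ominus> y \<in> JM M n ==> rep M n x y'"
  using mkM_at_eq[OF M, of y' y n] by (auto simp: rep_def)

lemma rep_clos:
  assumes "x \<in> clos M N" "submodule N R M"
  shows "\<exists>y\<in>N. rep M n x y"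
proof -
  obtain y where y: "y \<in> N" "x n = JM M n +> y" using assms(1) unfolding clos_def by blast
  then have "rep M n x y" using clos_carr[OF assms(1)] sub_carr[OF assms(2)] by (simp add: rep_def)
  with y(1) show ?thesis by blast
qed

lemma rep_coherent:
  assumes "rep M n x y"
  obtains v where "coherent M (JM M) v" "x = mkM M v" "v n \<ominus> y \<in> JM M n" "y \<in> carrier M"
proof -
  obtain v where v: "coherent M (JM M) v" "x = mkM M v" using assms Mh_iff[OF M] unfolding rep_def by blast
  then show ?thesis using that[OF v] rep_unique[OF rep_mkM[OF v(1)], of n y] assms by (simp add: rep_def)
qed

lemma rep_add:
  assumes "rep M n x y" "rep M n x' y'"
  shows "rep M n (x \<oplus>\<^bsub>Mhat M\<^esub> x') (y \<oplus> y')"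
proof -
  obtain v where v: "coherent M (JM M) v" "x = mkM M v" "v n \<ominus> y \<in> JM M n" "y \<in> carrier M" using rep_coherent[OF assms(1)] by blast
  obtain w where w: "coherent M (JM M) w" "x' = mkM M w" "w n \<ominus> y' \<in> JM M n" "y' \<in> carrier M" using rep_coherent[OF assms(2)] by blast
  note c = coherentMD[OF M v(1), of n] coherentMD[OF M w(1), of n]
  have "rep M n (x \<oplus>\<^bsub>Mhat M\<^esub> x') (v n \<oplus> w n)"
    unfolding v(2) w(2) Mh_add[OF M v(1) w(1)] by (rule rep_mkM[OF coherentM_add[OF M v(1) w(1)]])
  moreover have "(y \<oplus> y') \<ominus> (v n \<oplus> w n) \<in> JM M n"
    by (rule mod_add[OF M JMsub[OF M] v(4) c(1) w(4) c(2) mod_sym[OF M JMsub[OF M] c(1) v(4,3)] mod_sym[OF M JMsub[OF M] c(2) w(4,3)]])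
  ultimately show ?thesis using rep_mod v(4) w(4) by simp
qed

lemma rep_smult:
  assumes "rep M n x y" "coherent Rm J r"
  shows "rep M n (mk r \<odot>\<^bsub>Mhat M\<^esub> x) (r n \<odot> y)"
proof -
  obtain v where v: "coherent M (JM M) v" "x = mkM M v" "v n \<ominus> y \<in> JM M n" "y \<in> carrier M" using rep_coherent[OF assms(1)] by blast
  note c = coherentMD[OF M v(1), of n] coherentD[OF assms(2), of n]
  have "rep M n (mk r \<odot>\<^bsub>Mhat M\<^esub> x) (r n \<odot> v n)"
    unfolding v(2) Mh_smult[OF M assms(2) v(1)] by (rule rep_mkM[OF coherentM_smult[OF M assms(2) v(1)]])
  moreover have "r n \<odot> y \<ominus> r n \<odot> v n \<in> JM M n"
  proof -
    have "r n \<odot> y \<ominus> r n \<odot> v n = r n \<odot> (y \<ominus> v n)"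
      using c v(4) by (simp add: a_minus_def M.smult_r_distr M.smult_r_minus)
    then show ?thesis using sub_smult[OF JMsub[OF M] c(2) mod_sym[OF M JMsub[OF M] c(1) v(4,3)]] by simp
  qed
  ultimately show ?thesis using rep_mod v(4) c by simp
qed

lemma rep_smult_\<iota>: "rep M n x y ==> r \<in> carrier R ==> rep M n (\<iota> r \<odot>\<^bsub>Mhat M\<^esub> x) (r \<odot> y)"
  unfolding \<iota>_mk by (rule rep_smult[OF _ coherent_const])

lemma rep_lincomb:
  "(\<And>i. i < k ==> rep M n (f i) (y i)) ==> (\<And>i. i < k ==> c i \<in> carrier R) ==>
    rep M n (lincomb (rs (Mhat M)) f c k) (lincomb M y c k)"
proof (induction k)
  case 0
  then show ?case using rep_mkM[OF coherentM_const[OF M], of "\<zero>"] Mh_zero[OF M] by simp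
next
  case (Suc k)
  have "rep M n (lincomb (rs (Mhat M)) f c k) (lincomb M y c k)" by (rule Suc.IH) (use Suc.prems in auto)
  moreover have "rep M n (\<iota> (c k) \<odot>\<^bsub>Mhat M\<^esub> f k) (c k \<odot> y k)" by (rule rep_smult_\<iota>) (use Suc.prems in auto)
  ultimately show ?case using rep_add by simp
qed

lemma rep_uminus: "rep M n x y ==> rep M n (\<ominus>\<^bsub>Mhat M\<^esub> x) (\<ominus> y)"
proof -
  assume r: "rep M n x y"
  interpret H: module S "Mhat M" by (rule module_Mh[OF M])
  have c: "x \<in> carrier (Mhat M)" "y \<in> carrier M" using r by (auto simp: rep_def)
  have 1: "\<iota> (\<ominus>\<^bsub>R\<^esub> \<one>\<^bsub>R\<^esub>) = \<ominus>\<^bsub>S\<^esub> \<one>\<^bsub>S\<^esub>"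
    using S_uminus[OF coherent_const[OF one_closed]] by (simp add: \<iota>_mk S_one)
  show ?thesis using rep_smult_\<iota>[OF r, of "\<ominus>\<^bsub>R\<^esub> \<one>\<^bsub>R\<^esub>"] c 1 by (simp add: H.smult_l_minus M.smult_l_minus)
qed

lemma rep_minus: "rep M n x y ==> rep M n x' y' ==> rep M n (x \<ominus>\<^bsub>Mhat M\<^esub> x') (y \<ominus> y')"
  unfolding a_minus_def by (intro rep_add rep_uminus)

lemma imul_rep_zero:
  assumes "x \<in> imul (rs (Mhat M)) (J n) (carrier (Mhat M))"
  shows "rep M n x \<zero>"
  using assms
proof induction
  case imul_zero
  then show ?case using rep_mkM[OF coherentM_const[OF M], of "\<zero>"] Mh_zero[OF M] by simp
next
  case (imul_step y r x)
  have rc: "r \<in> carrier R" using imul_step(2) Jc by blast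
  obtain v where v: "coherent M (JM M) v" "x = mkM M v" using imul_step(3) Mh_iff[OF M] by blast
  have "rep M n (\<iota> r \<odot>\<^bsub>Mhat M\<^esub> x) (r \<odot> v n)" unfolding v(2) by (rule rep_smult_\<iota>[OF rep_mkM[OF v(1)] rc])
  moreover have "r \<odot> v n \<in> JM M n"
    unfolding JM_def by (rule imul_prod[OF M JI M.carrier_is_submodule imul_step(2) coherentMD[OF M v(1)]])
  then have "\<zero> \<ominus> r \<odot> v n \<in> JM M n" using sub_minus[OF JMsub[OF M] sub_zero[OF JMsub[OF M]]] by blast
  ultimately have "rep M n (\<iota> r \<odot>\<^bsub>Mhat M\<^esub> x) \<zero>" using rep_mod by blast
  from rep_add[OF imul_step.IH this] show ?case by simp
qed

text \<open>Closures are closed: an error in the \<open>n\<close>-th power does not affect the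
  \<open>n\<close>-th component. It is here that the completion being separated is used.\<close>

lemma in_closI:
  assumes "submodule N R M" "y \<in> carrier (Mhat M)"
    "\<And>n. \<exists>v\<in>imul (rs (Mhat M)) (J n) (carrier (Mhat M)). \<exists>w\<in>clos M N. y = v \<oplus>\<^bsub>Mhat M\<^esub> w"
  shows "y \<in> clos M N"
proof -
  have "\<exists>z\<in>N. y n = JM M n +> z" for n
  proof -
    obtain v w where vw: "v \<in> imul (rs (Mhat M)) (J n) (carrier (Mhat M))" "w \<in> clos M N" "y = v \<oplus>\<^bsub>Mhat M\<^esub> w" using assms(3) by blast
    obtain z where z: "z \<in> N" "rep M n w z" using rep_clos[OF vw(2) assms(1)] by blast
    have "rep M n y (\<zero> \<oplus> z)" unfolding vw(3) by (rule rep_add[OF imul_rep_zero[OF vw(1)] z(2)])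
    then show ?thesis using z sub_carr[OF assms(1)] by (auto simp: rep_def)
  qed
  then show ?thesis using assms(2) by (simp add: clos_def)
qed

end

subsection \<open>Powers of the extended ideal\<close>

lemma mk_lincomb:
  assumes "\<And>i. i < k ==> coherent Rm J (r i)" "\<And>i. i < k ==> coherent Rm J (v i)"
  shows "coherent Rm J (\<lambda>n. lincomb Rm (\<lambda>i. v i n) (\<lambda>i. r i n) k) \<and>
    lincomb (ring_as_module S) (\<lambda>i. mk (v i)) (\<lambda>i. mk (r i)) k = mk (\<lambda>n. lincomb Rm (\<lambda>i. v i n) (\<lambda>i. r i n) k)"
  using assms
proof (induction k)
  case 0
  then show ?case using coherent_const S_zero by simp
next
  case (Suc k)
  then have IH: "coherent Rm J (\<lambda>n. lincomb Rm (\<lambda>i. v i n) (\<lambda>i. r i n) k)"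
    "lincomb (ring_as_module S) (\<lambda>i. mk (v i)) (\<lambda>i. mk (r i)) k = mk (\<lambda>n. lincomb Rm (\<lambda>i. v i n) (\<lambda>i. r i n) k)" by auto
  have k: "coherent Rm J (r k)" "coherent Rm J (v k)" using Suc.prems by auto
  show ?case
    using coherent_add[OF IH(1) coherent_mult[OF k]] S_add[OF IH(1) coherent_mult[OF k]] S_mult[OF k] IH(2) by simp
qed

text \<open>The kernel of the projection to \<open>R/\<aa>^n\<close>. In contrast to the powers of
  the extended ideal, membership is decided by a single component; \<open>extended_power\<close>
  identifies the two.\<close>

definition Ker :: "nat \<Rightarrow> (nat \<Rightarrow> 'a set) set" where
  "Ker n = {x \<in> carrier S. x n = J n}"

lemma Ker_mk: "coherent Rm J r ==> mk r \<in> Ker n \<longleftrightarrow> r n \<in> J n"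
  using mk_closed mk_zero_at[OF coherentD] by (simp add: Ker_def)

lemma Ker_generated:
  obtains k g where "\<And>i. i < k ==> g i \<in> J n"
    "\<And>x. x \<in> Ker n ==> \<exists>c. (\<forall>i<k. c i \<in> carrier S) \<and> x = lincomb (ring_as_module S) (\<lambda>i. \<iota> (g i)) c k"
proof -
  note fg = fin_gen_ring[OF R]
  obtain k g where g: "\<And>i. i < k ==> g i \<in> J n" "\<And>v. (\<And>t. v t \<in> J n) ==> (\<And>t. v (Suc t) \<ominus>\<^bsub>Rm\<^esub> v t \<in> imul Rm (J t) (carrier Rm)) ==>
      \<exists>r. (\<forall>i<k. \<forall>t. r i t \<in> carrier R \<and> r i (Suc t) \<ominus>\<^bsub>R\<^esub> r i t \<in> J t) \<and>
        (\<forall>t. v t \<ominus>\<^bsub>Rm\<^esub> lincomb Rm g (\<lambda>i. r i t) k \<in> imul Rm (J t) (carrier Rm))"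
    using completion_generates_sub[OF R NR \<aa> fg Jsub] by blast
  have "\<exists>c. (\<forall>i<k. c i \<in> carrier S) \<and> x = lincomb (ring_as_module S) (\<lambda>i. \<iota> (g i)) c k" if x: "x \<in> Ker n" for x
  proof -
    obtain s where s: "coherent Rm J s" "x = mk s" using x S_iff unfolding Ker_def by blast
    have sn: "s n \<in> J n" using x s Ker_mk by simp
    have le: "s b \<ominus>\<^bsub>Rm\<^esub> s a \<in> J a" if "a \<le> b" for a b by (rule coherent_le[OF Rmod Jsub J_antimono s(1) that])
    \<comment> \<open>Replacing the first terms puts the whole sequence into \<open>J n\<close>
      without changing the limit.\<close>
    define v where "v t = s (max t n)" for t
    have v1: "v t \<in> J n" for t
    proof -
      have "s (max t n) \<ominus>\<^bsub>Rm\<^esub> s n \<in> J n" by (rule le) simp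
      then show ?thesis unfolding v_def using mod_mem[OF Rmod Jsub _ sn] coherentD[OF s(1)] by simp
    qed
    have v2: "v (Suc t) \<ominus>\<^bsub>Rm\<^esub> v t \<in> imul Rm (J t) (carrier Rm)" for t
    proof -
      have "s (max (Suc t) n) \<ominus>\<^bsub>Rm\<^esub> s (max t n) \<in> J (max t n)" by (rule le) simp
      then show ?thesis unfolding v_def imul_ring[OF JI] using J_antimono[of t "max t n"] by auto
    qed
    from g(2)[OF v1 v2] obtain r where r: "\<forall>i<k. \<forall>t. r i t \<in> carrier R \<and> r i (Suc t) \<ominus>\<^bsub>R\<^esub> r i t \<in> J t"
      "\<forall>t. v t \<ominus>\<^bsub>R\<^esub> lincomb Rm g (\<lambda>i. r i t) k \<in> J t" unfolding imul_ring[OF JI] by auto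
    have rc: "\<And>i. i < k ==> coherent Rm J (r i)" using r(1) by (simp add: coherent_def)
    have gc: "\<And>i. i < k ==> coherent Rm J (\<lambda>n. g i)" using coherent_const g(1) Jc by blast
    note L = mk_lincomb[where v="\<lambda>i n. g i", OF rc gc]
    have "J t +>\<^bsub>R\<^esub> s t = J t +>\<^bsub>R\<^esub> lincomb Rm g (\<lambda>i. r i t) k" for t
    proof -
      have vc: "v t \<in> carrier R" using v1 Jc by blast
      have lc: "lincomb Rm g (\<lambda>i. r i t) k \<in> carrier R" using coherentD[OF conjunct1[OF L]] by simp
      have "v t \<ominus>\<^bsub>R\<^esub> s t \<in> J t" using le[of t "max t n"] unfolding v_def by simp
      then have "J t +>\<^bsub>R\<^esub> v t = J t +>\<^bsub>R\<^esub> s t" using mk_at_eq[OF vc coherentD[OF s(1)]] by blast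
      moreover have "J t +>\<^bsub>R\<^esub> v t = J t +>\<^bsub>R\<^esub> lincomb Rm g (\<lambda>i. r i t) k" using mk_at_eq[OF vc lc] r(2) by blast
      ultimately show ?thesis by simp
    qed
    then have "x = lincomb (ring_as_module S) (\<lambda>i. \<iota> (g i)) (\<lambda>i. mk (r i)) k" unfolding s(2) \<iota>_mk using L by simp
    then show ?thesis using rc mk_closed by (intro exI[of _ "\<lambda>i. mk (r i)"]) auto
  qed
  then show ?thesis using that g(1) by blast
qed

lemma Ker_ideal: "ideal (Ker n) S"
proof -
  have "submodule (Ker n) S (ring_as_module S)"
  proof (rule submoduleI'[OF SRmod])
    interpret Jn: ideal "J n" R by (rule JI)
    show "Ker n \<subseteq> carrier (ring_as_module S)" by (auto simp: Ker_def)
    show "\<zero>\<^bsub>ring_as_module S\<^esub> \<in> Ker n" using S_zero_at S.zero_closed by (simp add: Ker_def)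
    fix x assume x: "x \<in> Ker n"
    then obtain r where r: "coherent Rm J r" "x = mk r" using S_iff unfolding Ker_def by blast
    then have rn: "r n \<in> J n" using Ker_mk x by blast
    show "x \<oplus>\<^bsub>ring_as_module S\<^esub> y \<in> Ker n" if y: "y \<in> Ker n" for y
    proof -
      obtain s where s: "coherent Rm J s" "y = mk s" using y S_iff unfolding Ker_def by blast
      then have sn: "s n \<in> J n" using Ker_mk y by blast
      show ?thesis using S_add[OF r(1) s(1)] Ker_mk[OF coherent_add[OF r(1) s(1)]] rn sn r(2) s(2) by simp
    qed
    show "y \<odot>\<^bsub>ring_as_module S\<^esub> x \<in> Ker n" if y: "y \<in> carrier S" for y
    proof -
      obtain s where s: "coherent Rm J s" "y = mk s" using y S_iff by blast
      show ?thesis using S_mult[OF s(1) r(1)] Ker_mk[OF coherent_mult[OF s(1) r(1)]] Jn.I_l_closed[OF rn coherentD[OF s(1)]] r(2) s(2) by simp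
    qed
  qed
  then show ?thesis using ideal_iff_submodule[OF cring_S] by blast
qed

lemma ideal_lincomb:
  assumes "ideal I S" "\<And>i. i < k ==> g i \<in> I" "\<And>i. i < k ==> c i \<in> carrier S"
  shows "lincomb (ring_as_module S) g c k \<in> I"
  by (rule lincomb_in_sub) (use assms ideal_iff_submodule[OF cring_S] in auto)

lemma extended_ideal_ideal: "ideal (extended_ideal R \<aa>) S"
  unfolding extended_ideal_def by (rule S.genideal_ideal) (use \<iota>_closed ideal.Icarr[OF \<aa>] in auto)

text \<open>One inclusion is the generation of \<open>Ker n\<close> by finitely many elements of
  \<open>\<aa>^n\<close>. For the other, a product from \<open>Ker n\<close> and
  \<open>Ker 1\<close> is represented at level \<open>n + 1\<close> by a product from
  \<open>\<aa>^n\<close> and \<open>\<aa>\<close>.\<close>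

lemma extended_power: "ideal_power S (extended_ideal R \<aa>) n = Ker n"
proof
  let ?e = "extended_ideal R \<aa>"
  note e = extended_ideal_ideal
  have \<iota>e: "\<iota> a \<in> ?e" if "a \<in> \<aa>" for a
    unfolding extended_ideal_def using S.genideal_self[of "\<iota> ` \<aa>"] \<iota>_closed ideal.Icarr[OF \<aa>] that by blast
  have \<iota>J: "\<iota> a \<in> ideal_power S ?e n" if "a \<in> J n" for a n
    using that
  proof (induction n arbitrary: a)
    case 0
    then show ?case unfolding ideal_power_0[OF R \<aa>] ideal_power_0[OF cring_S e] by (rule \<iota>_closed)
  next
    case (Suc n)
    have "a \<in> ideal_prod R (J n) \<aa>" using Suc.prems unfolding ideal_power_Suc[OF R \<aa>] .
    then show ?case unfolding ideal_power_Suc[OF cring_S e]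
    proof induction
      case (prod i j)
      have "\<iota> (i \<otimes>\<^bsub>R\<^esub> j) = \<iota> i \<otimes>\<^bsub>S\<^esub> \<iota> j" by (rule ring_hom_mult[OF \<iota>_hom]) (use prod Jc ideal.Icarr[OF \<aa>] in auto)
      then show ?case using ideal_prod.prod[OF Suc.IH[OF prod(1)] \<iota>e[OF prod(2)], of S] by simp
    next
      case (sum s1 s2)
      have "s1 \<in> carrier R" "s2 \<in> carrier R" using sum(1,2) ideal_prod_in_carrier[OF JI \<aa>] by blast+
      then have "\<iota> (s1 \<oplus>\<^bsub>R\<^esub> s2) = \<iota> s1 \<oplus>\<^bsub>S\<^esub> \<iota> s2" by (rule ring_hom_add[OF \<iota>_hom])
      then show ?case using ideal_prod.sum[OF sum(3,4)] by simp
    qed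
  qed
  show "Ker n \<subseteq> ideal_power S ?e n"
  proof
    fix x assume x: "x \<in> Ker n"
    obtain k g where kg: "\<And>i. i < k ==> g i \<in> J n"
      "\<And>x. x \<in> Ker n ==> \<exists>c. (\<forall>i<k. c i \<in> carrier S) \<and> x = lincomb (ring_as_module S) (\<lambda>i. \<iota> (g i)) c k"
      using Ker_generated by metis
    obtain c where c: "\<forall>i<k. c i \<in> carrier S" "x = lincomb (ring_as_module S) (\<lambda>i. \<iota> (g i)) c k" using kg(2)[OF x] by blast
    show "x \<in> ideal_power S ?e n" unfolding c(2)
      by (rule ideal_lincomb[OF ideal_power_ideal[OF cring_S e]]) (use \<iota>J kg(1) c(1) in auto)
  qed
  have eK: "?e \<subseteq> Ker (Suc 0)"
    unfolding extended_ideal_def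
  proof (rule S.genideal_minimal[OF Ker_ideal])
    show "\<iota> ` \<aa> \<subseteq> Ker (Suc 0)"
      using Ker_mk[OF coherent_const] ideal.Icarr[OF \<aa>] ideal_power_1[OF R \<aa>] unfolding \<iota>_mk by auto
  qed
  show "ideal_power S ?e n \<subseteq> Ker n"
  proof (induction n)
    case 0
    have "x 0 = J 0" if x: "x \<in> carrier S" for x
    proof -
      obtain r where r: "coherent Rm J r" "x = mk r" using x S_iff by blast
      have "r 0 \<in> J 0" using coherentD[OF r(1)] unfolding ideal_power_0[OF R \<aa>] .
      then show ?thesis unfolding r(2) using mk_zero_at[OF coherentD[OF r(1)]] by blast
    qed
    then show ?case unfolding ideal_power_0[OF cring_S e] Ker_def by blast
  next
    case (Suc n)
    have "x \<in> Ker (Suc n)" if "x \<in> ideal_prod S (ideal_power S ?e n) ?e" for x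
      using that
    proof induction
      case (prod i j)
      have i: "i \<in> Ker n" and j: "j \<in> Ker (Suc 0)" using prod Suc eK by auto
      obtain r where r: "coherent Rm J r" "i = mk r" using i S_iff unfolding Ker_def by blast
      obtain s where s: "coherent Rm J s" "j = mk s" using j S_iff unfolding Ker_def by blast
      have rn: "r n \<in> J n" using Ker_mk[OF r(1)] i r(2) by blast
      have s1: "s (Suc 0) \<in> J (Suc 0)" using Ker_mk[OF s(1)] j s(2) by blast
      have "r (Suc n) \<in> J n"
        using mod_mem[OF Rmod Jsub _ rn, of "r (Suc n)"] coherent_le[OF Rmod Jsub J_antimono r(1), of n "Suc n"] coherentD[OF r(1)] by simp
      moreover have "s (Suc n) \<in> \<aa>"
        using mod_mem[OF Rmod Jsub _ s1, of "s (Suc n)"] coherent_le[OF Rmod Jsub J_antimono s(1), of "Suc 0" "Suc n"] coherentD[OF s(1)] ideal_power_1[OF R \<aa>] by simp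
      ultimately have "r (Suc n) \<otimes>\<^bsub>R\<^esub> s (Suc n) \<in> J (Suc n)" unfolding ideal_power_Suc[OF R \<aa>] by (rule ideal_prod.prod)
      then show ?case using S_mult[OF r(1) s(1)] Ker_mk[OF coherent_mult[OF r(1) s(1)]] r(2) s(2) by simp
    next
      case (sum s1 s2)
      then show ?case using additive_subgroup.a_closed[OF ideal.axioms(1)[OF Ker_ideal]] by blast
    qed
    then show ?case unfolding ideal_power_Suc[OF cring_S e] by blast
  qed
qed

end

context adic
begin

subsection \<open>Base change to the completed ring\<close>

abbreviation "FR \<equiv> FM R"
abbreviation "FS \<equiv> free_module S"
abbreviation "Sm \<equiv> ring_as_module S"

definition \<iota>t :: "nat \<Rightarrow> (nat \<Rightarrow> 'a) \<Rightarrow> nat \<Rightarrow> (nat \<Rightarrow> 'a set)" where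
  "\<iota>t p x = (\<lambda>i\<in>{..<p}. \<iota> (x i))"

lemma lin_\<iota>: "lin R Rm (rs Sm) \<iota>"
  using \<iota>_closed ring_hom_add[OF \<iota>_hom] ring_hom_mult[OF \<iota>_hom] by (auto simp: lin_def)

lemma rs_tup: "rs (FS p) = tup (rs Sm) p"
  by (simp add: free_module_tup tup_def restrict_scalars_def)

lemma lin_\<iota>t: "lin R (FR p) (rs (FS p)) (\<iota>t p)"
proof -
  have "lin R (FR p) (tup (rs Sm) p) (\<lambda>x. \<lambda>i\<in>{..<p}. \<iota> (x i))"
    by (rule lin_into_tup) (use lin_comp[OF lin_tup_proj[of _ p R Rm] lin_\<iota>] in \<open>simp add: free_module_tup\<close>)
  then show ?thesis by (simp add: rs_tup \<iota>t_def[abs_def])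
qed

lemma \<iota>t_closed: "x \<in> carrier (FR p) ==> \<iota>t p x \<in> carrier (FS p)"
  using lin_closed[OF lin_\<iota>t] by simp

lemma \<iota>t_basis: "\<iota>t p (basis R p j) = basis S p j"
  using ring_hom_one[OF \<iota>_hom] \<iota>_zero by (auto simp: \<iota>t_def basis_def tup_inj_def)

text \<open>The extension of an \<open>R\<close>-linear map to the base-changed free module. With
  \<open>lin_restrict\<close> it identifies maps out of the base change with \<open>R\<close>-linear
  maps out of the original module.\<close>

definition ext :: "(nat \<Rightarrow> 'a set, 'n, 't) module_scheme \<Rightarrow> ((nat \<Rightarrow> 'a) \<Rightarrow> 'n) \<Rightarrow> nat \<Rightarrow> (nat \<Rightarrow> nat \<Rightarrow> 'a set) \<Rightarrow> 'n" where
  "ext X f p x = lincomb X (\<lambda>j. f (basis R p j)) x p"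

lemma ext_lin:
  assumes "module S X" "lin R (FR p) (rs X) f"
  shows "lin S (FS p) X (ext X f p)"
  unfolding ext_def[abs_def] by (rule lin_lincomb[OF assms(1)]) (use lin_closed[OF assms(2) basis_closed[OF R]] in simp)

lemma ext_basis:
  assumes "module S X" "lin R (FR p) (rs X) f" "j < p"
  shows "ext X f p (basis S p j) = f (basis R p j)"
proof -
  have "\<And>j. j < p ==> f (basis R p j) \<in> carrier X" using lin_closed[OF assms(2) basis_closed[OF R]] by simp
  then show ?thesis unfolding ext_def by (rule lincomb_basis[OF assms(1) _ assms(3)])
qed

lemma ext_\<iota>t:
  assumes "module S X" "lin R (FR p) (rs X) f" "x \<in> carrier (FR p)"
  shows "ext X f p (\<iota>t p x) = f x"
  by (rule lin_eq_basis[OF module_rs[OF assms(1)] lin_comp[OF lin_\<iota>t lin_restrict_scalars[OF \<iota>_hom ext_lin[OF assms(1,2)]]] assms(2) _ assms(3)])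
    (use ext_basis[OF assms(1,2)] \<iota>t_basis in simp)

lemma lin_\<iota>t_comp: "lin R (FR p) (FR q) f ==> lin R (FR p) (rs (FS q)) (\<lambda>x. \<iota>t q (f x))"
  by (rule lin_comp[OF _ lin_\<iota>t])

lemma lin_restrict:
  assumes "lin S (FS p) X f"
  shows "lin R (FR p) (rs X) (\<lambda>x. f (\<iota>t p x))"
  by (rule lin_comp[OF lin_\<iota>t lin_restrict_scalars[OF \<iota>_hom assms]])

text \<open>\<open>bc f p q\<close> is the base change of \<open>f\<close>, read off its matrix.\<close>

definition bc where
  "bc f p q = ext (FS q) (\<lambda>x. \<iota>t q (f x)) p"

lemma bc_lin: "lin R (FR p) (FR q) f ==> lin S (FS p) (FS q) (bc f p q)"
  unfolding bc_def by (rule ext_lin[OF SFmod lin_\<iota>t_comp])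

lemma bc_basis: "lin R (FR p) (FR q) f ==> j < p ==> bc f p q (basis S p j) = \<iota>t q (f (basis R p j))"
  unfolding bc_def by (rule ext_basis[OF SFmod lin_\<iota>t_comp])

lemma bc_\<iota>t: "lin R (FR p) (FR q) f ==> x \<in> carrier (FR p) ==> bc f p q (\<iota>t p x) = \<iota>t q (f x)"
  unfolding bc_def by (rule ext_\<iota>t[OF SFmod lin_\<iota>t_comp])

definition bce where
  "bce e p = ext Sm (\<lambda>x. \<iota> (e x)) p"

lemma bce_lin: "lin R (FR p) Rm e ==> lin S (FS p) Sm (bce e p)"
  unfolding bce_def by (rule ext_lin[OF SRmod lin_comp[OF _ lin_\<iota>]])

lemma bce_basis: "lin R (FR p) Rm e ==> j < p ==> bce e p (basis S p j) = \<iota> (e (basis R p j))"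
  unfolding bce_def by (rule ext_basis[OF SRmod lin_comp[OF _ lin_\<iota>]])

lemma bce_\<iota>t: "lin R (FR p) Rm e ==> x \<in> carrier (FR p) ==> bce e p (\<iota>t p x) = \<iota> (e x)"
  unfolding bce_def by (rule ext_\<iota>t[OF SRmod lin_comp[OF _ lin_\<iota>]])

lemma FS_coherent:
  assumes "x \<in> carrier (FS p)"
  obtains v where "\<And>i. i < p ==> coherent Rm J (v i)" "x = (\<lambda>i\<in>{..<p}. mk (v i))"
proof -
  have "\<forall>i. \<exists>v. i < p \<longrightarrow> coherent Rm J v \<and> x i = mk v" using free_closed[OF assms] S_iff by blast
  from choice[OF this] obtain v where v: "\<And>i. i < p ==> coherent Rm J (v i)" "\<And>i. i < p ==> x i = mk (v i)" by blast
  have "x = (\<lambda>i\<in>{..<p}. mk (v i))" using assms v(2) by (auto simp: free_module_def PiE_def extensional_def)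
  with v(1) show ?thesis by (rule that)
qed

lemma tuple_closed: "(\<And>i. i < p ==> coherent Rm J (v i)) ==> (\<lambda>i\<in>{..<p}. v i n) \<in> carrier (FR p)"
  using coherentD by (auto simp: free_module_def)

text \<open>Base-changed maps act on coherent sequences term by term, which links them to the
  statements about Cauchy sequences.\<close>

lemma bce_mk:
  assumes "lin R (FR p) Rm e" "\<And>i. i < p ==> coherent Rm J (v i)"
  shows "coherent Rm J (\<lambda>n. e (\<lambda>i\<in>{..<p}. v i n)) \<and> bce e p (\<lambda>i\<in>{..<p}. mk (v i)) = mk (\<lambda>n. e (\<lambda>i\<in>{..<p}. v i n))"
proof -
  have eb: "e (basis R p j) \<in> carrier R" for j using lin_closed[OF assms(1) basis_closed[OF R]] by simp
  have en: "e (\<lambda>i\<in>{..<p}. v i n) = lincomb Rm (\<lambda>j. e (basis R p j)) (\<lambda>i. v i n) p" for n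
  proof -
    have "e (\<lambda>i\<in>{..<p}. v i n) = lincomb Rm (\<lambda>j. e (basis R p j)) (\<lambda>i\<in>{..<p}. v i n) p"
      by (rule lin_expand[OF Rmod assms(1) tuple_closed[OF assms(2)]])
    also have "\<dots> = lincomb Rm (\<lambda>j. e (basis R p j)) (\<lambda>i. v i n) p" by (rule lincomb_cong) auto
    finally show ?thesis .
  qed
  have "bce e p (\<lambda>i\<in>{..<p}. mk (v i)) = lincomb Sm (\<lambda>j. mk (\<lambda>n. e (basis R p j))) (\<lambda>i. mk (v i)) p"
    unfolding bce_def ext_def \<iota>_mk by (rule lincomb_cong) auto
  then show ?thesis using mk_lincomb[where v="\<lambda>j n. e (basis R p j)", OF assms(2) coherent_const[OF eb]] unfolding en by simp
qed

lemma bc_mk: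
  assumes "lin R (FR p) (FR q) f" "\<And>i. i < p ==> coherent Rm J (v i)" "l < q"
  shows "bc f p q (\<lambda>i\<in>{..<p}. mk (v i)) l = mk (\<lambda>n. f (\<lambda>i\<in>{..<p}. v i n) l)"
proof -
  have fl: "lin R (FR p) Rm (\<lambda>x. f x l)"
    using lin_comp[OF assms(1), of Rm "\<lambda>x. x l"] lin_tup_proj[OF assms(3), of R Rm] by (simp add: free_module_tup)
  have x: "(\<lambda>i\<in>{..<p}. mk (v i)) i \<in> carrier S" if "i < p" for i using mk_closed[OF assms(2)] that by simp
  have "bc f p q (\<lambda>i\<in>{..<p}. mk (v i)) l = lincomb Sm (\<lambda>j. \<iota>t q (f (basis R p j)) l) (\<lambda>i\<in>{..<p}. mk (v i)) p"
    unfolding bc_def ext_def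
    by (rule lincomb_image[OF SFmod SRmod, where f="\<lambda>x. x l"])
      (use lin_tup_proj[OF assms(3), of S Sm] \<iota>t_closed[OF lin_closed[OF assms(1) basis_closed[OF R]]] x in \<open>auto simp: free_module_tup\<close>)
  also have "\<dots> = bce (\<lambda>x. f x l) p (\<lambda>i\<in>{..<p}. mk (v i))"
    unfolding bce_def ext_def by (rule lincomb_cong) (auto simp: \<iota>t_def assms(3))
  finally show ?thesis using bce_mk[OF fl assms(2)] by simp
qed

lemma tup_minus:
  assumes "module R M" "x \<in> carrier (tup M p)" "y \<in> carrier (tup M p)" "j < p"
  shows "(x \<ominus>\<^bsub>tup M p\<^esub> y) j = x j \<ominus>\<^bsub>M\<^esub> y j"
  using lin_minus[OF module_tup[OF assms(1)] assms(1) lin_tup_proj[OF assms(4)] assms(2,3)] .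

lemma free_minus:
  "x \<in> carrier (FR p) ==> y \<in> carrier (FR p) ==> j < p ==> (x \<ominus>\<^bsub>FR p\<^esub> y) j = x j \<ominus>\<^bsub>R\<^esub> y j"
  using tup_minus[OF Rmod, of x p y j] by (simp add: free_module_tup)

text \<open>Flatness of the completed ring in concrete form: for \<open>L\<close> zero, the kernel
  of the base change of \<open>\<delta>\<close> is generated by the kernel over \<open>R\<close>. It
  is \<open>completion_generates\<close> rewritten in coordinates.\<close>

lemma tuple_generated:
  assumes "lin R (FR p) B \<delta>" "fin_gen_module R B" "submodule L R B"
  obtains k g where "\<And>i. i < k ==> g i \<in> carrier (FR p)" "\<And>i. i < k ==> \<delta> (g i) \<in> L"
    "\<And>v. (\<And>i. i < p ==> coherent Rm J (v i)) ==>
      (\<And>n. \<exists>l\<in>L. \<delta> (\<lambda>i\<in>{..<p}. v i n) \<ominus>\<^bsub>B\<^esub> l \<in> imul B (J n) (carrier B)) ==>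
      \<exists>c. (\<forall>i<k. c i \<in> carrier S) \<and> (\<lambda>i\<in>{..<p}. mk (v i)) = lincomb (FS p) (\<lambda>i. \<iota>t p (g i)) c k"
proof -
  note Fc = module.carrier_is_submodule[OF Fmod]
  obtain k g where g: "\<And>i. i < k ==> g i \<in> carrier (FR p)" "\<And>i. i < k ==> \<delta> (g i) \<in> L"
    "\<And>v. (\<And>n. v n \<in> carrier (FR p)) ==> (\<And>n. v (Suc n) \<ominus>\<^bsub>FR p\<^esub> v n \<in> imul (FR p) (J n) (carrier (FR p))) ==>
      (\<And>n. \<exists>l\<in>L. \<delta> (v n) \<ominus>\<^bsub>B\<^esub> l \<in> imul B (J n) (carrier B)) ==>
      \<exists>r. (\<forall>i<k. \<forall>n. r i n \<in> carrier R \<and> r i (Suc n) \<ominus>\<^bsub>R\<^esub> r i n \<in> J n) \<and>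
        (\<forall>n. v n \<ominus>\<^bsub>FR p\<^esub> lincomb (FR p) g (\<lambda>i. r i n) k \<in> imul (FR p) (J n) (carrier (FR p)))"
    using completion_generates[OF R NR \<aa> fin_gen_free[OF R] assms(2,1) Fc assms(3)] by blast
  have main: "\<exists>c. (\<forall>i<k. c i \<in> carrier S) \<and> (\<lambda>i\<in>{..<p}. mk (v i)) = lincomb (FS p) (\<lambda>i. \<iota>t p (g i)) c k"
    if v: "\<And>i. i < p ==> coherent Rm J (v i)" and l: "\<And>n. \<exists>l\<in>L. \<delta> (\<lambda>i\<in>{..<p}. v i n) \<ominus>\<^bsub>B\<^esub> l \<in> imul B (J n) (carrier B)" for v
  proof -
    let ?v = "\<lambda>n. \<lambda>i\<in>{..<p}. v i n"
    have vc: "?v n \<in> carrier (FR p)" for n by (rule tuple_closed[OF v])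
    have "?v (Suc n) \<ominus>\<^bsub>FR p\<^esub> ?v n \<in> imul (FR p) (J n) (carrier (FR p))" for n
      unfolding free_module_tup
    proof (rule imul_tup[OF Rmod JI])
      show "?v (Suc n) \<ominus>\<^bsub>tup Rm p\<^esub> ?v n \<in> carrier (tup Rm p)"
        using sub_minus[OF Fc vc vc] by (simp add: free_module_tup)
      fix j assume j: "j < p"
      have "(?v (Suc n) \<ominus>\<^bsub>tup Rm p\<^esub> ?v n) j = v j (Suc n) \<ominus>\<^bsub>Rm\<^esub> v j n"
        using tup_minus[OF Rmod, of "?v (Suc n)" p "?v n" j] vc j by (simp add: free_module_tup)
      then show "(?v (Suc n) \<ominus>\<^bsub>tup Rm p\<^esub> ?v n) j \<in> imul Rm (J n) (carrier Rm)"
        using v[OF j] unfolding imul_ring[OF JI] by (simp add: coherent_def)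
    qed
    from g(3)[OF vc this l] obtain r where r: "\<forall>i<k. \<forall>n. r i n \<in> carrier R \<and> r i (Suc n) \<ominus>\<^bsub>R\<^esub> r i n \<in> J n"
      "\<forall>n. ?v n \<ominus>\<^bsub>FR p\<^esub> lincomb (FR p) g (\<lambda>i. r i n) k \<in> imul (FR p) (J n) (carrier (FR p))" by blast
    have rc: "\<And>i. i < k ==> coherent Rm J (r i)" using r(1) by (simp add: coherent_def)
    have lc: "lincomb (FR p) g (\<lambda>i. r i n) k \<in> carrier (FR p)" for n by (rule lincomb_closed[OF Fmod g(1)]) (use r(1) in auto)
    have comp: "lincomb (FR p) g (\<lambda>i. r i n) k j = lincomb Rm (\<lambda>i. g i j) (\<lambda>i. r i n) k" if "j < p" for n j
      by (rule lincomb_image[OF Fmod Rmod, where f="\<lambda>x. x j"])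
        (use lin_tup_proj[OF that, of R Rm] g(1) r(1) in \<open>auto simp: free_module_tup\<close>)
    have eq: "mk (v j) = mk (\<lambda>n. lincomb Rm (\<lambda>i. g i j) (\<lambda>i. r i n) k)" if j: "j < p" for j
    proof
      fix n
      have c: "v j n \<in> carrier R" "lincomb Rm (\<lambda>i. g i j) (\<lambda>i. r i n) k \<in> carrier R"
        using v[OF j] free_closed[OF lc[of n] j] comp[OF j, of n] by (auto simp: coherent_def)
      have r2: "?v n \<ominus>\<^bsub>FR p\<^esub> lincomb (FR p) g (\<lambda>i. r i n) k \<in> imul (FR p) (J n) (carrier (FR p))" using r(2) by blast
      have "(?v n \<ominus>\<^bsub>FR p\<^esub> lincomb (FR p) g (\<lambda>i. r i n) k) j \<in> imul Rm (J n) (carrier Rm)"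
        using imul_tup_D[OF Rmod JI r2[unfolded free_module_tup] j] unfolding free_module_tup .
      moreover have "(?v n \<ominus>\<^bsub>FR p\<^esub> lincomb (FR p) g (\<lambda>i. r i n) k) j = v j n \<ominus>\<^bsub>R\<^esub> lincomb Rm (\<lambda>i. g i j) (\<lambda>i. r i n) k"
        unfolding free_minus[OF vc lc j] comp[OF j] using j by simp
      ultimately show "J n +>\<^bsub>R\<^esub> v j n = J n +>\<^bsub>R\<^esub> lincomb Rm (\<lambda>i. g i j) (\<lambda>i. r i n) k"
        using mk_at_eq[OF c] unfolding imul_ring[OF JI] by simp
    qed
    have Sc: "\<And>i. i < k ==> mk (r i) \<in> carrier S" using mk_closed[OF rc] .
    have gS: "\<And>i. i < k ==> \<iota>t p (g i) \<in> carrier (FS p)" using \<iota>t_closed g(1) by blast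
    have LS: "lincomb (FS p) (\<lambda>i. \<iota>t p (g i)) (\<lambda>i. mk (r i)) k \<in> carrier (FS p)" by (rule lincomb_closed[OF SFmod gS Sc])
    have "(\<lambda>i\<in>{..<p}. mk (v i)) = lincomb (FS p) (\<lambda>i. \<iota>t p (g i)) (\<lambda>i. mk (r i)) k"
    proof (rule tup_eqI[of _ Sm p])
      show "(\<lambda>i\<in>{..<p}. mk (v i)) \<in> carrier (tup Sm p)" using mk_closed[OF v] by (auto simp: tup_def)
      show "lincomb (FS p) (\<lambda>i. \<iota>t p (g i)) (\<lambda>i. mk (r i)) k \<in> carrier (tup Sm p)" using LS by (simp add: free_module_tup)
      fix j assume j: "j < p"
      have gc: "\<And>i. i < k ==> coherent Rm J (\<lambda>n. g i j)" using coherent_const free_closed[OF g(1) j] by blast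
      have "lincomb (FS p) (\<lambda>i. \<iota>t p (g i)) (\<lambda>i. mk (r i)) k j = lincomb Sm (\<lambda>i. \<iota>t p (g i) j) (\<lambda>i. mk (r i)) k"
        by (rule lincomb_image[OF SFmod SRmod, where f="\<lambda>x. x j"])
          (use lin_tup_proj[OF j, of S Sm] gS Sc in \<open>auto simp: free_module_tup\<close>)
      also have "\<dots> = lincomb Sm (\<lambda>i. mk (\<lambda>n. g i j)) (\<lambda>i. mk (r i)) k"
        using j by (intro lincomb_cong) (auto simp: \<iota>t_def \<iota>_mk)
      also have "\<dots> = mk (\<lambda>n. lincomb Rm (\<lambda>i. g i j) (\<lambda>i. r i n) k)"
        using mk_lincomb[where v="\<lambda>i n. g i j" and r=r and k=k, OF rc gc] by blast
      finally show "(\<lambda>i\<in>{..<p}. mk (v i)) j = lincomb (FS p) (\<lambda>i. \<iota>t p (g i)) (\<lambda>i. mk (r i)) k j"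
        using eq[OF j] j by simp
    qed
    then show ?thesis using Sc by (intro exI[of _ "\<lambda>i. mk (r i)"]) auto
  qed
  show thesis by (rule that[OF g(1,2) main])
qed

definition dhat where "dhat p d i = bc (d i) (p (Suc i)) (p i)"

text \<open>Exactness is inherited because kernels over the completed ring are generated by images
  of kernels over \<open>R\<close>, and the latter consist of boundaries.\<close>

lemma fres_hat:
  assumes "fres R (J n) p d e"
  shows "fres S (Ker n) p (dhat p d) (bce e (p 0))"
proof -
  note d = fresD[OF assms]
  have dl: "lin S (FS (p (Suc i))) (FS (p i)) (dhat p d i)" for i unfolding dhat_def by (rule bc_lin[OF d(1)])
  have el: "lin S (FS (p 0)) Sm (bce e (p 0))" by (rule bce_lin[OF d(2)])
  have KS: "submodule (Ker n) S Sm" using Ker_ideal ideal_iff_submodule[OF cring_S] by blast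
  have \<iota>K: "\<iota> a \<in> Ker n" if "a \<in> J n" for a unfolding \<iota>_mk using Ker_mk[OF coherent_const[OF Jc[OF that]]] that by simp
  have dhat_\<iota>t: "dhat p d i (\<iota>t (p (Suc i)) x) = \<iota>t (p i) (d i x)" if "x \<in> carrier (FR (p (Suc i)))" for i x
    unfolding dhat_def by (rule bc_\<iota>t[OF d(1) that])
  have dhat_basis: "dhat p d i (basis S (p (Suc i)) j) = \<iota>t (p i) (d i (basis R (p (Suc i)) j))" if "j < p (Suc i)" for i j
    unfolding dhat_def by (rule bc_basis[OF d(1) that])
  note b = basis_closed[OF R]
  have im: "\<exists>y\<in>carrier (FS (p (Suc i))). lincomb (FS (p i)) (\<lambda>j. \<iota>t (p i) (g j)) c k = dhat p d i y"
    if g: "\<And>j. j < k ==> \<exists>h\<in>carrier (FR (p (Suc i))). g j = d i h" and c: "\<And>j. j < k ==> c j \<in> carrier S" for i g c k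
  proof -
    have "\<forall>j. \<exists>h. j < k \<longrightarrow> h \<in> carrier (FR (p (Suc i))) \<and> g j = d i h" using g by blast
    from choice[OF this] obtain h where h: "\<And>j. j < k ==> h j \<in> carrier (FR (p (Suc i)))" "\<And>j. j < k ==> g j = d i (h j)" by blast
    let ?y = "lincomb (FS (p (Suc i))) (\<lambda>j. \<iota>t (p (Suc i)) (h j)) c k"
    have "dhat p d i ?y = lincomb (FS (p i)) (\<lambda>j. dhat p d i (\<iota>t (p (Suc i)) (h j))) c k"
      by (rule lincomb_image[OF SFmod SFmod dl \<iota>t_closed[OF h(1)] c])
    also have "\<dots> = lincomb (FS (p i)) (\<lambda>j. \<iota>t (p i) (g j)) c k"
      by (rule lincomb_cong) (use dhat_\<iota>t[OF h(1)] h(2) in auto)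
    finally show ?thesis using lincomb_closed[OF SFmod \<iota>t_closed[OF h(1)] c] by (intro bexI[of _ ?y]) auto
  qed
  have u: "\<exists>u\<in>carrier (FS (p 0)). bce e (p 0) u \<ominus>\<^bsub>S\<^esub> \<one>\<^bsub>S\<^esub> \<in> Ker n"
  proof -
    obtain u where u: "u \<in> carrier (FR (p 0))" "e u \<ominus>\<^bsub>R\<^esub> \<one>\<^bsub>R\<^esub> \<in> J n" using d(3) by blast
    have eu: "e u \<in> carrier R" using lin_closed[OF d(2) u(1)] by simp
    have "bce e (p 0) (\<iota>t (p 0) u) \<ominus>\<^bsub>S\<^esub> \<one>\<^bsub>S\<^esub> = \<iota> (e u) \<ominus>\<^bsub>S\<^esub> \<iota> \<one>\<^bsub>R\<^esub>"
      using bce_\<iota>t[OF d(2) u(1)] ring_hom_one[OF \<iota>_hom] by simp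
    also have "\<dots> = \<iota> (e u \<ominus>\<^bsub>R\<^esub> \<one>\<^bsub>R\<^esub>)" using lin_minus[OF Rmod module_rs[OF SRmod] lin_\<iota>, of "e u" "\<one>\<^bsub>R\<^esub>"] eu by simp
    finally have "bce e (p 0) (\<iota>t (p 0) u) \<ominus>\<^bsub>S\<^esub> \<one>\<^bsub>S\<^esub> \<in> Ker n" using \<iota>K[OF u(2)] by metis
    then show ?thesis using \<iota>t_closed[OF u(1)] by blast
  qed
  have ed: "bce e (p 0) (dhat p d 0 y) \<in> Ker n" if y: "y \<in> carrier (FS (p (Suc 0)))" for y
    by (rule lin_in_sub[OF SRmod lin_comp[OF dl el] KS _ y])
      (use dhat_basis bce_\<iota>t[OF d(2) lin_closed[OF d(1) b]] \<iota>K[OF d(5)[OF b]] in simp)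
  have dd: "dhat p d i (dhat p d (Suc i) y) = \<zero>\<^bsub>FS (p i)\<^esub>" if y: "y \<in> carrier (FS (p (Suc (Suc i))))" for i y
    by (rule lin_eq_basis[OF SFmod lin_comp[OF dl dl] lin_const_zero[OF SFmod] _ y])
      (use dhat_basis dhat_\<iota>t[OF lin_closed[OF d(1) b]] d(7)[OF b] lin_zero[OF Fmod module_rs[OF SFmod] lin_\<iota>t] in simp)
  have ker0: "\<exists>y\<in>carrier (FS (p (Suc 0))). x = dhat p d 0 y" if x: "x \<in> carrier (FS (p 0))" "bce e (p 0) x \<in> Ker n" for x
  proof -
    obtain k g where g: "\<And>i. i < k ==> g i \<in> carrier (FR (p 0))" "\<And>i. i < k ==> e (g i) \<in> J n"
      "\<And>v. (\<And>i. i < p 0 ==> coherent Rm J (v i)) ==>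
      (\<And>t. \<exists>l\<in>J n. e (\<lambda>i\<in>{..<p 0}. v i t) \<ominus>\<^bsub>Rm\<^esub> l \<in> imul Rm (J t) (carrier Rm)) ==>
      \<exists>c. (\<forall>i<k. c i \<in> carrier S) \<and> (\<lambda>i\<in>{..<p 0}. mk (v i)) = lincomb (FS (p 0)) (\<lambda>i. \<iota>t (p 0) (g i)) c k"
      using tuple_generated[OF d(2) fin_gen_ring[OF R] Jsub] by blast
    obtain v where v: "\<And>i. i < p 0 ==> coherent Rm J (v i)" "x = (\<lambda>i\<in>{..<p 0}. mk (v i))" using FS_coherent[OF x(1)] by blast
    let ?e = "\<lambda>t. e (\<lambda>i\<in>{..<p 0}. v i t)"
    have em: "coherent Rm J ?e" "bce e (p 0) x = mk ?e" using bce_mk[OF d(2) v(1)] v(2) by auto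
    have en: "?e n \<in> J n" using Ker_mk[OF em(1)] x(2) em(2) by simp
    \<comment> \<open>Up to level \<open>n\<close> the \<open>n\<close>-th term serves as
      \<open>l\<close>; from there on the term itself already lies in \<open>J n\<close>.\<close>
    have "\<exists>l\<in>J n. ?e t \<ominus>\<^bsub>Rm\<^esub> l \<in> imul Rm (J t) (carrier Rm)" for t
    proof (cases "t \<le> n")
      case True
      have "?e n \<ominus>\<^bsub>Rm\<^esub> ?e t \<in> J t" by (rule coherent_le[OF Rmod Jsub J_antimono em(1) True])
      then have "?e t \<ominus>\<^bsub>Rm\<^esub> ?e n \<in> J t" using mod_sym[OF Rmod Jsub] em(1) by (simp add: coherent_def)
      then show ?thesis using en unfolding imul_ring[OF JI] by blast
    next
      case False
      then have nt: "n \<le> t" by simp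
      have "?e t \<ominus>\<^bsub>Rm\<^esub> ?e n \<in> J n" by (rule coherent_le[OF Rmod Jsub J_antimono em(1) nt])
      then have "?e t \<in> J n" using mod_mem[OF Rmod Jsub _ en] em(1) by (simp add: coherent_def)
      moreover have "?e t \<ominus>\<^bsub>Rm\<^esub> ?e t \<in> J t" by (rule mod_refl[OF Rmod Jsub]) (use em(1) in \<open>simp add: coherent_def\<close>)
      ultimately show ?thesis unfolding imul_ring[OF JI] by blast
    qed
    from g(3)[OF v(1) this] obtain c where c: "\<forall>i<k. c i \<in> carrier S" "x = lincomb (FS (p 0)) (\<lambda>i. \<iota>t (p 0) (g i)) c k"
      unfolding v(2) by blast
    have "\<exists>h\<in>carrier (FR (p (Suc 0))). g j = d 0 h" if "j < k" for j using d(4) g(1,2) that by blast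
    note h = this
    show ?thesis unfolding c(2) by (rule im[OF h]) (use c(1) in auto)
  qed
  have ker: "\<exists>y\<in>carrier (FS (p (Suc (Suc i)))). x = dhat p d (Suc i) y"
    if x: "x \<in> carrier (FS (p (Suc i)))" "dhat p d i x = \<zero>\<^bsub>FS (p i)\<^esub>" for i x
  proof -
    obtain k g where g: "\<And>j. j < k ==> g j \<in> carrier (FR (p (Suc i)))" "\<And>j. j < k ==> d i (g j) \<in> {\<zero>\<^bsub>FR (p i)\<^esub>}"
      "\<And>v. (\<And>j. j < p (Suc i) ==> coherent Rm J (v j)) ==>
      (\<And>t. \<exists>l\<in>{\<zero>\<^bsub>FR (p i)\<^esub>}. d i (\<lambda>j\<in>{..<p (Suc i)}. v j t) \<ominus>\<^bsub>FR (p i)\<^esub> l \<in> imul (FR (p i)) (J t) (carrier (FR (p i)))) ==>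
      \<exists>c. (\<forall>j<k. c j \<in> carrier S) \<and> (\<lambda>j\<in>{..<p (Suc i)}. mk (v j)) = lincomb (FS (p (Suc i))) (\<lambda>j. \<iota>t (p (Suc i)) (g j)) c k"
      using tuple_generated[OF d(1) fin_gen_free[OF R] submodule_zero[OF Fmod]] by blast
    obtain v where v: "\<And>j. j < p (Suc i) ==> coherent Rm J (v j)" "x = (\<lambda>j\<in>{..<p (Suc i)}. mk (v j))" using FS_coherent[OF x(1)] by blast
    let ?w = "\<lambda>t. \<lambda>j\<in>{..<p (Suc i)}. v j t"
    have dw: "d i (?w t) \<in> carrier (FR (p i))" for t by (rule lin_closed[OF d(1) tuple_closed[OF v(1)]])
    have "d i (?w t) \<in> imul (FR (p i)) (J t) (carrier (FR (p i)))" for t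
      unfolding free_module_tup
    proof (rule imul_tup[OF Rmod JI])
      show "d i (?w t) \<in> carrier (tup Rm (p i))" using dw[of t] by (simp add: free_module_tup)
      fix l assume l: "l < p i"
      have "mk (\<lambda>n. d i (?w n) l) = dhat p d i x l" unfolding v(2) dhat_def by (rule bc_mk[OF d(1) v(1) l, symmetric])
      also have "\<dots> = \<zero>\<^bsub>S\<^esub>" unfolding x(2) using tup_simps(2)[OF l, of Sm] by (simp add: free_module_tup)
      finally have eq: "mk (\<lambda>n. d i (?w n) l) = \<zero>\<^bsub>S\<^esub>" .
      have "J t +>\<^bsub>R\<^esub> d i (?w t) l = J t" using fun_cong[OF eq, of t] unfolding S_zero_at .
      then show "d i (?w t) l \<in> imul Rm (J t) (carrier Rm)"
        using mk_zero_at[OF free_closed[OF dw l]] unfolding imul_ring[OF JI] by simp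
    qed
    then have "\<exists>l\<in>{\<zero>\<^bsub>FR (p i)\<^esub>}. d i (?w t) \<ominus>\<^bsub>FR (p i)\<^esub> l \<in> imul (FR (p i)) (J t) (carrier (FR (p i)))" for t
      using sub_minus[OF submodule_imul[OF Fmod JI module.carrier_is_submodule[OF Fmod]] _ imul_zero] by blast
    from g(3)[OF v(1) this] obtain c where c: "\<forall>j<k. c j \<in> carrier S" "x = lincomb (FS (p (Suc i))) (\<lambda>j. \<iota>t (p (Suc i)) (g j)) c k"
      unfolding v(2) by blast
    have "\<exists>h\<in>carrier (FR (p (Suc (Suc i)))). g j = d (Suc i) h" if "j < k" for j using d(6) g(1,2) that by blast
    note h = this
    show ?thesis unfolding c(2) by (rule im[OF h]) (use c(1) in auto)
  qed
  have e0: "\<forall>x\<in>carrier (FS (p 0)). bce e (p 0) x \<in> Ker n \<longleftrightarrow> x \<in> dhat p d 0 ` carrier (FS (p (Suc 0)))"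
    using ker0 ed by blast
  have ei: "\<forall>i. \<forall>x\<in>carrier (FS (p (Suc i))). dhat p d i x = \<zero>\<^bsub>FS (p i)\<^esub> \<longleftrightarrow> x \<in> dhat p d (Suc i) ` carrier (FS (p (Suc (Suc i))))"
    using ker dd by blast
  show ?thesis unfolding fres_def using dl el u e0 ei by blast
qed

lemma clift_hat:
  assumes "fres R (J m) p d e" "fres R (J n) p' d' e'" "clift R p d e p' d' e' (J n) \<phi>"
  shows "clift S p (dhat p d) (bce e (p 0)) p' (dhat p' d') (bce e' (p' 0)) (Ker n) (\<lambda>i. bc (\<phi> i) (p i) (p' i))"
proof -
  note d = fresD[OF assms(1)] and d' = fresD[OF assms(2)]
  note b = basis_closed[OF R]
  have KS: "submodule (Ker n) S Sm" using Ker_ideal ideal_iff_submodule[OF cring_S] by blast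
  have \<iota>K: "\<iota> a \<in> Ker n" if "a \<in> J n" for a unfolding \<iota>_mk using Ker_mk[OF coherent_const[OF Jc[OF that]]] that by simp
  have \<phi>: "lin R (FR (p i)) (FR (p' i)) (\<phi> i)"
    "x \<in> carrier (FR (p (Suc i))) ==> d' i (\<phi> (Suc i) x) = \<phi> i (d i x)"
    "y \<in> carrier (FR (p 0)) ==> e' (\<phi> 0 y) \<ominus>\<^bsub>R\<^esub> e y \<in> J n" for i x y
    using assms(3) by (auto simp: clift_def cmap_def)
  show ?thesis unfolding clift_def cmap_def
  proof (intro conjI allI ballI)
    fix i show "lin S (FS (p i)) (FS (p' i)) (bc (\<phi> i) (p i) (p' i))" by (rule bc_lin[OF \<phi>(1)])
    fix x assume x: "x \<in> carrier (FS (p (Suc i)))"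
    show "dhat p' d' i (bc (\<phi> (Suc i)) (p (Suc i)) (p' (Suc i)) x) = bc (\<phi> i) (p i) (p' i) (dhat p d i x)"
      unfolding dhat_def
    proof (rule lin_eq_basis[OF SFmod lin_comp[OF bc_lin[OF \<phi>(1)] bc_lin[OF d'(1)]] lin_comp[OF bc_lin[OF d(1)] bc_lin[OF \<phi>(1)]] _ x])
      fix j assume j: "j < p (Suc i)"
      show "bc (d' i) (p' (Suc i)) (p' i) (bc (\<phi> (Suc i)) (p (Suc i)) (p' (Suc i)) (basis S (p (Suc i)) j)) =
         bc (\<phi> i) (p i) (p' i) (bc (d i) (p (Suc i)) (p i) (basis S (p (Suc i)) j))"
        using bc_basis[OF \<phi>(1) j] bc_basis[OF d(1) j] bc_\<iota>t[OF d'(1) lin_closed[OF \<phi>(1) b]] bc_\<iota>t[OF \<phi>(1) lin_closed[OF d(1) b]] \<phi>(2)[OF b]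
        by simp
    qed
  next
    fix x assume x: "x \<in> carrier (FS (p 0))"
    have "bce e' (p' 0) (bc (\<phi> 0) (p 0) (p' 0) x) \<ominus>\<^bsub>Sm\<^esub> bce e (p 0) x \<in> Ker n"
    proof (rule lin_in_sub[OF SRmod lin_diff[OF SRmod lin_comp[OF bc_lin[OF \<phi>(1)] bce_lin[OF d'(2)]] bce_lin[OF d(2)]] KS _ x])
      fix j assume j: "j < p 0"
      have c: "e' (\<phi> 0 (basis R (p 0) j)) \<in> carrier Rm" "e (basis R (p 0) j) \<in> carrier Rm"
        using lin_closed[OF d'(2) lin_closed[OF \<phi>(1) b]] lin_closed[OF d(2) b] by auto
      have eq: "bce e' (p' 0) (bc (\<phi> 0) (p 0) (p' 0) (basis S (p 0) j)) \<ominus>\<^bsub>Sm\<^esub> bce e (p 0) (basis S (p 0) j)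
          = \<iota> (e' (\<phi> 0 (basis R (p 0) j)) \<ominus>\<^bsub>R\<^esub> e (basis R (p 0) j))"
        using bc_basis[OF \<phi>(1) j] bce_basis[OF d(2) j] bce_\<iota>t[OF d'(2) lin_closed[OF \<phi>(1) b]]
          lin_minus[OF Rmod module_rs[OF SRmod] lin_\<iota> c] by simp
      show "bce e' (p' 0) (bc (\<phi> 0) (p 0) (p' 0) (basis S (p 0) j)) \<ominus>\<^bsub>Sm\<^esub> bce e (p 0) (basis S (p 0) j) \<in> Ker n"
        unfolding eq by (rule \<iota>K[OF \<phi>(3)[OF b]])
    qed
    then show "bce e' (p' 0) (bc (\<phi> 0) (p 0) (p' 0) x) \<ominus>\<^bsub>S\<^esub> bce e (p 0) x \<in> Ker n" by simp
  qed
qed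

text \<open>Linear maps from a base-changed free module to \<open>X\<close> correspond to
  \<open>R\<close>-linear maps from the original one, so both sides involve the same cochains. The
  base-changed resolutions belong to the powers of the extended ideal by
  \<open>extended_power\<close>.\<close>

lemma vanish_base_change:
  fixes X (structure)
  assumes X: "module S X" and N: "submodule N S X" and L: "submodule L S X" and LN: "L \<subseteq> N"
  shows "vanish S (extended_ideal R \<aa>) X N L k \<longleftrightarrow> vanish R \<aa> (rs X) N L k"
proof -
  note rX = module_rs[OF X] and rN = submodule_rs[OF X N] and rL = submodule_rs[OF X L]
  note b = basis_closed[OF R]
  obtain P D E where sys: "\<And>n. fres R (J n) (P n) (D n) (E n)" using fres_system[OF R NR \<aa>] by blast
  let ?P = P and ?D = "\<lambda>n. dhat (P n) (D n)" and ?E = "\<lambda>n. bce (E n) (P n 0)"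
  have sysS: "fres S (ideal_power S (extended_ideal R \<aa>) n) (P n) (?D n) (?E n)" for n
    unfolding extended_power by (rule fres_hat[OF sys])
  note d = fresD[OF sys]
  have dhat_\<iota>t: "?D n i (\<iota>t (P n (Suc i)) x) = \<iota>t (P n i) (D n i x)" if "x \<in> carrier (FR (P n (Suc i)))" for n i x
    unfolding dhat_def by (rule bc_\<iota>t[OF d(1) that])
  have dhat_basis: "?D n i (basis S (P n (Suc i)) j) = \<iota>t (P n i) (D n i (basis R (P n (Suc i)) j))" if "j < P n (Suc i)" for n i j
    unfolding dhat_def by (rule bc_basis[OF d(1) that])
  have lift: "\<exists>\<phi>. clift R (P m) (D m) (E m) (P n) (D n) (E n) (J n) \<phi>" if "n \<le> m" for m n
    by (rule fres_clift[OF R sys sys J_antimono[OF that] JI])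
  note liftS = clift_hat[OF sys sys, folded extended_power]
  show ?thesis
  proof
    assume v: "vanish S (extended_ideal R \<aa>) X N L k"
    show "vanish R \<aa> (rs X) N L k"
    proof (rule vanishI[OF rX rN rL LN \<aa> sys])
      fix n f assume f: "relcoc R (P n) (D n) (rs X) N L k f"
      then have f1: "lin R (FR (P n k)) (rs X) f" "\<And>x. x \<in> carrier (FR (P n k)) ==> f x \<in> N"
        "\<And>x. x \<in> carrier (FR (P n (Suc k))) ==> f (D n k x) \<in> L" by (auto simp: relcoc_def)
      let ?f = "ext X f (P n k)"
      note fl = ext_lin[OF X f1(1)]
      have "relcoc S (P n) (?D n) X N L k ?f"
        unfolding relcoc_def
      proof (intro conjI ballI fl)
        show "?f x \<in> N" if "x \<in> carrier (FS (P n k))" for x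
          by (rule lin_in_sub[OF X fl N _ that]) (use ext_basis[OF X f1(1)] f1(2)[OF b] in simp)
        show "?f (?D n k x) \<in> L" if "x \<in> carrier (FS (P n (Suc k)))" for x
          by (rule lin_in_sub[OF X lin_comp[OF fresD(1)[OF sysS] fl] L _ that])
            (use dhat_basis ext_\<iota>t[OF X f1(1) lin_closed[OF d(1) b]] f1(3)[OF b] in simp)
      qed
      from vanishD[OF X N L LN extended_ideal_ideal v sysS this]
      obtain m0 where m0: "m0 \<ge> n" "\<And>m \<phi>. m \<ge> m0 ==> clift S (P m) (?D m) (?E m) (P n) (?D n) (?E n) (ideal_power S (extended_ideal R \<aa>) n) \<phi> ==>
        relcob S (P m) (?D m) X N L k (\<lambda>x. ?f (\<phi> k x))" by blast
      obtain \<phi> where \<phi>: "clift R (P m0) (D m0) (E m0) (P n) (D n) (E n) (J n) \<phi>" using lift[OF m0(1)] by blast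
      have \<phi>l: "lin R (FR (P m0 i)) (FR (P n i)) (\<phi> i)" for i using \<phi> by (auto simp: clift_def cmap_def)
      have cob: "relcob S (P m0) (?D m0) X N L k (\<lambda>x. ?f (bc (\<phi> k) (P m0 k) (P n k) x))"
        using m0(2)[OF le_refl liftS[OF \<phi>]] .
      have ff: "?f (bc (\<phi> k) (P m0 k) (P n k) (\<iota>t (P m0 k) x)) = f (\<phi> k x)" if "x \<in> carrier (FR (P m0 k))" for x
        using bc_\<iota>t[OF \<phi>l that] ext_\<iota>t[OF X f1(1) lin_closed[OF \<phi>l that]] by simp
      have "relcob R (P m0) (D m0) (rs X) N L k (\<lambda>x. f (\<phi> k x))"
      proof (cases k)
        case 0
        have "f (\<phi> k x) \<in> L" if x: "x \<in> carrier (FR (P m0 k))" for x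
        proof -
          have "?f (bc (\<phi> k) (P m0 k) (P n k) (\<iota>t (P m0 k) x)) \<in> L" using cob \<iota>t_closed[OF x] 0 by (simp add: relcob_def)
          then show ?thesis unfolding ff[OF x] .
        qed
        then show ?thesis using 0 by (simp add: relcob_def)
      next
        case (Suc j)
        then obtain g where g: "lin S (FS (P m0 j)) X g" "\<And>x. x \<in> carrier (FS (P m0 j)) ==> g x \<in> N"
          "\<And>x. x \<in> carrier (FS (P m0 (Suc j))) ==> ?f (bc (\<phi> k) (P m0 k) (P n k) x) \<ominus> g (?D m0 j x) \<in> L"
          using cob by (auto simp: relcob_def)
        have "f (\<phi> k x) \<ominus> g (\<iota>t (P m0 j) (D m0 j x)) \<in> L" if x: "x \<in> carrier (FR (P m0 (Suc j)))" for x
          using g(3)[OF \<iota>t_closed[OF x]] ff[of x] x dhat_\<iota>t[OF x] Suc by simp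
        then show ?thesis unfolding relcob_def using Suc lin_restrict[OF g(1)] g(2)[OF \<iota>t_closed]
          by (auto intro!: exI[of _ "\<lambda>x. g (\<iota>t (P m0 j) x)"])
      qed
      then show "\<exists>m\<ge>n. \<exists>\<phi>. clift R (P m) (D m) (E m) (P n) (D n) (E n) (J n) \<phi> \<and> relcob R (P m) (D m) (rs X) N L k (\<lambda>x. f (\<phi> k x))"
        using m0(1) \<phi> by blast
    qed
  next
    assume v: "vanish R \<aa> (rs X) N L k"
    show "vanish S (extended_ideal R \<aa>) X N L k"
    proof (rule vanishI[OF X N L LN extended_ideal_ideal sysS])
      fix n f assume f: "relcoc S (P n) (?D n) X N L k f"
      then have f1: "lin S (FS (P n k)) X f" "\<And>x. x \<in> carrier (FS (P n k)) ==> f x \<in> N"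
        "\<And>x. x \<in> carrier (FS (P n (Suc k))) ==> f (?D n k x) \<in> L" by (auto simp: relcoc_def)
      let ?f = "\<lambda>x. f (\<iota>t (P n k) x)"
      have "relcoc R (P n) (D n) (rs X) N L k ?f"
        unfolding relcoc_def using lin_restrict[OF f1(1)] f1(2)[OF \<iota>t_closed] f1(3)[OF \<iota>t_closed] dhat_\<iota>t by auto
      from vanishD[OF rX rN rL LN \<aa> v sys this]
      obtain m0 where m0: "m0 \<ge> n" "\<And>m \<phi>. m \<ge> m0 ==> clift R (P m) (D m) (E m) (P n) (D n) (E n) (J n) \<phi> ==>
        relcob R (P m) (D m) (rs X) N L k (\<lambda>x. ?f (\<phi> k x))" by blast
      obtain \<phi> where \<phi>: "clift R (P m0) (D m0) (E m0) (P n) (D n) (E n) (J n) \<phi>" using lift[OF m0(1)] by blast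
      have \<phi>l: "lin R (FR (P m0 i)) (FR (P n i)) (\<phi> i)" for i using \<phi> by (auto simp: clift_def cmap_def)
      have cob: "relcob R (P m0) (D m0) (rs X) N L k (\<lambda>x. ?f (\<phi> k x))" by (rule m0(2)[OF le_refl \<phi>])
      let ?\<phi> = "bc (\<phi> k) (P m0 k) (P n k)"
      note f\<phi> = lin_comp[OF bc_lin[OF \<phi>l[of k]] f1(1)]
      have "relcob S (P m0) (?D m0) X N L k (\<lambda>x. f (?\<phi> x))"
      proof (cases k)
        case 0
        have "f (?\<phi> x) \<in> L" if "x \<in> carrier (FS (P m0 k))" for x
          by (rule lin_in_sub[OF X f\<phi> L _ that]) (use bc_basis[OF \<phi>l] cob b 0 in \<open>auto simp: relcob_def\<close>)
        then show ?thesis using 0 by (simp add: relcob_def)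
      next
        case (Suc j)
        then obtain g where g: "lin R (FR (P m0 j)) (rs X) g" "\<And>x. x \<in> carrier (FR (P m0 j)) ==> g x \<in> N"
          "\<And>x. x \<in> carrier (FR (P m0 (Suc j))) ==> ?f (\<phi> k x) \<ominus> g (D m0 j x) \<in> L"
          using cob by (auto simp: relcob_def)
        note gl = ext_lin[OF X g(1)]
        have f\<phi>': "lin S (FS (P m0 (Suc j))) X (\<lambda>x. f (?\<phi> x))" using f\<phi> Suc by simp
        have gN: "ext X g (P m0 j) x \<in> N" if "x \<in> carrier (FS (P m0 j))" for x
          by (rule lin_in_sub[OF X gl N _ that]) (use ext_basis[OF X g(1)] g(2)[OF b] in simp)
        have "f (?\<phi> x) \<ominus> ext X g (P m0 j) (?D m0 j x) \<in> L" if x: "x \<in> carrier (FS (P m0 (Suc j)))" for x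
          by (rule lin_in_sub[OF X lin_diff[OF X f\<phi>' lin_comp[OF fresD(1)[OF sysS] gl]] L _ x])
            (use bc_basis[OF \<phi>l] dhat_basis ext_\<iota>t[OF X g(1) lin_closed[OF d(1) b]] g(3)[OF b] Suc in simp)
        then show ?thesis unfolding relcob_def using Suc gl gN by (auto intro!: exI[of _ "ext X g (P m0 j)"])
      qed
      then show "\<exists>m\<ge>n. \<exists>\<phi>. clift S (P m) (?D m) (?E m) (P n) (?D n) (?E n) (ideal_power S (extended_ideal R \<aa>) n) \<phi> \<and>
          relcob S (P m) (?D m) X N L k (\<lambda>x. f (\<phi> k x))"
        using m0(1) liftS[OF \<phi>] by blast
    qed
  qed
qed

end

subsection \<open>Cocycles with values in the completion\<close>

lemma submodule_tup:
  assumes "module R M" "submodule N R M"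
  shows "submodule {u \<in> carrier (tup M p). \<forall>j<p. u j \<in> N} R (tup M p)"
  by (rule submoduleI'[OF module_tup[OF assms(1)]])
    (auto simp: tup_simps tup_closed[OF assms(1)] intro: sub_zero[OF assms(2)] sub_add[OF assms(2)] sub_smult[OF assms(2)])

lemma lin_lincomb_tup:
  assumes "module R M" "\<And>j. j < p ==> x j \<in> carrier R"
  shows "lin R (tup M p) M (\<lambda>u. lincomb M u x p)"
  by (rule lin_lincomb_vec[where k=p and w="\<lambda>j u. u j" and c=x, OF module_tup[OF assms(1)] assms(1)])
    (use lin_tup_proj assms(2) in auto)

lemma lincomb_fun_smult:
  assumes "module R X" "y \<in> carrier X" "\<And>i. i < k ==> a i \<in> carrier R" "\<And>i. i < k ==> c i \<in> carrier R"
  shows "lincomb (RM R) a c k \<odot>\<^bsub>X\<^esub> y = lincomb X (\<lambda>i. a i \<odot>\<^bsub>X\<^esub> y) c k"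
proof -
  interpret module R X by fact
  note Rm = module_ring_as_module[OF is_cring]
  show ?thesis
    using lincomb_image[OF Rm assms(1) lin_scale_elt[OF assms(1) lin_ident assms(2)], of k a c] assms(3,4) by simp
qed

context adic
begin

text \<open>Scalars of the completed ring act on the values of cochains, although the resolutions
  live over \<open>R\<close>.\<close>

lemma relcob_smultS:
  fixes X (structure)
  assumes X: "module S X" and N: "submodule N S X" and L: "submodule L S X" and LN: "L \<subseteq> N"
    and d: "\<And>i. lin R (FR (p (Suc i))) (FR (p i)) (d i)"
    and f: "relcob R p d (rs X) N L k f" "\<And>x. x \<in> carrier (FR (p k)) ==> f x \<in> carrier X" and \<sigma>: "\<sigma> \<in> carrier S"
  shows "relcob R p d (rs X) N L k (\<lambda>x. \<sigma> \<odot> f x)"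
proof (cases k)
  case 0
  then show ?thesis using f(1) sub_smult[OF L \<sigma>] by (simp add: relcob_def)
next
  case (Suc j)
  interpret X: module S X by (rule X)
  obtain g where g: "lin R (FR (p j)) (rs X) g" "\<And>x. x \<in> carrier (FR (p j)) ==> g x \<in> N"
    "\<And>x. x \<in> carrier (FR (p (Suc j))) ==> f x \<ominus> g (d j x) \<in> L" using f(1) Suc by (auto simp: relcob_def)
  have sm: "lin S X X (\<lambda>x. \<sigma> \<odot> x)" by (rule lin_scale[OF X lin_ident \<sigma>])
  have 1: "lin R (FR (p j)) (rs X) (\<lambda>x. \<sigma> \<odot> g x)"
    by (rule lin_comp[OF g(1) lin_restrict_scalars[OF \<iota>_hom sm]])
  have 2: "\<sigma> \<odot> f x \<ominus> \<sigma> \<odot> g (d j x) \<in> L" if x: "x \<in> carrier (FR (p (Suc j)))" for x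
  proof -
    have c: "f x \<in> carrier X" "g (d j x) \<in> carrier X" using f(2) x Suc lin_closed[OF g(1) lin_closed[OF d x]] by auto
    have "\<sigma> \<odot> f x \<ominus> \<sigma> \<odot> g (d j x) = \<sigma> \<odot> (f x \<ominus> g (d j x))"
      using lin_minus[OF X X sm c] by simp
    then show ?thesis using sub_smult[OF L \<sigma> g(3)[OF x]] by simp
  qed
  show ?thesis unfolding relcob_def using Suc 1 2 sub_smult[OF N \<sigma> g(2)] by (auto intro!: exI[of _ "\<lambda>x. \<sigma> \<odot> g x"])
qed

lemma relcob_lincombS:
  assumes X: "module S X" and N: "submodule N S X" and L: "submodule L S X" and LN: "L \<subseteq> N"
    and d: "\<And>i. lin R (FR (p (Suc i))) (FR (p i)) (d i)"
    and f: "\<And>i. i < m ==> relcob R p d (rs X) N L k (f i)" "\<And>i x. i < m ==> x \<in> carrier (FR (p k)) ==> f i x \<in> carrier X"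
    and c: "\<And>i. i < m ==> c i \<in> carrier S"
  shows "relcob R p d (rs X) N L k (\<lambda>x. lincomb X (\<lambda>i. f i x) c m)"
  using f c
proof (induction m)
  case 0
  show ?case using relcob_zero[OF module_rs[OF X] submodule_rs[OF X N] submodule_rs[OF X L] LN] by simp
next
  case (Suc m)
  interpret X: module S X by (rule X)
  have 1: "relcob R p d (rs X) N L k (\<lambda>x. lincomb X (\<lambda>i. f i x) c m)" using Suc by simp
  have 2: "relcob R p d (rs X) N L k (\<lambda>x. c m \<odot>\<^bsub>X\<^esub> f m x)" by (rule relcob_smultS[where p=p and d=d, OF X N L LN d]) (use Suc.prems in auto)
  have 3: "lincomb X (\<lambda>i. f i x) c m \<in> carrier X" if "x \<in> carrier (FR (p k))" for x
    by (rule lincomb_closed[OF X]) (use Suc.prems that in auto)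
  show ?case
    using relcob_add[where p=p and d=d, OF module_rs[OF X] submodule_rs[OF X N] submodule_rs[OF X L] LN 1 2 _ _ d] 3 Suc.prems by simp
qed

context
  fixes M :: "('a, 'm, 's) module_scheme" (structure) and N L :: "'m set"
  assumes fg: "fin_gen_module R M" and N: "submodule N R M" and L: "submodule L R M" and LN: "L \<subseteq> N"
begin

private lemmas M = fin_gen_moduleD[OF fg]

interpretation M: module R M by (rule M)

private abbreviation "MM \<equiv> Mhat M"
private abbreviation "N' \<equiv> clos M N"
private abbreviation "L' \<equiv> clos M L"

private lemmas MM = module_Mh[OF M]
private lemmas rMh = module_rs[OF MM]
private lemmas N'S = submodule_clos[OF M N]
private lemmas L'S = submodule_clos[OF M L]
private lemmas N'R = submodule_rs[OF MM N'S]
private lemmas L'R = submodule_rs[OF MM L'S]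
private lemmas L'N' = clos_mono[OF M LN]
private lemmas \<iota>l = lin_\<iota>M[OF M]

lemma relcob_\<iota>M:
  assumes d: "\<And>i. lin R (FR (p (Suc i))) (FR (p i)) (d i)" and f: "relcob R p d M N L k f" "\<And>x. x \<in> carrier (FR (p k)) ==> f x \<in> carrier M"
  shows "relcob R p d (rs MM) N' L' k (\<lambda>x. \<iota>M M (f x))"
proof (cases k)
  case 0
  then show ?thesis using f(1) \<iota>M_clos[OF M L] by (simp add: relcob_def)
next
  case (Suc j)
  then obtain g where g: "lin R (FR (p j)) M g" "\<And>x. x \<in> carrier (FR (p j)) ==> g x \<in> N"
    "\<And>x. x \<in> carrier (FR (p (Suc j))) ==> f x \<ominus> g (d j x) \<in> L" using f(1) by (auto simp: relcob_def)
  have "\<iota>M M (f x) \<ominus>\<^bsub>MM\<^esub> \<iota>M M (g (d j x)) \<in> L'" if x: "x \<in> carrier (FR (p (Suc j)))" for x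
    using lin_minus[OF M rMh \<iota>l, of "f x" "g (d j x)"] f(2) x Suc lin_closed[OF g(1) lin_closed[OF d x]] \<iota>M_clos[OF M L g(3)[OF x]] by simp
  then show ?thesis unfolding relcob_def using Suc lin_comp[OF g(1) \<iota>l] \<iota>M_clos[OF M N g(2)]
    by (auto intro!: exI[of _ "\<lambda>x. \<iota>M M (g x)"])
qed

text \<open>\<open>\<rho>\<close> is a combination of elements of \<open>\<aa>^n\<close> with
  coefficients in the completed ring, and each of these elements turns \<open>G\<close> into a
  coboundary by \<open>relcob_scale\<close>.\<close>

lemma relcob_Ker:
  assumes "fres R (J n) p d e" "relcoc R p d M N L k G" "\<rho> \<in> Ker n"
  shows "relcob R p d (rs MM) N' L' k (\<lambda>x. \<rho> \<odot>\<^bsub>MM\<^esub> \<iota>M M (G x))"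
proof -
  note d = fresD(1)[OF assms(1)]
  obtain kk a where a: "\<And>i. i < kk ==> a i \<in> J n"
    "\<And>x. x \<in> Ker n ==> \<exists>c. (\<forall>i<kk. c i \<in> carrier S) \<and> x = lincomb Sm (\<lambda>i. \<iota> (a i)) c kk"
    using Ker_generated by metis
  obtain c where c: "\<And>i. i < kk ==> c i \<in> carrier S" "\<rho> = lincomb Sm (\<lambda>i. \<iota> (a i)) c kk" using a(2)[OF assms(3)] by blast
  have G: "lin R (FR (p k)) M G" using assms(2) by (simp add: relcoc_def)
  have ac: "\<And>i. i < kk ==> a i \<in> carrier R" using a(1) Jc by blast
  have Gc: "\<iota>M M (G x) \<in> carrier MM" if "x \<in> carrier (FR (p k))" for x using lin_closed[OF lin_comp[OF G \<iota>l] that] by simp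
  have 1: "relcob R p d (rs MM) N' L' k (\<lambda>x. \<iota>M M (a i \<odot> G x))" if i: "i < kk" for i
    by (rule relcob_\<iota>M[where p=p and d=d, OF d relcob_scale[OF M N L LN assms(2,1) JI a(1)[OF i]]]) (use lin_closed[OF G] ac[OF i] in auto)
  have mc: "\<iota>M M (a i \<odot> G x) \<in> carrier MM" if "i < kk" "x \<in> carrier (FR (p k))" for i x
    using lin_closed[OF \<iota>l] ac[OF that(1)] lin_closed[OF G that(2)] by simp
  have "relcob R p d (rs MM) N' L' k (\<lambda>x. lincomb MM (\<lambda>i. \<iota>M M (a i \<odot> G x)) c kk)"
    by (rule relcob_lincombS[where p=p and d=d, OF MM N'S L'S L'N' d 1 mc c(1)])
  then show ?thesis
  proof (rule relcob_mod[OF rMh N'R L'R L'N', where p=p and d=d, OF _ _ _ _ d])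
    fix x assume x: "x \<in> carrier (FR (p k))"
    have "\<rho> \<odot>\<^bsub>MM\<^esub> \<iota>M M (G x) = lincomb MM (\<lambda>i. \<iota> (a i) \<odot>\<^bsub>MM\<^esub> \<iota>M M (G x)) c kk"
      unfolding c(2) by (rule lincomb_fun_smult[OF MM Gc[OF x] \<iota>_closed[OF ac] c(1)])
    also have "\<dots> = lincomb MM (\<lambda>i. \<iota>M M (a i \<odot> G x)) c kk"
      by (rule lincomb_cong) (use lin_smult[OF \<iota>l ac lin_closed[OF G x]] in auto)
    finally have e: "\<rho> \<odot>\<^bsub>MM\<^esub> \<iota>M M (G x) = lincomb MM (\<lambda>i. \<iota>M M (a i \<odot> G x)) c kk" .
    have lc: "lincomb MM (\<lambda>i. \<iota>M M (a i \<odot> G x)) c kk \<in> carrier (rs MM)"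
      using lincomb_closed[OF MM mc[OF _ x] c(1)] by simp
    show "lincomb MM (\<lambda>i. \<iota>M M (a i \<odot> G x)) c kk \<in> carrier (rs MM)" by (rule lc)
    show "\<rho> \<odot>\<^bsub>MM\<^esub> \<iota>M M (G x) \<in> carrier (rs MM)"
      "\<rho> \<odot>\<^bsub>MM\<^esub> \<iota>M M (G x) \<ominus>\<^bsub>rs MM\<^esub> lincomb MM (\<lambda>i. \<iota>M M (a i \<odot> G x)) c kk \<in> L'"
      unfolding e using lc mod_refl[OF rMh L'R lc] by auto
  qed
qed

text \<open>Surjectivity of Ext of \<open>R/\<aa>^n\<close> from \<open>N / L\<close> to the
  closures. Finitely many cocycles over \<open>R\<close> also express those in the completion; each
  coefficient is an element of \<open>R\<close> plus one of \<open>Ker n\<close>, and the second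
  part contributes a coboundary.\<close>

lemma relcoc_approx:
  assumes "fres R (J n) p d e" "relcoc R p d (rs MM) N' L' k f"
  obtains f0 h where "relcoc R p d M N L k f0" "relcob R p d (rs MM) N' L' k h"
    "\<And>x. x \<in> carrier (FR (p k)) ==> h x \<in> carrier MM"
    "\<And>x. x \<in> carrier (FR (p k)) ==> f x = h x \<oplus>\<^bsub>MM\<^esub> \<iota>M M (f0 x)"
proof -
  note d = fresD(1)[OF assms(1)] and b = basis_closed[OF R]
  have f: "lin R (FR (p k)) (rs MM) f" "\<And>x. x \<in> carrier (FR (p k)) ==> f x \<in> N'"
    "\<And>x. x \<in> carrier (FR (p (Suc k))) ==> f (d k x) \<in> L'" using assms(2) by (auto simp: relcoc_def)
  let ?p = "p k" and ?q = "p (Suc k)"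
  let ?A = "tup M ?p" and ?B = "tup M ?q"
  let ?C = "{u \<in> carrier ?A. \<forall>j<?p. u j \<in> N}" and ?L = "{u \<in> carrier ?B. \<forall>j<?q. u j \<in> L}"
  \<comment> \<open>Cochains are tuples of values on the basis, and the coboundary becomes a linear
    map between tuple modules.\<close>
  let ?\<delta> = "\<lambda>u. \<lambda>l\<in>{..<?q}. lincomb M u (d k (basis R ?q l)) ?p"
  have db: "d k (basis R ?q l) \<in> carrier (FR ?p)" for l by (rule lin_closed[OF d b])
  have \<delta>: "lin R ?A ?B ?\<delta>" by (rule lin_into_tup[OF lin_lincomb_tup[OF M]]) (rule free_closed[OF db])
  note C = submodule_tup[OF M N, of ?p] and Ls = submodule_tup[OF M L, of ?q]
  obtain kk g where g: "\<And>i. i < kk ==> g i \<in> ?C" "\<And>i. i < kk ==> ?\<delta> (g i) \<in> ?L"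
    and gen: "\<And>v. (\<And>n. v n \<in> ?C) ==> (\<And>n. v (Suc n) \<ominus>\<^bsub>?A\<^esub> v n \<in> imul ?A (J n) (carrier ?A)) ==>
      (\<And>n. \<exists>l\<in>?L. ?\<delta> (v n) \<ominus>\<^bsub>?B\<^esub> l \<in> imul ?B (J n) (carrier ?B)) ==>
      \<exists>r. (\<forall>i<kk. \<forall>n. r i n \<in> carrier R \<and> r i (Suc n) \<ominus>\<^bsub>R\<^esub> r i n \<in> J n) \<and>
        (\<forall>n. v n \<ominus>\<^bsub>?A\<^esub> lincomb ?A g (\<lambda>i. r i n) kk \<in> imul ?A (J n) (carrier ?A))"
    by (fact completion_generates[OF R NR \<aa> fin_gen_tup[OF fg] fin_gen_tup[OF fg] \<delta> C Ls])
  have Nc: "N \<subseteq> carrier M" using sub_carr[OF N] by blast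
  have "\<forall>j. \<exists>v. coherent M (JM M) v \<and> f (basis R ?p j) = mkM M v \<and> (\<forall>n. v n \<in> N)"
    using clos_coherent[OF M f(2)[OF b] Nc] by metis
  from choice[OF this] obtain w where w: "\<And>j. coherent M (JM M) (w j)" "\<And>j. f (basis R ?p j) = mkM M (w j)" "\<And>j n. w j n \<in> N" by blast
  have wc: "w j n \<in> carrier M" for j n using w(3) Nc by blast
  let ?v = "\<lambda>n. \<lambda>j\<in>{..<?p}. w j n"
  have vA: "?v n \<in> carrier ?A" for n using wc by (auto simp: tup_def)
  have v1: "?v n \<in> ?C" for n using vA w(3) by auto
  have v2: "?v (Suc n) \<ominus>\<^bsub>?A\<^esub> ?v n \<in> imul ?A (J n) (carrier ?A)" for n
  proof (rule imul_tup[OF M JI])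
    show "?v (Suc n) \<ominus>\<^bsub>?A\<^esub> ?v n \<in> carrier ?A" by (rule sub_minus[OF module.carrier_is_submodule[OF module_tup[OF M]] vA vA])
    fix j assume j: "j < ?p"
    have "(?v (Suc n) \<ominus>\<^bsub>?A\<^esub> ?v n) j = w j (Suc n) \<ominus> w j n" using tup_minus[OF M vA vA j] j by simp
    then show "(?v (Suc n) \<ominus>\<^bsub>?A\<^esub> ?v n) j \<in> imul M (J n) (carrier M)" using w(1)[of j] by (simp add: coherent_def JM_def)
  qed
  have rp: "rep M n (f x) (lincomb M (\<lambda>j. w j n) x ?p)" if x: "x \<in> carrier (FR ?p)" for n x
    unfolding lin_expand[OF rMh f(1) x]
    by (rule rep_lincomb[OF M]) (use rep_mkM[OF M w(1)] w(2) free_closed[OF x] in auto)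
  \<comment> \<open>The value of \<open>f\<close> at a boundary lies in the closure of
    \<open>L\<close>, so at level \<open>n\<close> it has a representative in
    \<open>L\<close>.\<close>
  have v3: "\<exists>l\<in>?L. ?\<delta> (?v n) \<ominus>\<^bsub>?B\<^esub> l \<in> imul ?B (J n) (carrier ?B)" for n
  proof -
    have "\<forall>l. \<exists>y. y \<in> L \<and> rep M n (f (d k (basis R ?q l))) y" using rep_clos[OF M f(3)[OF b] L] by blast
    from choice[OF this] obtain y where y: "\<And>l. y l \<in> L" "\<And>l. rep M n (f (d k (basis R ?q l))) (y l)" by blast
    let ?y = "\<lambda>l\<in>{..<?q}. y l"
    have yL: "?y \<in> ?L" using y(1) sub_carr[OF L] by (auto simp: tup_def)
    have yB: "?y \<in> carrier ?B" using yL by blast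
    note dB = lin_closed[OF \<delta> vA[of n]]
    have "?\<delta> (?v n) \<ominus>\<^bsub>?B\<^esub> ?y \<in> imul ?B (J n) (carrier ?B)"
    proof (rule imul_tup[OF M JI])
      show "?\<delta> (?v n) \<ominus>\<^bsub>?B\<^esub> ?y \<in> carrier ?B" by (rule sub_minus[OF module.carrier_is_submodule[OF module_tup[OF M]] dB yB])
      fix l assume l: "l < ?q"
      have "(?\<delta> (?v n) \<ominus>\<^bsub>?B\<^esub> ?y) l = ?\<delta> (?v n) l \<ominus> ?y l" by (rule tup_minus[OF M dB yB l])
      also have "\<dots> = lincomb M (\<lambda>j. w j n) (d k (basis R ?q l)) ?p \<ominus> y l"
        using l by (simp cong: lincomb_cong)
      finally show "(?\<delta> (?v n) \<ominus>\<^bsub>?B\<^esub> ?y) l \<in> imul M (J n) (carrier M)"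
        using rep_unique[OF M rp[OF db] y(2)] unfolding JM_def by simp
    qed
    then show ?thesis using yL by blast
  qed
  from gen[OF v1 v2 v3] obtain r where r: "\<forall>i<kk. \<forall>n. r i n \<in> carrier R \<and> r i (Suc n) \<ominus>\<^bsub>R\<^esub> r i n \<in> J n"
    "\<And>n. ?v n \<ominus>\<^bsub>?A\<^esub> lincomb ?A g (\<lambda>i. r i n) kk \<in> imul ?A (J n) (carrier ?A)" by blast
  have rc: "\<And>i. i < kk ==> coherent Rm J (r i)" using r(1) by (simp add: coherent_def)
  have rcn: "\<And>i n. i < kk ==> r i n \<in> carrier R" using r(1) by blast
  have gA: "\<And>i. i < kk ==> g i \<in> carrier ?A" using g(1) by blast
  have gN: "\<And>i j. i < kk ==> j < ?p ==> g i j \<in> N" using g(1) by blast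
  have gM: "\<And>i j. i < kk ==> j < ?p ==> g i j \<in> carrier M" using gN Nc by blast
  let ?G = "\<lambda>i x. lincomb M (g i) x ?p"
  have Gl: "lin R (FR ?p) M (?G i)" if "i < kk" for i by (rule lin_lincomb[OF M gM[OF that]])
  have Gb: "?G i (basis R ?p j) = g i j" if "i < kk" "j < ?p" for i j by (rule lincomb_basis[OF M gM[OF that(1)] that(2)])
  have Gcoc: "relcoc R p d M N L k (?G i)" if i: "i < kk" for i
    unfolding relcoc_def
  proof (intro conjI ballI Gl[OF i])
    show "?G i x \<in> N" if "x \<in> carrier (FR ?p)" for x by (rule lincomb_in_sub[OF N gN[OF i] free_closed[OF that]])
    show "?G i (d k x) \<in> L" if "x \<in> carrier (FR ?q)" for x
    proof (rule lin_in_sub[OF M lin_comp[OF d Gl[OF i]] L _ that])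
      fix l assume l: "l < ?q"
      have "?\<delta> (g i) l \<in> L" using g(2)[OF i] l by blast
      then show "?G i (d k (basis R ?q l)) \<in> L" using l by simp
    qed
  qed
  have fb: "f (basis R ?p j) = lincomb MM (\<lambda>i. \<iota>M M (?G i (basis R ?p j))) (\<lambda>i. mk (r i)) kk" if j: "j < ?p" for j
  proof -
    have gc: "\<And>i. i < kk ==> coherent M (JM M) (\<lambda>n. g i j)" using coherentM_const[OF M gM] j by blast
    note K = mkM_lincomb[OF M, where v="\<lambda>i n. g i j" and r=r and k=kk, OF rc gc]
    have lA: "lincomb ?A g (\<lambda>i. r i n) kk \<in> carrier ?A" for n by (rule lincomb_closed[OF module_tup[OF M] gA rcn])
    have "w j n \<ominus> lincomb M (\<lambda>i. g i j) (\<lambda>i. r i n) kk \<in> JM M n" for n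
    proof -
      have "lincomb ?A g (\<lambda>i. r i n) kk j = lincomb M (\<lambda>i. g i j) (\<lambda>i. r i n) kk"
        by (rule lincomb_image[OF module_tup[OF M] M lin_tup_proj[OF j] gA rcn])
      then have "(?v n \<ominus>\<^bsub>?A\<^esub> lincomb ?A g (\<lambda>i. r i n) kk) j = w j n \<ominus> lincomb M (\<lambda>i. g i j) (\<lambda>i. r i n) kk"
        using tup_minus[OF M vA lA j] j by simp
      then show ?thesis using imul_tup_D[OF M JI r(2) j, of n] unfolding JM_def by simp
    qed
    then have "mkM M (w j) = mkM M (\<lambda>n. lincomb M (\<lambda>i. g i j) (\<lambda>i. r i n) kk)"
      using mkM_eq_iff[OF M w(1) conjunct1[OF K]] by blast
    also have "\<dots> = lincomb MM (\<lambda>i. \<iota>M M (g i j)) (\<lambda>i. mk (r i)) kk" using conjunct2[OF K] unfolding \<iota>M_def by simp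
    also have "\<dots> = lincomb MM (\<lambda>i. \<iota>M M (?G i (basis R ?p j))) (\<lambda>i. mk (r i)) kk"
      by (rule lincomb_cong) (use Gb j in auto)
    finally show ?thesis using w(2) by simp
  qed
  have Sc: "\<And>i. i < kk ==> mk (r i) \<in> carrier S" using mk_closed[OF rc] .
  have \<iota>Gl: "lin R (FR ?p) (rs MM) (\<lambda>x. \<iota>M M (?G i x))" if "i < kk" for i by (rule lin_comp[OF Gl[OF that] \<iota>l])
  have suml: "lin R (FR ?p) (rs MM) (\<lambda>x. lincomb MM (\<lambda>i. \<iota>M M (?G i x)) c m)" if "m \<le> kk" "\<And>i. i < kk ==> c i \<in> carrier S" for c m
    using that(1)
  proof (induction m)
    case 0
    then show ?case using lin_const_zero[OF rMh] by simp
  next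
    case (Suc m)
    have "lin R (FR ?p) (rs MM) (\<lambda>x. c m \<odot>\<^bsub>MM\<^esub> \<iota>M M (?G m x))"
      by (rule lin_comp[OF \<iota>Gl lin_restrict_scalars[OF \<iota>_hom lin_scale[OF MM lin_ident]]]) (use Suc.prems that in auto)
    from lin_plus[OF rMh Suc.IH this] Suc.prems show ?case by simp
  qed
  have fx: "f x = lincomb MM (\<lambda>i. \<iota>M M (?G i x)) (\<lambda>i. mk (r i)) kk" if x: "x \<in> carrier (FR ?p)" for x
    by (rule lin_eq_basis[OF rMh f(1) suml[OF le_refl Sc] fb x])
  \<comment> \<open>The coefficients truncated at level \<open>n\<close>; the remainders
    \<open>?\<rho> i\<close> vanish there and lie in \<open>Ker n\<close>.\<close>
  let ?s = "\<lambda>i. r i n"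
  let ?\<rho> = "\<lambda>i. mk (\<lambda>t. r i t \<oplus>\<^bsub>R\<^esub> (\<ominus>\<^bsub>R\<^esub> r i n))"
  have mc: "coherent Rm J (\<lambda>t. \<ominus>\<^bsub>R\<^esub> r i n)" if "i < kk" for i using coherent_const rcn[OF that] by simp
  have \<rho>c: "coherent Rm J (\<lambda>t. r i t \<oplus>\<^bsub>R\<^esub> (\<ominus>\<^bsub>R\<^esub> r i n))" if "i < kk" for i by (rule coherent_add[OF rc[OF that] mc[OF that]])
  have \<rho>K: "?\<rho> i \<in> Ker n" if "i < kk" for i
    using Ker_mk[OF \<rho>c[OF that]] rcn[OF that] additive_subgroup.zero_closed[OF ideal.axioms(1)[OF JI]] by (simp add: r_neg)
  have \<rho>S: "?\<rho> i \<in> carrier S" if "i < kk" for i by (rule mk_closed[OF \<rho>c[OF that]])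
  have rs: "mk (r i) = ?\<rho> i \<oplus>\<^bsub>S\<^esub> \<iota> (?s i)" if "i < kk" for i
    unfolding \<iota>_mk S_add[OF \<rho>c[OF that] coherent_const[OF rcn[OF that]]]
    using rcn[OF that] by (simp add: a_assoc l_neg)
  let ?h = "\<lambda>x. lincomb MM (\<lambda>i. ?\<rho> i \<odot>\<^bsub>MM\<^esub> \<iota>M M (?G i x)) (\<lambda>i. \<one>\<^bsub>S\<^esub>) kk"
  let ?f0 = "\<lambda>x. lincomb M (\<lambda>i. ?G i x) ?s kk"
  have \<iota>Gc: "\<iota>M M (?G i x) \<in> carrier MM" if "i < kk" "x \<in> carrier (FR ?p)" for i x using lin_closed[OF \<iota>Gl[OF that(1)] that(2)] by simp
  have \<rho>Gc: "?\<rho> i \<odot>\<^bsub>MM\<^esub> \<iota>M M (?G i x) \<in> carrier MM" if "i < kk" "x \<in> carrier (FR ?p)" for i x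
    by (rule module.smult_closed[OF MM \<rho>S[OF that(1)] \<iota>Gc[OF that]])
  have hcob: "relcob R p d (rs MM) N' L' k ?h"
    by (rule relcob_lincombS[where p=p and d=d, OF MM N'S L'S L'N' d relcob_Ker[OF assms(1) Gcoc \<rho>K] \<rho>Gc]) auto
  have hc: "?h x \<in> carrier MM" if "x \<in> carrier (FR ?p)" for x
    by (rule lincomb_closed[OF MM \<rho>Gc[OF _ that]]) auto
  have f0l: "lin R (FR ?p) M ?f0" by (rule lin_lincomb_vec[OF Fmod M Gl rcn])
  have f0: "relcoc R p d M N L k ?f0"
    unfolding relcoc_def
  proof (intro conjI ballI f0l)
    show "?f0 x \<in> N" if "x \<in> carrier (FR ?p)" for x
      by (rule lincomb_in_sub[OF N _ rcn]) (use Gcoc that in \<open>auto simp: relcoc_def\<close>)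
    show "?f0 (d k x) \<in> L" if "x \<in> carrier (FR ?q)" for x
      by (rule lincomb_in_sub[OF L _ rcn]) (use Gcoc that in \<open>auto simp: relcoc_def\<close>)
  qed
  have feq: "f x = ?h x \<oplus>\<^bsub>MM\<^esub> \<iota>M M (?f0 x)" if x: "x \<in> carrier (FR ?p)" for x
  proof -
    interpret H: module S MM by (rule MM)
    have "f x = lincomb MM (\<lambda>i. \<iota>M M (?G i x)) (\<lambda>i. ?\<rho> i \<oplus>\<^bsub>S\<^esub> \<iota> (?s i)) kk"
      unfolding fx[OF x] by (rule lincomb_cong) (use rs in auto)
    also have "\<dots> = lincomb MM (\<lambda>i. \<iota>M M (?G i x)) ?\<rho> kk \<oplus>\<^bsub>MM\<^esub> lincomb MM (\<lambda>i. \<iota>M M (?G i x)) (\<lambda>i. \<iota> (?s i)) kk"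
      by (rule lincomb_add_coeff[OF MM \<iota>Gc[OF _ x] \<rho>S \<iota>_closed[OF rcn]])
    also have "lincomb MM (\<lambda>i. \<iota>M M (?G i x)) ?\<rho> kk = ?h x"
    proof -
      have "lincomb MM (\<lambda>i. \<iota>M M (?G i x)) ?\<rho> m = lincomb MM (\<lambda>i. ?\<rho> i \<odot>\<^bsub>MM\<^esub> \<iota>M M (?G i x)) (\<lambda>i. \<one>\<^bsub>S\<^esub>) m" if "m \<le> kk" for m
        using that by (induction m) (simp_all add: \<rho>Gc[OF _ x])
      then show ?thesis by blast
    qed
    also have "lincomb MM (\<lambda>i. \<iota>M M (?G i x)) (\<lambda>i. \<iota> (?s i)) kk = \<iota>M M (?f0 x)"
    proof -
      have "\<iota>M M (?f0 x) = lincomb (rs MM) (\<lambda>i. \<iota>M M (?G i x)) ?s kk"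
        by (rule lincomb_image[OF M rMh \<iota>l lin_closed[OF Gl x] rcn])
      also have "\<dots> = lincomb MM (\<lambda>i. \<iota>M M (?G i x)) (\<lambda>i. \<iota> (?s i)) kk" by (induction kk) simp_all
      finally show ?thesis by simp
    qed
    finally show ?thesis .
  qed
  show thesis by (rule that[OF f0 hcob hc feq])
qed

text \<open>Injectivity of the same comparison. If \<open>f\<close> becomes a coboundary in the
  completion, truncation approximates \<open>f\<close> to every order by coboundaries over
  \<open>R\<close>. Artin-Rees for the coboundaries \<open>B\<close> inside the cocycles
  \<open>Z\<close> gives \<open>f \<in> \<aa>^m Z + B\<close>, and
  \<open>\<aa>^m Z \<subseteq> B\<close> by \<open>relcob_scale\<close>.\<close>

lemma relcob_descent:
  assumes "fres R (J m) p d e" "relcoc R p d M N L k f" "relcob R p d (rs MM) N' L' k (\<lambda>x. \<iota>M M (f x))"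
  shows "relcob R p d M N L k f"
proof -
  note d = fresD(1)[OF assms(1)] and dd = fresD(7)[OF assms(1)] and b = basis_closed[OF R]
  have f: "lin R (FR (p k)) M f" using assms(2) by (simp add: relcoc_def)
  let ?p = "p k"
  let ?A = "tup M ?p"
  note A = module_tup[OF M, of ?p]
  let ?F = "\<lambda>u x. lincomb M u x ?p"
  have Fl: "lin R (FR ?p) M (?F u)" if "u \<in> carrier ?A" for u by (rule lin_lincomb[OF M tup_simps(1)[OF that]])
  have Fc: "?F u x \<in> carrier M" if "u \<in> carrier ?A" "x \<in> carrier (FR ?p)" for u x by (rule lin_closed[OF Fl[OF that(1)] that(2)])
  have Fadd: "?F (u \<oplus>\<^bsub>?A\<^esub> v) x = ?F u x \<oplus> ?F v x" if "u \<in> carrier ?A" "v \<in> carrier ?A" "x \<in> carrier (FR ?p)" for u v x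
    by (rule lin_add[OF lin_lincomb_tup[OF M free_closed[OF that(3)]] that(1,2)])
  have Fsm: "?F (r \<odot>\<^bsub>?A\<^esub> u) x = r \<odot> ?F u x" if "r \<in> carrier R" "u \<in> carrier ?A" "x \<in> carrier (FR ?p)" for r u x
    by (rule lin_smult[OF lin_lincomb_tup[OF M free_closed[OF that(3)]] that(1,2)])
  have Fz: "?F \<zero>\<^bsub>?A\<^esub> x = \<zero>" if "x \<in> carrier (FR ?p)" for x
    by (rule lin_zero[OF A M lin_lincomb_tup[OF M free_closed[OF that]]])
  let ?Z = "{u \<in> carrier ?A. relcoc R p d M N L k (?F u)}"
  let ?B = "{u \<in> carrier ?A. relcob R p d M N L k (?F u)}"
  note Ac = tup_closed[OF M, where n="p k"] and [simp] = tup_closed[OF M, where n="p k"]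
  have dx: "d k x \<in> carrier (FR ?p)" if "x \<in> carrier (FR (p (Suc k)))" for x by (rule lin_closed[OF d that])
  have Z: "submodule ?Z R ?A"
  proof (rule submoduleI'[OF A])
    show "\<zero>\<^bsub>?A\<^esub> \<in> ?Z" using Fl[OF Ac(1)] Fz dx sub_zero[OF N] sub_zero[OF L] by (simp add: relcoc_def)
    show "u \<oplus>\<^bsub>?A\<^esub> v \<in> ?Z" if "u \<in> ?Z" "v \<in> ?Z" for u v
      using that Fl[OF Ac(2), of u v] Fadd dx sub_add[OF N] sub_add[OF L] by (simp add: relcoc_def)
    show "r \<odot>\<^bsub>?A\<^esub> u \<in> ?Z" if "r \<in> carrier R" "u \<in> ?Z" for r u
      using that Fl[OF Ac(3), of r u] Fsm dx sub_smult[OF N] sub_smult[OF L] by (simp add: relcoc_def)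
  qed auto
  have B: "submodule ?B R ?A"
  proof (rule submoduleI'[OF A])
    show "\<zero>\<^bsub>?A\<^esub> \<in> ?B" using relcob_cong[OF relcob_zero[OF M N L LN], where f'="?F \<zero>\<^bsub>?A\<^esub>"] Fz by simp
    show "u \<oplus>\<^bsub>?A\<^esub> v \<in> ?B" if uv: "u \<in> ?B" "v \<in> ?B" for u v
    proof -
      have c: "u \<in> carrier ?A" "v \<in> carrier ?A" "relcob R p d M N L k (?F u)" "relcob R p d M N L k (?F v)" using uv by auto
      from relcob_add[OF M N L LN c(3,4) Fc[OF c(1)] Fc[OF c(2)] d]
      have "relcob R p d M N L k (?F (u \<oplus>\<^bsub>?A\<^esub> v))" by (rule relcob_cong) (use Fadd[OF c(1,2)] in auto)
      then show ?thesis using c by simp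
    qed
    show "r \<odot>\<^bsub>?A\<^esub> u \<in> ?B" if ru: "r \<in> carrier R" "u \<in> ?B" for r u
    proof -
      have c: "u \<in> carrier ?A" "relcob R p d M N L k (?F u)" using ru by auto
      from relcob_smult[OF M N L LN c(2) Fl[OF c(1)] d ru(1)]
      have "relcob R p d M N L k (?F (r \<odot>\<^bsub>?A\<^esub> u))" by (rule relcob_cong) (rule Fsm[OF ru(1) c(1)])
      then show ?thesis using c ru(1) by simp
    qed
  qed auto
  have BZ: "?B \<subseteq> ?Z"
  proof
    fix u assume u: "u \<in> ?B"
    then have uA: "u \<in> carrier ?A" and c: "relcob R p d M N L k (?F u)" by auto
    have "(\<forall>x\<in>carrier (FR ?p). ?F u x \<in> N) \<and> (\<forall>x\<in>carrier (FR (p (Suc k))). ?F u (d k x) \<in> L)"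
    proof (cases k)
      case 0
      then show ?thesis using c LN dx by (auto simp: relcob_def)
    next
      case (Suc j)
      then obtain g where g: "lin R (FR (p j)) M g" "\<And>x. x \<in> carrier (FR (p j)) ==> g x \<in> N"
        "\<And>x. x \<in> carrier (FR (p (Suc j))) ==> ?F u x \<ominus> g (d j x) \<in> L" using c by (auto simp: relcob_def)
      have "?F u x \<in> N" if x: "x \<in> carrier (FR ?p)" for x
        by (rule mod_mem[OF M N Fc[OF uA x] g(2)[OF lin_closed[OF d]]]) (use x Suc g(3)[of x] LN in auto)
      moreover have "?F u (d k x) \<in> L" if x: "x \<in> carrier (FR (p (Suc k)))" for x
      proof (rule mod_mem[OF M L Fc[OF uA dx[OF x]]])
        show "g (d j (d k x)) \<in> L" using dd[of x j] x Suc lin_zero[OF Fmod M g(1)] sub_zero[OF L] by simp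
        show "?F u (d k x) \<ominus> g (d j (d k x)) \<in> L" using g(3)[of "d k x"] dx[OF x] Suc by simp
      qed
      ultimately show ?thesis by blast
    qed
    then show "u \<in> ?Z" using uA Fl[OF uA] by (simp add: relcoc_def)
  qed
  \<comment> \<open>The order of approximation that Artin-Rees demands for landing in
    \<open>\<aa>^m Z + B\<close>.\<close>
  obtain t where t: "\<And>x l. x \<in> ?Z ==> l \<in> ?B ==> x \<ominus>\<^bsub>?A\<^esub> l \<in> imul ?A (J t) (carrier ?A) ==>
      \<exists>y\<in>imul ?A (J m) ?Z. \<exists>l\<in>?B. x = y \<oplus>\<^bsub>?A\<^esub> l"
    using weak_artin_rees[OF R NR fin_gen_noeth[OF R NR fin_gen_tup[OF fg]] \<aa> Z B BZ, where n=m] by (metis (no_types, lifting))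
  let ?u = "\<lambda>j\<in>{..<?p}. f (basis R ?p j)"
  have fb: "f (basis R ?p j) \<in> carrier M" for j by (rule lin_closed[OF f b])
  have uA: "?u \<in> carrier ?A" using fb by (simp add: tup_def)
  have Fu: "?F ?u x = f x" if x: "x \<in> carrier (FR ?p)" for x
    unfolding lin_expand[OF M f x] by (rule lincomb_cong) auto
  have uZ: "?u \<in> ?Z" using assms(2) uA Fl[OF uA] Fu dx by (simp add: relcoc_def)
  have "\<exists>bb\<in>?B. ?u \<ominus>\<^bsub>?A\<^esub> bb \<in> imul ?A (J t) (carrier ?A)"
  proof -
    have claim: "\<exists>bb\<in>?B. ?u \<ominus>\<^bsub>?A\<^esub> bb \<in> imul ?A (J t) (carrier ?A)"
      if bb: "bb \<in> carrier ?A" "relcob R p d M N L k (?F bb)" "\<And>j. j < ?p ==> f (basis R ?p j) \<ominus> bb j \<in> JM M t" for bb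
    proof (rule bexI[of _ bb])
      show "?u \<ominus>\<^bsub>?A\<^esub> bb \<in> imul ?A (J t) (carrier ?A)"
      proof (rule imul_tup[OF M JI])
        show "?u \<ominus>\<^bsub>?A\<^esub> bb \<in> carrier ?A" by (rule sub_minus[OF module.carrier_is_submodule[OF A] uA bb(1)])
        show "(?u \<ominus>\<^bsub>?A\<^esub> bb) j \<in> imul M (J t) (carrier M)" if "j < ?p" for j
          unfolding tup_minus[OF M uA bb(1) that] using bb(3)[OF that] that by (simp add: JM_def)
      qed
    qed (use bb in simp)
    show ?thesis
    proof (cases k)
      case 0
      have "\<forall>j. \<exists>y. y \<in> L \<and> rep M t (\<iota>M M (f (basis R ?p j))) y"
        using rep_clos[OF M _ L] assms(3) b 0 by (simp add: relcob_def) blast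
      from choice[OF this] obtain y where y: "\<And>j. y j \<in> L" "\<And>j. rep M t (\<iota>M M (f (basis R ?p j))) (y j)" by blast
      let ?b = "\<lambda>j\<in>{..<?p}. y j"
      have bA: "?b \<in> carrier ?A" using y(1) sub_carr[OF L] by (auto simp: tup_def)
      have "?F ?b x \<in> L" if "x \<in> carrier (FR ?p)" for x
        by (rule lincomb_in_sub[OF L]) (use y(1) free_closed[OF that] in auto)
      then have "relcob R p d M N L k (?F ?b)" using 0 by (simp add: relcob_def)
      then show ?thesis
        by (rule claim[OF bA]) (use rep_unique[OF M rep_\<iota>M[OF M fb] y(2)] in simp)
    next
      case (Suc i)
      obtain g where g: "lin R (FR (p i)) (rs MM) g" "\<And>x. x \<in> carrier (FR (p i)) ==> g x \<in> N'"
        "\<And>x. x \<in> carrier (FR (p (Suc i))) ==> \<iota>M M (f x) \<ominus>\<^bsub>MM\<^esub> g (d i x) \<in> L'" using assms(3) Suc by (auto simp: relcob_def)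
      \<comment> \<open>The bounding cochain \<open>g\<close> is truncated at level \<open>t\<close>
        on the basis.\<close>
      have "\<forall>j. \<exists>y. y \<in> N \<and> rep M t (g (basis R (p i) j)) y" using rep_clos[OF M g(2)[OF b] N] by blast
      from choice[OF this] obtain c where c: "\<And>j. c j \<in> N" "\<And>j. rep M t (g (basis R (p i) j)) (c j)" by blast
      let ?G = "\<lambda>x. lincomb M c x (p i)"
      have cc: "c j \<in> carrier M" for j using c(1) sub_carr[OF N] by blast
      have Gl: "lin R (FR (p i)) M ?G" by (rule lin_lincomb[OF M cc])
      have GN: "?G x \<in> N" if "x \<in> carrier (FR (p i))" for x by (rule lincomb_in_sub[OF N c(1) free_closed[OF that]])
      have Grep: "rep M t (g x) (?G x)" if x: "x \<in> carrier (FR (p i))" for x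
        unfolding lin_expand[OF rMh g(1) x] by (rule rep_lincomb[OF M c(2) free_closed[OF x]])
      have b': "basis R ?p j \<in> carrier (FR (p (Suc i)))" for j using b Suc by simp
      have "\<forall>j. \<exists>y. y \<in> L \<and> rep M t (\<iota>M M (f (basis R ?p j)) \<ominus>\<^bsub>MM\<^esub> g (d i (basis R ?p j))) y"
        using rep_clos[OF M g(3)[OF b'] L] by blast
      from choice[OF this] obtain y where y: "\<And>j. y j \<in> L" "\<And>j. rep M t (\<iota>M M (f (basis R ?p j)) \<ominus>\<^bsub>MM\<^esub> g (d i (basis R ?p j))) (y j)" by blast
      have yc: "y j \<in> carrier M" for j using y(1) sub_carr[OF L] by blast
      let ?Gd = "\<lambda>j. ?G (d i (basis R ?p j))"
      have Gdc: "?Gd j \<in> carrier M" for j by (rule lin_closed[OF Gl lin_closed[OF d b']])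
      \<comment> \<open>The coboundary of the truncation plus a correction \<open>y j\<close> in
        \<open>L\<close>, needed because \<open>f\<close> minus the coboundary of \<open>g\<close>
        vanishes only modulo the closure of \<open>L\<close>.\<close>
      let ?b = "\<lambda>j\<in>{..<?p}. y j \<oplus> ?Gd j"
      have bA: "?b \<in> carrier ?A" using yc Gdc by (simp add: tup_def)
      have "f (basis R ?p j) \<ominus> ?b j \<in> JM M t" if j: "j < ?p" for j
      proof -
        have "rep M t (\<iota>M M (f (basis R ?p j)) \<ominus>\<^bsub>MM\<^esub> g (d i (basis R ?p j))) (f (basis R ?p j) \<ominus> ?Gd j)"
          by (rule rep_minus[OF M rep_\<iota>M[OF M fb] Grep[OF lin_closed[OF d b']]])
        from rep_unique[OF M this y(2)] have "(f (basis R ?p j) \<ominus> ?Gd j) \<ominus> y j \<in> JM M t" .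
        moreover have "(f (basis R ?p j) \<ominus> ?Gd j) \<ominus> y j = f (basis R ?p j) \<ominus> (y j \<oplus> ?Gd j)"
          using fb yc Gdc by (simp add: a_minus_def M.minus_add M.a_ac)
        ultimately show ?thesis using j by simp
      qed
      moreover have "relcob R p d M N L k (?F ?b)"
      proof -
        have "?F ?b x \<ominus> ?G (d i x) \<in> L" if x: "x \<in> carrier (FR (p (Suc i)))" for x
        proof (rule lin_in_sub[OF M lin_diff[OF M _ lin_comp[OF d Gl]] L _ x])
          show "lin R (FR (p (Suc i))) M (?F ?b)" using Fl[OF bA] Suc by simp
          fix j assume "j < p (Suc i)"
          then have j: "j < ?p" using Suc by simp
          have "?F ?b (basis R ?p j) = y j \<oplus> ?Gd j"
            using lincomb_basis[where u="?b", OF M tup_simps(1)[OF bA] j] j by simp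
          then show "?F ?b (basis R (p (Suc i)) j) \<ominus> ?G (d i (basis R (p (Suc i)) j)) \<in> L"
            using mod_cancel(4)[OF M yc Gdc] y(1) Suc by simp
        qed
        then show ?thesis unfolding relcob_def using Suc Gl GN by (auto intro!: exI[of _ ?G])
      qed
      ultimately show ?thesis using claim[OF bA] by blast
    qed
  qed
  then obtain bb where bb: "bb \<in> ?B" "?u \<ominus>\<^bsub>?A\<^esub> bb \<in> imul ?A (J t) (carrier ?A)" by blast
  obtain y l where yl: "y \<in> imul ?A (J m) ?Z" "l \<in> ?B" "?u = y \<oplus>\<^bsub>?A\<^esub> l" using t[OF uZ bb] by blast
  have "r \<odot>\<^bsub>?A\<^esub> z \<in> ?B" if rz: "r \<in> J m" "z \<in> ?Z" for r z
  proof -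
    have z: "z \<in> carrier ?A" "relcoc R p d M N L k (?F z)" using rz(2) by auto
    have r: "r \<in> carrier R" using rz(1) Jc by blast
    from relcob_scale[OF M N L LN z(2) assms(1) JI rz(1)]
    have "relcob R p d M N L k (?F (r \<odot>\<^bsub>?A\<^esub> z))" by (rule relcob_cong) (rule Fsm[OF r z(1)])
    then show ?thesis using r z by simp
  qed
  then have "y \<in> ?B" using imul_in_sub[OF B _ yl(1)] by blast
  then have "?u \<in> ?B" unfolding yl(3) by (rule sub_add[OF B _ yl(2)])
  then have "relcob R p d M N L k (?F ?u)" by blast
  then show ?thesis by (rule relcob_cong) (use Fu in simp)
qed

text \<open>Both sides are tested on the same resolutions over \<open>R\<close>. Up to coboundaries
  the cocycles agree by \<open>relcoc_approx\<close>, and dying is detected over \<open>R\<close> by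
  \<open>relcob_descent\<close>.\<close>

theorem vanish_completion: "vanish R \<aa> M N L k \<longleftrightarrow> vanish R \<aa> (rs MM) N' L' k"
proof -
  obtain P D E where sys: "\<And>n. fres R (J n) (P n) (D n) (E n)" using fres_system[OF R NR \<aa>] by blast
  note d = fresD[OF sys]
  have lift: "\<exists>\<phi>. clift R (P m) (D m) (E m) (P n) (D n) (E n) (J n) \<phi>" if "n \<le> m" for m n
    by (rule fres_clift[OF R sys sys J_antimono[OF that] JI])
  show ?thesis
  proof
    assume v: "vanish R \<aa> M N L k"
    show "vanish R \<aa> (rs MM) N' L' k"
    proof (rule vanishI[OF rMh N'R L'R L'N' \<aa> sys])
      fix n f assume f: "relcoc R (P n) (D n) (rs MM) N' L' k f"
      have fl: "lin R (FR (P n k)) (rs MM) f" using f by (simp add: relcoc_def)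
      obtain f0 h where f0: "relcoc R (P n) (D n) M N L k f0" "relcob R (P n) (D n) (rs MM) N' L' k h"
        "\<And>x. x \<in> carrier (FR (P n k)) ==> h x \<in> carrier MM"
        "\<And>x. x \<in> carrier (FR (P n k)) ==> f x = h x \<oplus>\<^bsub>MM\<^esub> \<iota>M M (f0 x)" using relcoc_approx[OF sys f] by blast
      have f0l: "lin R (FR (P n k)) M f0" using f0(1) by (simp add: relcoc_def)
      obtain m0 where m0: "m0 \<ge> n" "\<And>m \<phi>. m \<ge> m0 ==> clift R (P m) (D m) (E m) (P n) (D n) (E n) (J n) \<phi> ==>
        relcob R (P m) (D m) M N L k (\<lambda>x. f0 (\<phi> k x))" using vanishD[OF M N L LN \<aa> v sys f0(1)] by blast
      obtain \<phi> where \<phi>: "clift R (P m0) (D m0) (E m0) (P n) (D n) (E n) (J n) \<phi>" using lift[OF m0(1)] by blast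
      have c: "cmap R (P m0) (D m0) (P n) (D n) \<phi>" using \<phi> by (simp add: clift_def)
      have \<phi>l: "lin R (FR (P m0 k)) (FR (P n k)) (\<phi> k)" using c by (simp add: cmap_def)
      note \<phi>c = lin_closed[OF \<phi>l]
      have 1: "relcob R (P m0) (D m0) (rs MM) N' L' k (\<lambda>x. \<iota>M M (f0 (\<phi> k x)))"
        by (rule relcob_\<iota>M[OF d(1) m0(2)[OF le_refl \<phi>] lin_closed[OF f0l \<phi>c]])
      have 2: "relcob R (P m0) (D m0) (rs MM) N' L' k (\<lambda>x. h (\<phi> k x))" by (rule relcob_comp[OF rMh N'R L'R L'N' f0(2) c])
      have \<iota>c: "\<iota>M M (f0 (\<phi> k x)) \<in> carrier (rs MM)" if "x \<in> carrier (FR (P m0 k))" for x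
        by (rule lin_closed[OF \<iota>l lin_closed[OF f0l \<phi>c[OF that]]])
      have hc: "h (\<phi> k x) \<in> carrier (rs MM)" if "x \<in> carrier (FR (P m0 k))" for x using f0(3)[OF \<phi>c[OF that]] by simp
      from relcob_add[OF rMh N'R L'R L'N' 2 1 hc \<iota>c d(1)]
      have "relcob R (P m0) (D m0) (rs MM) N' L' k (\<lambda>x. f (\<phi> k x))"
      proof (rule relcob_mod[OF rMh N'R L'R L'N', where p="P m0" and d="D m0", OF _ _ _ _ d(1)])
        fix x assume x: "x \<in> carrier (FR (P m0 k))"
        have e: "h (\<phi> k x) \<oplus>\<^bsub>rs MM\<^esub> \<iota>M M (f0 (\<phi> k x)) = f (\<phi> k x)" using f0(4)[OF \<phi>c[OF x]] by simp
        have fc: "f (\<phi> k x) \<in> carrier (rs MM)" by (rule lin_closed[OF fl \<phi>c[OF x]])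
        show "f (\<phi> k x) \<in> carrier (rs MM)" by (rule fc)
        show "h (\<phi> k x) \<oplus>\<^bsub>rs MM\<^esub> \<iota>M M (f0 (\<phi> k x)) \<in> carrier (rs MM)"
          "f (\<phi> k x) \<ominus>\<^bsub>rs MM\<^esub> (h (\<phi> k x) \<oplus>\<^bsub>rs MM\<^esub> \<iota>M M (f0 (\<phi> k x))) \<in> L'"
          unfolding e using fc mod_refl[OF rMh L'R fc] by auto
      qed
      then show "\<exists>m\<ge>n. \<exists>\<phi>. clift R (P m) (D m) (E m) (P n) (D n) (E n) (J n) \<phi> \<and> relcob R (P m) (D m) (rs MM) N' L' k (\<lambda>x. f (\<phi> k x))"
        using m0(1) \<phi> by blast
    qed
  next
    assume v: "vanish R \<aa> (rs MM) N' L' k"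
    show "vanish R \<aa> M N L k"
    proof (rule vanishI[OF M N L LN \<aa> sys])
      fix n f assume f: "relcoc R (P n) (D n) M N L k f"
      have "relcoc R (P n) (D n) (rs MM) N' L' k (\<lambda>x. \<iota>M M (f x))"
        using f lin_comp[OF conjunct1[OF f[unfolded relcoc_def]] \<iota>l] \<iota>M_clos[OF M N] \<iota>M_clos[OF M L] by (simp add: relcoc_def)
      from vanishD[OF rMh N'R L'R L'N' \<aa> v sys this]
      obtain m0 where m0: "m0 \<ge> n" "\<And>m \<phi>. m \<ge> m0 ==> clift R (P m) (D m) (E m) (P n) (D n) (E n) (J n) \<phi> ==>
        relcob R (P m) (D m) (rs MM) N' L' k (\<lambda>x. \<iota>M M (f (\<phi> k x)))" by blast
      obtain \<phi> where \<phi>: "clift R (P m0) (D m0) (E m0) (P n) (D n) (E n) (J n) \<phi>" using lift[OF m0(1)] by blast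
      have c: "cmap R (P m0) (D m0) (P n) (D n) \<phi>" using \<phi> by (simp add: clift_def)
      have "relcob R (P m0) (D m0) M N L k (\<lambda>x. f (\<phi> k x))"
        by (rule relcob_descent[OF sys relcoc_comp[OF M N L LN f c] m0(2)[OF le_refl \<phi>]])
      then show "\<exists>m\<ge>n. \<exists>\<phi>. clift R (P m) (D m) (E m) (P n) (D n) (E n) (J n) \<phi> \<and> relcob R (P m) (D m) M N L k (\<lambda>x. f (\<phi> k x))"
        using m0(1) \<phi> by blast
    qed
  qed
qed

end

end

subsection \<open>Local cohomology\<close>

lemma module_homs_lin: "f \<in> module_homs R A C ==> lin R A C f"
  by (auto simp: module_homs_def lin_def)

lemma restrict_module_homs:
  assumes "module R A" "lin R A C f"
  shows "restrict f (carrier A) \<in> module_homs R A C"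
proof -
  interpret module R A by fact
  show ?thesis using assms(2) by (auto simp: module_homs_def lin_def)
qed

lemma module_homs_eqI:
  assumes "f \<in> module_homs R A C" "g \<in> module_homs R A C" "\<And>x. x \<in> carrier A ==> f x = g x"
  shows "f = g"
  using assms by (auto simp: module_homs_def intro: PiE_ext)

context
  fixes R :: "('a, 'r) ring_scheme" and X :: "('a, 'm, 's) module_scheme" (structure)
  assumes X: "module R X"
begin

interpretation X: module R X by (rule X)

private lemmas R3 = X.is_cring
private lemmas Rmod3 = module_ring_as_module[OF R3]
private lemmas Fmod3 = module_free[OF R3]

lemma cocycles_iff:
  "f \<in> cocycles R F X k \<longleftrightarrow> f \<in> module_homs R (FM R (res_rank F k)) X \<and>
    relcoc R (res_rank F) (res_diff F) X (carrier X) {\<zero>} k f"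
proof -
  have "compose A f g = (\<lambda>x\<in>A. \<zero>) \<longleftrightarrow> (\<forall>x\<in>A. f (g x) = \<zero>)" for A and g :: "(nat \<Rightarrow> 'a) \<Rightarrow> (nat \<Rightarrow> 'a)"
    by (auto simp: compose_def restrict_def fun_eq_iff)
  then show ?thesis
    using module_homs_lin[of f R "FM R (res_rank F k)" X] lin_closed[of R "FM R (res_rank F k)" X f]
    by (auto simp: cocycles_def a_kernel_def' cochain_module_def Hom_module_def cochain_diff_def res_module_def relcoc_def)
qed

text \<open>The two notions differ in extensionality: the cochains in \<open>Hom_module\<close> are
  undefined off the carrier, while the bounding maps in \<open>relcob\<close> are arbitrary there
  and are restricted.\<close>

lemma coboundaries_iff:
  assumes d: "\<And>i. lin R (FM R (res_rank F (Suc i))) (FM R (res_rank F i)) (res_diff F i)"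
  shows "f \<in> coboundaries R F X k \<longleftrightarrow> f \<in> module_homs R (FM R (res_rank F k)) X \<and>
    relcob R (res_rank F) (res_diff F) X (carrier X) {\<zero>} k f"
proof (cases k)
  case 0
  have z: "(\<lambda>x\<in>carrier (FM R (res_rank F 0)). \<zero>) \<in> module_homs R (FM R (res_rank F 0)) X"
    by (rule restrict_module_homs[OF Fmod3 lin_const_zero[OF X]])
  have "f = (\<lambda>x\<in>carrier (FM R (res_rank F 0)). \<zero>)"
    if "f \<in> module_homs R (FM R (res_rank F 0)) X" "\<forall>x\<in>carrier (FM R (res_rank F 0)). f x = \<zero>"
    by (rule module_homs_eqI[OF that(1) z]) (use that(2) in simp)
  then show ?thesis using 0 z
    by (auto simp: relcob_def cochain_module_def Hom_module_def res_module_def)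
next
  case (Suc j)
  let ?A = "FM R (res_rank F (Suc j))" and ?B = "FM R (res_rank F j)"
  have "f \<in> coboundaries R F X k \<longleftrightarrow> (\<exists>g\<in>module_homs R ?B X. f = compose (carrier ?A) g (res_diff F j))"
    using Suc by (auto simp: cochain_module_def Hom_module_def res_module_def cochain_diff_def)
  also have "\<dots> \<longleftrightarrow> f \<in> module_homs R ?A X \<and> (\<exists>g. lin R ?B X g \<and> (\<forall>x\<in>carrier ?A. f x = g (res_diff F j x)))"
  proof (intro iffI conjI)
    assume "\<exists>g\<in>module_homs R ?B X. f = compose (carrier ?A) g (res_diff F j)"
    then obtain g where g: "g \<in> module_homs R ?B X" "f = compose (carrier ?A) g (res_diff F j)" by blast
    show "f \<in> module_homs R ?A X" unfolding g(2) compose_def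
      by (rule restrict_module_homs[OF Fmod3 lin_comp[OF d module_homs_lin[OF g(1)]]])
    show "\<exists>g. lin R ?B X g \<and> (\<forall>x\<in>carrier ?A. f x = g (res_diff F j x))"
      using module_homs_lin[OF g(1)] g(2) by (auto simp: compose_def)
  next
    assume "f \<in> module_homs R ?A X \<and> (\<exists>g. lin R ?B X g \<and> (\<forall>x\<in>carrier ?A. f x = g (res_diff F j x)))"
    then obtain g where f: "f \<in> module_homs R ?A X" and g: "lin R ?B X g" "\<And>x. x \<in> carrier ?A ==> f x = g (res_diff F j x)" by blast
    have "f = (\<lambda>x\<in>carrier ?A. g (res_diff F j x))"
      by (rule module_homs_eqI[OF f restrict_module_homs[OF Fmod3 lin_comp[OF d g(1)]]]) (simp add: g(2))
    then have "f = compose (carrier ?A) (restrict g (carrier ?B)) (res_diff F j)"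
      using lin_closed[OF d[of j]] by (auto simp: compose_def fun_eq_iff restrict_def)
    then show "\<exists>g\<in>module_homs R ?B X. f = compose (carrier ?A) g (res_diff F j)"
      using restrict_module_homs[OF Fmod3 g(1)] by blast
  qed
  also have "\<dots> \<longleftrightarrow> f \<in> module_homs R ?A X \<and>
      (\<exists>g. lin R ?B X g \<and> (\<forall>x\<in>carrier ?B. g x \<in> carrier X) \<and> (\<forall>x\<in>carrier ?A. f x \<ominus> g (res_diff F j x) \<in> {\<zero>}))"
  proof (rule conj_cong[OF refl], rule ex_cong1)
    fix g assume f: "f \<in> module_homs R ?A X"
    show "(lin R ?B X g \<and> (\<forall>x\<in>carrier ?A. f x = g (res_diff F j x))) \<longleftrightarrow>
      (lin R ?B X g \<and> (\<forall>x\<in>carrier ?B. g x \<in> carrier X) \<and> (\<forall>x\<in>carrier ?A. f x \<ominus> g (res_diff F j x) \<in> {\<zero>}))"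
    proof (cases "lin R ?B X g")
      case True
      then show ?thesis
        using minus_zero_iff[OF X lin_closed[OF module_homs_lin[OF f]] lin_closed[OF True lin_closed[OF d]]] lin_closed[OF True] by auto
    qed simp
  qed
  finally show ?thesis using Suc by (simp add: relcob_def)
qed

section \<open>The resolutions and chain maps selected by choice\<close>

context
  fixes \<aa> :: "'a set"
  assumes \<aa>: "ideal \<aa> R" and ex: "\<And>n. \<exists>p d e. fres R (ideal_power R \<aa> n) p d e"
begin

private abbreviation "\<AA> \<equiv> ideal_power R \<aa>"
private abbreviation "Fr n \<equiv> free_resolution R (quot_power R \<aa> n)"
private abbreviation "P n \<equiv> res_rank (Fr n)"
private abbreviation "D n \<equiv> res_diff (Fr n)"
private abbreviation "qp n \<equiv> quot_proj (RM R) (\<AA> (Suc n)) (\<AA> n)"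
private abbreviation "\<Phi> n \<equiv> SOME \<phi>. is_chain_lift R (Fr (Suc n)) (Fr n) (qp n) \<phi>"

private lemmas JI3 = ideal_power_ideal[OF R3 \<aa>]

lemma submodule_J: "submodule (\<AA> n) R (RM R)"
  using ideal_iff_submodule[OF R3] JI3 by blast

private lemmas Qmod = module_quot[OF Rmod3 submodule_J]

lemma is_free_resolution_fres:
  assumes "fres R (\<AA> n) p d e"
  shows "is_free_resolution R (quot_power R \<aa> n)
    \<lparr>res_rank = p, res_diff = (\<lambda>i. restrict (d i) (carrier (FM R (p (Suc i))))),
     res_aug = (\<lambda>x\<in>carrier (FM R (p 0)). \<AA> n +>\<^bsub>RM R\<^esub> e x)\<rparr>" (is "is_free_resolution R ?Q ?F")
proof -
  note d = fresD[OF assms]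
  have q: "\<AA> n +>\<^bsub>RM R\<^esub> x = \<zero>\<^bsub>?Q\<^esub> \<longleftrightarrow> x \<in> \<AA> n" if "x \<in> carrier R" for x
    using coset_eq_self[OF Rmod3 submodule_J, of x n] that by (simp add: quot_power_def quot_module_simps)
  have ec: "e x \<in> carrier R" if "x \<in> carrier (FM R (p 0))" for x using lin_closed[OF d(2) that] by simp
  have 1: "(\<lambda>x\<in>carrier (FM R (p 0)). \<AA> n +>\<^bsub>RM R\<^esub> e x) \<in> module_homs R (FM R (p 0)) ?Q"
    unfolding quot_power_def by (rule restrict_module_homs[OF Fmod3 lin_comp[OF d(2) lin_quot[OF Rmod3 submodule_J]]])
  have 2: "(\<lambda>x\<in>carrier (FM R (p 0)). \<AA> n +>\<^bsub>RM R\<^esub> e x) ` carrier (FM R (p 0)) = carrier ?Q"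
  proof (intro equalityI subsetI)
    fix y assume "y \<in> (\<lambda>x\<in>carrier (FM R (p 0)). \<AA> n +>\<^bsub>RM R\<^esub> e x) ` carrier (FM R (p 0))"
    then show "y \<in> carrier ?Q" using lin_closed[OF module_homs_lin[OF 1]] by blast
  next
    fix y assume "y \<in> carrier ?Q"
    then obtain r where r: "r \<in> carrier R" "y = \<AA> n +>\<^bsub>RM R\<^esub> r" by (auto simp: quot_power_def quot_module_simps rcosets_iff)
    obtain u where u: "u \<in> carrier (FM R (p 0))" "e u \<ominus>\<^bsub>R\<^esub> \<one>\<^bsub>R\<^esub> \<in> \<AA> n" using d(3) by blast
    have ru: "r \<odot>\<^bsub>FM R (p 0)\<^esub> u \<in> carrier (FM R (p 0))" using module.smult_closed[OF Fmod3 r(1) u(1)] .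
    have "\<AA> n +>\<^bsub>RM R\<^esub> e (r \<odot>\<^bsub>FM R (p 0)\<^esub> u) = y"
      unfolding r(2) using coset_eq_iff[OF Rmod3 submodule_J, of "e (r \<odot>\<^bsub>FM R (p 0)\<^esub> u)" r] ec[OF ru] r(1)
        fres_unit_smult[OF R3 assms JI3 u r(1)] by simp
    then show "y \<in> (\<lambda>x\<in>carrier (FM R (p 0)). \<AA> n +>\<^bsub>RM R\<^esub> e x) ` carrier (FM R (p 0))" using ru by force
  qed
  have 3: "d 0 ` carrier (FM R (p (Suc 0))) = {x \<in> carrier (FM R (p 0)). e x \<in> \<AA> n}"
    using d(4,5) lin_closed[OF d(1)] by blast
  have 4: "d (Suc i) ` carrier (FM R (p (Suc (Suc i)))) = {x \<in> carrier (FM R (p (Suc i))). d i x = \<zero>\<^bsub>FM R (p i)\<^esub>}" for i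
    using d(6,7) lin_closed[OF d(1)] by blast
  show ?thesis
    unfolding is_free_resolution_def using 1 2 3 4 restrict_module_homs[OF Fmod3 d(1)] q ec
    by (auto simp: res_module_def a_kernel_def')
qed

text \<open>The selected resolution is genuine because \<open>ex\<close> supplies one, and its
  augmentation into the residue ring lifts to \<open>R\<close> by freeness. Existence is assumed in
  place of the Noetherian property because the result is also applied over the completed
  ring.\<close>

lemma free_resolution_fres:
  obtains E where "\<And>n. fres R (\<AA> n) (P n) (D n) (E n)"
    "\<And>n x. x \<in> carrier (FM R (P n 0)) ==> res_aug (Fr n) x = \<AA> n +>\<^bsub>RM R\<^esub> E n x"
proof -
  have "\<forall>n. \<exists>e. fres R (\<AA> n) (P n) (D n) e \<and> (\<forall>x\<in>carrier (FM R (P n 0)). res_aug (Fr n) x = \<AA> n +>\<^bsub>RM R\<^esub> e x)"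
  proof
    fix n
    let ?Q = "quot_power R \<aa> n"
    have "is_free_resolution R ?Q (Fr n)"
      unfolding free_resolution_def using ex[of n] someI[where P="is_free_resolution R ?Q", OF is_free_resolution_fres] by blast
    then have d: "\<And>i. lin R (FM R (P n (Suc i))) (FM R (P n i)) (D n i)" and a: "lin R (FM R (P n 0)) ?Q (res_aug (Fr n))"
      and s: "res_aug (Fr n) ` carrier (FM R (P n 0)) = carrier ?Q"
      and k0: "D n 0 ` carrier (FM R (P n (Suc 0))) = {x \<in> carrier (FM R (P n 0)). res_aug (Fr n) x = \<zero>\<^bsub>?Q\<^esub>}"
      and k: "\<And>i. D n (Suc i) ` carrier (FM R (P n (Suc (Suc i)))) = {x \<in> carrier (FM R (P n (Suc i))). D n i x = \<zero>\<^bsub>FM R (P n i)\<^esub>}"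
      by (simp_all add: is_free_resolution_def res_module_def a_kernel_def' module_homs_lin)
    have "\<exists>y\<in>carrier (RM R). res_aug (Fr n) x = \<AA> n +>\<^bsub>RM R\<^esub> y" if "x \<in> carrier (FM R (P n 0))" for x
      using lin_closed[OF a that] by (simp add: quot_power_def quot_module_simps rcosets_iff)
    moreover have "lin R (FM R (P n 0)) (quot_module R (RM R) (\<AA> n)) (res_aug (Fr n))" using a by (simp only: quot_power_def)
    ultimately
    obtain e where e: "lin R (FM R (P n 0)) (RM R) e" "\<And>x. x \<in> carrier (FM R (P n 0)) ==> res_aug (Fr n) x = \<AA> n +>\<^bsub>RM R\<^esub> e x"
      using lin_lift_eq[OF R3 Rmod3 Qmod lin_quot[OF Rmod3 submodule_J]] by blast
    have ec: "e x \<in> carrier (RM R)" if "x \<in> carrier (FM R (P n 0))" for x by (rule lin_closed[OF e(1) that])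
    have "\<AA> n +>\<^bsub>RM R\<^esub> \<one>\<^bsub>R\<^esub> \<in> res_aug (Fr n) ` carrier (FM R (P n 0))" unfolding s by (auto simp: quot_power_def quot_module_simps rcosets_iff)
    then obtain u where u: "u \<in> carrier (FM R (P n 0))" "res_aug (Fr n) u = \<AA> n +>\<^bsub>RM R\<^esub> \<one>\<^bsub>R\<^esub>" by (elim imageE) simp
    then have "e u \<ominus>\<^bsub>R\<^esub> \<one>\<^bsub>R\<^esub> \<in> \<AA> n" using coset_eq_iff[OF Rmod3 submodule_J ec[OF u(1)], of "\<one>\<^bsub>R\<^esub>"] e(2)[OF u(1)] by simp
    moreover have "e x \<in> \<AA> n \<longleftrightarrow> x \<in> D n 0 ` carrier (FM R (P n (Suc 0)))" if x: "x \<in> carrier (FM R (P n 0))" for x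
      unfolding k0 using x e(2)[OF x] coset_eq_self[OF Rmod3 submodule_J ec[OF x], of n]
      by (simp add: quot_power_def quot_module_simps)
    ultimately have "fres R (\<AA> n) (P n) (D n) e" unfolding fres_def using d e(1) u(1) k by blast
    then show "\<exists>e. fres R (\<AA> n) (P n) (D n) e \<and> (\<forall>x\<in>carrier (FM R (P n 0)). res_aug (Fr n) x = \<AA> n +>\<^bsub>RM R\<^esub> e x)" using e(2) by blast
  qed
  from choice[OF this] that show thesis by blast
qed

text \<open>The selected chain map is genuine by the comparison theorem; agreement of augmentations
  as cosets is congruence in \<open>R\<close>.\<close>

lemma chain_lift_clift:
  assumes "fres R (\<AA> n) (P n) (D n) e" "\<And>x. x \<in> carrier (FM R (P n 0)) ==> res_aug (Fr n) x = \<AA> n +>\<^bsub>RM R\<^esub> e x"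
    "fres R (\<AA> (Suc n)) (P (Suc n)) (D (Suc n)) e'"
    "\<And>x. x \<in> carrier (FM R (P (Suc n) 0)) ==> res_aug (Fr (Suc n)) x = \<AA> (Suc n) +>\<^bsub>RM R\<^esub> e' x"
  shows "clift R (P (Suc n)) (D (Suc n)) e' (P n) (D n) e (\<AA> n) (\<Phi> n)"
proof -
  have JJ: "\<AA> (Suc n) \<subseteq> \<AA> n" by (rule ideal_power_antimono[OF R3 \<aa>]) simp
  have e: "e x \<in> carrier (RM R)" if "x \<in> carrier (FM R (P n 0))" for x by (rule lin_closed[OF fresD(2)[OF assms(1)] that])
  have e': "e' x \<in> carrier (RM R)" if "x \<in> carrier (FM R (P (Suc n) 0))" for x by (rule lin_closed[OF fresD(2)[OF assms(3)] that])
  have q: "qp n (\<AA> (Suc n) +>\<^bsub>RM R\<^esub> y) = \<AA> n +>\<^bsub>RM R\<^esub> y" if "y \<in> carrier (RM R)" for y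
    using coset_proj[OF Rmod3 submodule_J submodule_J JJ that] that rcosets_iff[of "\<AA> (Suc n) +>\<^bsub>RM R\<^esub> y" "(RM R)" "\<AA> (Suc n)"]
    by (auto simp: quot_proj_def)
  have aug: "res_aug (Fr n) y = qp n (res_aug (Fr (Suc n)) x) \<longleftrightarrow> e y \<ominus>\<^bsub>R\<^esub> e' x \<in> \<AA> n"
    if "x \<in> carrier (FM R (P (Suc n) 0))" "y \<in> carrier (FM R (P n 0))" for x y
    using coset_eq_iff[OF Rmod3 submodule_J e[OF that(2)] e'[OF that(1)], of n] q[OF e'[OF that(1)]] assms(2,4) that by simp
  obtain \<phi> where "clift R (P (Suc n)) (D (Suc n)) e' (P n) (D n) e (\<AA> n) \<phi>" using fres_clift[OF R3 assms(3,1) JJ JI3] by blast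
  then have \<phi>: "\<And>i. lin R (FM R (P (Suc n) i)) (FM R (P n i)) (\<phi> i)"
    "\<And>i x. x \<in> carrier (FM R (P (Suc n) (Suc i))) ==> D n i (\<phi> (Suc i) x) = \<phi> i (D (Suc n) i x)"
    "\<And>x. x \<in> carrier (FM R (P (Suc n) 0)) ==> e (\<phi> 0 x) \<ominus>\<^bsub>R\<^esub> e' x \<in> \<AA> n" by (auto simp: clift_def cmap_def)
  have "is_chain_lift R (Fr (Suc n)) (Fr n) (qp n) (\<lambda>i. restrict (\<phi> i) (carrier (FM R (P (Suc n) i))))"
    unfolding is_chain_lift_def res_module_def
    using restrict_module_homs[OF Fmod3 \<phi>(1)] \<phi>(2,3) aug lin_closed[OF \<phi>(1)] lin_closed[OF fresD(1)[OF assms(3)]] by auto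
  then have "is_chain_lift R (Fr (Suc n)) (Fr n) (qp n) (\<Phi> n)"
    by (rule someI[where P="is_chain_lift R (Fr (Suc n)) (Fr n) (qp n)"])
  then have "\<And>i. lin R (FM R (P (Suc n) i)) (FM R (P n i)) (\<Phi> n i)"
    "\<And>i x. x \<in> carrier (FM R (P (Suc n) (Suc i))) ==> D n i (\<Phi> n (Suc i) x) = \<Phi> n i (D (Suc n) i x)"
    "\<And>x. x \<in> carrier (FM R (P (Suc n) 0)) ==> res_aug (Fr n) (\<Phi> n 0 x) = qp n (res_aug (Fr (Suc n)) x)"
    by (auto simp: is_chain_lift_def res_module_def module_homs_lin)
  then show ?thesis using aug lin_closed[of R "FM R (P (Suc n) 0)" "FM R (P n 0)" "\<Phi> n 0"] by (auto simp: clift_def cmap_def)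
qed

section \<open>Ext classes and their direct limit\<close>

context
  fixes k :: nat
begin

private abbreviation "C n \<equiv> carrier (FM R (P n k))"
private abbreviation "Hs n \<equiv> module_homs R (FM R (P n k)) X"
private abbreviation "H n \<equiv> Hom_module R (FM R (P n k)) X"
private abbreviation "Z n \<equiv> cocycles R (Fr n) X k"
private abbreviation "B n \<equiv> coboundaries R (Fr n) X k"
private abbreviation "cl n f \<equiv> B n +>\<^bsub>H n\<^esub> f"
private abbreviation "A n \<equiv> Ext_module R k (quot_power R \<aa> n) X"
private abbreviation "\<tau> n \<equiv> Ext_map R k (quot_power R \<aa> (Suc n)) (quot_power R \<aa> n) (qp n) X"
private abbreviation "cob n \<equiv> relcob R (P n) (D n) X (carrier X) {\<zero>} k"
private abbreviation "coc n \<equiv> relcoc R (P n) (D n) X (carrier X) {\<zero>} k"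
private abbreviation "pl n b f \<equiv> (\<lambda>x\<in>C n. b x \<oplus> f x)"

private lemmas XN = X X.carrier_is_submodule submodule_zero[OF X]

lemma D_lin: "lin R (FM R (P n (Suc i))) (FM R (P n i)) (D n i)"
  by (rule free_resolution_fres) (rule fresD(1))

private lemmas B_iff = coboundaries_iff[OF D_lin]

lemma B_homs: "b \<in> B n ==> b \<in> Hs n"
  by (simp add: B_iff)

lemma Hs_closed: "f \<in> Hs n ==> x \<in> C n ==> f x \<in> carrier X"
  by (auto simp: module_homs_def)

lemma pl_homs: "b \<in> Hs n ==> f \<in> Hs n ==> pl n b f \<in> Hs n"
  by (rule restrict_module_homs[OF Fmod3 lin_plus[OF X module_homs_lin module_homs_lin]])

lemma B_zero: "(\<lambda>x\<in>C n. \<zero>) \<in> B n"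
proof -
  have "cob n (\<lambda>x\<in>C n. \<zero>)" by (rule relcob_cong[OF relcob_zero[OF XN]]) auto
  then show ?thesis using restrict_module_homs[OF Fmod3 lin_const_zero[OF X]] by (simp add: B_iff)
qed

lemma B_add:
  assumes "b \<in> B n" "c \<in> B n"
  shows "pl n b c \<in> B n"
proof -
  have b: "b \<in> Hs n" "c \<in> Hs n" "cob n b" "cob n c" using assms by (auto simp: B_iff)
  have "cob n (\<lambda>x. b x \<oplus> c x)"
    by (rule relcob_add[OF XN _ b(3,4) _ _ D_lin]) (auto simp: Hs_closed[OF b(1)] Hs_closed[OF b(2)])
  then show ?thesis using pl_homs[OF b(1,2)] by (auto simp: B_iff elim: relcob_cong)
qed

lemma B_uminus:
  assumes "b \<in> B n"
  shows "(\<lambda>x\<in>C n. \<ominus> b x) \<in> B n"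
proof -
  have b: "b \<in> Hs n" "cob n b" using assms by (auto simp: B_iff)
  have m: "\<ominus>\<^bsub>R\<^esub> \<one>\<^bsub>R\<^esub> \<in> carrier R" by simp
  have e: "\<ominus> b x = (\<ominus>\<^bsub>R\<^esub> \<one>\<^bsub>R\<^esub>) \<odot> b x" if "x \<in> C n" for x
    using Hs_closed[OF b(1) that] by (simp add: X.smult_l_minus)
  have "cob n (\<lambda>x\<in>C n. \<ominus> b x)"
    by (rule relcob_cong[OF relcob_smult[OF XN _ b(2) module_homs_lin[OF b(1)] D_lin m]]) (use e in auto)
  moreover have "lin R (FM R (P n k)) X (\<lambda>x. \<ominus> b x)"
    by (rule lin_cong[OF Fmod3 lin_scale[OF X module_homs_lin[OF b(1)] m]]) (use e in simp)
  ultimately show ?thesis using restrict_module_homs[OF Fmod3] by (simp add: B_iff)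
qed

lemma cl_iff: "h \<in> cl n f \<longleftrightarrow> (\<exists>b\<in>B n. h = pl n b f)"
  by (auto simp: a_r_coset_def' Hom_module_def)

lemma cl_absorb:
  assumes b: "b \<in> B n" and f: "f \<in> Hs n"
  shows "cl n (pl n b f) = cl n f"
proof (intro equalityI subsetI)
  note bf = Hs_closed[OF B_homs[OF b]] Hs_closed[OF f]
  fix h assume "h \<in> cl n (pl n b f)"
  then obtain c where c: "c \<in> B n" "h = pl n c (pl n b f)" unfolding cl_iff by blast
  have "h = pl n (pl n c b) f"
    unfolding c(2) using bf Hs_closed[OF B_homs[OF c(1)]] by (intro restrict_ext) (simp add: X.a_assoc)
  then show "h \<in> cl n f" using B_add[OF c(1) b] cl_iff by blast
next
  note bf = Hs_closed[OF B_homs[OF b]] Hs_closed[OF f]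
  fix h assume "h \<in> cl n f"
  then obtain c where c: "c \<in> B n" "h = pl n c f" unfolding cl_iff by blast
  have "h = pl n (pl n c (\<lambda>x\<in>C n. \<ominus> b x)) (pl n b f)"
    unfolding c(2) using bf Hs_closed[OF B_homs[OF c(1)]]
    by (intro restrict_ext) (simp add: X.a_assoc X.r_neg1)
  then show "h \<in> cl n (pl n b f)" using B_add[OF c(1) B_uminus[OF b]] cl_iff by blast
qed

lemma cl_self:
  assumes f: "f \<in> Hs n"
  shows "f \<in> cl n f"
proof -
  have "f = pl n (\<lambda>x\<in>C n. \<zero>) f"
    by (rule module_homs_eqI[OF f pl_homs[OF B_homs[OF B_zero] f]]) (simp add: Hs_closed[OF f])
  then show ?thesis using B_zero cl_iff by blast
qed

lemma cl_zero: "cl n (\<lambda>x\<in>C n. \<zero>) = B n"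
proof -
  have "pl n b (\<lambda>x\<in>C n. \<zero>) = b" if "b \<in> B n" for b
    by (rule module_homs_eqI[OF pl_homs[OF B_homs[OF that] B_homs[OF B_zero]] B_homs[OF that]])
      (simp add: Hs_closed[OF B_homs[OF that]])
  then show ?thesis unfolding cl_iff[abs_def] by (auto simp: cl_iff)
qed

lemma cl_eq_B:
  assumes f: "f \<in> Hs n"
  shows "cl n f = B n \<longleftrightarrow> cob n f"
proof
  assume "cl n f = B n"
  then show "cob n f" using cl_self[OF f] by (simp add: B_iff)
next
  assume "cob n f"
  then have b: "f \<in> B n" using f by (simp add: B_iff)
  have "pl n f (\<lambda>x\<in>C n. \<zero>) = f"
    by (rule module_homs_eqI[OF pl_homs[OF f B_homs[OF B_zero]] f]) (simp add: Hs_closed[OF f])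
  then show "cl n f = B n" using cl_absorb[OF b B_homs[OF B_zero]] cl_zero by simp
qed

lemma Ext_carrier: "c \<in> carrier (A n) \<longleftrightarrow> (\<exists>f\<in>Z n. c = cl n f)"
  by (simp add: Ext_module_def Let_def quot_module_simps rcosets_iff a_r_coset_def' cochain_module_def res_module_def)

lemma Ext_zero: "\<zero>\<^bsub>A n\<^esub> = B n"
  by (simp add: Ext_module_def Let_def quot_module_simps)

text \<open>\<open>Ext_map\<close> takes a union over all representatives of a class. They give the
  same coset because pulling back preserves coboundaries.\<close>

lemma T_cl:
  assumes f: "f \<in> Z n" and \<Phi>: "cmap R (P (Suc n)) (D (Suc n)) (P n) (D n) (\<Phi> n)"
  shows "\<tau> n (cl n f) = cl (Suc n) (\<lambda>x\<in>C (Suc n). f (\<Phi> n k x))"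
proof -
  have l: "lin R (FM R (P (Suc n) k)) (FM R (P n k)) (\<Phi> n k)" using \<Phi> by (simp add: cmap_def)
  have fh: "f \<in> Hs n" using f by (simp add: cocycles_iff)
  have fh': "(\<lambda>x\<in>C (Suc n). g (\<Phi> n k x)) \<in> Hs (Suc n)" if "g \<in> Hs n" for g
    by (rule restrict_module_homs[OF Fmod3 lin_comp[OF l module_homs_lin[OF that]]])
  have "\<tau> n (cl n f) = (\<Union>g\<in>cl n f. cl (Suc n) (\<lambda>x\<in>C (Suc n). g (\<Phi> n k x)))"
    using f Ext_carrier[of "cl n f" n]
    by (auto simp: Ext_map_def Let_def cochain_module_def res_module_def compose_def)
  moreover have "cl (Suc n) (\<lambda>x\<in>C (Suc n). g (\<Phi> n k x)) = cl (Suc n) (\<lambda>x\<in>C (Suc n). f (\<Phi> n k x))" if "g \<in> cl n f" for g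
  proof -
    obtain b where b: "b \<in> B n" "g = pl n b f" using \<open>g \<in> cl n f\<close> unfolding cl_iff by blast
    have bh: "b \<in> Hs n" "cob n b" using b(1) by (auto simp: B_iff)
    have "cob (Suc n) (\<lambda>x\<in>C (Suc n). b (\<Phi> n k x))"
      by (rule relcob_cong[OF relcob_comp[OF XN _ bh(2) \<Phi>]]) auto
    then have bB: "(\<lambda>x\<in>C (Suc n). b (\<Phi> n k x)) \<in> B (Suc n)" using fh'[OF bh(1)] by (simp add: B_iff)
    have e: "(\<lambda>x\<in>C (Suc n). g (\<Phi> n k x)) = pl (Suc n) (\<lambda>x\<in>C (Suc n). b (\<Phi> n k x)) (\<lambda>x\<in>C (Suc n). f (\<Phi> n k x))"
      unfolding b(2) using lin_closed[OF l] by (intro restrict_ext) simp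
    show ?thesis unfolding e by (rule cl_absorb[OF bB fh'[OF fh]])
  qed
  ultimately show ?thesis using cl_self[OF fh] by blast
qed

text \<open>A composite of selected chain maps is some lift of the composite projection. Which one
  it is does not matter for \<open>vanish\<close>.\<close>

lemma transition_cl:
  assumes E: "\<And>n. fres R (\<AA> n) (P n) (D n) (E n)"
    "\<And>n x. x \<in> carrier (FM R (P n 0)) ==> res_aug (Fr n) x = \<AA> n +>\<^bsub>RM R\<^esub> E n x"
  shows "\<exists>\<psi>. clift R (P (n + j)) (D (n + j)) (E (n + j)) (P n) (D n) (E n) (\<AA> n) \<psi> \<and>
    (\<forall>f\<in>Z n. transition \<tau> n j (cl n f) = cl (n + j) (\<lambda>x\<in>C (n + j). f (\<psi> k x)))"
proof (induction j)
  case 0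
  have "E n x \<ominus>\<^bsub>R\<^esub> E n x \<in> \<AA> n" if "x \<in> carrier (FM R (P n 0))" for x
    using mod_refl[OF Rmod3 submodule_J lin_closed[OF fresD(2)[OF E(1)] that]] by simp
  then have "clift R (P n) (D n) (E n) (P n) (D n) (E n) (\<AA> n) (\<lambda>i x. x)"
    by (auto simp: clift_def cmap_def lin_ident)
  moreover have "(\<lambda>x\<in>C n. f x) = f" if "f \<in> Z n" for f
    using that by (auto simp: cocycles_iff module_homs_def PiE_def intro!: extensional_restrict)
  ultimately show ?case by (intro exI[of _ "\<lambda>i x. x"]) simp
next
  case (Suc j)
  then obtain \<psi> where \<psi>: "clift R (P (n + j)) (D (n + j)) (E (n + j)) (P n) (D n) (E n) (\<AA> n) \<psi>"
    "\<And>f. f \<in> Z n ==> transition \<tau> n j (cl n f) = cl (n + j) (\<lambda>x\<in>C (n + j). f (\<psi> k x))" by blast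
  note \<Phi> = chain_lift_clift[OF E E, where n="n + j"]
  have \<Phi>c: "cmap R (P (Suc (n + j))) (D (Suc (n + j))) (P (n + j)) (D (n + j)) (\<Phi> (n + j))" using \<Phi> by (simp add: clift_def)
  then have \<Phi>l: "lin R (FM R (P (Suc (n + j)) k)) (FM R (P (n + j) k)) (\<Phi> (n + j) k)" by (simp add: cmap_def)
  have 1: "clift R (P (Suc (n + j))) (D (Suc (n + j))) (E (Suc (n + j))) (P n) (D n) (E n) (\<AA> n) (\<lambda>i x. \<psi> i (\<Phi> (n + j) i x))"
    by (rule clift_comp[OF R3 \<Phi> \<psi>(1) ideal_power_antimono[OF R3 \<aa>] JI3 fresD(2)[OF E(1)] fresD(2)[OF E(1)] fresD(2)[OF E(1)] D_lin]) simp_all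
  have 2: "transition \<tau> n (Suc j) (cl n f) = cl (Suc (n + j)) (\<lambda>x\<in>C (Suc (n + j)). f (\<psi> k (\<Phi> (n + j) k x)))" if f: "f \<in> Z n" for f
  proof -
    have c: "coc n f" using f by (simp add: cocycles_iff)
    have "coc (n + j) (\<lambda>x. f (\<psi> k x))" by (rule relcoc_comp[OF XN _ c]) (use \<psi>(1) in \<open>auto simp: clift_def\<close>)
    then have "(\<lambda>x\<in>C (n + j). f (\<psi> k x)) \<in> Z (n + j)"
      using restrict_module_homs[OF Fmod3, of "P (n + j) k" X "\<lambda>x. f (\<psi> k x)"] lin_closed[OF D_lin]
      by (auto simp: cocycles_iff relcoc_def intro: module_homs_lin)
    from T_cl[OF this \<Phi>c] show ?thesis using \<psi>(2)[OF f] lin_closed[OF \<Phi>l] by (simp cong: restrict_cong)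
  qed
  show ?case unfolding add_Suc_right using 1 2 by blast
qed

text \<open>A direct limit over a sequence is zero iff every class is killed by a composite of
  transition maps, and being killed means that the pulled-back cocycle is a coboundary.\<close>

theorem zero_local_cohomology_iff:
  "zero_module (local_cohomology R \<aa> k X) \<longleftrightarrow> vanish R \<aa> X (carrier X) {\<zero>} k"
proof -
  obtain E where E: "\<And>n. fres R (\<AA> n) (P n) (D n) (E n)"
    "\<And>n x. x \<in> carrier (FM R (P n 0)) ==> res_aug (Fr n) x = \<AA> n +>\<^bsub>RM R\<^esub> E n x"
    by (fact free_resolution_fres)
  have z0: "{\<zero>} \<subseteq> carrier X" by simp
  let ?r = "dirlim_rel A \<tau>"
  have zZ: "(\<lambda>x\<in>C n. \<zero>) \<in> Z n" for n
    using B_homs[OF B_zero] lin_closed[OF D_lin] module_homs_lin[OF B_homs[OF B_zero]]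
    by (auto simp: cocycles_iff relcoc_def)
  have killed: "\<exists>\<psi>. clift R (P (n + j)) (D (n + j)) (E (n + j)) (P n) (D n) (E n) (\<AA> n) \<psi> \<and>
    (\<forall>f\<in>Z n. transition \<tau> n j (cl n f) = B (n + j) \<longleftrightarrow> cob (n + j) (\<lambda>x. f (\<psi> k x)))" for n j
  proof -
    obtain \<psi> where \<psi>: "clift R (P (n + j)) (D (n + j)) (E (n + j)) (P n) (D n) (E n) (\<AA> n) \<psi>"
      "\<And>f. f \<in> Z n ==> transition \<tau> n j (cl n f) = cl (n + j) (\<lambda>x\<in>C (n + j). f (\<psi> k x))"
      using transition_cl[OF E] by blast
    have "transition \<tau> n j (cl n f) = B (n + j) \<longleftrightarrow> cob (n + j) (\<lambda>x. f (\<psi> k x))" if f: "f \<in> Z n" for f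
    proof -
      have "lin R (FM R (P (n + j) k)) (FM R (P n k)) (\<psi> k)" using \<psi>(1) by (simp add: clift_def cmap_def)
      moreover have "lin R (FM R (P n k)) X f" using f by (simp add: cocycles_iff module_homs_lin)
      ultimately have "(\<lambda>x\<in>C (n + j). f (\<psi> k x)) \<in> Hs (n + j)" by (rule restrict_module_homs[OF Fmod3 lin_comp])
      moreover have "cob (n + j) (\<lambda>x\<in>C (n + j). f (\<psi> k x)) \<longleftrightarrow> cob (n + j) (\<lambda>x. f (\<psi> k x))"
        by (rule iffI; erule relcob_cong) simp_all
      ultimately show ?thesis unfolding \<psi>(2)[OF f] using cl_eq_B by simp
    qed
    then show ?thesis using \<psi>(1) by blast
  qed
  have TB: "transition \<tau> n j (B n) = B (n + j)" for n j
  proof -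
    obtain \<psi> where c: "clift R (P (n + j)) (D (n + j)) (E (n + j)) (P n) (D n) (E n) (\<AA> n) \<psi>"
      and \<psi>: "\<forall>f\<in>Z n. transition \<tau> n j (cl n f) = B (n + j) \<longleftrightarrow> cob (n + j) (\<lambda>x. f (\<psi> k x))" using killed by blast
    have "cmap R (P (n + j)) (D (n + j)) (P n) (D n) \<psi>" using c by (simp add: clift_def)
    then have "cob (n + j) (\<lambda>x. (\<lambda>x\<in>C n. \<zero>) (\<psi> k x))" using relcob_comp[OF XN z0] B_zero B_iff by metis
    then show ?thesis using bspec[OF \<psi> zZ] unfolding cl_zero by blast
  qed
  have T_add: "transition \<tau> n (j + i) c = transition \<tau> (n + j) i (transition \<tau> n j c)" for n j i c
    by (induction i) (simp_all add: add.assoc)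
  have Bc: "B n \<in> carrier (A n)" for n using Ext_carrier zZ cl_zero by blast
  have "zero_module (local_cohomology R \<aa> k X) \<longleftrightarrow> (\<forall>n. \<forall>f\<in>Z n. \<exists>j. transition \<tau> n j (cl n f) = B (n + j))"
  proof
    assume z: "zero_module (local_cohomology R \<aa> k X)"
    show "\<forall>n. \<forall>f\<in>Z n. \<exists>j. transition \<tau> n j (cl n f) = B (n + j)"
    proof (intro allI ballI)
      fix n f assume "f \<in> Z n"
      then have c: "cl n f \<in> carrier (A n)" using Ext_carrier by blast
      then have "?r `` {(n, cl n f)} \<in> (SIGMA n:UNIV. carrier (A n)) // ?r" by (intro quotientI) simp
      then have "?r `` {(n, cl n f)} = ?r `` {(0, B 0)}"
        using z Ext_zero[of 0] by (simp add: zero_module_def local_cohomology_def dirlim_def)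
      moreover have "((n, cl n f), (n, cl n f)) \<in> ?r" using c by (auto simp: dirlim_rel_def intro!: exI[of _ 0])
      ultimately have "((0, B 0), (n, cl n f)) \<in> ?r" by blast
      then obtain i j where "0 + i = n + j" "transition \<tau> 0 i (B 0) = transition \<tau> n j (cl n f)" by (auto simp: dirlim_rel_def)
      then show "\<exists>j. transition \<tau> n j (cl n f) = B (n + j)" using TB[of 0 i] by auto
    qed
  next
    assume k: "\<forall>n. \<forall>f\<in>Z n. \<exists>j. transition \<tau> n j (cl n f) = B (n + j)"
    have kk: "\<exists>j. \<forall>i\<ge>j. transition \<tau> n i c = B (n + i)" if c: "c \<in> carrier (A n)" for n c
    proof -
      obtain f where "f \<in> Z n" "c = cl n f" using c unfolding Ext_carrier by blast
      then obtain j where j: "transition \<tau> n j c = B (n + j)" using k by blast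
      have "transition \<tau> n i c = B (n + i)" if "i \<ge> j" for i
        using T_add[of n j "i - j" c] j TB[of "n + j" "i - j"] that by simp
      then show ?thesis by blast
    qed
    \<comment> \<open>Any two classes become zero at a common stage, so the disjoint union consists
      of a single equivalence class.\<close>
    have full: "((n, c), (m, c')) \<in> ?r" if c: "c \<in> carrier (A n)" "c' \<in> carrier (A m)" for n m c c'
    proof -
      obtain i where i: "\<And>j. j \<ge> i ==> transition \<tau> n j c = B (n + j)" using kk[OF c(1)] by blast
      obtain i' where i': "\<And>j. j \<ge> i' ==> transition \<tau> m j c' = B (m + j)" using kk[OF c(2)] by blast
      have e: "n + (m + i + i') = m + (n + i + i')" by simp
      have "transition \<tau> n (m + i + i') c = transition \<tau> m (n + i + i') c'"
        using i[of "m + i + i'"] i'[of "n + i + i'"] e by simp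
      then show ?thesis using c e unfolding dirlim_rel_def by blast
    qed
    have "?r `` {(n, c)} = (SIGMA n:UNIV. carrier (A n))" if "c \<in> carrier (A n)" for n c
      using full[OF that] by (auto simp: dirlim_rel_def)
    then have "(SIGMA n:UNIV. carrier (A n)) // ?r = {?r `` {(0, B 0)}}" using Bc[of 0] by (auto simp: quotient_def)
    then show "zero_module (local_cohomology R \<aa> k X)"
      using Ext_zero[of 0] by (simp add: zero_module_def local_cohomology_def dirlim_def)
  qed
  also have "\<dots> \<longleftrightarrow> vanish R \<aa> X (carrier X) {\<zero>} k"
  proof
    assume k: "\<forall>n. \<forall>f\<in>Z n. \<exists>j. transition \<tau> n j (cl n f) = B (n + j)"
    show "vanish R \<aa> X (carrier X) {\<zero>} k"
    proof (rule vanishI[OF XN z0 \<aa> E(1)])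
      fix n f assume f: "coc n f"
      let ?f = "restrict f (C n)"
      have fZ: "?f \<in> Z n" using f restrict_module_homs[OF Fmod3, of "P n k" X f] lin_closed[OF D_lin]
        by (auto simp: cocycles_iff relcoc_def intro: module_homs_lin)
      then obtain j where j0: "transition \<tau> n j (cl n ?f) = B (n + j)" using k by blast
      obtain \<psi> where \<psi>: "clift R (P (n + j)) (D (n + j)) (E (n + j)) (P n) (D n) (E n) (\<AA> n) \<psi>"
        "\<forall>f\<in>Z n. transition \<tau> n j (cl n f) = B (n + j) \<longleftrightarrow> cob (n + j) (\<lambda>x. f (\<psi> k x))" using killed by blast
      have j: "clift R (P (n + j)) (D (n + j)) (E (n + j)) (P n) (D n) (E n) (\<AA> n) \<psi>" "cob (n + j) (\<lambda>x. ?f (\<psi> k x))"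
        using \<psi>(1) bspec[OF \<psi>(2) fZ] j0 by blast+
      have "lin R (FM R (P (n + j) k)) (FM R (P n k)) (\<psi> k)" using j(1) by (simp add: clift_def cmap_def)
      then have "cob (n + j) (\<lambda>x. f (\<psi> k x))" by (intro relcob_cong[OF j(2)]) (simp add: lin_closed)
      then show "\<exists>m\<ge>n. \<exists>\<phi>. clift R (P m) (D m) (E m) (P n) (D n) (E n) (\<AA> n) \<phi> \<and> cob m (\<lambda>x. f (\<phi> k x))"
        using j(1) le_add1 by blast
    qed
  next
    assume v: "vanish R \<aa> X (carrier X) {\<zero>} k"
    show "\<forall>n. \<forall>f\<in>Z n. \<exists>j. transition \<tau> n j (cl n f) = B (n + j)"
    proof (intro allI ballI)
      fix n f assume f: "f \<in> Z n"
      then have "coc n f" by (simp add: cocycles_iff)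
      from vanishD[OF XN z0 \<aa> v E(1) this] obtain m0 where m0: "m0 \<ge> n"
        "\<And>m \<phi>. m \<ge> m0 ==> clift R (P m) (D m) (E m) (P n) (D n) (E n) (\<AA> n) \<phi> ==> cob m (\<lambda>x. f (\<phi> k x))" by blast
      obtain j where j: "m0 = n + j" using m0(1) le_Suc_ex by blast
      obtain \<psi> where "clift R (P (n + j)) (D (n + j)) (E (n + j)) (P n) (D n) (E n) (\<AA> n) \<psi>"
        "\<forall>f\<in>Z n. transition \<tau> n j (cl n f) = B (n + j) \<longleftrightarrow> cob (n + j) (\<lambda>x. f (\<psi> k x))" using killed by blast
      then show "\<exists>j. transition \<tau> n j (cl n f) = B (n + j)" using m0(2) j f by blast
    qed
  qed
  finally show ?thesis .
qed

end

end

end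

text \<open>Negation is given by a description over the carrier, so shrinking the carrier changes
  its definition; uniqueness of inverses shows that the value stays the same.\<close>

lemma minus_sub:
  assumes "module R X" "submodule N R X" "x \<in> N" "y \<in> N"
  shows "x \<ominus>\<^bsub>X\<lparr>carrier := N\<rparr>\<^esub> y = x \<ominus>\<^bsub>X\<^esub> y"
proof -
  interpret X: module R X by fact
  interpret N: module R "X\<lparr>carrier := N\<rparr>" by (rule submodule.submodule_is_module[OF assms(2,1)])
  have "\<ominus>\<^bsub>X\<^esub> y = \<ominus>\<^bsub>X\<lparr>carrier := N\<rparr>\<^esub> y"
    by (rule X.minus_equality) (use N.l_neg[of y] N.a_inv_closed[of y] assms sub_carr[OF assms(2)] in auto)
  then show ?thesis by (simp add: a_minus_def)
qed

lemma lin_carrier_updateD: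
  "submodule N R X ==> lin R A (X\<lparr>carrier := N\<rparr>) f ==> lin R A X f"
  by (auto simp: lin_def intro: sub_carr)

lemma lin_carrier_updateI:
  "lin R A X f ==> (\<And>x. x \<in> carrier A ==> f x \<in> N) ==> lin R A (X\<lparr>carrier := N\<rparr>) f"
  by (simp add: lin_def)

text \<open>Any model \<open>Y\<close> of \<open>N / L\<close> may be used: cochains into
  \<open>Y\<close> lift along \<open>\<pi>\<close> by freeness, and vanishing in \<open>Y\<close> is
  membership in \<open>L\<close>. Submodules and quotient modules are both instances.\<close>

lemma vanish_surj:
  fixes Y (structure)
  assumes X: "module R X" and N: "submodule N R X" and Y: "module R Y" and \<pi>: "lin R (X\<lparr>carrier := N\<rparr>) Y \<pi>"
    and surj: "\<And>y. y \<in> carrier Y ==> \<exists>x\<in>N. y = \<pi> x" and ker: "\<And>x. x \<in> N ==> \<pi> x = \<zero> \<longleftrightarrow> x \<in> L"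
  shows "vanish R \<aa> Y (carrier Y) {\<zero>} k \<longleftrightarrow> vanish R \<aa> X N L k"
proof -
  interpret X: module R X by (rule X)
  interpret Y: module R Y by (rule Y)
  let ?F = "FM R" and ?J = "ideal_power R \<aa>"
  let ?cob = "\<lambda>p d. relcob R p d Y (carrier Y) {\<zero>} k" and ?coc = "\<lambda>p d. relcoc R p d Y (carrier Y) {\<zero>} k"
  let ?van = "vanish R \<aa> Y (carrier Y) {\<zero>} k"
  note R = X.is_cring and XN = submodule.submodule_is_module[OF N X]
  have lift: "\<exists>g. lin R (?F n) X g \<and> (\<forall>x\<in>carrier (?F n). g x \<in> N) \<and> (\<forall>x\<in>carrier (?F n). f x = \<pi> (g x))"
    if f: "lin R (?F n) Y f" for n f
  proof -
    have "\<exists>y\<in>carrier (X\<lparr>carrier := N\<rparr>). f x = \<pi> y" if "x \<in> carrier (?F n)" for x using surj[OF lin_closed[OF f that]] by simp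
    then obtain g where g: "lin R (?F n) (X\<lparr>carrier := N\<rparr>) g" "\<And>x. x \<in> carrier (?F n) ==> f x = \<pi> (g x)"
      using lin_lift_eq[OF R XN Y \<pi> f] by blast
    then show ?thesis using lin_carrier_updateD[OF N g(1)] lin_closed[OF g(1)] by auto
  qed
  have \<pi>m: "\<pi> (x \<ominus>\<^bsub>X\<^esub> y) = \<pi> x \<ominus> \<pi> y" if "x \<in> N" "y \<in> N" for x y
    using lin_minus[OF XN Y \<pi>, of x y] minus_sub[OF X N that] that by simp
  have \<pi>c: "\<pi> x \<in> carrier Y" if "x \<in> N" for x using lin_closed[OF \<pi>] that by simp
  have \<pi>k: "\<pi> x \<ominus> \<pi> y = \<zero> \<longleftrightarrow> x \<ominus>\<^bsub>X\<^esub> y \<in> L" if "x \<in> N" "y \<in> N" for x y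
    using ker[OF sub_minus[OF N that]] \<pi>m[OF that] by simp
  have \<pi>l: "lin R (?F n) Y (\<lambda>x. \<pi> (f x))" if "lin R (?F n) X f" "\<And>x. x \<in> carrier (?F n) ==> f x \<in> N" for n f
    by (rule lin_comp[OF lin_carrier_updateI[OF that] \<pi>])
  have coc: "?coc p d (\<lambda>x. \<pi> (f x)) \<longleftrightarrow> relcoc R p d X N L k f"
    if "lin R (?F (p k)) X f" "\<And>x. x \<in> carrier (?F (p k)) ==> f x \<in> N" "\<And>i. lin R (?F (p (Suc i))) (?F (p i)) (d i)" for p d f
    unfolding relcoc_def using that(1,2) \<pi>l[OF that(1,2)] \<pi>c ker lin_closed[OF that(3)] by auto
  have cob: "?cob p d (\<lambda>x. \<pi> (f x)) \<longleftrightarrow> relcob R p d X N L k f"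
    if "\<And>x. x \<in> carrier (?F (p k)) ==> f x \<in> N" "\<And>i. lin R (?F (p (Suc i))) (?F (p i)) (d i)" for p d f
  proof (cases k)
    case 0
    then show ?thesis using that ker by (auto simp: relcob_def)
  next
    case (Suc j)
    have dc: "d j x \<in> carrier (?F (p j))" if "x \<in> carrier (?F (p (Suc j)))" for x using lin_closed[OF \<open>\<And>i. lin R (?F (p (Suc i))) (?F (p i)) (d i)\<close> that] .
    show ?thesis
    proof
      assume "?cob p d (\<lambda>x. \<pi> (f x))"
      then obtain h where h: "lin R (?F (p j)) Y h" "\<And>x. x \<in> carrier (?F (p (Suc j))) ==> \<pi> (f x) \<ominus> h (d j x) = \<zero>"
        using Suc by (auto simp: relcob_def)
      obtain g where g: "lin R (?F (p j)) X g" "\<forall>x\<in>carrier (?F (p j)). g x \<in> N" "\<forall>x\<in>carrier (?F (p j)). h x = \<pi> (g x)" using lift[OF h(1)] by blast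
      have "f x \<ominus>\<^bsub>X\<^esub> g (d j x) \<in> L" if "x \<in> carrier (?F (p (Suc j)))" for x
        using h(2)[OF that] \<pi>k[of "f x" "g (d j x)"] g(2,3) dc[OF that] \<open>\<And>x. x \<in> carrier (?F (p k)) ==> f x \<in> N\<close>[of x] that Suc by simp
      then show "relcob R p d X N L k f" using g(1,2) Suc by (auto simp: relcob_def)
    next
      assume "relcob R p d X N L k f"
      then obtain g where g: "lin R (?F (p j)) X g" "\<And>x. x \<in> carrier (?F (p j)) ==> g x \<in> N"
        "\<And>x. x \<in> carrier (?F (p (Suc j))) ==> f x \<ominus>\<^bsub>X\<^esub> g (d j x) \<in> L" using Suc by (auto simp: relcob_def)
      have "\<pi> (f x) \<ominus> \<pi> (g (d j x)) = \<zero>" if "x \<in> carrier (?F (p (Suc j)))" for x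
        using g(3)[OF that] \<pi>k[of "f x" "g (d j x)"] g(2)[OF dc[OF that]] \<open>\<And>x. x \<in> carrier (?F (p k)) ==> f x \<in> N\<close>[of x] that Suc by simp
      then show "?cob p d (\<lambda>x. \<pi> (f x))"
        using \<pi>l[OF g(1,2)] \<pi>c g(2) Suc by (auto simp: relcob_def intro!: exI[of _ "\<lambda>x. \<pi> (g x)"])
    qed
  qed
  show ?thesis
  proof
    assume v: "?van"
    show "vanish R \<aa> X N L k"
      unfolding vanish_def
    proof (intro allI impI)
      fix n p d e f assume p: "fres R (?J n) p d e" and f: "relcoc R p d X N L k f"
      have fl: "lin R (?F (p k)) X f" and fN: "\<And>x. x \<in> carrier (?F (p k)) ==> f x \<in> N" using f by (auto simp: relcoc_def)
      have "?coc p d (\<lambda>x. \<pi> (f x))" using coc[OF fl fN fresD(1)[OF p]] f by blast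
      with v p obtain m0 where m0: "m0 \<ge> n" "\<And>m p' d' e' \<phi>. m \<ge> m0 ==> fres R (?J m) p' d' e' ==>
        clift R p' d' e' p d e (?J n) \<phi> ==> ?cob p' d' (\<lambda>x. \<pi> (f (\<phi> k x)))"
        unfolding vanish_def by blast
      show "\<exists>m0\<ge>n. \<forall>m\<ge>m0. \<forall>p' d' e' \<phi>. fres R (?J m) p' d' e' \<longrightarrow>
        clift R p' d' e' p d e (?J n) \<phi> \<longrightarrow> relcob R p' d' X N L k (\<lambda>x. f (\<phi> k x))"
      proof (intro exI[of _ m0] conjI allI impI m0(1))
        fix m p' d' e' \<phi> assume a: "m \<ge> m0" "fres R (?J m) p' d' e'" "clift R p' d' e' p d e (?J n) \<phi>"
        have \<phi>: "lin R (?F (p' k)) (?F (p k)) (\<phi> k)" using a(3) by (simp add: clift_def cmap_def)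
        have "f (\<phi> k x) \<in> N" if "x \<in> carrier (?F (p' k))" for x by (rule fN[OF lin_closed[OF \<phi> that]])
        then show "relcob R p' d' X N L k (\<lambda>x. f (\<phi> k x))" using cob[where p=p' and d=d' and f="\<lambda>x. f (\<phi> k x)"] fresD(1)[OF a(2)] m0(2)[OF a] by blast
      qed
    qed
  next
    assume v: "vanish R \<aa> X N L k"
    show "?van"
      unfolding vanish_def
    proof (intro allI impI)
      fix n p d e f' assume p: "fres R (?J n) p d e" and f': "?coc p d f'"
      have "lin R (?F (p k)) Y f'" using f' by (simp add: relcoc_def)
      from lift[OF this] obtain f where fl: "lin R (?F (p k)) X f" and fN: "\<And>x. x \<in> carrier (?F (p k)) ==> f x \<in> N"
        and e: "\<And>x. x \<in> carrier (?F (p k)) ==> f' x = \<pi> (f x)" by blast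
      have "?coc p d (\<lambda>x. \<pi> (f x))"
        using f' e \<pi>l[OF fl fN] lin_closed[OF fresD(1)[OF p]] by (simp add: relcoc_def)
      then have "relcoc R p d X N L k f" using coc[OF fl fN fresD(1)[OF p]] by blast
      with v p obtain m0 where m0: "m0 \<ge> n" "\<And>m p' d' e' \<phi>. m \<ge> m0 ==> fres R (?J m) p' d' e' ==>
        clift R p' d' e' p d e (?J n) \<phi> ==> relcob R p' d' X N L k (\<lambda>x. f (\<phi> k x))"
        unfolding vanish_def by blast
      show "\<exists>m0\<ge>n. \<forall>m\<ge>m0. \<forall>p' d' e' \<phi>. fres R (?J m) p' d' e' \<longrightarrow>
        clift R p' d' e' p d e (?J n) \<phi> \<longrightarrow> ?cob p' d' (\<lambda>x. f' (\<phi> k x))"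
      proof (intro exI[of _ m0] conjI allI impI m0(1))
        fix m p' d' e' \<phi> assume a: "m \<ge> m0" "fres R (?J m) p' d' e'" "clift R p' d' e' p d e (?J n) \<phi>"
        have \<phi>: "lin R (?F (p' k)) (?F (p k)) (\<phi> k)" using a(3) by (simp add: clift_def cmap_def)
        have "f (\<phi> k x) \<in> N" if "x \<in> carrier (?F (p' k))" for x by (rule fN[OF lin_closed[OF \<phi> that]])
        then have "?cob p' d' (\<lambda>x. \<pi> (f (\<phi> k x)))"
          using cob[where p=p' and d=d' and f="\<lambda>x. f (\<phi> k x)"] fresD(1)[OF a(2)] m0(2)[OF a] by blast
        then show "?cob p' d' (\<lambda>x. f' (\<phi> k x))" by (rule relcob_cong) (use e lin_closed[OF \<phi>] in simp)
      qed
    qed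
  qed
qed

lemma submodule_carrier_update:
  assumes "module R X" "submodule N R X" "submodule L R X" "L \<subseteq> N"
  shows "submodule L R (X\<lparr>carrier := N\<rparr>)"
  by (rule submoduleI'[OF submodule.submodule_is_module[OF assms(2,1)]])
    (use assms sub_zero[OF assms(3)] sub_add[OF assms(3)] sub_smult[OF assms(3)] in auto)

context
  fixes R :: "('a, 'r) ring_scheme" and X :: "('a, 'm, 's) module_scheme" and \<aa> :: "'a set" and N :: "'m set"
  assumes X: "module R X" and \<aa>: "ideal \<aa> R" and ex: "\<And>n. \<exists>p d e. fres R (ideal_power R \<aa> n) p d e"
    and N: "submodule N R X"
begin

interpretation X: module R X by (rule X)
private lemmas XN2 = submodule.submodule_is_module[OF N X]

lemma zero_local_cohomology_sub:
  "zero_module (local_cohomology R \<aa> k (X\<lparr>carrier := N\<rparr>)) \<longleftrightarrow> vanish R \<aa> X N {\<zero>\<^bsub>X\<^esub>} k"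
  unfolding zero_local_cohomology_iff[OF XN2 \<aa> ex] by (rule vanish_surj[OF X N XN2 lin_ident]) auto

lemma zero_local_cohomology_quot:
  assumes "submodule L R X" "L \<subseteq> N"
  shows "zero_module (local_cohomology R \<aa> k (quot_module R (X\<lparr>carrier := N\<rparr>) L)) \<longleftrightarrow> vanish R \<aa> X N L k"
proof -
  note L = submodule_carrier_update[OF X N assms]
  note Q = module_quot[OF XN2 L]
  show ?thesis
    unfolding zero_local_cohomology_iff[OF Q \<aa> ex]
  proof (rule vanish_surj[OF X N Q lin_quot[OF XN2 L]])
    fix x assume "x \<in> N"
    then show "L +>\<^bsub>X\<lparr>carrier := N\<rparr>\<^esub> x = \<zero>\<^bsub>quot_module R (X\<lparr>carrier := N\<rparr>) L\<^esub> \<longleftrightarrow> x \<in> L"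
      using coset_eq_self[OF XN2 L, of x] by (simp add: quot_module_simps)
  qed (auto simp: quot_module_simps rcosets_iff)
qed

end

subsection \<open>The filtration of the completion\<close>

lemma fin_gen_quot:
  assumes X: "module R X" and N: "submodule N R X" and L: "submodule L R X" and LN: "L \<subseteq> N" and g: "generates R X N k g"
  shows "fin_gen_module R (quot_module R (X\<lparr>carrier := N\<rparr>) L)"
proof -
  interpret X: module R X by (rule X)
  let ?X = "X\<lparr>carrier := N\<rparr>"
  note XN = submodule.submodule_is_module[OF N X] and L' = submodule_carrier_update[OF X N L LN]
  let ?Q = "quot_module R ?X L"
  have gN: "\<And>i. i < k ==> g i \<in> N" using g by (simp add: generates_def)
  have l: "lincomb ?X g c m = lincomb X g c m" for c m by (induction m) auto
  have "\<exists>c. (\<forall>i<k. c i \<in> carrier R) \<and> y = lincomb ?Q (\<lambda>i. L +>\<^bsub>?X\<^esub> g i) c k" if y: "y \<in> carrier ?Q" for y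
  proof -
    obtain x where x: "x \<in> N" "y = L +>\<^bsub>?X\<^esub> x" using y by (auto simp: quot_module_simps rcosets_iff)
    obtain c where c: "\<forall>i<k. c i \<in> carrier R" "x = lincomb X g c k" using g x(1) unfolding generates_def by blast
    have "L +>\<^bsub>?X\<^esub> lincomb ?X g c k = lincomb ?Q (\<lambda>i. L +>\<^bsub>?X\<^esub> g i) c k"
      by (rule lincomb_image[OF XN module_quot[OF XN L'] lin_quot[OF XN L']]) (use gN c(1) in auto)
    then show ?thesis using x(2) c l by auto
  qed
  moreover have "L +>\<^bsub>?X\<^esub> g i \<in> carrier ?Q" if "i < k" for i using gN[OF that] by (auto simp: quot_module_simps rcosets_iff)
  ultimately show ?thesis unfolding fin_gen_module_iff[OF module_quot[OF XN L']] generates_def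
    by (intro exI[of _ k] exI[of _ "\<lambda>i. L +>\<^bsub>?X\<^esub> g i"]) blast
qed

lemma zero_quot_iff:
  assumes X: "module R X" and N: "submodule N R X" and L: "submodule L R X" and LN: "L \<subseteq> N"
  shows "zero_module (quot_module R (X\<lparr>carrier := N\<rparr>) L) \<longleftrightarrow> N = L"
proof -
  interpret X: module R X by (rule X)
  let ?X = "X\<lparr>carrier := N\<rparr>"
  note XN = submodule.submodule_is_module[OF N X] and L' = submodule_carrier_update[OF X N L LN]
  have e: "L +>\<^bsub>?X\<^esub> x = L \<longleftrightarrow> x \<in> L" if "x \<in> N" for x using coset_eq_self[OF XN L', of x] that by simp
  have "zero_module (quot_module R ?X L) \<longleftrightarrow> (\<forall>x\<in>N. L +>\<^bsub>?X\<^esub> x = L)"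
  proof
    assume "zero_module (quot_module R ?X L)"
    then show "\<forall>x\<in>N. L +>\<^bsub>?X\<^esub> x = L" using rcosets_iff[of _ ?X L] by (auto simp: zero_module_def quot_module_simps)
  next
    assume "\<forall>x\<in>N. L +>\<^bsub>?X\<^esub> x = L"
    then show "zero_module (quot_module R ?X L)" using rcosets_iff[of _ ?X L] sub_zero[OF N]
      by (auto simp: zero_module_def quot_module_simps)
  qed
  then show ?thesis using e LN by blast
qed

lemma cd_le_iff: "cd R \<aa> M \<le> ereal (real i) \<longleftrightarrow> (\<forall>k>i. zero_module (local_cohomology R \<aa> k M))"
  unfolding cd_def by (auto simp: SUP_le_iff) (meson leI)

lemma cd_cong:
  assumes "\<And>k. zero_module (local_cohomology R \<aa> k M) \<longleftrightarrow> zero_module (local_cohomology R' \<aa>' k M')"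
  shows "cd R \<aa> M = cd R' \<aa>' M'"
  using assms by (simp add: cd_def)

text \<open>The cohomology sits in a single degree, and the value of \<open>cd\<close> identifies
  it.\<close>

lemma relative_CM_degree:
  assumes "relative_CM R \<aa> N" "cd R \<aa> N = ereal (real i)" "k \<noteq> i"
  shows "zero_module (local_cohomology R \<aa> k N)"
proof -
  obtain j where j: "{i. \<not> zero_module (local_cohomology R \<aa> i N)} = {j}"
    using assms(1) unfolding relative_CM_def by blast
  then have "i = j" using assms(2) by (simp add: cd_def)
  then show ?thesis using j assms(3) by blast
qed

context adic
begin

text \<open>Obtained by base change from \<open>R\<close>, so no finiteness property of the
  completed ring is involved.\<close>

lemma fres_S_exists: "\<exists>p d e. fres S (ideal_power S (extended_ideal R \<aa>) n) p d e"
  using fres_exists[OF R NR JI] fres_hat unfolding extended_power by meson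

context
  fixes M :: "('a, 'm, 's) module_scheme" and N L :: "'m set"
  assumes fg: "fin_gen_module R M" and N: "submodule N R M" and L: "submodule L R M" and LN: "L \<subseteq> N"
begin

private lemmas modM = fin_gen_moduleD[OF fg]

private lemmas Nh = submodule_clos[OF modM N] and Lh = submodule_clos[OF modM L]

text \<open>The change of rings and the passage to closures are combined: from the completed ring
  down to \<open>R\<close>, then from the closures to the submodules of \<open>M\<close>.\<close>

lemma vanish_clos: "vanish S (extended_ideal R \<aa>) (Mhat M) (clos M N) (clos M L) k \<longleftrightarrow> vanish R \<aa> M N L k"
  using vanish_base_change[OF module_Mh[OF modM] Nh Lh clos_mono[OF modM LN]] vanish_completion[OF fg N L LN] by blast

lemma zero_local_cohomology_quot_clos:
  "zero_module (local_cohomology S (extended_ideal R \<aa>) k (quot_module S ((Mhat M)\<lparr>carrier := clos M N\<rparr>) (clos M L))) \<longleftrightarrow>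
    zero_module (local_cohomology R \<aa> k (quot_module R (M\<lparr>carrier := N\<rparr>) L))"
  unfolding zero_local_cohomology_quot[OF module_Mh[OF modM] extended_ideal_ideal fres_S_exists Nh Lh clos_mono[OF modM LN]]
    zero_local_cohomology_quot[OF modM \<aa> fres_exists[OF R NR JI] N L LN] by (rule vanish_clos)

end

context
  fixes M :: "('a, 'm, 's) module_scheme"
  assumes fg: "fin_gen_module R M"
begin

private lemmas Mmod = fin_gen_moduleD[OF fg]

private lemmas Mh = module_Mh[OF Mmod]
private abbreviation "\<bb> \<equiv> extended_ideal R \<aa>"

lemma zero_local_cohomology_clos:
  assumes N: "submodule N R M"
  shows "zero_module (local_cohomology S \<bb> k ((Mhat M)\<lparr>carrier := clos M N\<rparr>)) \<longleftrightarrow>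
    zero_module (local_cohomology R \<aa> k (M\<lparr>carrier := N\<rparr>))"
  unfolding zero_local_cohomology_sub[OF Mh extended_ideal_ideal fres_S_exists submodule_clos[OF Mmod N]]
    zero_local_cohomology_sub[OF Mmod \<aa> fres_exists[OF R NR JI] N] clos_zero[OF Mmod, symmetric]
  by (rule vanish_clos[OF fg N submodule_zero[OF Mmod]]) (use sub_zero[OF N] in simp)

lemma cd_clos: "submodule N R M ==> cd S \<bb> ((Mhat M)\<lparr>carrier := clos M N\<rparr>) = cd R \<aa> (M\<lparr>carrier := N\<rparr>)"
  by (rule cd_cong) (rule zero_local_cohomology_clos)

lemma cd_Mhat: "cd S \<bb> (Mhat M) = cd R \<aa> M"
  using cd_clos[OF module.carrier_is_submodule[OF Mmod]] by (simp add: clos_carrier[OF Mmod])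

lemma fin_gen_Mhat: "fin_gen_module S (Mhat M)"
proof -
  obtain k g where "generates S (Mhat M) (clos M (carrier M)) k (\<lambda>i. \<iota>M M (g i))"
    using clos_generated[OF Mmod fg module.carrier_is_submodule[OF Mmod]] by blast
  then show ?thesis unfolding fin_gen_module_iff[OF Mh] clos_carrier[OF Mmod] by blast
qed

text \<open>Since \<open>\<aa>\<close> is generated by finitely many elements, the cohomological dimension is finite.\<close>

lemma cd_attained:
  assumes "ereal (real i) \<le> cd R \<aa> M"
  obtains c where "cd R \<aa> M = ereal (real c)"
proof -
  interpret M: module R M by (rule Mmod)
  let ?A = "{k. \<not> zero_module (local_cohomology R \<aa> k M)}"
  obtain r g where rg: "generates R Rm \<aa> r g" using generates_ideal[OF R NR \<aa>] by blast
  have "zero_module (local_cohomology R \<aa> k M)" if "k > r" for k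
    unfolding zero_local_cohomology_iff[OF Mmod \<aa> fres_exists[OF R NR JI]]
    by (rule vanish_bounded[OF NR \<aa> rg Mmod M.carrier_is_submodule submodule_zero[OF Mmod] _ that]) simp
  then have fin: "finite ?A" by (intro finite_subset[of ?A "{..r}"]) (auto simp: not_le[symmetric])
  have ne: "?A \<noteq> {}"
  proof
    assume "?A = {}"
    then have "cd R \<aa> M = -\<infinity>" unfolding cd_def by (simp only: image_empty Sup_empty bot_ereal_def)
    then show False using assms by simp
  qed
  have "cd R \<aa> M = ereal (real (Max ?A))"
    unfolding cd_def
    by (rule antisym[OF SUP_least SUP_upper[OF Max_in[OF fin ne]]]) (simp add: Max_ge[OF fin])
  then show ?thesis by (rule that)
qed

context
  fixes F :: "nat \<Rightarrow> 'm set"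
  assumes F: "is_cd_filtration R \<aa> M F"
    and Q: "\<And>i. i \<ge> 1 ==> ereal (real i) \<le> cd R \<aa> M ==>
      zero_module (quot_module R (M\<lparr>carrier := F i\<rparr>) (F (i - 1))) \<or>
      relative_CM R \<aa> (quot_module R (M\<lparr>carrier := F i\<rparr>) (F (i - 1))) \<and>
        cd R \<aa> (quot_module R (M\<lparr>carrier := F i\<rparr>) (F (i - 1))) = ereal (real i)"
begin

private lemma Fi:
  assumes "ereal (real i) \<le> cd R \<aa> M"
  shows "submodule (F i) R M" "cd R \<aa> (M\<lparr>carrier := F i\<rparr>) \<le> ereal (real i)"
    "\<And>N. submodule N R M ==> cd R \<aa> (M\<lparr>carrier := N\<rparr>) \<le> ereal (real i) ==> N \<subseteq> F i"
  using F assms by (auto simp: is_cd_filtration_def)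

text \<open>\<open>F j\<close> is itself a competitor in the maximality of
  \<open>F i\<close>.\<close>

private lemma Fmono:
  assumes "ereal (real i) \<le> cd R \<aa> M" "j \<le> i"
  shows "ereal (real j) \<le> cd R \<aa> M" "F j \<subseteq> F i"
proof -
  have ji: "ereal (real j) \<le> ereal (real i)" using assms(2) by simp
  then show j: "ereal (real j) \<le> cd R \<aa> M" using assms(1) by (rule order_trans)
  show "F j \<subseteq> F i" by (rule Fi(3)[OF assms(1) Fi(1)[OF j] order_trans[OF Fi(2)[OF j] ji]])
qed

text \<open>Descend through the filtration: a submodule \<open>N\<close> of \<open>clos M (F j)\<close> with \<open>cd(N) < j\<close> maps to zero in
  the separated module \<open>clos M (F j) / clos M (F (j - 1))\<close>, whose local cohomology is concentrated
  in degree \<open>j\<close>.\<close>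

lemma clos_filtration_max:
  assumes i: "ereal (real i) \<le> cd R \<aa> M" and N: "submodule N S (Mhat M)" and c: "cd S \<bb> ((Mhat M)\<lparr>carrier := N\<rparr>) \<le> ereal (real i)"
  shows "N \<subseteq> clos M (F i)"
proof -
  interpret M: module R M by (rule Mmod)
  interpret H: module S "Mhat M" by (rule Mh)
  obtain c where cd: "cd R \<aa> M = ereal (real c)" using cd_attained[OF i] .
  note H0 = submodule_zero[OF Mh]
  have vN: "vanish R \<aa> (rs (Mhat M)) N {\<zero>\<^bsub>Mhat M\<^esub>} k" if "k > i" for k
  proof -
    have "zero_module (local_cohomology S \<bb> k ((Mhat M)\<lparr>carrier := N\<rparr>))"
      using \<open>cd S \<bb> ((Mhat M)\<lparr>carrier := N\<rparr>) \<le> ereal (real i)\<close> that unfolding cd_le_iff by blast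
    then show ?thesis
      using zero_local_cohomology_sub[OF Mh extended_ideal_ideal fres_S_exists N] vanish_base_change[OF Mh N H0] sub_zero[OF N] by simp
  qed
  \<comment> \<open>Induction from the top index \<open>c\<close> downwards;
    \<open>l = c - i\<close> is the claim.\<close>
  have "N \<subseteq> clos M (F (c - l))" if "l \<le> c - i" for l
    using that
  proof (induction l)
    case 0
    \<comment> \<open>The whole of \<open>M\<close> has cohomological dimension \<open>c\<close> and
      so competes in the maximality of \<open>F c\<close>.\<close>
    have "carrier M \<subseteq> F c" by (rule Fi(3)) (use cd M.carrier_is_submodule in auto)
    then show ?case using clos_mono[OF Mmod] clos_carrier[OF Mmod] sub_carr[OF N] by (simp, blast)
  next
    case (Suc l)
    let ?j = "c - l"
    have j: "c - Suc l = ?j - 1" "?j \<ge> 1" "i < ?j" and jc: "ereal (real ?j) \<le> cd R \<aa> M" using Suc.prems cd by auto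
    have IH: "N \<subseteq> clos M (F ?j)" using Suc by simp
    have j1: "?j - 1 \<le> ?j" by simp
    note Fj = Fi(1)[OF jc] and Fj1 = Fi(1)[OF Fmono(1)[OF jc j1]] and FF = Fmono(2)[OF jc j1]
    show ?case
    proof (cases "F ?j = F (?j - 1)")
      case True
      show ?thesis unfolding j(1) True[symmetric] by (rule IH)
    next
      case False
      then have q: "relative_CM R \<aa> (quot_module R (M\<lparr>carrier := F ?j\<rparr>) (F (?j - 1)))"
        "cd R \<aa> (quot_module R (M\<lparr>carrier := F ?j\<rparr>) (F (?j - 1))) = ereal (real ?j)"
        using Q[OF j(2) jc] zero_quot_iff[OF Mmod Fj Fj1 FF] by auto
      \<comment> \<open>The quotient has cohomology in degree \<open>?j > i\<close> alone, so
        everything up to \<open>i\<close> vanishes, and \<open>vanish_completion\<close> carries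
        this to the closures.\<close>
      have v: "vanish R \<aa> (rs (Mhat M)) (clos M (F ?j)) (clos M (F (?j - 1))) k" if "k \<le> i" for k
        using relative_CM_degree[OF q, of k] that j(3)
        unfolding zero_local_cohomology_quot[OF Mmod \<aa> fres_exists[OF R NR JI] Fj Fj1 FF] vanish_completion[OF fg Fj Fj1 FF] by simp
      show ?thesis
        unfolding j(1)
      proof
        fix y assume y: "y \<in> N"
        show "y \<in> clos M (F (?j - 1))"
        proof (rule in_closI[OF Mmod Fj1 sub_carr[OF N y]])
          fix n
          \<comment> \<open>The two ranges of vanishing meet at \<open>i\<close>: above it for
            \<open>N\<close>, up to it for the quotient of the closures.\<close>
          have "\<exists>v\<in>imul (rs (Mhat M)) (J n) (clos M (F ?j)). \<exists>w\<in>clos M (F (?j - 1)). y = v \<oplus>\<^bsub>rs (Mhat M)\<^esub> w"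
            by (rule vanish_imp_in_imul_sum[OF NR \<aa> module_rs[OF Mh] submodule_rs[OF Mh N]
              submodule_rs[OF Mh submodule_clos[OF Mmod Fj]] submodule_rs[OF Mh submodule_clos[OF Mmod Fj1]] IH clos_mono[OF Mmod FF] _ v y])
              (use vN in auto)
          then show "\<exists>v\<in>imul (rs (Mhat M)) (J n) (carrier (Mhat M)). \<exists>w\<in>clos M (F (?j - 1)). y = v \<oplus>\<^bsub>Mhat M\<^esub> w"
            using imul_mono[of "J n" "J n" "clos M (F ?j)" "carrier (Mhat M)" "rs (Mhat M)"] clos_carr[OF Mmod] by (simp, blast)
        qed
      qed
    qed
  qed
  from this[of "c - i"] show ?thesis using i cd by simp
qed

text \<open>The closures of the \<open>F i\<close> are the witness. Their quotients have nonzero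
  local cohomology in the same degrees as those over \<open>R\<close>, and
  \<open>clos_filtration_max\<close> supplies maximality among all submodules of the
  completion.\<close>

lemma rcmf_Mhat: "rcmf S \<bb> (Mhat M)"
  unfolding rcmf_def
proof (intro conjI exI[of _ "\<lambda>i. clos M (F i)"] allI impI)
  show "fin_gen_module S (Mhat M)" by (rule fin_gen_Mhat)
  show "is_cd_filtration S \<bb> (Mhat M) (\<lambda>i. clos M (F i))"
    unfolding is_cd_filtration_def cd_Mhat
    using submodule_clos[OF Mmod Fi(1)] cd_clos[OF Fi(1)] Fi(2) clos_filtration_max by auto
  fix i :: nat assume i: "1 \<le> i" and "ereal (real i) \<le> cd S \<bb> (Mhat M)"
  then have ic: "ereal (real i) \<le> cd R \<aa> M" by (simp add: cd_Mhat)
  have i1: "i - 1 \<le> i" by simp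
  note Fi' = Fi(1)[OF ic] and Fi1 = Fi(1)[OF Fmono(1)[OF ic i1]] and FF = Fmono(2)[OF ic i1]
  let ?Q = "quot_module S ((Mhat M)\<lparr>carrier := clos M (F i)\<rparr>) (clos M (F (i - 1)))"
  note C = submodule_clos[OF Mmod Fi'] submodule_clos[OF Mmod Fi1] clos_mono[OF Mmod FF]
  have "zero_module ?Q \<or> relative_CM S \<bb> ?Q \<and> cd S \<bb> ?Q = ereal (real i)"
  proof (cases "F i = F (i - 1)")
    case True
    then show ?thesis using zero_quot_iff[OF Mh C] by simp
  next
    case False
    then have q: "relative_CM R \<aa> (quot_module R (M\<lparr>carrier := F i\<rparr>) (F (i - 1)))"
      "cd R \<aa> (quot_module R (M\<lparr>carrier := F i\<rparr>) (F (i - 1))) = ereal (real i)"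
      using Q[OF i ic] zero_quot_iff[OF Mmod Fi' Fi1 FF] by auto
    note z = zero_local_cohomology_quot_clos[OF fg Fi' Fi1 FF]
    obtain k g where "generates S (Mhat M) (clos M (F i)) k (\<lambda>i. \<iota>M M (g i))" using clos_generated[OF Mmod fg Fi'] by blast
    then have "fin_gen_module S ?Q" by (rule fin_gen_quot[OF Mh C])
    then have "relative_CM S \<bb> ?Q" using q(1) unfolding relative_CM_def z by blast
    then show ?thesis using q(2) cd_cong[OF z] by simp
  qed
  then show "let Q = ?Q in zero_module Q \<or> relative_CM S \<bb> Q \<and> cd S \<bb> Q = ereal (real i)" by (simp add: Let_def)
qed

end

end

end

theorem proposition2p26:
  fixes R :: "('a, 'r) ring_scheme"
    and \<aa> :: "'a set"
    and M :: "('a, 'm, 's) module_scheme"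
  assumes "cring R"
    and "noetherian_ring R"
    and "ideal \<aa> R"
    and "\<aa> \<noteq> carrier R"
    and "rcmf R \<aa> M"
  shows "rcmf (completion_ring R \<aa>) (extended_ideal R \<aa>) (completion_module R \<aa> M)"
proof -
  interpret adic R \<aa> by (rule adic.intro) (rule assms)+
  obtain F where "is_cd_filtration R \<aa> M F" "\<And>i. i \<ge> 1 ==> ereal (real i) \<le> cd R \<aa> M ==>
      zero_module (quot_module R (M\<lparr>carrier := F i\<rparr>) (F (i - 1))) \<or>
      relative_CM R \<aa> (quot_module R (M\<lparr>carrier := F i\<rparr>) (F (i - 1))) \<and>
        cd R \<aa> (quot_module R (M\<lparr>carrier := F i\<rparr>) (F (i - 1))) = ereal (real i)"
    using assms(5) unfolding rcmf_def Let_def by blast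
  with assms(5) show ?thesis by (intro rcmf_Mhat) (simp add: rcmf_def)
qed

end
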